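(* Let $k>0$, $n\in\{2,3\}$, let $D\subset\mathbb R^n$ be a bounded set with $\Omega:=\mathbb R^n\setminus D$, and let $u\in H^1_{loc}(\Omega)$ solve $\Delta u+k^2u=0$ in $\Omega$. Then the following are equivalent: (SRC) $\lim_{r\to\infty}r^{\frac{n-1}{2}}|\partial_ru(r,\hat x)-iku(r,\hat x)|=0$ uniformly in $\hat x\in\mathbb S^{n-1}$; (GSRC) $\int_\Omega(1+|x|^2)^{\delta-1}|\nabla u-ik\hat xu|^2dx<\infty$ for some $\delta\in(1/2,1)$. Here $r=|x|$ and $\hat x=x/|x|$.
   Context: Standard polar coordinates $x=r\hat x$, $r>0$, $\hat x\in\mathbb S^{n-1}$. *)

theory Defs
  imports "HOL-Analysis.Analysis"
begin

definition partial_deriv :: "'n::finite \<Rightarrow> (real^'n \<Rightarrow> real) \<Rightarrow> real^'n \<Rightarrow> real" where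
  "partial_deriv j f x = deriv (\<lambda>t. f (x + t *\<^sub>R axis j 1)) 0"

fun iter_partial :: "'n::finite list \<Rightarrow> (real^'n \<Rightarrow> real) \<Rightarrow> real^'n \<Rightarrow> real" where
  "iter_partial [] f = f"
| "iter_partial (j # js) f = partial_deriv j (iter_partial js f)"

definition smooth_fun :: "(real^'n::finite \<Rightarrow> real) \<Rightarrow> bool" where
  "smooth_fun f \<longleftrightarrow>
     (\<forall>js. continuous_on UNIV (iter_partial js f) \<and>
        (\<forall>j x. (\<lambda>t. iter_partial js f (x + t *\<^sub>R axis j 1)) differentiable (at 0)))"

definition test_fun :: "(real^'n::finite) set \<Rightarrow> (real^'n \<Rightarrow> real) \<Rightarrow> bool" where
  "test_fun U \<phi> \<longleftrightarrow> smooth_fun \<phi> \<and> compact (closure {x. \<phi> x \<noteq> 0}) \<and> closure {x. \<phi> x \<noteq> 0} \<subseteq> U"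

definition weak_gradient :: "(real^'n::finite) set \<Rightarrow> (real^'n \<Rightarrow> complex) \<Rightarrow> (real^'n \<Rightarrow> complex^'n) \<Rightarrow> bool" where
  "weak_gradient U u G \<longleftrightarrow>
     set_borel_measurable lebesgue U u \<and>
     (\<forall>j. set_borel_measurable lebesgue U (\<lambda>x. G x $ j)) \<and>
     (\<forall>\<phi> j. test_fun U \<phi> \<longrightarrow>
        set_integrable lebesgue U (\<lambda>x. u x * of_real (partial_deriv j \<phi> x)) \<and>
        set_integrable lebesgue U (\<lambda>x. G x $ j * of_real (\<phi> x)) \<and>
        (LINT x:U|lebesgue. u x * of_real (partial_deriv j \<phi> x))
          = - (LINT x:U|lebesgue. G x $ j * of_real (\<phi> x)))"

text \<open>H^1_loc(Omega) in the scattering-theory sense: u and its weak gradient G are square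
  integrable on Omega \<inter> B_R for every R.\<close>
definition H1_loc_with_grad :: "(real^'n::finite) set \<Rightarrow> (real^'n \<Rightarrow> complex) \<Rightarrow> (real^'n \<Rightarrow> complex^'n) \<Rightarrow> bool" where
  "H1_loc_with_grad \<Omega> u G \<longleftrightarrow> weak_gradient \<Omega> u G \<and>
     (\<forall>R>0. set_integrable lebesgue (\<Omega> \<inter> ball 0 R) (\<lambda>x. (norm (u x))\<^sup>2) \<and>
            set_integrable lebesgue (\<Omega> \<inter> ball 0 R) (\<lambda>x. (norm (G x))\<^sup>2))"

definition weak_helmholtz :: "real \<Rightarrow> (real^'n::finite) set \<Rightarrow> (real^'n \<Rightarrow> complex) \<Rightarrow> (real^'n \<Rightarrow> complex^'n) \<Rightarrow> bool" where
  "weak_helmholtz k U u G \<longleftrightarrow>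
     (\<forall>\<phi>. test_fun U \<phi> \<longrightarrow>
        set_integrable lebesgue U (\<lambda>x. (\<Sum>j\<in>UNIV. G x $ j * of_real (partial_deriv j \<phi> x))
                                        - of_real (k\<^sup>2) * u x * of_real (\<phi> x)) \<and>
        (LINT x:U|lebesgue. (\<Sum>j\<in>UNIV. G x $ j * of_real (partial_deriv j \<phi> x))
                              - of_real (k\<^sup>2) * u x * of_real (\<phi> x)) = 0)"

definition SRC :: "real \<Rightarrow> (real^'n::finite \<Rightarrow> complex) \<Rightarrow> bool" where
  "SRC k u \<longleftrightarrow>
     (\<forall>\<epsilon>>0. \<exists>R. \<forall>r\<ge>R. \<forall>xh. norm xh = 1 \<longrightarrow>
        r powr ((real CARD('n) - 1) / 2) *
          norm (vector_derivative (\<lambda>t. u (t *\<^sub>R xh)) (at r) - \<i> * of_real k * u (r *\<^sub>R xh)) < \<epsilon>)"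

definition GSRC :: "real \<Rightarrow> (real^'n::finite) set \<Rightarrow> (real^'n \<Rightarrow> complex) \<Rightarrow> (real^'n \<Rightarrow> complex^'n) \<Rightarrow> bool" where
  "GSRC k \<Omega> u G \<longleftrightarrow>
     (\<exists>\<delta>. 1/2 < \<delta> \<and> \<delta> < 1 \<and>
        (\<integral>\<^sup>+ x\<in>\<Omega>. ennreal ((1 + (norm x)\<^sup>2) powr (\<delta> - 1) *
            (norm (G x - (\<chi> j. \<i> * of_real k * of_real (x $ j / norm x) * u x)))\<^sup>2) \<partial>lebesgue) < \<infinity>)"

end

theory Submission
  imports Defs "HOL-Probability.Distributions"
begin

text \<open>
  Outside a ball the solution is represented by Green's formula with smooth radial cut-offs: $u$ is an
  inner potential, supported near the obstacle, minus an outer potential supported in the shell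
  $R \le |y| \le 2R$. Both conditions imply that the weighted shell mean \<open>QR R\<close> of
  $|\partial_r u - iku|^2$ tends to zero. Conservation of the energy flux
  $\mathrm{Im} \int \partial_r u \, \bar u$ then bounds the shell mean of $|u|^2$, so by the radiation
  condition of the fundamental solution the outer potential vanishes as $R \to \infty$. What
  remains, the inner potential, satisfies $|\nabla u - ik\hat x u| \le K |x|^{-(n+1)/2}$, which gives
  both conditions back.
\<close>

section \<open>Smooth cut-off functions and gradients\<close>

text \<open>The solution is given only weakly, with a square integrable gradient, so boundary values
  on spheres are not at hand. Radial cut-offs of positive width turn the surface integrals of the
  classical argument into integrals over shells, where \<open>u\<close> and its weak gradient may
  stand as they are. The same formula supplies regularity: away from the shells the sources have
  positive distance and the kernel can be differentiated.

  The radiation defect alone does not bound \<open>u\<close>, since it controls only a combination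
  of \<open>u\<close> and its radial derivative. The missing information is the flux, which is the
  same through every shell.

  The values 2 and 3 of the dimension matter only for the fundamental solution. For n = 3 it is
  e^(ikr)/r. For n = 2 put s = 1 + i t^2 in the integral of e^(ikrs) (s^2 - 1)^(-1/2) along the ray
  upwards from s = 1: the square in t cancels the endpoint singularity and the Gaussian integral
  \<open>hank\<close> appears, whose decay, radiation condition and behaviour at zero all follow by
  scaling t.\<close>

definition expflat :: "real poly \<Rightarrow> real \<Rightarrow> real" where
  "expflat p t = (if t > 0 then poly p (inverse t) * exp (- inverse t) else 0)"

lemma poly_exp_tendsto_0: "((\<lambda>x. poly p x * exp (- x)) \<longlongrightarrow> 0) at_top" for p :: "real poly"
proof -
  have "((\<lambda>x. \<Sum>i\<le>degree p. coeff p i * (x ^ i / exp x)) \<longlongrightarrow> (\<Sum>i\<le>degree p. coeff p i * 0)) at_top"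
    by (intro tendsto_intros tendsto_power_div_exp_0)
  then show ?thesis
    by (simp add: poly_altdef sum_distrib_right exp_minus divide_inverse mult.assoc)
qed

text \<open>The functions p(1/t) e^(-1/t), extended by zero to t <= 0, are closed under
  differentiation: with X = 1/t the derivative belongs to the polynomial X^2 (p - p'). Smoothness of
  all orders thus reduces to one step, and flatness at 0 is the decay of a polynomial times e^(-X)
  at infinity.\<close>

lemma expflat_has_derivative:
  "(expflat p has_real_derivative expflat ([:0, 0, 1:] * (p - pderiv p)) t) (at t)"
proof -
  consider "t > 0" | "t < 0" | "t = 0" by linarith
  then show ?thesis
  proof cases
    case 1
    have i: "(inverse has_real_derivative - (inverse t)\<^sup>2) (at t)"
      using DERIV_inverse[of t UNIV] 1 by (simp add: power2_eq_square)
    have "((\<lambda>t. poly p (inverse t) * exp (- inverse t)) has_real_derivative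
            poly (pderiv p) (inverse t) * (- (inverse t)\<^sup>2) * exp (- inverse t) +
            exp (- inverse t) * (- (- (inverse t)\<^sup>2)) * poly p (inverse t)) (at t)"
      by (intro DERIV_mult DERIV_chain2[OF poly_DERIV i] DERIV_chain2[OF DERIV_exp DERIV_minus[OF i]])
    also have "poly (pderiv p) (inverse t) * (- (inverse t)\<^sup>2) * exp (- inverse t) +
            exp (- inverse t) * (- (- (inverse t)\<^sup>2)) * poly p (inverse t) =
            expflat ([:0, 0, 1:] * (p - pderiv p)) t"
      using 1 by (simp add: expflat_def power2_eq_square algebra_simps)
    finally have "((\<lambda>t. poly p (inverse t) * exp (- inverse t)) has_real_derivative
            expflat ([:0, 0, 1:] * (p - pderiv p)) t) (at t)" .
    moreover have "\<forall>\<^sub>F x in nhds t. expflat p x = poly p (inverse x) * exp (- inverse x)"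
      by (rule eventually_mono[OF eventually_nhds_in_open[of "{0<..}" t]])
         (use 1 in \<open>simp_all add: expflat_def\<close>)
    ultimately show ?thesis by (simp add: DERIV_cong_ev[OF refl _ refl])
  next
    case 2
    have "\<forall>\<^sub>F x in nhds t. expflat p x = 0"
      by (rule eventually_mono[OF eventually_nhds_in_open[of "{..<0}" t]])
         (use 2 in \<open>simp_all add: expflat_def\<close>)
    then have "(expflat p has_real_derivative 0) (at t)"
      using DERIV_cong_ev[of t t "expflat p" "\<lambda>_. 0" 0 0] by simp
    then show ?thesis using 2 by (simp add: expflat_def)
  next
    case 3
    \<comment> \<open>The right difference quotient at 0 is X p(X) e^(-X) with X = 1/h; hence the
      polynomial is multiplied by its variable.\<close>
    have "((\<lambda>x. poly (pCons 0 p) x * exp (- x)) \<longlongrightarrow> 0) at_top" by (rule poly_exp_tendsto_0)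
    then have "((\<lambda>x. poly (pCons 0 p) (inverse x) * exp (- inverse x)) \<longlongrightarrow> 0) (at_right 0)"
      using filterlim_compose[OF _ filterlim_inverse_at_top_right] by blast
    moreover have "\<forall>\<^sub>F h in at_right 0. poly (pCons 0 p) (inverse h) * exp (- inverse h)
        = (expflat p (0 + h) - expflat p 0) / h"
      using eventually_at_right_less[of "0::real"]
      by (rule eventually_mono) (simp add: expflat_def divide_inverse)
    ultimately have R: "((\<lambda>h. (expflat p (0 + h) - expflat p 0) / h) \<longlongrightarrow> 0) (at_right 0)"
      by (rule Lim_transform_eventually)
    have "\<forall>\<^sub>F h in at_left 0. (expflat p (0 + h) - expflat p 0) / h = 0"
      by (simp add: expflat_def eventually_at_filter)
    then have L: "((\<lambda>h. (expflat p (0 + h) - expflat p 0) / h) \<longlongrightarrow> 0) (at_left 0)"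
      by (rule tendsto_eventually)
    show ?thesis using filterlim_split_at[OF L R] 3
      by (simp add: DERIV_def expflat_def)
  qed
qed

text \<open>Leibniz's rule for e^(-1/(e+t)) e^(-1/(e-t)), recorded symbolically: an entry (p, q)
  stands for one product of two flat functions, and differentiation doubles the list. The minus sign
  is the inner derivative of e - t.\<close>

fun bump_terms :: "nat \<Rightarrow> (real poly \<times> real poly) list" where
  "bump_terms 0 = [(1, 1)]"
| "bump_terms (Suc m) =
     map (\<lambda>(p, q). ([:0, 0, 1:] * (p - pderiv p), q)) (bump_terms m) @
     map (\<lambda>(p, q). (p, - ([:0, 0, 1:] * (q - pderiv q)))) (bump_terms m)"

lemma expflat_uminus: "expflat (- p) t = - expflat p t"
  by (simp add: expflat_def)

text \<open>The bump comes with its whole sequence of derivatives, so that a product of bumps in the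
  coordinates can be differentiated any number of times by raising indices.\<close>

lemma smooth_bump_exists:
  assumes "e > 0"
  obtains d :: "nat \<Rightarrow> real \<Rightarrow> real" where
    "\<And>m t. (d m has_real_derivative d (Suc m) t) (at t)"
    "\<And>t. d 0 t \<ge> 0" "\<And>t. \<bar>t\<bar> \<ge> e \<Longrightarrow> d 0 t = 0" "\<And>t. \<bar>t\<bar> < e \<Longrightarrow> d 0 t > 0"
proof -
  define D where "D xs t = (\<Sum>(p, q)\<leftarrow>xs. expflat p (e + t) * expflat q (e - t))" for xs t
  have D: "(D xs has_real_derivative
      D (map (\<lambda>(p, q). ([:0, 0, 1:] * (p - pderiv p), q)) xs @
         map (\<lambda>(p, q). (p, - ([:0, 0, 1:] * (q - pderiv q)))) xs) t) (at t)" for xs t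
  proof (induction xs)
    case Nil
    then show ?case by (simp add: D_def)
  next
    case (Cons a xs)
    obtain p q where a: "a = (p, q)" by force
    have "((\<lambda>t. expflat p (e + t) * expflat q (e - t)) has_real_derivative
       expflat ([:0, 0, 1:] * (p - pderiv p)) (e + t) * expflat q (e - t) +
       expflat p (e + t) * expflat (- ([:0, 0, 1:] * (q - pderiv q))) (e - t)) (at t)"
      unfolding expflat_uminus
      by (rule DERIV_cong[OF DERIV_mult[OF DERIV_chain2[OF expflat_has_derivative] DERIV_chain2[OF expflat_has_derivative]]])
         (auto intro!: derivative_eq_intros)
    from DERIV_add[OF this Cons] show ?case by (simp add: D_def a algebra_simps)
  qed
  show ?thesis
  proof (rule that[of "\<lambda>m. D (bump_terms m)"])
    show "(D (bump_terms m) has_real_derivative D (bump_terms (Suc m)) t) (at t)" for m t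
      using D by simp
    show "D (bump_terms 0) t \<ge> 0" for t by (simp add: D_def expflat_def)
    show "D (bump_terms 0) t = 0" if "\<bar>t\<bar> \<ge> e" for t using that by (auto simp: D_def expflat_def)
    show "D (bump_terms 0) t > 0" if "\<bar>t\<bar> < e" for t using that by (simp add: D_def expflat_def)
  qed
qed

text \<open>Test functions are defined through partial derivatives, whereas product and chain rules
  live on Frechet derivatives. A Frechet derivative given by its coordinates carries both, for real
  and complex values alike.\<close>

definition has_grad :: "(real^'n::finite \<Rightarrow> 'b::real_normed_vector) \<Rightarrow> ('n \<Rightarrow> 'b) \<Rightarrow> real^'n \<Rightarrow> bool" where
  "has_grad f g x \<longleftrightarrow> (f has_derivative (\<lambda>h. \<Sum>j\<in>UNIV. (h $ j) *\<^sub>R g j)) (at x)"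

lemma has_gradI: "(f has_derivative f') (at x) \<Longrightarrow> (\<And>h. f' h = (\<Sum>j\<in>UNIV. (h $ j) *\<^sub>R g j)) \<Longrightarrow> has_grad f g x"
  unfolding has_grad_def by (erule has_derivative_eq_rhs) (simp add: fun_eq_iff)

lemma has_grad_cong:
  assumes "has_grad f g x" "\<And>j. g j = g' j" shows "has_grad f g' x"
  using assms by (simp add: has_grad_def)

lemma has_grad_cong_ev:
  assumes "has_grad f g x" "open S" "x \<in> S" "\<And>y. y \<in> S \<Longrightarrow> f y = f' y" shows "has_grad f' g x"
  using assms unfolding has_grad_def by (blast intro: has_derivative_transform_within_open)

lemma has_grad_continuous: "has_grad f g x \<Longrightarrow> isCont f x"
  unfolding has_grad_def by (rule has_derivative_continuous)

lemma has_grad_unique: "has_grad f g x \<Longrightarrow> has_grad f g' x \<Longrightarrow> g j = g' j"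
proof -
  assume "has_grad f g x" "has_grad f g' x"
  then have "(\<lambda>h. \<Sum>j\<in>UNIV. (h $ j) *\<^sub>R g j) = (\<lambda>h. \<Sum>j\<in>UNIV. (h $ j) *\<^sub>R g' j)"
    unfolding has_grad_def by (rule has_derivative_unique)
  from fun_cong[OF this, of "axis j 1"] show ?thesis
    by (simp add: axis_def if_distrib[of "\<lambda>a. a *\<^sub>R _"] sum.delta cong: if_cong)
qed

lemma has_grad_const: "has_grad (\<lambda>_. c) (\<lambda>_. 0) x"
  unfolding has_grad_def by simp

lemma has_grad_nth: "has_grad (\<lambda>x. x $ i) (\<lambda>j. if i = j then 1 else 0) x"
  unfolding has_grad_def
  by (rule has_derivative_eq_rhs[OF bounded_linear.has_derivative[OF bounded_linear_vec_nth has_derivative_ident]])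
     (auto simp: if_distrib[of "\<lambda>a. _ * a"] sum.delta' cong: if_cong)

lemma has_grad_add: "has_grad f g x \<Longrightarrow> has_grad f' g' x \<Longrightarrow> has_grad (\<lambda>x. f x + f' x) (\<lambda>j. g j + g' j) x"
  unfolding has_grad_def
  by (drule (1) has_derivative_add) (simp add: algebra_simps sum.distrib)

lemma has_grad_sum:
  "(\<And>i. i \<in> I \<Longrightarrow> has_grad (f i) (g i) x) \<Longrightarrow> has_grad (\<lambda>x. \<Sum>i\<in>I. f i x) (\<lambda>j. \<Sum>i\<in>I. g i j) x"
  by (induction I rule: infinite_finite_induct) (auto intro: has_grad_const has_grad_add)

lemma has_grad_linear:
  assumes "bounded_linear L" "has_grad f g x" shows "has_grad (\<lambda>x. L (f x)) (\<lambda>j. L (g j)) x"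
  using bounded_linear.has_derivative[OF assms(1) assms(2)[unfolded has_grad_def]]
  by (rule has_gradI) (simp add: linear_sum[OF bounded_linear.linear[OF assms(1)]]
      linear_cmul[OF bounded_linear.linear[OF assms(1)]])

lemma has_grad_mult:
  fixes f f' :: "real^'n \<Rightarrow> 'b::real_normed_field"
  shows "has_grad f g x \<Longrightarrow> has_grad f' g' x \<Longrightarrow> has_grad (\<lambda>x. f x * f' x) (\<lambda>j. g j * f' x + f x * g' j) x"
  unfolding has_grad_def
  by (drule (1) has_derivative_mult)
     (simp add: algebra_simps sum.distrib sum_distrib_left sum_distrib_right)

lemma has_grad_minus_arg:
  assumes "has_grad f g (a - x)" shows "has_grad (\<lambda>x. f (a - x)) (\<lambda>j. - g j) x"
proof -
  have "((\<lambda>x. f (a - x)) has_derivative (\<lambda>h. \<Sum>j\<in>UNIV. ((- h) $ j) *\<^sub>R g j)) (at x)"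
    by (rule has_derivative_compose[where f="\<lambda>x. a - x" and f'="\<lambda>h. - h", OF _ assms[unfolded has_grad_def]])
       (auto intro!: derivative_eq_intros)
  then show ?thesis by (rule has_gradI) simp
qed

lemma has_grad_shift_arg:
  assumes "has_grad f g (x - a)" shows "has_grad (\<lambda>x. f (x - a)) g x"
proof -
  have "((\<lambda>x. f (x - a)) has_derivative (\<lambda>h. \<Sum>j\<in>UNIV. (h $ j) *\<^sub>R g j)) (at x)"
    by (rule has_derivative_compose[where f="\<lambda>x. x - a" and f'="\<lambda>h. h", OF _ assms[unfolded has_grad_def]])
       (auto intro!: derivative_eq_intros)
  then show ?thesis by (rule has_gradI) simp
qed

lemma has_grad_direction:
  assumes "has_grad f g (x + t *\<^sub>R v)"
  shows "((\<lambda>t. f (x + t *\<^sub>R v)) has_vector_derivative (\<Sum>j\<in>UNIV. (v $ j) *\<^sub>R g j)) (at t)"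
proof -
  have "((\<lambda>t. f (x + t *\<^sub>R v)) has_derivative (\<lambda>h. \<Sum>j\<in>UNIV. ((h *\<^sub>R v) $ j) *\<^sub>R g j)) (at t)"
    by (rule has_derivative_compose[where f="\<lambda>t. x + t *\<^sub>R v" and f'="\<lambda>h. h *\<^sub>R v", OF _ assms[unfolded has_grad_def]])
       (auto intro!: derivative_eq_intros)
  then show ?thesis
    by (simp add: has_vector_derivative_def scaleR_sum_right)
qed

lemma partial_deriv_eq:
  fixes f :: "real^'n \<Rightarrow> real"
  assumes "has_grad f g x"
  shows "partial_deriv j f x = g j" "(\<lambda>t. f (x + t *\<^sub>R axis j 1)) differentiable (at 0)"
proof -
  have "((\<lambda>t. f (x + t *\<^sub>R axis j 1)) has_real_derivative g j) (at 0)"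
    using has_grad_direction[of f g x 0 "axis j 1"] assms
    by (simp add: axis_def if_distrib[of "\<lambda>a. a * _"] sum.delta has_real_derivative_iff_has_vector_derivative cong: if_cong)
  then show "partial_deriv j f x = g j" "(\<lambda>t. f (x + t *\<^sub>R axis j 1)) differentiable (at 0)"
    unfolding partial_deriv_def real_differentiable_def by (blast intro: DERIV_imp_deriv)+
qed

section \<open>Differentiation under the integral sign and mollification\<close>

text \<open>Dominated convergence along a continuous parameter, reduced to sequences. The domination
  is asked near \<open>x0\<close> but not at \<open>x0\<close>, where a difference quotient carries
  no information.\<close>

lemma tendsto_integral_dominated_at:
  fixes s :: "'a::metric_space \<Rightarrow> 'b \<Rightarrow> 'c::{banach, second_countable_topology}"
  assumes "r > 0" "\<And>x. x \<in> ball x0 r \<Longrightarrow> s x \<in> borel_measurable M"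
    and B: "integrable M B" and bd: "\<And>x y. x \<in> ball x0 r \<Longrightarrow> x \<noteq> x0 \<Longrightarrow> y \<in> space M \<Longrightarrow> norm (s x y) \<le> B y"
    and lim: "\<And>y. y \<in> space M \<Longrightarrow> ((\<lambda>x. s x y) \<longlongrightarrow> f y) (at x0)"
    and f: "f \<in> borel_measurable M"
  shows "((\<lambda>x. integral\<^sup>L M (s x)) \<longlongrightarrow> integral\<^sup>L M f) (at x0)"
  unfolding tendsto_at_iff_sequentially comp_def
proof (intro allI impI)
  fix X :: "nat \<Rightarrow> 'a" assume X: "\<forall>i. X i \<in> UNIV - {x0}" "X \<longlonglongrightarrow> x0"
  obtain N where N: "\<And>n. n \<ge> N \<Longrightarrow> X n \<in> ball x0 r"
    using X(2) \<open>r > 0\<close> by (metis lim_sequentially dist_commute mem_ball)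
  have "(\<lambda>n. integral\<^sup>L M (s (X (n + N)))) \<longlonglongrightarrow> integral\<^sup>L M f"
  proof (rule integral_dominated_convergence[where w=B])
    show "s (X (n + N)) \<in> borel_measurable M" for n using N assms(2) by simp
    show "AE y in M. (\<lambda>n. s (X (n + N)) y) \<longlonglongrightarrow> f y"
    proof (rule AE_I2)
      fix y assume "y \<in> space M"
      then have "(\<lambda>n. s (X n) y) \<longlonglongrightarrow> f y"
        using lim X unfolding tendsto_at_iff_sequentially comp_def by blast
      then show "(\<lambda>n. s (X (n + N)) y) \<longlonglongrightarrow> f y" by (rule LIMSEQ_ignore_initial_segment)
    qed
    show "AE y in M. norm (s (X (n + N)) y) \<le> B y" for n
      using N[of "n + N"] bd X(1) by (intro AE_I2) auto
  qed (use f B in auto)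
  then show "(\<lambda>n. integral\<^sup>L M (s (X n))) \<longlonglongrightarrow> integral\<^sup>L M f"
    by (rule LIMSEQ_offset)
qed

lemma isCont_integral_dominated:
  fixes s :: "'a::metric_space \<Rightarrow> 'b \<Rightarrow> 'c::{banach, second_countable_topology}"
  assumes "r > 0" "\<And>x. x \<in> ball x0 r \<Longrightarrow> s x \<in> borel_measurable M"
    and "integrable M B" "\<And>x y. x \<in> ball x0 r \<Longrightarrow> y \<in> space M \<Longrightarrow> norm (s x y) \<le> B y"
    and "\<And>y. y \<in> space M \<Longrightarrow> isCont (\<lambda>x. s x y) x0"
  shows "isCont (\<lambda>x. integral\<^sup>L M (s x)) x0"
  unfolding isCont_def
  by (rule tendsto_integral_dominated_at[where B=B]) (use assms in \<open>auto simp: isCont_def\<close>)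

text \<open>A bound on the partial derivatives over a whole ball gives, by the mean value inequality
  on this convex set, a Lipschitz bound for the integrand, and with it one integrable majorant for
  all difference quotients.\<close>

lemma has_grad_integral:
  fixes g :: "real^'n \<Rightarrow> 'b \<Rightarrow> 'c::{banach, second_countable_topology}"
  assumes r: "r > 0" and int: "\<And>x. x \<in> ball x0 r \<Longrightarrow> integrable M (g x)"
    and der: "\<And>x y. x \<in> ball x0 r \<Longrightarrow> y \<in> space M \<Longrightarrow> has_grad (\<lambda>x. g x y) (\<lambda>j. D j x y) x"
    and bd: "\<And>x y j. x \<in> ball x0 r \<Longrightarrow> y \<in> space M \<Longrightarrow> norm (D j x y) \<le> B y"
    and B: "integrable M B"
    and meas: "\<And>j. D j x0 \<in> borel_measurable M"
  shows "has_grad (\<lambda>x. integral\<^sup>L M (g x)) (\<lambda>j. integral\<^sup>L M (D j x0)) x0"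
proof -
  define L where "L h y = (\<Sum>j\<in>UNIV. (h $ j) *\<^sub>R D j x0 y)" for h :: "real^'n" and y
  have x0: "x0 \<in> ball x0 r" using r by simp
  have iD: "integrable M (D j x0)" for j
    by (rule Bochner_Integration.integrable_bound[OF B meas])
       (auto intro!: AE_I2 order_trans[OF bd[OF x0] abs_ge_self])
  have iL: "integrable M (L h)" for h unfolding L_def
    by (intro Bochner_Integration.integrable_sum integrable_scaleR_right iD)
  have Leq: "integral\<^sup>L M (L h) = (\<Sum>j\<in>UNIV. (h $ j) *\<^sub>R integral\<^sup>L M (D j x0))" for h
    unfolding L_def by (simp add: iD)
  have lip: "norm (g x y - g x0 y) \<le> (real CARD('n) * B y) * norm (x - x0)"
    if x: "x \<in> ball x0 r" and y: "y \<in> space M" for x y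
  proof (rule differentiable_bound[OF convex_ball])
    show "((\<lambda>x. g x y) has_derivative (\<lambda>h. \<Sum>j\<in>UNIV. (h $ j) *\<^sub>R D j z y)) (at z within ball x0 r)"
      if "z \<in> ball x0 r" for z
      using der[OF that y] unfolding has_grad_def by (rule has_derivative_at_withinI)
    show "onorm (\<lambda>h. \<Sum>j\<in>UNIV. (h $ j) *\<^sub>R D j z y) \<le> real CARD('n) * B y" if z: "z \<in> ball x0 r" for z
    proof (rule onorm_le)
      fix h :: "real^'n"
      have "norm (\<Sum>j\<in>UNIV. (h $ j) *\<^sub>R D j z y) \<le> (\<Sum>j\<in>(UNIV::'n set). norm h * B y)"
        by (rule sum_norm_le) (auto intro!: mult_mono component_le_norm_cart bd[OF z y])
      then show "norm (\<Sum>j\<in>UNIV. (h $ j) *\<^sub>R D j z y) \<le> real CARD('n) * B y * norm h"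
        by (simp add: ac_simps)
    qed
  qed (use x x0 in auto)
  have Lb: "norm (L h y) \<le> (real CARD('n) * B y) * norm h" if "y \<in> space M" for h y
  proof -
    have "norm (\<Sum>j\<in>UNIV. (h $ j) *\<^sub>R D j x0 y) \<le> (\<Sum>j\<in>(UNIV::'n set). norm h * B y)"
      by (rule sum_norm_le) (auto intro!: mult_mono component_le_norm_cart bd[OF x0 that])
    then show ?thesis by (simp add: ac_simps L_def)
  qed
  \<comment> \<open>In the majorant one multiple of n B bounds the increment and the other the
    linear part.\<close>
  have "((\<lambda>x. integral\<^sup>L M (\<lambda>y. (g x y - g x0 y - L (x - x0) y) /\<^sub>R norm (x - x0))) \<longlongrightarrow> integral\<^sup>L M (\<lambda>_. 0)) (at x0)"
  proof (rule tendsto_integral_dominated_at[OF r, where B="\<lambda>y. 2 * real CARD('n) * B y"])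
    show "(\<lambda>y. (g x y - g x0 y - L (x - x0) y) /\<^sub>R norm (x - x0)) \<in> borel_measurable M" if "x \<in> ball x0 r" for x
      using int[OF that] int[OF x0] iL[of "x - x0"] by measurable
    show "norm ((g x y - g x0 y - L (x - x0) y) /\<^sub>R norm (x - x0)) \<le> 2 * real CARD('n) * B y"
      if "x \<in> ball x0 r" "x \<noteq> x0" "y \<in> space M" for x y
    proof -
      have "norm (g x y - g x0 y - L (x - x0) y) \<le> 2 * real CARD('n) * B y * norm (x - x0)"
        using norm_triangle_ineq4[of "g x y - g x0 y" "L (x - x0) y"] lip[OF that(1,3)] Lb[OF that(3), of "x - x0"]
        by simp
      then show ?thesis using that(2) by (simp add: divide_simps norm_divide mult.commute)
    qed
    show "((\<lambda>x. (g x y - g x0 y - L (x - x0) y) /\<^sub>R norm (x - x0)) \<longlongrightarrow> 0) (at x0)" if "y \<in> space M" for y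
      using der[OF x0 that] unfolding has_grad_def has_derivative_at' has_derivative_def L_def
      by (simp add: Lim_ident_at)
  qed (use B in auto)
  moreover have "\<forall>\<^sub>F x in at x0. integral\<^sup>L M (\<lambda>y. (g x y - g x0 y - L (x - x0) y) /\<^sub>R norm (x - x0)) =
     (integral\<^sup>L M (g x) - integral\<^sup>L M (g x0) - integral\<^sup>L M (L (x - x0))) /\<^sub>R norm (x - x0)"
    unfolding eventually_at_topological
    by (rule exI[of _ "ball x0 r"]) (use r int x0 iL in \<open>auto simp: Bochner_Integration.integral_diff\<close>)
  ultimately have "((\<lambda>x. (integral\<^sup>L M (g x) - integral\<^sup>L M (g x0) - integral\<^sup>L M (L (x - x0))) /\<^sub>R norm (x - x0)) \<longlongrightarrow> 0) (at x0)"
    by (simp add: Lim_transform_eventually)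
  moreover have "bounded_linear (\<lambda>h::real^'n. \<Sum>j\<in>UNIV. (h $ j) *\<^sub>R integral\<^sup>L M (D j x0))"
    by (intro bounded_linear_sum bounded_linear_scaleR_const bounded_linear_vec_nth)
  ultimately show ?thesis
    unfolding has_grad_def has_derivative_def by (simp add: Leq Lim_ident_at)
qed

section \<open>Convolution with a smooth bump\<close>

lemma lborel_integral_reflect:
  fixes f :: "real^'n \<Rightarrow> 'b::{banach, second_countable_topology}"
  assumes "f \<in> borel_measurable borel"
  shows "(\<integral>z. f (x - z) \<partial>lborel) = integral\<^sup>L lborel f"
proof -
  have "distr lborel borel (\<lambda>z. x - z) = (lborel :: (real^'n) measure)"
    using lborel_affine[of "- 1" x] by (simp add: density_1)
  then have "integral\<^sup>L lborel f = integral\<^sup>L (distr lborel borel (\<lambda>z. x - z)) f" by simp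
  also have "\<dots> = (\<integral>z. f (x - z) \<partial>lborel)" by (rule integral_distr) (use assms in auto)
  finally show ?thesis by simp
qed


lemma compact_support_grad_zero:
  assumes "compact K" "\<And>x. x \<notin> K \<Longrightarrow> f x = 0" "has_grad f g x" "x \<notin> K"
  shows "g j = 0"
proof -
  have "has_grad f (\<lambda>_. 0) x"
    by (rule has_grad_cong_ev[OF has_grad_const[of 0 x], of "- K"])
       (use assms compact_imp_closed in \<open>auto simp: open_Compl\<close>)
  from has_grad_unique[OF assms(3) this] show ?thesis .
qed

lemma has_grad_continuous_on: "(\<And>x. has_grad f (\<lambda>j. g j x) x) \<Longrightarrow> continuous_on UNIV f"
  by (meson continuous_at_imp_continuous_on has_grad_continuous)

text \<open>All derivatives fall on the factor \<open>\<rho>\<close>. The mollification uses this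
  with the roles exchanged: derivatives on the bump give smoothness, derivatives on the mollified
  function give approximation of its gradient.\<close>

lemma convolution_has_grad:
  fixes \<phi> \<rho> :: "real^'n \<Rightarrow> real"
  assumes \<phi>: "continuous_on UNIV \<phi>" and K: "compact K" and supp: "\<And>x. x \<notin> K \<Longrightarrow> \<phi> x = 0"
    and \<rho>: "\<And>z. has_grad \<rho> (\<lambda>j. \<rho>' j z) z" and \<rho>': "\<And>j. continuous_on UNIV (\<rho>' j)"
  shows "has_grad (\<lambda>x. \<integral>z. \<phi> z * \<rho> (x - z) \<partial>lborel) (\<lambda>j. \<integral>z. \<phi> z * \<rho>' j (x - z) \<partial>lborel) x"
proof -
  have c\<rho>: "continuous_on UNIV \<rho>" by (rule has_grad_continuous_on[OF \<rho>])
  have meas: "(\<lambda>z. \<phi> z * f (x - z)) \<in> borel_measurable borel" if "continuous_on UNIV f" for f :: "real^'n \<Rightarrow> real" and x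
    by (rule borel_measurable_continuous_onI)
       (intro continuous_intros \<phi> continuous_on_compose2[OF that], auto)
  have "\<exists>C. \<forall>x'\<in>ball x 1. \<forall>z. \<bar>\<phi> z * f (x' - z)\<bar> \<le> C * indicator K z"
    if f: "continuous_on UNIV f" for f :: "real^'n \<Rightarrow> real"
  proof -
    have "compact ((\<lambda>(x', z). \<phi> z * f (x' - z)) ` (cball x 1 \<times> K))"
      by (intro compact_continuous_image compact_Times K)
         (auto simp: case_prod_beta intro!: continuous_intros continuous_on_compose2[OF \<phi>] continuous_on_compose2[OF f])
    then obtain C where C: "\<And>x' z. x' \<in> cball x 1 \<Longrightarrow> z \<in> K \<Longrightarrow> \<bar>\<phi> z * f (x' - z)\<bar> \<le> C"
      by (auto dest!: compact_imp_bounded simp: bounded_iff simp del: mem_cball) blast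
    show ?thesis
    proof (intro exI[of _ C] ballI allI)
      fix x' z assume "x' \<in> ball x 1"
      then show "\<bar>\<phi> z * f (x' - z)\<bar> \<le> C * indicator K z"
        using C[of x' z] supp[of z] by (cases "z \<in> K") (auto simp: less_imp_le)
    qed
  qed
  note bound = this
  obtain C0 where C0: "\<And>x' z. x' \<in> ball x 1 \<Longrightarrow> \<bar>\<phi> z * \<rho> (x' - z)\<bar> \<le> C0 * indicator K z"
    using bound[OF c\<rho>] by blast
  have "\<exists>C. \<forall>j. \<forall>x'\<in>ball x 1. \<forall>z. \<bar>\<phi> z * \<rho>' j (x' - z)\<bar> \<le> C j * indicator K z"
    using bound[OF \<rho>'] by metis
  then obtain C where C: "\<And>j x' z. x' \<in> ball x 1 \<Longrightarrow> \<bar>\<phi> z * \<rho>' j (x' - z)\<bar> \<le> C j * indicator K z"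
    by blast
  have "integrable lborel (indicator K :: _ \<Rightarrow> real)"
    using emeasure_compact_finite[OF K] K by (intro integrable_real_indicator) (auto intro: borel_compact)
  note this[simp]
  have C': "C j \<le> (\<Sum>j\<in>UNIV. \<bar>C j\<bar>)" for j
    using member_le_sum[of j UNIV "\<lambda>j. \<bar>C j\<bar>"] by simp
  show ?thesis
  proof (rule has_grad_integral[where r=1 and D="\<lambda>j x z. \<phi> z * \<rho>' j (x - z)" and B="\<lambda>z. (\<Sum>j\<in>UNIV. \<bar>C j\<bar>) * indicator K z"])
    fix x' assume x': "x' \<in> ball x 1"
    show "integrable lborel (\<lambda>z. \<phi> z * \<rho> (x' - z))"
      by (rule Bochner_Integration.integrable_bound[of _ "\<lambda>z. C0 * indicator K z"])
         (use meas[OF c\<rho>] C0[OF x'] in \<open>auto intro!: AE_I2 order_trans[OF _ abs_ge_self]\<close>)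
    fix z
    have "has_grad (\<lambda>x. \<rho> (x - z)) (\<lambda>j. \<rho>' j (x' - z)) x'"
      by (rule has_grad_shift_arg[OF \<rho>])
    from has_grad_mult[OF has_grad_const this, of "\<phi> z"]
    show "has_grad (\<lambda>x. \<phi> z * \<rho> (x - z)) (\<lambda>j. \<phi> z * \<rho>' j (x' - z)) x'" by simp
    fix j
    show "norm (\<phi> z * \<rho>' j (x' - z)) \<le> (\<Sum>j\<in>UNIV. \<bar>C j\<bar>) * indicator K z"
      using C[OF x', of z j] mult_right_mono[OF C'[of j], of "indicator K z"] by simp
  qed (use meas[OF \<rho>'] in auto)
qed

text \<open>The multi-index \<open>m\<close> names the order of differentiation in each coordinate;
  the partial derivative in direction j only raises its j-th entry.\<close>

lemma has_grad_prod_components: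
  fixes d :: "nat \<Rightarrow> real \<Rightarrow> real"
  assumes "\<And>m t. (d m has_real_derivative d (Suc m) t) (at t)"
  shows "has_grad (\<lambda>z. \<Prod>i\<in>UNIV. d (m i) (z $ i))
           (\<lambda>j. \<Prod>i\<in>UNIV. d ((m(j := Suc (m j))) i) (z $ i)) z"
proof -
  have 1: "((\<lambda>z. d (m i) (z $ i)) has_derivative (\<lambda>h. d (Suc (m i)) (z $ i) * h $ i)) (at z)" for i
    by (rule has_derivative_compose[OF bounded_linear.has_derivative[OF bounded_linear_vec_nth has_derivative_ident]
          assms[unfolded has_field_derivative_def]])
  have eq: "(\<Prod>i\<in>UNIV. d ((m(j := Suc (m j))) i) (z $ i)) = d (Suc (m j)) (z $ j) * (\<Prod>i\<in>UNIV - {j}. d (m i) (z $ i))" for j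
  proof -
    have "(\<Prod>i\<in>UNIV. d ((m(j := Suc (m j))) i) (z $ i)) = d (Suc (m j)) (z $ j) * (\<Prod>i\<in>UNIV - {j}. d ((m(j := Suc (m j))) i) (z $ i))"
      by (subst prod.remove[of _ j]) auto
    also have "(\<Prod>i\<in>UNIV - {j}. d ((m(j := Suc (m j))) i) (z $ i)) = (\<Prod>i\<in>UNIV - {j}. d (m i) (z $ i))"
      by (rule prod.cong) auto
    finally show ?thesis .
  qed
  show ?thesis
    by (rule has_gradI[OF has_derivative_prod[OF 1]]) (simp only: eq real_scaleR_def ac_simps)
qed

text \<open>Averaging against a probability density on the ball of radius \<open>e\<close>.
  Quantifying over all a and c serves three purposes at once: a = c = 0 gives the support, a = 0
  uniform bounds, and a equal to the value at x convergence.\<close>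

lemma mollifier_exists:
  fixes \<phi> :: "real^'n \<Rightarrow> real" and \<phi>' :: "'n \<Rightarrow> real^'n \<Rightarrow> real"
  assumes \<phi>: "\<And>x. has_grad \<phi> (\<lambda>j. \<phi>' j x) x" and \<phi>': "\<And>j. continuous_on UNIV (\<phi>' j)"
    and K: "compact K" and supp: "\<And>x. x \<notin> K \<Longrightarrow> \<phi> x = 0" and e: "e > 0"
  obtains \<psi> where "smooth_fun \<psi>"
    "\<And>x a c. (\<And>y. y \<in> cball x e \<Longrightarrow> \<bar>\<phi> y - a\<bar> \<le> c) \<Longrightarrow> \<bar>\<psi> x - a\<bar> \<le> c"
    "\<And>j x a c. (\<And>y. y \<in> cball x e \<Longrightarrow> \<bar>\<phi>' j y - a\<bar> \<le> c) \<Longrightarrow> \<bar>partial_deriv j \<psi> x - a\<bar> \<le> c"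
proof -
  \<comment> \<open>Half-width e/n in each coordinate puts the supporting cube inside the ball,
    because the Euclidean norm is at most the sum of the absolute coordinates.\<close>
  obtain d :: "nat \<Rightarrow> real \<Rightarrow> real" where d: "\<And>m t. (d m has_real_derivative d (Suc m) t) (at t)"
    "\<And>t. d 0 t \<ge> 0" "\<And>t. \<bar>t\<bar> \<ge> e / CARD('n) \<Longrightarrow> d 0 t = 0" "\<And>t. \<bar>t\<bar> < e / CARD('n) \<Longrightarrow> d 0 t > 0"
    using smooth_bump_exists[of "e / CARD('n)"] e by auto
  define P where "P m z = (\<Prod>i\<in>UNIV. d (m i) (z $ i))" for m and z :: "real^'n"
  define m0 where "m0 = (\<lambda>i::'n. 0::nat)"
  have P: "has_grad (P m) (\<lambda>j. P (m(j := Suc (m j))) z) z" for m z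
    unfolding P_def by (rule has_grad_prod_components, rule d(1))
  have cP: "continuous_on UNIV (P m)" for m by (rule has_grad_continuous_on[OF P])
  define \<rho> where "\<rho> = P m0"
  have \<rho>0: "\<rho> z \<ge> 0" for z unfolding \<rho>_def P_def m0_def by (intro prod_nonneg) (simp add: d)
  have \<rho>e: "\<rho> z = 0" if "norm z > e" for z
  proof -
    have "\<exists>i. \<bar>z $ i\<bar> \<ge> e / CARD('n)"
    proof (rule ccontr)
      assume "\<not> ?thesis"
      then have "(\<Sum>i\<in>UNIV. \<bar>z $ i\<bar>) \<le> (\<Sum>i\<in>(UNIV::'n set). e / CARD('n))"
        by (intro sum_mono) (simp add: not_le less_imp_le)
      then show False using norm_le_l1_cart[of z] that by simp
    qed
    then obtain i where "d (m0 i) (z $ i) = 0" using d(3) by (auto simp: m0_def)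
    then show ?thesis unfolding \<rho>_def P_def by (auto intro: prod_zero)
  qed
  have c\<rho>: "continuous_on UNIV \<rho>" unfolding \<rho>_def by (rule cP)
  have [measurable]: "\<rho> \<in> borel_measurable borel" by (rule borel_measurable_continuous_onI[OF c\<rho>])
  have icont: "integrable lborel (\<lambda>z. f z * \<rho> z)" if "continuous_on UNIV f" for f :: "real^'n \<Rightarrow> real"
  proof -
    have "set_integrable lborel (cball 0 e) (\<lambda>z. f z * \<rho> z)"
      unfolding set_integrable_def by (rule borel_integrable_compact) (auto intro!: continuous_intros continuous_on_subset[OF that] continuous_on_subset[OF c\<rho>])
    moreover have "(\<lambda>z. indicator (cball 0 e) z *\<^sub>R (f z * \<rho> z)) = (\<lambda>z. f z * \<rho> z)"
      by (auto simp: indicator_def fun_eq_iff \<rho>e)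
    ultimately show ?thesis by (simp add: set_integrable_def)
  qed
  have i\<rho>: "integrable lborel \<rho>" using icont[of "\<lambda>_. 1"] by simp
  define I where "I = integral\<^sup>L lborel \<rho>"
  \<comment> \<open>The set where the bump is nonzero is open. Were the mass zero, this set would be
    negligible, hence empty, but it contains 0.\<close>
  have I0: "I \<noteq> 0"
  proof
    assume "I = 0"
    then have "AE z in lborel. \<rho> z = 0"
      using integral_nonneg_eq_0_iff_AE[OF i\<rho>] \<rho>0 by (simp add: I_def)
    then have "AE z in lebesgue. \<rho> z = 0" by (rule AE_completion)
    moreover have o: "open {z. \<rho> z \<noteq> 0}" by (intro open_Collect_neq c\<rho> continuous_intros)
    then have "{z. \<rho> z \<noteq> 0} \<in> sets lebesgue" by auto
    ultimately have "negligible {z. \<rho> z \<noteq> 0}"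
      unfolding negligible_iff_null_sets by (subst AE_iff_null_sets) simp_all
    then have "\<rho> 0 = 0" using open_not_negligible[OF o] by blast
    moreover have "\<rho> 0 > 0" unfolding \<rho>_def P_def m0_def using e by (intro prod_pos) (simp add: d)
    ultimately show False by simp
  qed
  have "I \<ge> 0" unfolding I_def by (rule Bochner_Integration.integral_nonneg) (rule \<rho>0)
  then have I: "I > 0" using I0 by linarith
  define Q where "Q m x = (\<integral>z. (\<phi> z / I) * P m (x - z) \<partial>lborel)" for m and x :: "real^'n"
  have c\<phi>: "continuous_on UNIV \<phi>" by (rule has_grad_continuous_on[OF \<phi>])
  have Q: "has_grad (Q m) (\<lambda>j. Q (m(j := Suc (m j))) x) x" for m x
    unfolding Q_def
    by (rule convolution_has_grad[OF _ K _ P cP]) (auto simp: supp I0 intro!: continuous_intros c\<phi>)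
  \<comment> \<open>Partial derivatives only raise the multi-index, so every iterated partial
    derivative is again some \<open>Q m\<close>.\<close>
  have "\<exists>m. iter_partial js (Q m0) = Q m" for js
  proof (induction js)
    case (Cons j js)
    then obtain m where m: "iter_partial js (Q m0) = Q m" by blast
    show ?case
      by (rule exI[of _ "m(j := Suc (m j))"]) (auto simp: m partial_deriv_eq(1)[OF Q] simp del: fun_upd_apply intro!: ext)
  qed auto
  then have sm: "smooth_fun (Q m0)"
    unfolding smooth_fun_def
  proof (intro allI)
    fix js
    obtain m where "iter_partial js (Q m0) = Q m"
      using \<open>\<And>js. \<exists>m. iter_partial js (Q m0) = Q m\<close> by blast
    then show "continuous_on UNIV (iter_partial js (Q m0)) \<and>
        (\<forall>j x. (\<lambda>t. iter_partial js (Q m0) (x + t *\<^sub>R axis j 1)) differentiable (at 0))"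
      using partial_deriv_eq(2)[OF Q] has_grad_continuous_on[OF Q] by simp
  qed
  have avg: "\<bar>(\<integral>z. (f z / I) * \<rho> (x - z) \<partial>lborel) - a\<bar> \<le> c"
    if f: "continuous_on UNIV f" and b: "\<And>y. y \<in> cball x e \<Longrightarrow> \<bar>f y - a\<bar> \<le> c" for f :: "real^'n \<Rightarrow> real" and x a c
  proof -
    have cf: "continuous_on UNIV (\<lambda>y. f (x - y))" by (intro continuous_on_compose2[OF f] continuous_intros) auto
    have [measurable]: "f \<in> borel_measurable borel" by (rule borel_measurable_continuous_onI[OF f])
    have "(\<integral>z. (f z / I) * \<rho> (x - z) \<partial>lborel) = (\<integral>y. (f (x - y) / I) * \<rho> y \<partial>lborel)"
      using lborel_integral_reflect[of "\<lambda>z. (f z / I) * \<rho> (x - z)" x] by (auto simp: I0)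
    also have "\<dots> = (\<integral>y. f (x - y) * \<rho> y \<partial>lborel) / I"
      by (subst integral_divide_zero[symmetric]) (simp add: field_simps)
    also have "\<dots> - a = ((\<integral>y. f (x - y) * \<rho> y \<partial>lborel) - (\<integral>y. a * \<rho> y \<partial>lborel)) / I"
      using I by (simp add: I_def field_simps)
    also have "(\<integral>y. f (x - y) * \<rho> y \<partial>lborel) - (\<integral>y. a * \<rho> y \<partial>lborel) = (\<integral>y. (f (x - y) - a) * \<rho> y \<partial>lborel)"
      by (subst Bochner_Integration.integral_diff[symmetric]) (auto intro!: icont cf simp: i\<rho> left_diff_distrib)
    finally have 1: "(\<integral>z. (f z / I) * \<rho> (x - z) \<partial>lborel) - a = (\<integral>y. (f (x - y) - a) * \<rho> y \<partial>lborel) / I" .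
    have "\<bar>\<integral>y. (f (x - y) - a) * \<rho> y \<partial>lborel\<bar> \<le> (\<integral>y. c * \<rho> y \<partial>lborel)"
    proof (rule integral_abs_bound_integral)
      show "integrable lborel (\<lambda>y. (f (x - y) - a) * \<rho> y)" by (intro icont continuous_intros cf)
      show "\<bar>(f (x - y) - a) * \<rho> y\<bar> \<le> c * \<rho> y" for y
        using b[of "x - y"] \<rho>0[of y] \<rho>e[of y] by (cases "norm y \<le> e") (auto simp: abs_mult dist_norm intro!: mult_right_mono)
    qed (use i\<rho> in auto)
    also have "\<dots> = c * I" by (simp add: I_def)
    finally show ?thesis unfolding 1 using I by (simp add: field_simps)
  qed
  \<comment> \<open>A second expression for the same gradient: after reflection the bump is the
    fixed factor and the derivative falls on \<open>\<phi>\<close>.\<close>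
  have Q': "has_grad (Q m0) (\<lambda>j. \<integral>z. (\<phi>' j z / I) * \<rho> (x - z) \<partial>lborel) x" for x
  proof -
    have m\<phi>[measurable]: "\<phi> \<in> borel_measurable borel" by (rule borel_measurable_continuous_onI[OF c\<phi>])
    have m\<phi>'[measurable]: "\<phi>' j \<in> borel_measurable borel" for j by (rule borel_measurable_continuous_onI[OF \<phi>'])
    have e1: "(\<integral>z. (f z / I) * \<rho> (x - z) \<partial>lborel) = (\<integral>z. (\<rho> z * indicator (cball 0 e) z / I) * f (x - z) \<partial>lborel)"
      if [measurable]: "f \<in> borel_measurable borel" for f x
    proof -
      have "(\<integral>z. (f z / I) * \<rho> (x - z) \<partial>lborel) = (\<integral>y. (f (x - y) / I) * \<rho> y \<partial>lborel)"
        using lborel_integral_reflect[of "\<lambda>z. (f z / I) * \<rho> (x - z)" x] by (auto simp: I0)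
      also have "\<dots> = (\<integral>z. (\<rho> z * indicator (cball 0 e) z / I) * f (x - z) \<partial>lborel)"
        by (rule Bochner_Integration.integral_cong) (auto simp: indicator_def \<rho>e)
      finally show ?thesis .
    qed
    have Qe: "Q m0 = (\<lambda>x. \<integral>z. (\<rho> z / I) * \<phi> (x - z) \<partial>lborel)"
      using lborel_integral_reflect[of "\<lambda>z. (\<phi> z / I) * \<rho> (x - z)" x for x]
      by (auto simp: Q_def \<rho>_def[symmetric] fun_eq_iff ac_simps)
    have "has_grad (Q m0) (\<lambda>j. \<integral>z. (\<rho> z / I) * \<phi>' j (x - z) \<partial>lborel) x"
      unfolding Qe
      by (rule convolution_has_grad[OF _ compact_cball[of 0 e] _ \<phi> \<phi>'])
         (auto simp: \<rho>e I0 intro!: continuous_intros c\<rho>)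
    then show ?thesis
      by (rule has_grad_cong)
         (use lborel_integral_reflect[of "\<lambda>z. (\<phi>' j z / I) * \<rho> (x - z)" x for j] in \<open>auto simp: ac_simps\<close>)
  qed
  show ?thesis
  proof (rule that[of "Q m0", OF sm])
    show "\<bar>Q m0 x - a\<bar> \<le> c" if "\<And>y. y \<in> cball x e \<Longrightarrow> \<bar>\<phi> y - a\<bar> \<le> c" for x a c
      using avg[OF c\<phi> that] by (simp add: Q_def \<rho>_def)
    show "\<bar>partial_deriv j (Q m0) x - a\<bar> \<le> c" if "\<And>y. y \<in> cball x e \<Longrightarrow> \<bar>\<phi>' j y - a\<bar> \<le> c" for j x a c
      unfolding partial_deriv_eq(1)[OF Q'] by (rule avg[OF \<phi>' that])
  qed
qed

section \<open>Weak solutions outside a ball\<close>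

text \<open>The gradient is kept as data and \<open>K\<close> need not be the exact support, so that
  products with other functions are formed by writing down the product rule.\<close>

definition C1c :: "(real^'n::finite \<Rightarrow> complex) \<Rightarrow> ('n \<Rightarrow> real^'n \<Rightarrow> complex) \<Rightarrow> (real^'n) set \<Rightarrow> bool" where
  "C1c \<phi> \<phi>' K \<longleftrightarrow> compact K \<and> (\<forall>x. has_grad \<phi> (\<lambda>j. \<phi>' j x) x) \<and>
     (\<forall>j. continuous_on UNIV (\<phi>' j)) \<and> (\<forall>x. x \<notin> K \<longrightarrow> \<phi> x = 0)"

lemma C1cD:
  assumes "C1c \<phi> \<phi>' K"
  shows "compact K" "has_grad \<phi> (\<lambda>j. \<phi>' j x) x" "continuous_on UNIV (\<phi>' j)" "continuous_on UNIV \<phi>"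
    "x \<notin> K \<Longrightarrow> \<phi> x = 0" "x \<notin> K \<Longrightarrow> \<phi>' j x = 0"
proof -
  show 1: "compact K" "has_grad \<phi> (\<lambda>j. \<phi>' j x) x" "continuous_on UNIV (\<phi>' j)" "x \<notin> K \<Longrightarrow> \<phi> x = 0" for x j
    using assms by (auto simp: C1c_def)
  show "continuous_on UNIV \<phi>" by (rule has_grad_continuous_on[OF 1(2)])
  show "x \<notin> K \<Longrightarrow> \<phi>' j x = 0" using compact_support_grad_zero[OF 1(1) 1(4) 1(2)] .
qed

lemma continuous_compact_support_bounded:
  fixes f :: "'a::topological_space \<Rightarrow> 'b::real_normed_vector"
  assumes "continuous_on UNIV f" "compact K" "\<And>x. x \<notin> K \<Longrightarrow> f x = 0"
  shows "\<exists>B. \<forall>x. norm (f x) \<le> B"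
proof -
  have "bounded (f ` K)"
    using assms by (intro compact_imp_bounded compact_continuous_image) (auto intro: continuous_on_subset)
  then obtain B where B: "\<And>x. x \<in> K \<Longrightarrow> norm (f x) \<le> B" unfolding bounded_iff by auto
  show ?thesis
    by (rule exI[of _ "max B 0"]) (use B assms(3) in \<open>force simp: le_max_iff_disj\<close>)
qed

text \<open>Exactly what dominated convergence needs against a locally integrable factor: one
  compact set and one bound for all m, and pointwise limits of the functions and of their
  gradients.\<close>

definition test_approx :: "(real^'n::finite) set \<Rightarrow> (real^'n \<Rightarrow> real) \<Rightarrow> ('n \<Rightarrow> real^'n \<Rightarrow> real) \<Rightarrow>
    (nat \<Rightarrow> real^'n \<Rightarrow> real) \<Rightarrow> (real^'n) set \<Rightarrow> real \<Rightarrow> bool" where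
  "test_approx U \<phi> \<phi>' \<psi> K B \<longleftrightarrow> compact K \<and> K \<subseteq> U \<and> (\<forall>m. test_fun U (\<psi> m)) \<and>
     (\<forall>m x. x \<notin> K \<longrightarrow> \<psi> m x = 0) \<and> (\<forall>m j x. x \<notin> K \<longrightarrow> partial_deriv j (\<psi> m) x = 0) \<and>
     (\<forall>m x. \<bar>\<psi> m x\<bar> \<le> B) \<and> (\<forall>m j x. \<bar>partial_deriv j (\<psi> m) x\<bar> \<le> B) \<and>
     (\<forall>x. (\<lambda>m. \<psi> m x) \<longlonglongrightarrow> \<phi> x) \<and> (\<forall>x j. (\<lambda>m. partial_deriv j (\<psi> m) x) \<longlonglongrightarrow> \<phi>' j x)"

lemma test_fun_approximation:
  fixes \<phi> :: "real^'n \<Rightarrow> real" and \<phi>' :: "'n \<Rightarrow> real^'n \<Rightarrow> real"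
  assumes \<phi>: "\<And>x. has_grad \<phi> (\<lambda>j. \<phi>' j x) x" and \<phi>': "\<And>j. continuous_on UNIV (\<phi>' j)"
    and K: "compact K" and supp: "\<And>x. x \<notin> K \<Longrightarrow> \<phi> x = 0" and U: "open U" "K \<subseteq> U"
  shows "\<exists>\<psi> K' B. test_approx U \<phi> \<phi>' \<psi> K' B"
proof -
  obtain e where e: "e > 0" "(\<Union>x\<in>K. ball x e) \<subseteq> U"
    using compact_subset_open_imp_ball_epsilon_subset[OF K U] by metis
  \<comment> \<open>Mollifying at radius at most e/2 keeps all supports in the closed
    e/2-neighbourhood of \<open>K\<close>; as a sum of two compact sets it is compact.\<close>
  define K' where "K' = {x + y | x y. x \<in> K \<and> y \<in> cball 0 (e / 2)}"
  have K': "compact K'" unfolding K'_def by (rule compact_sums[OF K compact_cball])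
  have K'U: "K' \<subseteq> U"
  proof
    fix x assume "x \<in> K'"
    then obtain a y where "x = a + y" "a \<in> K" "norm y \<le> e / 2" unfolding K'_def by auto
    then have "x \<in> ball a e" using e(1) by (simp add: dist_norm)
    then show "x \<in> U" using e(2) \<open>a \<in> K\<close> by blast
  qed
  have supp': "\<phi>' j x = 0" if "x \<notin> K" for j x
    by (rule compact_support_grad_zero[OF K supp \<phi> that])
  have c\<phi>: "continuous_on UNIV \<phi>" by (rule has_grad_continuous_on[OF \<phi>])
  define \<epsilon> where "\<epsilon> m = (e / 2) / real (Suc m)" for m
  have \<epsilon>: "\<epsilon> m > 0" "\<epsilon> m \<le> e / 2" for m using e(1) by (auto simp: \<epsilon>_def divide_simps)
  have \<epsilon>lim: "\<epsilon> \<longlonglongrightarrow> 0" unfolding \<epsilon>_def by (rule LIMSEQ_Suc[OF lim_const_over_n])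
  define P where "P m \<psi> \<longleftrightarrow> smooth_fun \<psi> \<and> (\<forall>x a c. (\<forall>y\<in>cball x (\<epsilon> m). \<bar>\<phi> y - a\<bar> \<le> c) \<longrightarrow> \<bar>\<psi> x - a\<bar> \<le> c) \<and>
      (\<forall>j x a c. (\<forall>y\<in>cball x (\<epsilon> m). \<bar>\<phi>' j y - a\<bar> \<le> c) \<longrightarrow> \<bar>partial_deriv j \<psi> x - a\<bar> \<le> c)" for m and \<psi> :: "real^'n \<Rightarrow> real"
  have "\<exists>\<psi>. P m \<psi>" for m
  proof (rule mollifier_exists[OF \<phi> \<phi>' K supp \<epsilon>(1)[of m]], assumption)
    fix \<psi> :: "real^'n \<Rightarrow> real" assume "smooth_fun \<psi>"
      "\<And>x a c. (\<And>y. y \<in> cball x (\<epsilon> m) \<Longrightarrow> \<bar>\<phi> y - a\<bar> \<le> c) \<Longrightarrow> \<bar>\<psi> x - a\<bar> \<le> c"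
      "\<And>j x a c. (\<And>y. y \<in> cball x (\<epsilon> m) \<Longrightarrow> \<bar>\<phi>' j y - a\<bar> \<le> c) \<Longrightarrow> \<bar>partial_deriv j \<psi> x - a\<bar> \<le> c"
    then have "P m \<psi>" unfolding P_def by simp
    then show "\<exists>\<psi>. P m \<psi>" by (rule exI[of "P m"])
  qed
  then obtain \<psi> where \<psi>P: "\<And>m. P m (\<psi> m)" using choice[of P] by blast
  have sm: "smooth_fun (\<psi> m)" for m using \<psi>P by (simp add: P_def)
  have \<psi>: "\<bar>\<psi> m x - a\<bar> \<le> c" if "\<And>y. y \<in> cball x (\<epsilon> m) \<Longrightarrow> \<bar>\<phi> y - a\<bar> \<le> c" for m x a c
    using \<psi>P[of m] that unfolding P_def by simp
  have \<psi>': "\<bar>partial_deriv j (\<psi> m) x - a\<bar> \<le> c" if "\<And>y. y \<in> cball x (\<epsilon> m) \<Longrightarrow> \<bar>\<phi>' j y - a\<bar> \<le> c" for m j x a c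
    using \<psi>P[of m] that unfolding P_def by simp
  have out: "y \<notin> K" if "x \<notin> K'" "y \<in> cball x (\<epsilon> m)" for x y m
  proof
    assume "y \<in> K"
    moreover have "x - y \<in> cball 0 (e / 2)" using that(2) \<epsilon>(2)[of m] by (simp add: dist_norm norm_minus_commute)
    ultimately have "y + (x - y) \<in> K'" unfolding K'_def by blast
    then show False using that(1) by simp
  qed
  have z: "\<psi> m x = 0" "partial_deriv j (\<psi> m) x = 0" if "x \<notin> K'" for m j x
    using \<psi>[of x m 0 0] \<psi>'[of x m j 0 0] out[OF that, of _ m] supp supp' by force+
  have sub: "closure {x. \<psi> m x \<noteq> 0} \<subseteq> K'" for m
    by (rule closure_minimal) (use z compact_imp_closed[OF K'] in auto)
  have lim: "(\<lambda>m. s m x) \<longlonglongrightarrow> f x"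
    if f: "continuous_on UNIV f" and s: "\<And>m x a c. (\<And>y. y \<in> cball x (\<epsilon> m) \<Longrightarrow> \<bar>f y - a\<bar> \<le> c) \<Longrightarrow> \<bar>s m x - a\<bar> \<le> c"
    for f :: "real^'n \<Rightarrow> real" and s :: "nat \<Rightarrow> real^'n \<Rightarrow> real" and x
  proof (rule metric_LIMSEQ_I)
    fix r :: real assume "r > 0"
    then obtain d where d: "d > 0" "\<And>y. dist y x < d \<Longrightarrow> dist (f y) (f x) < r / 2"
      using f unfolding continuous_on_iff by (metis UNIV_I half_gt_zero)
    obtain N where N: "\<And>m. m \<ge> N \<Longrightarrow> \<epsilon> m < d"
      using \<epsilon>lim[THEN metric_LIMSEQ_D, OF d(1)] unfolding dist_real_def diff_zero
      by (blast intro: order.strict_trans1[OF abs_ge_self])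
    have "\<bar>s m x - f x\<bar> \<le> r / 2" if "m \<ge> N" for m
    proof (rule s)
      fix y assume "y \<in> cball x (\<epsilon> m)"
      then show "\<bar>f y - f x\<bar> \<le> r / 2" using d(2)[of y] N[OF that] by (simp add: dist_commute dist_real_def abs_minus_commute)
    qed
    then show "\<exists>N. \<forall>n\<ge>N. dist (s n x) (f x) < r" using \<open>r > 0\<close> by (intro exI[of _ N]) (force simp: dist_real_def)
  qed
  obtain B0 where B0: "\<And>x. norm (\<phi> x) \<le> B0"
    using continuous_compact_support_bounded[OF c\<phi> K supp] by blast
  have "\<exists>B. \<forall>j x. norm (\<phi>' j x) \<le> B j"
    by (intro choice allI continuous_compact_support_bounded[OF \<phi>' K supp'])
  then obtain B1 where B1: "\<And>j x. norm (\<phi>' j x) \<le> B1 j" by blast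
  define B where "B = \<bar>B0\<bar> + (\<Sum>j\<in>UNIV. \<bar>B1 j\<bar>)"
  have B: "B0 \<le> B" "B1 j \<le> B" for j
    using member_le_sum[of j UNIV "\<lambda>j. \<bar>B1 j\<bar>"] sum_nonneg[of UNIV "\<lambda>j. \<bar>B1 j\<bar>"] by (auto simp: B_def)
  have "test_approx U \<phi> \<phi>' \<psi> K' B"
    unfolding test_approx_def
  proof (intro conjI allI impI K' K'U)
    show "test_fun U (\<psi> m)" for m
      unfolding test_fun_def
    proof (intro conjI sm)
      have "K' \<inter> closure {x. \<psi> m x \<noteq> 0} = closure {x. \<psi> m x \<noteq> 0}" using sub[of m] by blast
      from compact_Int_closed[OF K' closed_closure, of "{x. \<psi> m x \<noteq> 0}", unfolded this]
      show "compact (closure {x. \<psi> m x \<noteq> 0})" .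
    qed (use sub[of m] K'U in blast)
    show "\<bar>\<psi> m x\<bar> \<le> B" for m x using \<psi>[of x m 0 B] order_trans[OF B0 B(1)] by simp
    show "\<bar>partial_deriv j (\<psi> m) x\<bar> \<le> B" for m j x using \<psi>'[of x m j 0 B] order_trans[OF B1 B(2)] by simp
    show "(\<lambda>m. \<psi> m x) \<longlonglongrightarrow> \<phi> x" for x by (rule lim[OF c\<phi> \<psi>])
    show "(\<lambda>m. partial_deriv j (\<psi> m) x) \<longlonglongrightarrow> \<phi>' j x" for x j by (rule lim[OF \<phi>' \<psi>'])
  qed (use z in auto)
  then show ?thesis by blast
qed

text \<open>This rests on a <= a^2 + 1 and the finite measure of the ball.\<close>

lemma integrable_of_square_integrable:
  fixes f :: "'a::euclidean_space \<Rightarrow> complex"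
  assumes m[measurable]: "f \<in> borel_measurable lebesgue"
    and sq: "integrable lebesgue (\<lambda>x. indicator (ball 0 R) x * (norm (f x))\<^sup>2)"
    and "K \<subseteq> ball 0 R" and K[measurable]: "K \<in> sets lebesgue"
  shows "integrable lebesgue (\<lambda>x. indicator K x * norm (f x))"
proof (rule Bochner_Integration.integrable_bound)
  show "integrable lebesgue (\<lambda>x. indicator (ball 0 R) x * (norm (f x))\<^sup>2 + indicator (ball 0 R) x :: real)"
    using sq emeasure_bounded_finite[OF bounded_ball, of "0::'a" R]
    by (intro Bochner_Integration.integrable_add integrable_real_indicator)
       auto
  have "a \<le> a\<^sup>2 + 1" if "a \<ge> 0" for a :: real
    using zero_le_power2[of "a - 1/2"] by (simp add: power2_eq_square algebra_simps)
  then show "AE x in lebesgue. norm (indicator K x * norm (f x)) \<le> norm (indicator (ball 0 R) x * (norm (f x))\<^sup>2 + indicator (ball 0 R) x :: real)"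
    using assms(3) by (intro AE_I2) (auto simp: indicator_def)
qed simp

text \<open>Here \<open>u\<close> and \<open>G\<close> are a solution and its weak gradient extended by zero into the obstacle;
  the extension solves nothing in the ball of radius \<open>R0\<close>, which is why all test functions
  live outside it. Test functions are only \<open>C\<^sup>1\<close>, so that cut-offs times the fundamental
  solution are admissible.\<close>

locale exterior_helmholtz =
  fixes k R0 :: real and u :: "real^'n::finite \<Rightarrow> complex" and G :: "'n \<Rightarrow> real^'n \<Rightarrow> complex"
  assumes k: "k > 0" and R0: "R0 > 0"
    and u_meas: "u \<in> borel_measurable lebesgue"
    and G_meas: "\<And>j. G j \<in> borel_measurable lebesgue"
    and u_sq: "\<And>R. integrable lebesgue (\<lambda>x. indicator (ball 0 R) x * (norm (u x))\<^sup>2)"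
    and G_sq: "\<And>j R. integrable lebesgue (\<lambda>x. indicator (ball 0 R) x * (norm (G j x))\<^sup>2)"
    and u_cont: "continuous_on {x. norm x > R0} u"
    and weak_grad: "\<And>\<phi> \<phi>' K j. C1c \<phi> \<phi>' K \<Longrightarrow> K \<subseteq> {x. norm x > R0} \<Longrightarrow>
       (LINT x|lebesgue. u x * \<phi>' j x) = - (LINT x|lebesgue. G j x * \<phi> x)"
    and weak_eq: "\<And>\<phi> \<phi>' K. C1c \<phi> \<phi>' K \<Longrightarrow> K \<subseteq> {x. norm x > R0} \<Longrightarrow>
       (LINT x|lebesgue. (\<Sum>j\<in>UNIV. G j x * \<phi>' j x) - of_real (k\<^sup>2) * u x * \<phi> x) = 0"

lemma integrable_mult_bounded:
  fixes f g :: "'a::euclidean_space \<Rightarrow> complex"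
  assumes "integrable lebesgue (\<lambda>x. indicator K x * norm (f x))" and [measurable]: "f \<in> borel_measurable lebesgue"
    "g \<in> borel_measurable lebesgue"
    and "\<And>x. x \<notin> K \<Longrightarrow> g x = 0" "\<And>x. norm (g x) \<le> B"
  shows "integrable lebesgue (\<lambda>x. f x * g x)"
proof (rule Bochner_Integration.integrable_bound)
  show "integrable lebesgue (\<lambda>x. B * (indicator K x * norm (f x)))" using assms(1) by simp
  show "AE x in lebesgue. norm (f x * g x) \<le> norm (B * (indicator K x * norm (f x)))"
  proof (rule AE_I2)
    fix x
    have "norm (g x) * norm (f x) \<le> B * norm (f x)" using assms(5) by (intro mult_right_mono) auto
    then show "norm (f x * g x) \<le> norm (B * (indicator K x * norm (f x)))"
      using assms(4)[of x] by (cases "x \<in> K") (auto simp: norm_mult mult.commute intro: order_trans[OF _ abs_ge_self])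
  qed
qed simp


lemma C1c_bounded:
  assumes "C1c \<phi> \<phi>' K"
  shows "\<exists>B. \<forall>x. norm (\<phi> x) \<le> B" "\<exists>B. \<forall>j x. norm (\<phi>' j x) \<le> B"
proof -
  note D = C1cD[OF assms]
  show "\<exists>B. \<forall>x. norm (\<phi> x) \<le> B" by (rule continuous_compact_support_bounded[OF D(4,1,5)])
  have "\<exists>B. \<forall>j x. norm (\<phi>' j x) \<le> B j"
    by (intro choice allI continuous_compact_support_bounded[OF D(3,1,6)])
  then obtain B where "\<And>j x. norm (\<phi>' j x) \<le> B j" by blast
  moreover have "B j \<le> (\<Sum>j\<in>UNIV. \<bar>B j\<bar>)" for j
    using member_le_sum[of j UNIV "\<lambda>j. \<bar>B j\<bar>"] by simp
  ultimately have "\<And>j x. norm (\<phi>' j x) \<le> (\<Sum>j\<in>UNIV. \<bar>B j\<bar>)" by (rule order_trans)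
  then show "\<exists>B. \<forall>j x. norm (\<phi>' j x) \<le> B" by blast
qed

lemma borel_measurable_lebesgue_continuous:
  fixes f :: "'a::euclidean_space \<Rightarrow> 'b::euclidean_space"
  assumes "continuous_on UNIV f" shows "f \<in> borel_measurable lebesgue"
  using borel_measurable_continuous_onI[OF assms] by (intro measurable_completion) simp

lemma C1c_measurable:
  assumes "C1c \<phi> \<phi>' K" shows "\<phi> \<in> borel_measurable lebesgue" "\<phi>' j \<in> borel_measurable lebesgue"
  using C1cD(3,4)[OF assms] by (auto intro: borel_measurable_lebesgue_continuous)

lemma (in exterior_helmholtz) u_l1:
  assumes "compact K" shows "integrable lebesgue (\<lambda>x. indicator K x * norm (u x))"
proof -
  obtain R where "K \<subseteq> ball 0 R" using compact_imp_bounded[OF assms] bounded_subset_ballD by blast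
  then show ?thesis using integrable_of_square_integrable[OF u_meas u_sq] assms by (simp add: lmeasurable_compact fmeasurableD)
qed

lemma (in exterior_helmholtz) G_l1:
  assumes "compact K" shows "integrable lebesgue (\<lambda>x. indicator K x * norm (G j x))"
proof -
  obtain R where "K \<subseteq> ball 0 R" using compact_imp_bounded[OF assms] bounded_subset_ballD by blast
  then show ?thesis using integrable_of_square_integrable[OF G_meas G_sq] assms by (simp add: lmeasurable_compact fmeasurableD)
qed

lemma tendsto_integral_mult:
  fixes f :: "'a::euclidean_space \<Rightarrow> complex" and s :: "nat \<Rightarrow> 'a \<Rightarrow> real"
  assumes f: "integrable lebesgue (\<lambda>x. indicator K x * norm (f x))" "f \<in> borel_measurable lebesgue"
    and s: "\<And>m. (\<lambda>x. f x * of_real (s m x)) \<in> borel_measurable lebesgue"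
    and z: "\<And>m x. x \<notin> K \<Longrightarrow> s m x = 0" and B: "\<And>m x. \<bar>s m x\<bar> \<le> B"
    and l: "\<And>x. (\<lambda>m. s m x) \<longlonglongrightarrow> g x" and g: "g \<in> borel_measurable lebesgue"
  shows "(\<lambda>m. LINT x|lebesgue. f x * of_real (s m x)) \<longlonglongrightarrow> (LINT x|lebesgue. f x * of_real (g x))"
proof (rule integral_dominated_convergence[where w="\<lambda>x. B * (indicator K x * norm (f x))"])
  show "AE x in lebesgue. norm (f x * of_real (s m x)) \<le> B * (indicator K x * norm (f x))" for m
  proof (rule AE_I2)
    fix x
    have "\<bar>s m x\<bar> * norm (f x) \<le> B * norm (f x)" using B by (intro mult_right_mono) auto
    then show "norm (f x * of_real (s m x)) \<le> B * (indicator K x * norm (f x))"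
      using z[of x m] by (cases "x \<in> K") (auto simp: norm_mult mult.commute)
  qed
  show "AE x in lebesgue. (\<lambda>m. f x * of_real (s m x)) \<longlonglongrightarrow> f x * of_real (g x)"
    by (intro AE_I2 tendsto_intros l)
qed (use f s g in auto)

text \<open>The definitions test with smooth real functions, the potential theory needs complex C1
  functions. Real and imaginary parts bridge the first difference, a limit along smooth
  approximations the second.\<close>

lemma exterior_helmholtz_of_weak:
  fixes u :: "real^'n \<Rightarrow> complex" and G :: "real^'n \<Rightarrow> complex^'n"
  assumes "k > 0" "R0 > 0" and U: "open U" "{x. norm x > R0} \<subseteq> U"
    and H1: "H1_loc_with_grad U u G" and wh: "weak_helmholtz k U u G" and cu: "continuous_on U u"
  shows "exterior_helmholtz k R0 (\<lambda>x. if x \<in> U then u x else 0) (\<lambda>j x. if x \<in> U then G x $ j else 0)"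
proof -
  define u0 where "u0 x = (if x \<in> U then u x else 0)" for x
  define G0 where "G0 j x = (if x \<in> U then G x $ j else 0)" for j x
  have wg: "weak_gradient U u G" and sq: "\<And>R. R > 0 \<Longrightarrow> set_integrable lebesgue (U \<inter> ball 0 R) (\<lambda>x. (norm (u x))\<^sup>2)"
     "\<And>R. R > 0 \<Longrightarrow> set_integrable lebesgue (U \<inter> ball 0 R) (\<lambda>x. (norm (G x))\<^sup>2)"
    using H1 by (auto simp: H1_loc_with_grad_def)
  have u0e: "u0 = (\<lambda>x. indicator U x *\<^sub>R u x)" and G0e: "G0 j = (\<lambda>x. indicator U x *\<^sub>R (G x $ j))" for j
    by (auto simp: u0_def G0_def indicator_def)
  have mu[measurable]: "u0 \<in> borel_measurable lebesgue" and mG[measurable]: "G0 j \<in> borel_measurable lebesgue" for j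
    using wg unfolding weak_gradient_def set_borel_measurable_def u0e G0e by auto
  have Um[measurable]: "U \<in> sets lebesgue" using U(1) by auto
  have u2: "integrable lebesgue (\<lambda>x. indicator (ball 0 R) x * (norm (u0 x))\<^sup>2)" for R
  proof (cases "R > 0")
    case True
    have "(\<lambda>x. indicator (U \<inter> ball 0 R) x *\<^sub>R (norm (u x))\<^sup>2) = (\<lambda>x. indicator (ball 0 R) x * (norm (u0 x))\<^sup>2)"
      by (auto simp: indicator_def u0_def)
    then show ?thesis using sq(1)[OF True] by (simp add: set_integrable_def)
  qed (simp add: ball_empty)
  have [measurable]: "ball 0 R \<in> sets lebesgue" for R :: real by simp
  have G2: "integrable lebesgue (\<lambda>x. indicator (ball 0 R) x * (norm (G0 j x))\<^sup>2)" for j R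
  proof (cases "R > 0")
    case True
    show ?thesis
    proof (rule Bochner_Integration.integrable_bound[OF sq(2)[OF True, unfolded set_integrable_def]])
      show "AE x in lebesgue. norm (indicator (ball 0 R) x * (norm (G0 j x))\<^sup>2)
         \<le> norm (indicator (U \<inter> ball 0 R) x *\<^sub>R (norm (G x))\<^sup>2)"
        by (rule AE_I2) (auto simp: indicator_def G0_def intro!: power_mono Finite_Cartesian_Product.norm_nth_le)
    qed simp
  qed (simp add: ball_empty)
  have l1: "integrable lebesgue (\<lambda>x. indicator K x * norm (u0 x))" "integrable lebesgue (\<lambda>x. indicator K x * norm (G0 j x))"
    if K: "compact K" for K j
  proof -
    obtain R where "K \<subseteq> ball 0 R" using compact_imp_bounded[OF K] bounded_subset_ballD by blast
    then show "integrable lebesgue (\<lambda>x. indicator K x * norm (u0 x))" "integrable lebesgue (\<lambda>x. indicator K x * norm (G0 j x))"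
      using integrable_of_square_integrable[OF mu u2] integrable_of_square_integrable[OF mG G2] K
      by (simp_all add: lmeasurable_compact fmeasurableD)
  qed
  \<comment> \<open>Both weak identities for a real C1 test function, as limits of those for its
    smooth approximations.\<close>
  have real: "(LINT x|lebesgue. u0 x * of_real (\<phi>' j x)) = - (LINT x|lebesgue. G0 j x * of_real (\<phi> x))"
    "(\<Sum>j\<in>UNIV. LINT x|lebesgue. G0 j x * of_real (\<phi>' j x)) - of_real (k\<^sup>2) * (LINT x|lebesgue. u0 x * of_real (\<phi> x)) = 0"
    if \<phi>: "\<And>x. has_grad \<phi> (\<lambda>j. \<phi>' j x) x" and \<phi>': "\<And>j. continuous_on UNIV (\<phi>' j)"
     and K: "compact K" and supp: "\<And>x. x \<notin> K \<Longrightarrow> \<phi> x = 0" and KU: "K \<subseteq> U"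
    for \<phi> :: "real^'n \<Rightarrow> real" and \<phi>' K j
  proof -
    obtain \<psi> K' B where "test_approx U \<phi> \<phi>' \<psi> K' B"
      using test_fun_approximation[OF \<phi> \<phi>' K supp U(1) KU] by blast
    then have K': "compact K'" "K' \<subseteq> U"
      and tf: "\<And>m. test_fun U (\<psi> m)"
      and z: "\<And>m x. x \<notin> K' \<Longrightarrow> \<psi> m x = 0" "\<And>m j x. x \<notin> K' \<Longrightarrow> partial_deriv j (\<psi> m) x = 0"
      and B: "\<And>m x. \<bar>\<psi> m x\<bar> \<le> B" "\<And>m j x. \<bar>partial_deriv j (\<psi> m) x\<bar> \<le> B"
      and lim: "\<And>x. (\<lambda>m. \<psi> m x) \<longlonglongrightarrow> \<phi> x" "\<And>x j. (\<lambda>m. partial_deriv j (\<psi> m) x) \<longlonglongrightarrow> \<phi>' j x"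
      by (simp_all add: test_approx_def)
    have m\<psi>[measurable]: "\<psi> m \<in> borel_measurable lebesgue" "partial_deriv j (\<psi> m) \<in> borel_measurable lebesgue" for m j
    proof -
      have "continuous_on UNIV (iter_partial js (\<psi> m))" for js
        using tf[of m] unfolding test_fun_def smooth_fun_def by simp
      from this[of "[]"] this[of "[j]"]
      have "continuous_on UNIV (\<psi> m)" "continuous_on UNIV (partial_deriv j (\<psi> m))" by simp_all
      then show "\<psi> m \<in> borel_measurable lebesgue" "partial_deriv j (\<psi> m) \<in> borel_measurable lebesgue"
        using borel_measurable_lebesgue_continuous by auto
    qed
    have m\<phi>: "\<phi> \<in> borel_measurable lebesgue" "\<phi>' j \<in> borel_measurable lebesgue" for j
      using \<phi>' has_grad_continuous_on[OF \<phi>] borel_measurable_lebesgue_continuous by auto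
    have L1: "(\<lambda>m. LINT x|lebesgue. u0 x * of_real (\<psi> m x)) \<longlonglongrightarrow> (LINT x|lebesgue. u0 x * of_real (\<phi> x))"
      by (rule tendsto_integral_mult[OF l1(1)[OF K'(1)] mu _ z(1) B(1) lim(1)]) (use m\<phi> in auto)
    have L2: "(\<lambda>m. LINT x|lebesgue. u0 x * of_real (partial_deriv j (\<psi> m) x)) \<longlonglongrightarrow> (LINT x|lebesgue. u0 x * of_real (\<phi>' j x))" for j
      by (rule tendsto_integral_mult[OF l1(1)[OF K'(1)] mu _ z(2) B(2) lim(2)]) (use m\<phi> in auto)
    have L3: "(\<lambda>m. LINT x|lebesgue. G0 j x * of_real (\<psi> m x)) \<longlonglongrightarrow> (LINT x|lebesgue. G0 j x * of_real (\<phi> x))" for j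
      by (rule tendsto_integral_mult[OF l1(2)[OF K'(1)] mG _ z(1) B(1) lim(1)]) (use m\<phi> in auto)
    have L4: "(\<lambda>m. LINT x|lebesgue. G0 j x * of_real (partial_deriv j (\<psi> m) x)) \<longlonglongrightarrow> (LINT x|lebesgue. G0 j x * of_real (\<phi>' j x))" for j
      by (rule tendsto_integral_mult[OF l1(2)[OF K'(1)] mG _ z(2) B(2) lim(2)]) (use m\<phi> in auto)
    have "(LINT x:U|lebesgue. u x * of_real (partial_deriv j (\<psi> m) x)) = - (LINT x:U|lebesgue. G x $ j * of_real (\<psi> m x))" for j m
      using wg tf[of m] unfolding weak_gradient_def by blast
    then have "(LINT x|lebesgue. u0 x * of_real (partial_deriv j (\<psi> m) x)) = - (LINT x|lebesgue. G0 j x * of_real (\<psi> m x))" for j m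
      by (simp add: set_lebesgue_integral_def u0e G0e)
    with L2[of j] have "(\<lambda>m. - (LINT x|lebesgue. G0 j x * of_real (\<psi> m x))) \<longlonglongrightarrow> (LINT x|lebesgue. u0 x * of_real (\<phi>' j x))" by simp
    from LIMSEQ_unique[OF this tendsto_minus[OF L3[of j]]]
    show "(LINT x|lebesgue. u0 x * of_real (\<phi>' j x)) = - (LINT x|lebesgue. G0 j x * of_real (\<phi> x))" .
    have "(LINT x:U|lebesgue. (\<Sum>j\<in>UNIV. G x $ j * of_real (partial_deriv j (\<psi> m) x)) - of_real (k\<^sup>2) * u x * of_real (\<psi> m x)) = 0" for m
      using wh tf[of m] unfolding weak_helmholtz_def by blast
    moreover have "indicator U x *\<^sub>R ((\<Sum>j\<in>UNIV. G x $ j * of_real (partial_deriv j (\<psi> m) x)) - of_real (k\<^sup>2) * u x * of_real (\<psi> m x))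
       = (\<Sum>j\<in>UNIV. G0 j x * of_real (partial_deriv j (\<psi> m) x)) - of_real (k\<^sup>2) * (u0 x * of_real (\<psi> m x))" for x m
      by (cases "x \<in> U") (auto simp: u0_def G0_def)
    moreover have i: "integrable lebesgue (\<lambda>x. G0 j x * of_real (partial_deriv j (\<psi> m) x))" "integrable lebesgue (\<lambda>x. u0 x * of_real (\<psi> m x))" for m j
      by (rule integrable_mult_bounded[OF l1(2)[OF K'(1)], where B=B], use z(2) B(2) in auto)
         (rule integrable_mult_bounded[OF l1(1)[OF K'(1)], where B=B], use z(1) B(1) in auto)
    ultimately have "(\<Sum>j\<in>UNIV. LINT x|lebesgue. G0 j x * of_real (partial_deriv j (\<psi> m) x)) - of_real (k\<^sup>2) * (LINT x|lebesgue. u0 x * of_real (\<psi> m x)) = 0" for m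
      by (simp add: set_lebesgue_integral_def)
    moreover have "(\<lambda>m. (\<Sum>j\<in>UNIV. LINT x|lebesgue. G0 j x * of_real (partial_deriv j (\<psi> m) x)) - of_real (k\<^sup>2) * (LINT x|lebesgue. u0 x * of_real (\<psi> m x)))
      \<longlonglongrightarrow> (\<Sum>j\<in>UNIV. LINT x|lebesgue. G0 j x * of_real (\<phi>' j x)) - of_real (k\<^sup>2) * (LINT x|lebesgue. u0 x * of_real (\<phi> x))"
      by (intro tendsto_intros L1 L4)
    ultimately show "(\<Sum>j\<in>UNIV. LINT x|lebesgue. G0 j x * of_real (\<phi>' j x)) - of_real (k\<^sup>2) * (LINT x|lebesgue. u0 x * of_real (\<phi> x)) = 0"
      by (simp add: LIMSEQ_const_iff)
  qed
  show ?thesis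
    unfolding u0_def[symmetric] G0_def[symmetric]
  proof
    show "continuous_on {x. norm x > R0} u0"
      using continuous_on_subset[OF cu U(2)] by (rule continuous_on_eq) (use U(2) in \<open>auto simp: u0_def\<close>)
  next
    fix \<phi> :: "real^'n \<Rightarrow> complex" and \<phi>' K assume C: "C1c \<phi> \<phi>' K" and KR: "K \<subseteq> {x. R0 < norm x}"
    note D = C1cD[OF C]
    have KU: "K \<subseteq> U" using KR U(2) by blast
    have parts: "has_grad (\<lambda>x. Re (\<phi> x)) (\<lambda>j. Re (\<phi>' j x)) x" "has_grad (\<lambda>x. Im (\<phi> x)) (\<lambda>j. Im (\<phi>' j x)) x" for x
      by (rule has_grad_linear[OF bounded_linear_Re D(2)] has_grad_linear[OF bounded_linear_Im D(2)])+
    have conts: "continuous_on UNIV (\<lambda>x. Re (\<phi>' j x))" "continuous_on UNIV (\<lambda>x. Im (\<phi>' j x))" for j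
      by (intro continuous_intros D(3))+
    have zz: "x \<notin> K \<Longrightarrow> Re (\<phi> x) = 0" "x \<notin> K \<Longrightarrow> Im (\<phi> x) = 0" for x using D(5) by simp_all
    have re: "(LINT x|lebesgue. u0 x * of_real (Re (\<phi>' j x))) = - (LINT x|lebesgue. G0 j x * of_real (Re (\<phi> x)))"
      "(\<Sum>j\<in>UNIV. LINT x|lebesgue. G0 j x * of_real (Re (\<phi>' j x))) - of_real (k\<^sup>2) * (LINT x|lebesgue. u0 x * of_real (Re (\<phi> x))) = 0" for j
      by (rule real[OF parts(1) conts(1) D(1) zz(1) KU]; simp)+
    have im: "(LINT x|lebesgue. u0 x * of_real (Im (\<phi>' j x))) = - (LINT x|lebesgue. G0 j x * of_real (Im (\<phi> x)))"
      "(\<Sum>j\<in>UNIV. LINT x|lebesgue. G0 j x * of_real (Im (\<phi>' j x))) - of_real (k\<^sup>2) * (LINT x|lebesgue. u0 x * of_real (Im (\<phi> x))) = 0" for j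
      by (rule real[OF parts(2) conts(2) D(1) zz(2) KU]; simp)+
    obtain B where B: "\<And>x. norm (\<phi> x) \<le> B" using C1c_bounded(1)[OF C] by blast
    obtain B' where B': "\<And>j x. norm (\<phi>' j x) \<le> B'" using C1c_bounded(2)[OF C] by blast
    note [measurable] = C1c_measurable[OF C]
    \<comment> \<open>Compact support and boundedness of the test function make both parts
      integrable against a factor that is merely locally integrable.\<close>
    have split: "(LINT x|lebesgue. f x * g x) = (LINT x|lebesgue. f x * of_real (Re (g x))) + \<i> * (LINT x|lebesgue. f x * of_real (Im (g x)))"
      if f: "integrable lebesgue (\<lambda>x. indicator K x * norm (f x))" "f \<in> borel_measurable lebesgue"
       and [measurable]: "g \<in> borel_measurable lebesgue" and g: "\<And>x. x \<notin> K \<Longrightarrow> g x = 0" and b: "\<And>x. norm (g x) \<le> b"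
      for f g :: "real^'n \<Rightarrow> complex" and b
    proof -
      have "integrable lebesgue (\<lambda>x. f x * of_real (Re (g x)))" "integrable lebesgue (\<lambda>x. f x * of_real (Im (g x)))"
        by (rule integrable_mult_bounded[OF f(1), where B=b]; use f(2) g b order_trans[OF abs_Re_le_cmod b] order_trans[OF abs_Im_le_cmod b] in auto)+
      then have "(LINT x|lebesgue. f x * of_real (Re (g x))) + \<i> * (LINT x|lebesgue. f x * of_real (Im (g x)))
        = (LINT x|lebesgue. f x * of_real (Re (g x)) + \<i> * (f x * of_real (Im (g x))))" by simp
      also have "\<dots> = (LINT x|lebesgue. f x * g x)"
        by (rule Bochner_Integration.integral_cong) (auto simp: complex_eq_iff)
      finally show ?thesis by simp
    qed
    have s: "(LINT x|lebesgue. u0 x * \<phi>' j x) = (LINT x|lebesgue. u0 x * of_real (Re (\<phi>' j x))) + \<i> * (LINT x|lebesgue. u0 x * of_real (Im (\<phi>' j x)))"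
      "(LINT x|lebesgue. G0 j x * \<phi>' j x) = (LINT x|lebesgue. G0 j x * of_real (Re (\<phi>' j x))) + \<i> * (LINT x|lebesgue. G0 j x * of_real (Im (\<phi>' j x)))"
      "(LINT x|lebesgue. u0 x * \<phi> x) = (LINT x|lebesgue. u0 x * of_real (Re (\<phi> x))) + \<i> * (LINT x|lebesgue. u0 x * of_real (Im (\<phi> x)))"
      "(LINT x|lebesgue. G0 j x * \<phi> x) = (LINT x|lebesgue. G0 j x * of_real (Re (\<phi> x))) + \<i> * (LINT x|lebesgue. G0 j x * of_real (Im (\<phi> x)))" for j
      by (rule split[OF l1(1)[OF D(1)] mu _ D(6) B'] split[OF l1(2)[OF D(1)] mG _ D(6) B'] split[OF l1(1)[OF D(1)] mu _ D(5) B] split[OF l1(2)[OF D(1)] mG _ D(5) B]; simp)+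
    show "(LINT x|lebesgue. u0 x * \<phi>' j x) = - (LINT x|lebesgue. G0 j x * \<phi> x)" for j
      unfolding s re(1) im(1) by (simp add: algebra_simps)
    have i: "integrable lebesgue (\<lambda>x. G0 j x * \<phi>' j x)" "integrable lebesgue (\<lambda>x. u0 x * \<phi> x)" for j
      by (rule integrable_mult_bounded[OF l1(2)[OF D(1)] mG _ D(6) B'] integrable_mult_bounded[OF l1(1)[OF D(1)] mu _ D(5) B]; simp)+
    have "(LINT x|lebesgue. (\<Sum>j\<in>UNIV. G0 j x * \<phi>' j x) - of_real (k\<^sup>2) * u0 x * \<phi> x)
        = (\<Sum>j\<in>UNIV. LINT x|lebesgue. G0 j x * \<phi>' j x) - of_real (k\<^sup>2) * (LINT x|lebesgue. u0 x * \<phi> x)"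
      using i by (simp add: mult.assoc)
    also have "\<dots> = ((\<Sum>j\<in>UNIV. LINT x|lebesgue. G0 j x * of_real (Re (\<phi>' j x))) - of_real (k\<^sup>2) * (LINT x|lebesgue. u0 x * of_real (Re (\<phi> x))))
        + \<i> * ((\<Sum>j\<in>UNIV. LINT x|lebesgue. G0 j x * of_real (Im (\<phi>' j x))) - of_real (k\<^sup>2) * (LINT x|lebesgue. u0 x * of_real (Im (\<phi> x))))"
      unfolding s by (simp add: algebra_simps sum.distrib sum_distrib_left)
    also have "\<dots> = 0" unfolding re(2) im(2) by simp
    finally show "(LINT x|lebesgue. (\<Sum>j\<in>UNIV. G0 j x * \<phi>' j x) - of_real (k\<^sup>2) * u0 x * \<phi> x) = 0" .
  qed (use assms mu mG u2 G2 in auto)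
qed

section \<open>The radial fundamental solution\<close>

text \<open>The one-dimensional case of \<open>has_grad_integral\<close>, with the parameter
  regarded as a vector with a single coordinate.\<close>

lemma has_vector_derivative_integral:
  fixes g :: "real \<Rightarrow> 'b \<Rightarrow> 'c::{banach, second_countable_topology}"
  assumes e: "e > 0" and int: "\<And>x. x \<in> ball r e \<Longrightarrow> integrable M (g x)"
    and der: "\<And>x y. x \<in> ball r e \<Longrightarrow> y \<in> space M \<Longrightarrow> ((\<lambda>x. g x y) has_vector_derivative D x y) (at x)"
    and bd: "\<And>x y. x \<in> ball r e \<Longrightarrow> y \<in> space M \<Longrightarrow> norm (D x y) \<le> B y"
    and B: "integrable M B" and meas: "D r \<in> borel_measurable M"
  shows "((\<lambda>x. integral\<^sup>L M (g x)) has_vector_derivative integral\<^sup>L M (D r)) (at r)"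
proof -
  have in_ball: "x $ 1 \<in> ball r e" if "x \<in> ball (vec r) e" for x :: "real^1"
  proof -
    have "\<bar>(vec r - x) $ 1\<bar> \<le> norm (vec r - x)" by (rule component_le_norm_cart)
    then show ?thesis using that by (simp add: dist_norm)
  qed
  have "has_grad (\<lambda>x::real^1. integral\<^sup>L M (g (x $ 1))) (\<lambda>j. integral\<^sup>L M (D ((vec r :: real^1) $ 1))) (vec r)"
  proof (rule has_grad_integral[OF e, where D="\<lambda>j x. D (x $ 1)" and B=B])
    show "has_grad (\<lambda>x::real^1. g (x $ 1) y) (\<lambda>j. D (x $ 1) y) x" if "x \<in> ball (vec r) e" "y \<in> space M" for x y
      unfolding has_grad_def
      by (rule has_derivative_eq_rhs[OF has_derivative_compose[OF bounded_linear.has_derivative[OF bounded_linear_vec_nth has_derivative_ident]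
          der[OF in_ball[OF that(1)] that(2), unfolded has_vector_derivative_def]]]) (simp add: sum_1)
  qed (use int bd B meas in_ball in auto)
  moreover have "(vec r :: real^1) = 0 + r *\<^sub>R axis 1 1" by (simp add: vec_eq_iff axis_def)
  ultimately have "has_grad (\<lambda>x::real^1. integral\<^sup>L M (g (x $ 1))) (\<lambda>j. integral\<^sup>L M (D r)) (0 + r *\<^sub>R axis 1 1)"
    by simp
  from has_grad_direction[OF this] show ?thesis by (simp add: sum_1 axis_def)
qed

section \<open>Gaussian integrals and the Hankel function\<close>

lemma integrable_gaussian_moment:
  assumes "a > 0" shows "integrable lborel (\<lambda>t::real. t ^ m * exp (- (a * t\<^sup>2)))"
proof -
  define \<sigma> where "\<sigma> = sqrt (1 / (2 * a))"
  have \<sigma>: "\<sigma> > 0" "\<sigma>\<^sup>2 = 1 / (2 * a)" using assms by (auto simp: \<sigma>_def)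
  have "integrable lborel (\<lambda>t. sqrt (2 * pi * \<sigma>\<^sup>2) * (normal_density 0 \<sigma> t * (t - 0) ^ m))"
    by (intro integrable_mult_right integrable_normal_moment[OF \<sigma>(1)])
  moreover have "sqrt (2 * pi * \<sigma>\<^sup>2) * (normal_density 0 \<sigma> t * (t - 0) ^ m) = t ^ m * exp (- (a * t\<^sup>2))" for t
  proof -
    have "sqrt (2 * pi * \<sigma>\<^sup>2) \<noteq> 0" using \<sigma>(1) by simp
    moreover have "- (t - 0)\<^sup>2 / (2 * \<sigma>\<^sup>2) = - (a * t\<^sup>2)" using assms by (simp add: \<sigma>(2) field_simps)
    ultimately show ?thesis unfolding normal_density_def by simp
  qed
  ultimately show ?thesis by (simp only:)
qed

lemma integrable_gaussian_weight:
  assumes "a > 0" shows "integrable lborel (\<lambda>t::real. (1 + t\<^sup>2) ^ m * exp (- (a * t\<^sup>2)))"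
proof -
  have "(1 + t\<^sup>2) ^ m * exp (- (a * t\<^sup>2)) = (\<Sum>i\<le>m. real (m choose i) * (t ^ (2 * i) * exp (- (a * t\<^sup>2))))" for t :: real
    by (subst add.commute, subst binomial_ring) (simp add: sum_distrib_right power_mult mult.assoc)
  then show ?thesis using integrable_gaussian_moment[OF assms] by simp
qed

text \<open>\<open>hank k 0 r\<close> is a multiple of $H^{(1)}_0(kr)$ written as a contour integral, and \<open>hank k m r\<close> is its
  $m$-th derivative up to the factor $(-k)^m$. No other Bessel function theory is needed.\<close>

definition hank_integrand :: "real \<Rightarrow> nat \<Rightarrow> real \<Rightarrow> real \<Rightarrow> complex" where
  "hank_integrand k m r t = (of_real (t\<^sup>2) - \<i>) ^ m * exp (- of_real (k * r) * (of_real (t\<^sup>2) - \<i>)) *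
     inverse (csqrt (of_real (t\<^sup>2) - 2 * \<i>))"

definition hank :: "real \<Rightarrow> nat \<Rightarrow> real \<Rightarrow> complex" where
  "hank k m r = (\<integral>t. hank_integrand k m r t \<partial>lborel)"

lemma csqrt_arg_not_nonpos: "of_real (t\<^sup>2) - 2 * \<i> * of_real r \<notin> \<real>\<^sub>\<le>\<^sub>0" if "r > 0"
  using that by (auto simp: complex_nonpos_Reals_iff)

lemma norm_csqrt_arg: "norm (csqrt z) = sqrt (norm z)"
proof -
  have "(norm (csqrt z))\<^sup>2 = norm z" by (metis norm_power power2_csqrt)
  then show ?thesis by (metis norm_ge_zero real_sqrt_unique)
qed

text \<open>The imaginary part of t^2 - 2i is -2 for every t, so the root stays away from zero: the
  contour integral has no singularity left.\<close>

lemma norm_inverse_csqrt_le_1: "norm (inverse (csqrt (of_real (t\<^sup>2) - 2 * \<i>))) \<le> 1"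
proof -
  have "norm (of_real (t\<^sup>2) - 2 * \<i>) \<ge> \<bar>Im (of_real (t\<^sup>2) - 2 * \<i>)\<bar>" by (rule abs_Im_le_cmod)
  then have "1 \<le> norm (of_real (t\<^sup>2) - 2 * \<i>)" by simp
  then have "1 \<le> norm (csqrt (of_real (t\<^sup>2) - 2 * \<i>))" unfolding norm_csqrt_arg by (rule real_sqrt_ge_one)
  then show ?thesis unfolding norm_inverse by (simp only: inverse_le_1_iff) simp
qed

lemma norm_hank_exp: "norm (exp (- of_real (k * r) * (of_real (t\<^sup>2) - \<i>))) = exp (- (k * r * t\<^sup>2))"
  by (simp add: norm_exp_eq_Re)

lemma hank_integrand_bound:
  "norm (hank_integrand k m r t) \<le> (1 + t\<^sup>2) ^ m * exp (- (k * r * t\<^sup>2))"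
proof -
  have "norm (of_real (t\<^sup>2) - \<i>) \<le> 1 + t\<^sup>2"
    using norm_triangle_ineq4[of "of_real (t\<^sup>2)" \<i>] by (simp add: norm_power)
  then have "norm (hank_integrand k m r t) \<le> ((1 + t\<^sup>2) ^ m * exp (- (k * r * t\<^sup>2))) * 1"
    unfolding hank_integrand_def norm_mult norm_power norm_hank_exp
    by (intro mult_mono norm_inverse_csqrt_le_1 power_mono) auto
  then show ?thesis by simp
qed

lemma isCont_csqrt_arg: "isCont (\<lambda>t. inverse (csqrt (of_real (t\<^sup>2) - 2 * \<i>))) t"
proof -
  have "isCont (\<lambda>t. csqrt (of_real (t\<^sup>2) - 2 * \<i>)) t"
    by (rule isCont_o2[where g=csqrt]) (use csqrt_arg_not_nonpos[of 1 t] in \<open>auto intro!: continuous_intros continuous_at_csqrt\<close>)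
  moreover have "of_real (t\<^sup>2) - 2 * \<i> \<noteq> 0" by (simp add: complex_eq_iff)
  then have "csqrt (of_real (t\<^sup>2) - 2 * \<i>) \<noteq> 0" by simp
  ultimately show ?thesis by (intro continuous_intros)
qed

lemma isCont_hank_integrand: "isCont (hank_integrand k m r) t"
  unfolding hank_integrand_def by (intro continuous_intros isCont_csqrt_arg)

lemma hank_integrand_measurable [measurable]: "hank_integrand k m r \<in> borel_measurable borel"
  by (rule borel_measurable_continuous_onI) (simp add: continuous_at_imp_continuous_on isCont_hank_integrand)

lemma integrable_hank_integrand: "k > 0 \<Longrightarrow> r > 0 \<Longrightarrow> integrable lborel (hank_integrand k m r)"
  by (rule Bochner_Integration.integrable_bound[OF integrable_gaussian_weight[of "k * r" m]])
     (auto intro!: AE_I2 order_trans[OF hank_integrand_bound])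

lemma hank_deriv:
  assumes k: "k > 0" and r: "r > 0"
  shows "(hank k m has_vector_derivative (- of_real k * hank k (Suc m) r)) (at r)"
proof -
  have "((\<lambda>x. \<integral>t. hank_integrand k m x t \<partial>lborel) has_vector_derivative
      (\<integral>t. - of_real k * hank_integrand k (Suc m) r t \<partial>lborel)) (at r)"
  \<comment> \<open>On the ball of radius r/2 the parameter stays above r/2, so the Gaussian with
    exponent k r/2 dominates.\<close>
  proof (rule has_vector_derivative_integral[where e="r/2" and B="\<lambda>t. k * ((1 + t\<^sup>2) ^ Suc m * exp (- (k * (r / 2) * t\<^sup>2)))"])
    fix x t assume "x \<in> ball r (r / 2)"
    then have "\<bar>r - x\<bar> < r / 2" by (simp add: dist_real_def)
    then have x: "x \<ge> r / 2" by linarith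
    have "((\<lambda>x. exp (- of_real (k * x) * (of_real (t\<^sup>2) - \<i>))) has_vector_derivative
        - of_real k * (of_real (t\<^sup>2) - \<i>) * exp (- of_real (k * x) * (of_real (t\<^sup>2) - \<i>))) (at x)"
    proof -
      have "((\<lambda>z. exp (- (of_real k * z) * (of_real (t\<^sup>2) - \<i>))) has_field_derivative
        exp (- (of_real k * of_real x) * (of_real (t\<^sup>2) - \<i>)) * (- of_real k * (of_real (t\<^sup>2) - \<i>))) (at (of_real x))"
        by (auto intro!: derivative_eq_intros)
      from has_field_derivative_at_within[OF this, THEN has_vector_derivative_real_field]
      show ?thesis by (simp add: mult.commute)
    qed
    from has_vector_derivative_mult_right[OF has_vector_derivative_mult_left[OF this], of "(of_real (t\<^sup>2) - \<i>) ^ m" "inverse (csqrt (of_real (t\<^sup>2) - 2 * \<i>))"]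
    show "((\<lambda>x. hank_integrand k m x t) has_vector_derivative - of_real k * hank_integrand k (Suc m) x t) (at x)"
      by (simp add: hank_integrand_def mult_ac)
    have "k * (r / 2) * t\<^sup>2 \<le> k * x * t\<^sup>2"
      by (intro mult_right_mono mult_left_mono x) (use k in auto)
    then have "exp (- (k * x * t\<^sup>2)) \<le> exp (- (k * (r / 2) * t\<^sup>2))"
      by (simp only: exp_le_cancel_iff neg_le_iff_le)
    then have "norm (hank_integrand k (Suc m) x t) \<le> (1 + t\<^sup>2) ^ Suc m * exp (- (k * (r / 2) * t\<^sup>2))"
      by (intro order_trans[OF hank_integrand_bound] mult_left_mono) auto
    then show "norm (- of_real k * hank_integrand k (Suc m) x t) \<le> k * ((1 + t\<^sup>2) ^ Suc m * exp (- (k * (r / 2) * t\<^sup>2)))"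
      using k by (simp add: norm_mult mult_left_mono)
  next
    fix x assume "x \<in> ball r (r / 2)"
    then have "\<bar>r - x\<bar> < r / 2" by (simp add: dist_real_def)
    then have "x > 0" using r by linarith
    then show "integrable lborel (hank_integrand k m x)" using k by (rule integrable_hank_integrand[rotated])
  next
    show "integrable lborel (\<lambda>t. k * ((1 + t\<^sup>2) ^ Suc m * exp (- (k * (r / 2) * t\<^sup>2))))"
      by (intro integrable_mult_right integrable_gaussian_weight) (use k r in auto)
  qed (use r in auto)
  then show ?thesis unfolding hank_def by simp
qed


text \<open>Bessel's operator in r, applied to the integrand, is an exact derivative in t. The
  primitive \<open>W\<close> is a multiple of (s^2 - 1)^(1/2) e^(ikrs) in the contour variable s = 1
  + i t^2.\<close>

lemma hank_integrand_total_derivative: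
  fixes k r :: real
  assumes "r > 0"
  defines "W \<equiv> \<lambda>t. - of_real (k / (2 * r)) * (of_real t * csqrt (of_real (t\<^sup>2) - 2 * \<i>) * exp (- of_real (k * r) * (of_real (t\<^sup>2) - \<i>)))"
  shows "(W has_vector_derivative (of_real (k\<^sup>2) * hank_integrand k 2 r t - of_real (k / r) * hank_integrand k 1 r t + of_real (k\<^sup>2) * hank_integrand k 0 r t)) (at t)"
proof -
  define z where "z = complex_of_real t"
  define S where "S = csqrt (z\<^sup>2 - 2 * \<i>)"
  have n: "z\<^sup>2 - 2 * \<i> \<notin> \<real>\<^sub>\<le>\<^sub>0" using csqrt_arg_not_nonpos[of 1 t] by (simp add: z_def)
  have S0: "S \<noteq> 0" using n by (auto simp: S_def complex_nonpos_Reals_iff)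
  have S2: "S * S = z\<^sup>2 - 2 * \<i>" unfolding S_def by (metis power2_csqrt power2_eq_square)
  define P where "P = exp (- of_real (k * r) * (z\<^sup>2 - \<i>))"
  have D1: "((\<lambda>z. csqrt (z\<^sup>2 - 2 * \<i>)) has_field_derivative (2 * z) / (2 * S)) (at z)"
    unfolding S_def
    by (rule has_field_derivative_csqrt'[where f="\<lambda>z. z\<^sup>2 - 2 * \<i>"])
       (use n in \<open>auto intro!: derivative_eq_intros\<close>)
  have D2: "((\<lambda>z. exp (- of_real (k * r) * (z\<^sup>2 - \<i>))) has_field_derivative P * (- of_real (k * r) * (2 * z))) (at z)"
    unfolding P_def by (rule DERIV_chain2[OF DERIV_exp]) (auto intro!: derivative_eq_intros)
  have D: "((\<lambda>z. - of_real (k / (2 * r)) * (z * csqrt (z\<^sup>2 - 2 * \<i>) * exp (- of_real (k * r) * (z\<^sup>2 - \<i>)))) has_field_derivative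
     (- of_real (k / (2 * r)) * ((S + z * (z / S)) * P + z * S * (P * (- of_real (k * r) * (2 * z)))))) (at z)"
    by (rule DERIV_cong[OF DERIV_cmult[OF DERIV_mult[OF DERIV_mult[OF DERIV_ident D1] D2]]])
       (simp add: S_def P_def add.commute)
  have "(W has_vector_derivative (- of_real (k / (2 * r)) * ((S + z * (z / S)) * P + z * S * (P * (- of_real (k * r) * (2 * z)))))) (at t)"
    using has_field_derivative_at_within[OF D[unfolded z_def], THEN has_vector_derivative_real_field] by (simp add: W_def z_def)
  also have "- of_real (k / (2 * r)) * ((S + z * (z / S)) * P + z * S * (P * (- of_real (k * r) * (2 * z))))
     = of_real (k\<^sup>2) * hank_integrand k 2 r t - of_real (k / r) * hank_integrand k 1 r t + of_real (k\<^sup>2) * hank_integrand k 0 r t"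
  proof -
    have h: "hank_integrand k m r t = (z\<^sup>2 - \<i>) ^ m * P / S" for m
      by (simp add: hank_integrand_def z_def S_def P_def divide_inverse)
    define c where "c = complex_of_real (k / (2 * r))"
    define K where "K = complex_of_real (k * r)"
    have cK: "2 * c * K = of_real (k\<^sup>2)" "of_real (k / r) = 2 * c"
      using assms(1) by (simp_all add: c_def K_def power2_eq_square)
    define Q where "Q = S + z * (z / S)"
    have QS: "Q * S = S * S + z * z" using S0 by (simp add: Q_def field_simps)
    \<comment> \<open>Multiplication by the root clears the denominators, and S^2 = z^2 - 2i then
      makes both sides polynomial in z, up to the exponential.\<close>
    have "(- c * (Q * P + z * S * (P * (- K * (2 * z))))) * S
      = - c * ((Q * S) * P) + (2 * c * K) * (z * z * (S * S) * P)"
      by (simp add: algebra_simps)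
    also have "\<dots> = (2 * c * K) * ((z\<^sup>2 - \<i>)\<^sup>2 * P) - 2 * c * ((z\<^sup>2 - \<i>) * P) + (2 * c * K) * P"
      unfolding QS S2 by (simp add: algebra_simps power2_eq_square)
    finally have "- c * (Q * P + z * S * (P * (- K * (2 * z))))
       = ((2 * c * K) * ((z\<^sup>2 - \<i>)\<^sup>2 * P) - 2 * c * ((z\<^sup>2 - \<i>) * P) + (2 * c * K) * P) / S"
      by (rule eq_divide_imp[OF S0])
    then show ?thesis unfolding h c_def[symmetric] K_def[symmetric] Q_def[symmetric] cK by (simp add: add_divide_distrib diff_divide_distrib)
  qed
  finally show ?thesis .
qed


text \<open>Integrating the total derivative over the line leaves only boundary values, which vanish
  by Gaussian decay.\<close>

lemma hank_ode:
  assumes k: "k > 0" and r: "r > 0"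
  shows "of_real (k\<^sup>2) * hank k 2 r - of_real (k / r) * hank k 1 r + of_real (k\<^sup>2) * hank k 0 r = 0"
proof -
  define f where "f t = of_real (k\<^sup>2) * hank_integrand k 2 r t - of_real (k / r) * hank_integrand k 1 r t + of_real (k\<^sup>2) * hank_integrand k 0 r t" for t
  define W where "W t = - of_real (k / (2 * r)) * (of_real t * csqrt (of_real (t\<^sup>2) - 2 * \<i>) * exp (- of_real (k * r) * (of_real (t\<^sup>2) - \<i>)))" for t
  note int = integrable_hank_integrand[OF k r]
  have f: "integrable lborel f" unfolding f_def by (intro Bochner_Integration.integrable_add Bochner_Integration.integrable_diff integrable_mult_right int)
  \<comment> \<open>The bound is written as a polynomial in k r t^2 times an exponential, so that
    \<open>poly_exp_tendsto_0\<close> serves both ends of the line.\<close>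
  have bd: "norm (W t) \<le> k / (2 * r) * (poly [:2, 1 / (k * r):] (k * r * t\<^sup>2) * exp (- (k * r * t\<^sup>2)))" for t
  proof -
    have "norm (csqrt (of_real (t\<^sup>2) - 2 * \<i>)) \<le> sqrt (t\<^sup>2 + 2)"
      unfolding norm_csqrt_arg using norm_triangle_ineq4[of "of_real (t\<^sup>2)" "2 * \<i>"] by (simp add: norm_mult norm_power)
    moreover have "\<bar>t\<bar> \<le> sqrt (t\<^sup>2 + 2)" by (rule real_le_rsqrt) simp
    ultimately have "\<bar>t\<bar> * norm (csqrt (of_real (t\<^sup>2) - 2 * \<i>)) \<le> sqrt (t\<^sup>2 + 2) * sqrt (t\<^sup>2 + 2)"
      by (intro mult_mono) auto
    also have "\<dots> = t\<^sup>2 + 2" by simp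
    finally have 1: "\<bar>t\<bar> * norm (csqrt (of_real (t\<^sup>2) - 2 * \<i>)) \<le> t\<^sup>2 + 2" .
    have "norm (W t) = k / (2 * r) * ((\<bar>t\<bar> * norm (csqrt (of_real (t\<^sup>2) - 2 * \<i>))) * exp (- (k * r * t\<^sup>2)))"
      unfolding W_def norm_mult norm_minus_cancel norm_hank_exp using k r by (simp add: norm_divide)
    also have "\<dots> \<le> k / (2 * r) * ((t\<^sup>2 + 2) * exp (- (k * r * t\<^sup>2)))"
      using k r by (intro mult_left_mono mult_right_mono 1) auto
    also have "t\<^sup>2 + 2 = poly [:2, 1 / (k * r):] (k * r * t\<^sup>2)" using k r by simp
    finally show ?thesis .
  qed
  have lim: "(W \<longlongrightarrow> 0) F" if F: "filterlim (\<lambda>t. t\<^sup>2) at_top F" for F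
  proof (rule tendsto_norm_zero_cancel, rule tendsto_sandwich[OF _ _ tendsto_const])
    show "\<forall>\<^sub>F t in F. norm (W t) \<le> k / (2 * r) * (poly [:2, 1 / (k * r):] (k * r * t\<^sup>2) * exp (- (k * r * t\<^sup>2)))"
      using bd by simp
    have "filterlim (\<lambda>t. k * r * t\<^sup>2) at_top F"
      by (rule filterlim_tendsto_pos_mult_at_top[OF tendsto_const _ F]) (use k r in simp)
    from filterlim_compose[OF poly_exp_tendsto_0 this]
    show "((\<lambda>t. k / (2 * r) * (poly [:2, 1 / (k * r):] (k * r * t\<^sup>2) * exp (- (k * r * t\<^sup>2)))) \<longlongrightarrow> 0) F"
      by (rule tendsto_mult_right_zero)
  qed simp
  have sq: "filterlim (\<lambda>t::real. t\<^sup>2) at_top at_top" "filterlim (\<lambda>t::real. t\<^sup>2) at_top at_bot"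
  proof -
    show 1: "filterlim (\<lambda>t::real. t\<^sup>2) at_top at_top" by (rule filterlim_pow_at_top[OF _ filterlim_ident]) simp
    have "filterlim (\<lambda>t::real. (- t)\<^sup>2) at_top at_bot"
      by (rule filterlim_compose[OF 1 filterlim_uminus_at_top_at_bot])
    then show "filterlim (\<lambda>t::real. t\<^sup>2) at_top at_bot" by simp
  qed
  have "(LBINT t=-\<infinity>..\<infinity>. f t) = 0 - 0"
  proof (rule interval_integral_FTC_integrable)
    show "(W has_vector_derivative f t) (at t)" for t
      unfolding W_def f_def by (rule hank_integrand_total_derivative[OF r])
    show "isCont f t" for t unfolding f_def by (intro continuous_intros isCont_hank_integrand)
    show "set_integrable lborel (einterval (- \<infinity>) \<infinity>) f" using f by (simp add: set_integrable_def)
    show "((W \<circ> real_of_ereal) \<longlongrightarrow> 0) (at_right (- \<infinity>))" "((W \<circ> real_of_ereal) \<longlongrightarrow> 0) (at_left \<infinity>)"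
      unfolding at_right_MInf at_left_PInf by (simp_all add: filterlim_filtermap lim sq)
  qed simp
  then have "integral\<^sup>L lborel f = 0"
    by (simp add: interval_lebesgue_integral_def set_lebesgue_integral_def)
  then show ?thesis unfolding f_def hank_def by (simp add: int)
qed

text \<open>Substituting sqrt r t for t extracts the power of r: -1/2 for m = 0 gives the decay of
  the Hankel function, -3/2 for m = 2 its radiation condition.\<close>

lemma gaussian_scaling:
  assumes "r > 0"
  shows "(\<integral>t. (t::real) ^ m * exp (- (k * r * t\<^sup>2)) \<partial>lborel) = r powr (- (real m + 1) / 2) * (\<integral>t. t ^ m * exp (- (k * t\<^sup>2)) \<partial>lborel)"
proof -
  have "(\<integral>t. t ^ m * exp (- (k * t\<^sup>2)) \<partial>lborel) = sqrt r * (\<integral>t. (sqrt r * t) ^ m * exp (- (k * (sqrt r * t)\<^sup>2)) \<partial>lborel)"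
    using lborel_integral_real_affine[of "sqrt r" "\<lambda>t. t ^ m * exp (- (k * t\<^sup>2))" 0] assms by simp
  also have "(\<lambda>t. (sqrt r * t) ^ m * exp (- (k * (sqrt r * t)\<^sup>2))) = (\<lambda>t. sqrt r ^ m * (t ^ m * exp (- (k * r * t\<^sup>2))))"
    using assms by (simp add: fun_eq_iff power_mult_distrib mult_ac)
  also have "sqrt r * (\<integral>t. sqrt r ^ m * (t ^ m * exp (- (k * r * t\<^sup>2))) \<partial>lborel) = sqrt r ^ Suc m * (\<integral>t. t ^ m * exp (- (k * r * t\<^sup>2)) \<partial>lborel)"
    by simp
  also have "sqrt r ^ Suc m = r powr ((real m + 1) / 2)"
  proof -
    have "sqrt r ^ Suc m = sqrt r powr real (Suc m)" using assms by (intro powr_realpow[symmetric]) simp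
    also have "\<dots> = r powr (1 / 2 * real (Suc m))"
      using assms by (subst powr_half_sqrt[symmetric]) (simp_all only: powr_powr less_imp_le)
    finally show ?thesis by (simp add: field_simps)
  qed
  finally have "(\<integral>t. t ^ m * exp (- (k * t\<^sup>2)) \<partial>lborel) = r powr ((real m + 1) / 2) * (\<integral>t. t ^ m * exp (- (k * r * t\<^sup>2)) \<partial>lborel)" .
  then have "r powr (- ((real m + 1) / 2)) * (\<integral>t. t ^ m * exp (- (k * t\<^sup>2)) \<partial>lborel) = (r powr (- ((real m + 1) / 2)) * r powr ((real m + 1) / 2)) * (\<integral>t. t ^ m * exp (- (k * r * t\<^sup>2)) \<partial>lborel)"
    by (simp only: mult.assoc)
  also have "r powr (- ((real m + 1) / 2)) * r powr ((real m + 1) / 2) = 1"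
    unfolding powr_add[symmetric] using assms by simp
  finally show ?thesis by (simp only: minus_divide_left mult_1)
qed

definition gauss_moment :: "real \<Rightarrow> nat \<Rightarrow> real" where
  "gauss_moment k m = (\<integral>t. t ^ m * exp (- (k * t\<^sup>2)) \<partial>lborel)"

lemma norm_hank_0_le:
  assumes k: "k > 0" and r: "r > 0"
  shows "norm (hank k 0 r) \<le> gauss_moment k 0 * r powr (- 1 / 2)"
proof -
  have "norm (hank k 0 r) \<le> (\<integral>t. t ^ 0 * exp (- (k * r * t\<^sup>2)) \<partial>lborel)" unfolding hank_def
    by (rule Bochner_Integration.integral_norm_bound_integral[OF integrable_hank_integrand[OF k r] integrable_gaussian_moment])
       (use hank_integrand_bound[of k 0 r] k r in auto)
  then show ?thesis using gaussian_scaling[OF r, of 0 k] by (simp add: gauss_moment_def mult.commute)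
qed

text \<open>Differentiation contributes the factor t^2 - i, and adding i times the function leaves
  t^2. The oscillation comes out of the integral, and the extra t^2 gains one power of r over plain
  decay.\<close>

lemma hank_radiation:
  assumes k: "k > 0" and r: "r > 0"
  defines "A \<equiv> (\<integral>t. of_real (t\<^sup>2 * exp (- (k * r * t\<^sup>2))) * inverse (csqrt (of_real (t\<^sup>2) - 2 * \<i>)) \<partial>lborel)"
  shows "- of_real k * hank k 1 r - \<i> * of_real k * hank k 0 r = - of_real k * exp (\<i> * of_real (k * r)) * A"
    "norm (- of_real k * hank k 1 r - \<i> * of_real k * hank k 0 r) \<le> k * gauss_moment k 2 * r powr (- 3 / 2)"
proof -
  have e: "exp (- of_real (k * r) * (of_real (t\<^sup>2) - \<i>)) = exp (\<i> * of_real (k * r)) * of_real (exp (- (k * r * t\<^sup>2)))" for t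
    by (simp add: exp_add[symmetric] exp_of_real[symmetric] algebra_simps)
  have "hank k 1 r + \<i> * hank k 0 r = (\<integral>t. hank_integrand k 1 r t + \<i> * hank_integrand k 0 r t \<partial>lborel)"
    unfolding hank_def using integrable_hank_integrand[OF k r] by simp
  also have "(\<lambda>t. hank_integrand k 1 r t + \<i> * hank_integrand k 0 r t) =
     (\<lambda>t. exp (\<i> * of_real (k * r)) * (of_real (t\<^sup>2 * exp (- (k * r * t\<^sup>2))) * inverse (csqrt (of_real (t\<^sup>2) - 2 * \<i>))))"
    unfolding hank_integrand_def e by (simp add: fun_eq_iff algebra_simps)
  finally have 1: "hank k 1 r + \<i> * hank k 0 r = exp (\<i> * of_real (k * r)) * A"
    unfolding A_def by simp
  have "- of_real k * hank k 1 r - \<i> * of_real k * hank k 0 r = - of_real k * (hank k 1 r + \<i> * hank k 0 r)"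
    by (simp add: algebra_simps)
  then show 2: "- of_real k * hank k 1 r - \<i> * of_real k * hank k 0 r = - of_real k * exp (\<i> * of_real (k * r)) * A"
    unfolding 1 by simp
  have m: "(\<lambda>t. inverse (csqrt (of_real (t\<^sup>2) - 2 * \<i>))) \<in> borel_measurable borel"
    by (intro borel_measurable_continuous_onI continuous_at_imp_continuous_on ballI isCont_csqrt_arg)
  have nb: "norm (of_real (t\<^sup>2 * exp (- (k * r * t\<^sup>2))) * inverse (csqrt (of_real (t\<^sup>2) - 2 * \<i>))) \<le> t ^ 2 * exp (- (k * r * t\<^sup>2))" for t
  proof -
    have "norm (of_real (t\<^sup>2 * exp (- (k * r * t\<^sup>2))) * inverse (csqrt (of_real (t\<^sup>2) - 2 * \<i>))) \<le> (t ^ 2 * exp (- (k * r * t\<^sup>2))) * 1"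
      unfolding norm_mult norm_of_real by (intro mult_mono norm_inverse_csqrt_le_1) (auto simp: abs_mult)
    then show ?thesis by simp
  qed
  have im: "integrable lborel (\<lambda>t. t ^ 2 * exp (- (k * r * t\<^sup>2)))" by (rule integrable_gaussian_moment) (use k r in simp)
  have "norm A \<le> (\<integral>t. t ^ 2 * exp (- (k * r * t\<^sup>2)) \<partial>lborel)" unfolding A_def
  proof (rule Bochner_Integration.integral_norm_bound_integral)
    show "integrable lborel (\<lambda>t. of_real (t\<^sup>2 * exp (- (k * r * t\<^sup>2))) * inverse (csqrt (of_real (t\<^sup>2) - 2 * \<i>)))"
      by (rule Bochner_Integration.integrable_bound[OF im]) (use m nb in \<open>auto intro!: AE_I2 order_trans[OF nb] simp del: power_mult_distrib\<close>)
  qed (use nb im in auto)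
  also have "\<dots> = gauss_moment k 2 * r powr (- 3 / 2)" using gaussian_scaling[OF r, of 2 k] by (simp add: gauss_moment_def mult.commute)
  finally have "k * norm A \<le> k * (gauss_moment k 2 * r powr (- 3 / 2))" using k by (intro mult_left_mono) auto
  then show "norm (- of_real k * hank k 1 r - \<i> * of_real k * hank k 0 r) \<le> k * gauss_moment k 2 * r powr (- 3 / 2)"
    unfolding 2 using k by (simp add: norm_mult norm_exp_eq_Re mult.assoc)
qed


text \<open>This is the derivative of the logarithmic singularity. By \<open>hank_radiation\<close>
  the derivative consists of an integral \<open>A\<close> and a multiple of \<open>hank k 0\<close>.
  The latter is O(r^(-1/2)) and disappears after multiplication by r, while rescaling t by sqrt r
  turns r times \<open>A\<close> into an integral that converges as r tends to 0.\<close>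

lemma hank_1_limit:
  assumes k: "k > 0"
  shows "((\<lambda>r. of_real r * (- of_real k * hank k 1 r)) \<longlongrightarrow> - of_real (k * (\<integral>t. \<bar>t\<bar> * exp (- (k * t\<^sup>2)) \<partial>lborel))) (at_right 0)"
proof -
  \<comment> \<open>The absolute value of r extends the rescaled integral to both sides of 0, where
    the two-sided dominated limit applies.\<close>
  define B where "B r = (\<integral>t. of_real (t\<^sup>2 * exp (- (k * t\<^sup>2))) * inverse (csqrt (of_real (t\<^sup>2) - 2 * \<i> * of_real \<bar>r\<bar>)) \<partial>lborel)" for r
  define A where "A r = (\<integral>t. of_real (t\<^sup>2 * exp (- (k * r * t\<^sup>2))) * inverse (csqrt (of_real (t\<^sup>2) - 2 * \<i>)) \<partial>lborel)" for r
  have AB: "of_real r * A r = B r" if r: "r > 0" for r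
  proof -
    \<comment> \<open>The principal root commutes with positive factors: the right side squares to
      the argument and lies in the half plane that singles out the principal root.\<close>
    have sc: "csqrt (of_real r * z) = of_real (sqrt r) * csqrt z" for z
    proof -
      have "csqrt ((of_real (sqrt r) * csqrt z)\<^sup>2) = of_real (sqrt r) * csqrt z"
        by (rule csqrt_square) (use csqrt_principal[of z] r in auto)
      moreover have "(of_real (sqrt r))\<^sup>2 = complex_of_real r" using r by (simp flip: of_real_power)
      ultimately show ?thesis by (simp add: power_mult_distrib)
    qed
    have "B r = sqrt r *\<^sub>R (\<integral>t. of_real ((sqrt r * t)\<^sup>2 * exp (- (k * (sqrt r * t)\<^sup>2))) * inverse (csqrt (of_real ((sqrt r * t)\<^sup>2) - 2 * \<i> * of_real \<bar>r\<bar>)) \<partial>lborel)"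
      unfolding B_def using r by (subst lborel_integral_real_affine[of "sqrt r" _ 0]) simp_all
    also have "(\<lambda>t. of_real ((sqrt r * t)\<^sup>2 * exp (- (k * (sqrt r * t)\<^sup>2))) * inverse (csqrt (of_real ((sqrt r * t)\<^sup>2) - 2 * \<i> * of_real \<bar>r\<bar>))) =
        (\<lambda>t. of_real (sqrt r) * (of_real (t\<^sup>2 * exp (- (k * r * t\<^sup>2))) * inverse (csqrt (of_real (t\<^sup>2) - 2 * \<i>))))"
    proof
      fix t
      have 1: "(sqrt r * t)\<^sup>2 = r * t\<^sup>2" using r by (simp add: power_mult_distrib)
      have 2: "complex_of_real (r * t\<^sup>2) - 2 * \<i> * of_real \<bar>r\<bar> = of_real r * (of_real (t\<^sup>2) - 2 * \<i>)"
        using r by (simp add: algebra_simps)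
      have 3: "complex_of_real r = of_real (sqrt r) * of_real (sqrt r)" using r by (simp flip: of_real_mult)
      show "of_real ((sqrt r * t)\<^sup>2 * exp (- (k * (sqrt r * t)\<^sup>2))) * inverse (csqrt (of_real ((sqrt r * t)\<^sup>2) - 2 * \<i> * of_real \<bar>r\<bar>)) =
        of_real (sqrt r) * (of_real (t\<^sup>2 * exp (- (k * r * t\<^sup>2))) * inverse (csqrt (of_real (t\<^sup>2) - 2 * \<i>)))"
        unfolding 1 unfolding 2 sc unfolding of_real_mult[of "r * t\<^sup>2"] of_real_mult[of r] 3
        using r by (simp add: field_simps)
    qed
    also have "sqrt r *\<^sub>R (\<integral>t. of_real (sqrt r) * (of_real (t\<^sup>2 * exp (- (k * r * t\<^sup>2))) * inverse (csqrt (of_real (t\<^sup>2) - 2 * \<i>))) \<partial>lborel) = of_real r * A r"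
    proof -
      have "(\<integral>t. of_real (sqrt r) * (of_real (t\<^sup>2 * exp (- (k * r * t\<^sup>2))) * inverse (csqrt (of_real (t\<^sup>2) - 2 * \<i>))) \<partial>lborel) = of_real (sqrt r) * A r"
        unfolding A_def by (rule integral_mult_right_zero)
      moreover have "sqrt r *\<^sub>R (of_real (sqrt r) * A r) = of_real r * A r"
        using r by (simp only: scaleR_conv_of_real mult.assoc[symmetric] of_real_mult[symmetric] real_sqrt_mult_self abs_of_pos)
      ultimately show ?thesis by (simp only:)
    qed
    finally show ?thesis by simp
  qed
  have imom: "integrable lborel (\<lambda>t. \<bar>t\<bar> * exp (- (k * t\<^sup>2)))"
    using integrable_abs[OF integrable_gaussian_moment[OF k, of 1]] by (simp add: abs_mult)
  have "(B \<longlongrightarrow> (\<integral>t. of_real (\<bar>t\<bar> * exp (- (k * t\<^sup>2))) \<partial>lborel)) (at 0)"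
    unfolding B_def
  proof (rule tendsto_integral_dominated_at[where r=1 and B="\<lambda>t. \<bar>t\<bar> * exp (- (k * t\<^sup>2))"])
    \<comment> \<open>The modulus of the argument is at least t^2, so the root is at least |t|,
      whatever r is.\<close>
    show "norm (of_real (t\<^sup>2 * exp (- (k * t\<^sup>2))) * inverse (csqrt (of_real (t\<^sup>2) - 2 * \<i> * of_real \<bar>r\<bar>))) \<le> \<bar>t\<bar> * exp (- (k * t\<^sup>2))" for r t
    proof (cases "t = 0")
      case False
      have "t\<^sup>2 \<le> norm (of_real (t\<^sup>2) - 2 * \<i> * of_real \<bar>r\<bar>)"
        using abs_Re_le_cmod[of "of_real (t\<^sup>2) - 2 * \<i> * of_real \<bar>r\<bar>"] by simp
      then have "\<bar>t\<bar> \<le> norm (csqrt (of_real (t\<^sup>2) - 2 * \<i> * of_real \<bar>r\<bar>))"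
        unfolding norm_csqrt_arg by (metis real_sqrt_abs real_sqrt_le_mono)
      then have "norm (inverse (csqrt (of_real (t\<^sup>2) - 2 * \<i> * of_real \<bar>r\<bar>))) \<le> inverse \<bar>t\<bar>"
        unfolding norm_inverse using False by (intro le_imp_inverse_le) auto
      then have "norm (of_real (t\<^sup>2 * exp (- (k * t\<^sup>2))) * inverse (csqrt (of_real (t\<^sup>2) - 2 * \<i> * of_real \<bar>r\<bar>))) \<le> (t\<^sup>2 * exp (- (k * t\<^sup>2))) * inverse \<bar>t\<bar>"
        unfolding norm_mult norm_of_real by (intro mult_mono) (auto simp: abs_mult)
      also have "(t\<^sup>2 * exp (- (k * t\<^sup>2))) * inverse \<bar>t\<bar> = (\<bar>t\<bar> * \<bar>t\<bar> * inverse \<bar>t\<bar>) * exp (- (k * t\<^sup>2))"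
        by (simp only: mult_ac power2_eq_square abs_mult_self_eq)
      also have "\<bar>t\<bar> * \<bar>t\<bar> * inverse \<bar>t\<bar> = \<bar>t\<bar>" using False by (simp add: mult.assoc del: abs_mult_self_eq)
      finally show ?thesis .
    qed simp
    show "((\<lambda>r. of_real (t\<^sup>2 * exp (- (k * t\<^sup>2))) * inverse (csqrt (of_real (t\<^sup>2) - 2 * \<i> * of_real \<bar>r\<bar>))) \<longlongrightarrow> of_real (\<bar>t\<bar> * exp (- (k * t\<^sup>2)))) (at 0)" for t
    proof (cases "t = 0")
      case False
      have n: "complex_of_real (t\<^sup>2) \<notin> \<real>\<^sub>\<le>\<^sub>0" using False by (simp add: complex_nonpos_Reals_iff)
      have i: "((\<lambda>r. of_real (t\<^sup>2) - 2 * \<i> * of_real \<bar>r\<bar>) \<longlongrightarrow> of_real (t\<^sup>2) - 2 * \<i> * of_real \<bar>0\<bar>) (at 0)"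
        by (intro tendsto_intros)
      have c: "csqrt (of_real (t\<^sup>2)) = of_real \<bar>t\<bar>" by (simp flip: of_real_power)
      have "((\<lambda>r. csqrt (of_real (t\<^sup>2) - 2 * \<i> * of_real \<bar>r\<bar>)) \<longlongrightarrow> csqrt (of_real (t\<^sup>2))) (at 0)"
        by (rule isCont_tendsto_compose[OF continuous_at_csqrt[OF n]]) (use i in simp)
      then have "((\<lambda>r. of_real (t\<^sup>2 * exp (- (k * t\<^sup>2))) * inverse (csqrt (of_real (t\<^sup>2) - 2 * \<i> * of_real \<bar>r\<bar>))) \<longlongrightarrow> of_real (t\<^sup>2 * exp (- (k * t\<^sup>2))) * inverse (of_real \<bar>t\<bar>)) (at 0)"
        unfolding c using False by (intro tendsto_intros) auto
      also have "of_real (t\<^sup>2 * exp (- (k * t\<^sup>2))) * inverse (complex_of_real \<bar>t\<bar>) = of_real (\<bar>t\<bar> * exp (- (k * t\<^sup>2)))"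
        using False by (simp add: power2_eq_square divide_simps flip: of_real_mult of_real_inverse of_real_power)
      finally show ?thesis .
    qed simp
    show "(\<lambda>t. of_real (t\<^sup>2 * exp (- (k * t\<^sup>2))) * inverse (csqrt (of_real (t\<^sup>2) - 2 * \<i> * of_real \<bar>r\<bar>))) \<in> borel_measurable lborel" for r
    proof -
      have "(\<lambda>t. csqrt (of_real (t\<^sup>2) - 2 * \<i> * of_real \<bar>r\<bar>)) \<in> borel_measurable borel"
      \<comment> \<open>At r = 0 the argument meets the branch point for t = 0, but there the root
        is simply |t|.\<close>
      proof (cases "r = 0")
        case True
        have "csqrt (of_real (t\<^sup>2)) = of_real \<bar>t\<bar>" for t by (simp flip: of_real_power)
        then show ?thesis using True by simp
      next
        case False
        have "isCont (\<lambda>t. csqrt (of_real (t\<^sup>2) - 2 * \<i> * of_real \<bar>r\<bar>)) t" for t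
          by (rule isCont_o2[where g=csqrt and f="\<lambda>t. of_real (t\<^sup>2) - 2 * \<i> * of_real \<bar>r\<bar>"])
             (intro continuous_intros, rule continuous_at_csqrt, rule csqrt_arg_not_nonpos, use False in simp)
        then have "continuous_on UNIV (\<lambda>t. csqrt (of_real (t\<^sup>2) - 2 * \<i> * of_real \<bar>r\<bar>))"
          by (intro continuous_at_imp_continuous_on ballI)
        then show ?thesis by (rule borel_measurable_continuous_onI)
      qed
      then show ?thesis by simp
    qed
  qed (use imom in auto)
  then have limB: "(B \<longlongrightarrow> of_real (\<integral>t. \<bar>t\<bar> * exp (- (k * t\<^sup>2)) \<partial>lborel)) (at_right 0)"
    by (simp only: integral_complex_of_real) (rule tendsto_within_subset, auto)
  have lim0: "((\<lambda>r. of_real r * hank k 0 r) \<longlongrightarrow> 0) (at_right 0)"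
  proof (rule tendsto_norm_zero_cancel, rule tendsto_sandwich[OF _ _ tendsto_const])
    show "\<forall>\<^sub>F r in at_right 0. norm (of_real r * hank k 0 r) \<le> gauss_moment k 0 * sqrt r"
      using eventually_at_right_less[of "0::real"]
    proof (rule eventually_mono)
      fix r :: real assume r: "r > 0"
      have "norm (of_real r * hank k 0 r) \<le> r * (gauss_moment k 0 * r powr (- 1 / 2))"
        using norm_hank_0_le[OF k r] r by (simp add: norm_mult)
      also have "\<dots> = gauss_moment k 0 * (r powr 1 * r powr (- 1 / 2))" using r by simp
      also have "r powr 1 * r powr (- 1 / 2) = sqrt r" unfolding powr_add[symmetric] using r by (simp add: powr_half_sqrt)
      finally show "norm (of_real r * hank k 0 r) \<le> gauss_moment k 0 * sqrt r" .
    qed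
    have "((\<lambda>r. gauss_moment k 0 * sqrt r) \<longlongrightarrow> gauss_moment k 0 * sqrt 0) (at_right 0)" by (intro tendsto_intros)
    then show "((\<lambda>r. gauss_moment k 0 * sqrt r) \<longlongrightarrow> 0) (at_right 0)" by simp
  qed simp
  have "((\<lambda>r. \<i> * of_real k * (of_real r * hank k 0 r) - of_real k * exp (\<i> * of_real (k * r)) * B r) \<longlongrightarrow>
     \<i> * of_real k * 0 - of_real k * exp (\<i> * of_real (k * 0)) * of_real (\<integral>t. \<bar>t\<bar> * exp (- (k * t\<^sup>2)) \<partial>lborel)) (at_right 0)"
    by (intro tendsto_intros lim0 limB)
  moreover have "\<forall>\<^sub>F r in at_right 0. \<i> * of_real k * (of_real r * hank k 0 r) - of_real k * exp (\<i> * of_real (k * r)) * B r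
      = of_real r * (- of_real k * hank k 1 r)"
    using eventually_at_right_less[of "0::real"]
  proof (rule eventually_mono)
    fix r :: real assume r: "r > 0"
    show "\<i> * of_real k * (of_real r * hank k 0 r) - of_real k * exp (\<i> * of_real (k * r)) * B r = of_real r * (- of_real k * hank k 1 r)"
    proof -
      have "\<i> * of_real k * (of_real r * hank k 0 r) - of_real k * exp (\<i> * of_real (k * r)) * B r
          = of_real r * (\<i> * of_real k * hank k 0 r + (- of_real k * exp (\<i> * of_real (k * r)) * A r))"
        unfolding AB[OF r, symmetric] by (simp add: algebra_simps)
      also have "\<i> * of_real k * hank k 0 r + (- of_real k * exp (\<i> * of_real (k * r)) * A r) = - of_real k * hank k 1 r"
        unfolding A_def hank_radiation(1)[OF k r, symmetric] by simp
      finally show ?thesis .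
    qed
  qed
  ultimately show ?thesis by (simp add: Lim_transform_eventually)
qed

text \<open>\<open>F\<close> is the fundamental solution as a function of $s = r^2$, which keeps \<open>F (z \<bullet> z)\<close> differentiable
  without square roots. The two last bounds are decay and the radiation condition, one order better.\<close>

definition fundamental_radial :: "nat \<Rightarrow> real \<Rightarrow> (real \<Rightarrow> complex) \<Rightarrow> (real \<Rightarrow> complex) \<Rightarrow> (real \<Rightarrow> complex) \<Rightarrow> complex \<Rightarrow> real \<Rightarrow> bool" where
  "fundamental_radial n k F F' F'' c C \<longleftrightarrow> c \<noteq> 0 \<and>
    (\<forall>s>0. (F has_vector_derivative F' s) (at s) \<and> (F' has_vector_derivative F'' s) (at s) \<and> isCont F'' s \<and>
       of_real (4 * s) * F'' s + of_real (2 * real n) * F' s + of_real (k\<^sup>2) * F s = 0) \<and>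
    ((\<lambda>s. of_real (sqrt s ^ n) * F' s) \<longlongrightarrow> c) (at_right 0) \<and>
    ((\<lambda>s. of_real (sqrt s ^ n) * F s) \<longlongrightarrow> 0) (at_right 0) \<and>
    (\<forall>r\<ge>1. norm (F (r\<^sup>2)) \<le> C * r powr (- (real n - 1) / 2) \<and>
       norm (of_real (2 * r) * F' (r\<^sup>2) - \<i> * of_real k * F (r\<^sup>2)) \<le> C * r powr (- (real n + 1) / 2))"

text \<open>The radial equation h'' + (n-1) h'/r + k^2 h = 0 rewritten in s = r^2. Since h'(r) = 2 r
  F'(r^2), the constant of the singularity is halved.\<close>

lemma fundamental_radial_of_radius:
  fixes h h1 h2 :: "real \<Rightarrow> complex"
  assumes n: "n \<ge> 1" and d: "\<And>r. r > 0 \<Longrightarrow> (h has_vector_derivative h1 r) (at r)" "\<And>r. r > 0 \<Longrightarrow> (h1 has_vector_derivative h2 r) (at r)"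
    "\<And>r. r > 0 \<Longrightarrow> isCont h2 r"
    and ode: "\<And>r. r > 0 \<Longrightarrow> h2 r + of_real ((real n - 1) / r) * h1 r + of_real (k\<^sup>2) * h r = 0"
    and l1: "((\<lambda>r. of_real (r ^ (n - 1)) * h1 r) \<longlongrightarrow> c) (at_right 0)" "c \<noteq> 0"
    and l2: "((\<lambda>r. of_real (r ^ n) * h r) \<longlongrightarrow> 0) (at_right 0)"
    and b: "\<And>r. r \<ge> 1 \<Longrightarrow> norm (h r) \<le> C * r powr (- (real n - 1) / 2)"
      "\<And>r. r \<ge> 1 \<Longrightarrow> norm (h1 r - \<i> * of_real k * h r) \<le> C * r powr (- (real n + 1) / 2)"
  shows "fundamental_radial n k (\<lambda>s. h (sqrt s)) (\<lambda>s. h1 (sqrt s) / of_real (2 * sqrt s))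
     (\<lambda>s. (h2 (sqrt s) - h1 (sqrt s) / of_real (sqrt s)) / of_real (4 * s)) (c / 2) C"
  unfolding fundamental_radial_def
proof (intro conjI allI impI)
  show "c / 2 \<noteq> 0" using l1(2) by simp
  have sq: "filterlim sqrt (at_right 0) (at_right 0)"
  proof -
    have "(sqrt \<longlongrightarrow> sqrt 0) (at_right 0)" by (intro tendsto_intros)
    then have "(sqrt \<longlongrightarrow> 0) (at_right 0)" by (simp only: real_sqrt_zero)
    moreover have "\<forall>\<^sub>F s in at_right 0. sqrt s \<in> {0<..} \<and> sqrt s \<noteq> 0"
      using eventually_at_right_less[of "0::real"] by (rule eventually_mono) simp
    ultimately show ?thesis unfolding filterlim_at by (intro conjI)
  qed
  have "((\<lambda>s. of_real (sqrt s ^ (n - 1)) * h1 (sqrt s)) \<longlongrightarrow> c) (at_right 0)" by (rule filterlim_compose[OF l1(1) sq])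
  then have "((\<lambda>s. of_real (sqrt s ^ (n - 1)) * h1 (sqrt s) / 2) \<longlongrightarrow> c / 2) (at_right 0)" by (intro tendsto_intros) auto
  moreover have "\<forall>\<^sub>F s in at_right 0. of_real (sqrt s ^ (n - 1)) * h1 (sqrt s) / 2 = of_real (sqrt s ^ n) * (h1 (sqrt s) / of_real (2 * sqrt s))"
    using eventually_at_right_less[of "0::real"]
    by (rule eventually_mono) (use n in \<open>auto simp: field_simps power_eq_if\<close>)
  ultimately show "((\<lambda>s. of_real (sqrt s ^ n) * (h1 (sqrt s) / of_real (2 * sqrt s))) \<longlongrightarrow> c / 2) (at_right 0)"
    by (rule Lim_transform_eventually)
  show "((\<lambda>s. of_real (sqrt s ^ n) * h (sqrt s)) \<longlongrightarrow> 0) (at_right 0)" by (rule filterlim_compose[OF l2 sq])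
next
  fix s :: real assume s: "0 < s"
  have sd: "(sqrt has_vector_derivative (1 / (2 * sqrt s))) (at s)"
  proof -
    have "inverse (sqrt s) / 2 = 1 / (2 * sqrt s)" by (simp add: inverse_eq_divide)
    then show ?thesis using DERIV_real_sqrt[OF s] unfolding has_real_derivative_iff_has_vector_derivative by (simp only:)
  qed
  have sc: "sqrt s > 0" "sqrt s * sqrt s = s" using s by auto
  define q where "q = complex_of_real (sqrt s)"
  have "complex_of_real s = of_real (sqrt s * sqrt s)" by (simp only: sc(2))
  then have q: "q \<noteq> 0" "of_real s = q * q" using sc(1) by (auto simp only: q_def of_real_mult of_real_eq_0_iff)
  have comp: "((\<lambda>s. g (sqrt s)) has_vector_derivative g' / of_real (2 * sqrt s)) (at s)"
    if "(g has_vector_derivative g') (at (sqrt s))" for g :: "real \<Rightarrow> complex" and g'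
  proof -
    have "(1 / (2 * sqrt s)) *\<^sub>R g' = g' / of_real (2 * sqrt s)"
      by (simp only: scaleR_conv_of_real of_real_divide of_real_1 times_divide_eq_left mult_1)
    then show ?thesis using vector_diff_chain_at[OF sd that] by (simp only: o_def)
  qed
  show "((\<lambda>s. h (sqrt s)) has_vector_derivative h1 (sqrt s) / of_real (2 * sqrt s)) (at s)" by (rule comp[OF d(1)[OF sc(1)]])
  have id: "((\<lambda>s. inverse (of_real (2 * sqrt s)) :: complex) has_vector_derivative - of_real (1 / (4 * (sqrt s * s)))) (at s)"
  proof -
    have "((\<lambda>s. inverse (2 * sqrt s)) has_real_derivative - (1 / (4 * (sqrt s * s)))) (at s)"
      using s by (auto intro!: derivative_eq_intros simp: divide_simps)
    then have "((\<lambda>s. complex_of_real (inverse (2 * sqrt s))) has_vector_derivative complex_of_real (- (1 / (4 * (sqrt s * s))))) (at s)"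
      by (rule has_vector_derivative_of_real)
    then show ?thesis by (simp only: of_real_inverse of_real_minus)
  qed
  from has_vector_derivative_mult[OF comp[OF d(2)[OF sc(1)]] this]
  have "((\<lambda>s. h1 (sqrt s) / of_real (2 * sqrt s)) has_vector_derivative
      (h1 (sqrt s) * - of_real (1 / (4 * (sqrt s * s))) + h2 (sqrt s) / of_real (2 * sqrt s) * inverse (of_real (2 * sqrt s)))) (at s)"
    by (simp only: divide_inverse)
  also have "h1 (sqrt s) * - of_real (1 / (4 * (sqrt s * s))) + h2 (sqrt s) / of_real (2 * sqrt s) * inverse (of_real (2 * sqrt s))
      = (h2 (sqrt s) - h1 (sqrt s) / of_real (sqrt s)) / of_real (4 * s)"
  proof -
    have alg: "H1 * - inverse (4 * (q * (q * q))) + H2 / (2 * q) * inverse (2 * q) = (H2 - H1 / q) / (4 * (q * q))"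
      for H1 H2 :: complex using q(1) by (simp add: divide_simps)
    have "complex_of_real (1 / (4 * (sqrt s * s))) = inverse (4 * (q * (q * q)))"
      by (simp only: of_real_divide of_real_mult of_real_1 of_real_numeral q(2) q_def[symmetric] inverse_eq_divide)
    moreover have "complex_of_real (2 * sqrt s) = 2 * q" "complex_of_real (4 * s) = 4 * (q * q)"
      by (simp_all only: of_real_mult of_real_numeral q(2) q_def[symmetric])
    ultimately show ?thesis by (simp only: alg q_def[symmetric])
  qed
  finally show "((\<lambda>s. h1 (sqrt s) / of_real (2 * sqrt s)) has_vector_derivative (h2 (sqrt s) - h1 (sqrt s) / of_real (sqrt s)) / of_real (4 * s)) (at s)" .
  have "isCont (\<lambda>s. h2 (sqrt s)) s" "isCont (\<lambda>s. h1 (sqrt s)) s"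
    using isCont_o2[OF isCont_real_sqrt d(3)[OF sc(1)]] isCont_o2[OF isCont_real_sqrt has_vector_derivative_continuous[OF d(2)[OF sc(1)]]]
    by auto
  then show "isCont (\<lambda>s. (h2 (sqrt s) - h1 (sqrt s) / of_real (sqrt s)) / of_real (4 * s)) s"
    using s by (intro continuous_intros) auto
  have "h2 (sqrt s) + (of_nat n - 1) / q * h1 (sqrt s) + of_real (k\<^sup>2) * h (sqrt s) = 0"
    using ode[OF sc(1)] by (simp only: q_def of_real_divide of_real_diff of_real_of_nat_eq of_real_1)
  show "of_real (4 * s) * ((h2 (sqrt s) - h1 (sqrt s) / of_real (sqrt s)) / of_real (4 * s)) + of_real (2 * real n) * (h1 (sqrt s) / of_real (2 * sqrt s)) + of_real (k\<^sup>2) * h (sqrt s) = 0"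
  proof -
    have alg: "4 * (q * q) * ((H2 - H1 / q) / (4 * (q * q))) + 2 * N * (H1 / (2 * q)) + Z = H2 + (N - 1) / q * H1 + Z"
      for H1 H2 N Z :: complex using q(1) by (simp add: field_simps)
    have "complex_of_real (2 * sqrt s) = 2 * q" "complex_of_real (4 * s) = 4 * (q * q)" "complex_of_real (2 * real n) = 2 * of_nat n"
      by (simp_all only: of_real_mult of_real_numeral q(2) q_def[symmetric] of_real_of_nat_eq)
    then show ?thesis using \<open>h2 (sqrt s) + (of_nat n - 1) / q * h1 (sqrt s) + of_real (k\<^sup>2) * h (sqrt s) = 0\<close>
      by (simp only: alg q_def[symmetric])
  qed
next
  fix r :: real assume r: "1 \<le> r"
  then show "norm (h (sqrt (r\<^sup>2))) \<le> C * r powr (- (real n - 1) / 2)" using b(1) by simp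
  show "norm (of_real (2 * r) * (h1 (sqrt (r\<^sup>2)) / of_real (2 * sqrt (r\<^sup>2))) - \<i> * of_real k * h (sqrt (r\<^sup>2))) \<le> C * r powr (- (real n + 1) / 2)"
    using b(2)[OF r] r by simp
qed


lemma gauss_abs_moment_pos:
  fixes k :: real
  assumes k: "k > 0" shows "(\<integral>t. \<bar>t\<bar> * exp (- (k * t\<^sup>2)) \<partial>lborel) \<noteq> 0"
proof
  assume 0: "(\<integral>t. \<bar>t\<bar> * exp (- (k * t\<^sup>2)) \<partial>lborel) = 0"
  have "integrable lborel (\<lambda>t. \<bar>t\<bar> * exp (- (k * t\<^sup>2)))"
    using integrable_abs[OF integrable_gaussian_moment[OF k, of 1]] by (simp add: abs_mult)
  then have "AE t in lborel. \<bar>t\<bar> * exp (- (k * t\<^sup>2)) = 0"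
    using 0 by (subst (asm) integral_nonneg_eq_0_iff_AE) auto
  then have "AE t::real in lborel. t \<notin> {0<..<1}" by (rule AE_mp) (intro AE_I2, auto)
  then have "emeasure lborel {0<..<1::real} = 0" by (subst (asm) AE_iff_null_sets[symmetric]) auto
  then show False by simp
qed

text \<open>Both dimensions only have to meet the hypotheses of
  \<open>fundamental_radial_of_radius\<close>: for n = 2 by the Hankel integral, where the constant
  is the strength of the logarithm, for n = 3 by e^(ikr)/r.\<close>

lemma fundamental_radial_exists:
  assumes k: "k > 0" and n: "n = 2 \<or> n = 3"
  shows "\<exists>F F' F'' c C. fundamental_radial n k F F' F'' c C"
  using n
proof
  assume n: "n = 2"
  define c where "c = complex_of_real (- (k * (\<integral>t. \<bar>t\<bar> * exp (- (k * t\<^sup>2)) \<partial>lborel)))"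
  define C where "C = max (gauss_moment k 0) (k * gauss_moment k 2)"
  note d = hank_deriv[OF k]
  have "\<exists>F F' F''. fundamental_radial n k F F' F'' (c / 2) C"
  proof (intro exI, rule fundamental_radial_of_radius)
    show "(hank k 0 has_vector_derivative - of_real k * hank k 1 r) (at r)" if "r > 0" for r
      using d[OF that, of 0] by simp
    show "((\<lambda>r. - of_real k * hank k 1 r) has_vector_derivative of_real (k\<^sup>2) * hank k 2 r) (at r)" if "r > 0" for r
    proof -
      have "- of_real k * (- of_real k * hank k (Suc 1) r) = of_real (k\<^sup>2) * hank k 2 r"
        by (simp add: power2_eq_square numeral_2_eq_2)
      then show ?thesis using has_vector_derivative_mult_right[OF d[OF that, of 1], of "- of_real k"] by (simp only:)
    qed
    show "isCont (\<lambda>r. of_real (k\<^sup>2) * hank k 2 r) r" if "r > 0" for r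
      using has_vector_derivative_continuous[OF d[OF that, of 2]] by (intro continuous_intros)
    show "of_real (k\<^sup>2) * hank k 2 r + of_real ((real n - 1) / r) * (- of_real k * hank k 1 r) + of_real (k\<^sup>2) * hank k 0 r = 0" if "r > 0" for r
    proof -
      have "of_real ((real n - 1) / r) * (- of_real k * hank k 1 r) = - (of_real (k / r) * hank k 1 r)" by (simp add: n)
      then show ?thesis using hank_ode[OF k that] by (simp only: add_uminus_conv_diff)
    qed
    show "((\<lambda>r. of_real (r ^ (n - 1)) * (- of_real k * hank k 1 r)) \<longlongrightarrow> c) (at_right 0)"
      using hank_1_limit[OF k] by (simp add: n c_def)
    show "c \<noteq> 0" using gauss_abs_moment_pos[OF k] k by (simp add: c_def)
    show "((\<lambda>r. of_real (r ^ n) * hank k 0 r) \<longlongrightarrow> 0) (at_right 0)"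
    proof (rule tendsto_norm_zero_cancel, rule tendsto_sandwich[OF _ _ tendsto_const])
      show "\<forall>\<^sub>F r in at_right 0. norm (of_real (r ^ n) * hank k 0 r) \<le> gauss_moment k 0 * (r * sqrt r)"
        using eventually_at_right_less[of "0::real"]
      proof (rule eventually_mono)
        fix r :: real assume r: "r > 0"
        have "norm (of_real (r ^ n) * hank k 0 r) \<le> r\<^sup>2 * (gauss_moment k 0 * r powr (- 1 / 2))"
          unfolding norm_mult norm_of_real by (intro mult_mono norm_hank_0_le k r) (auto simp: n)
        also have "\<dots> = gauss_moment k 0 * (r * (r powr 1 * r powr (- 1 / 2)))" using r by (simp add: power2_eq_square)
        also have "r powr 1 * r powr (- 1 / 2) = sqrt r" unfolding powr_add[symmetric] using r by (simp add: powr_half_sqrt)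
        finally show "norm (of_real (r ^ n) * hank k 0 r) \<le> gauss_moment k 0 * (r * sqrt r)" .
      qed
      have "((\<lambda>r. gauss_moment k 0 * (r * sqrt r)) \<longlongrightarrow> gauss_moment k 0 * (0 * sqrt 0)) (at_right 0)"
        by (intro tendsto_intros)
      then show "((\<lambda>r. gauss_moment k 0 * (r * sqrt r)) \<longlongrightarrow> 0) (at_right 0)" by simp
    qed simp
    show "norm (hank k 0 r) \<le> C * r powr (- (real n - 1) / 2)" if "r \<ge> 1" for r
    proof -
      have "norm (hank k 0 r) \<le> gauss_moment k 0 * r powr (- 1 / 2)" using norm_hank_0_le[OF k] that by simp
      also have "\<dots> \<le> C * r powr (- 1 / 2)" unfolding C_def by (intro mult_right_mono) auto
      finally show ?thesis by (simp add: n)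
    qed
    show "norm (- of_real k * hank k 1 r - \<i> * of_real k * hank k 0 r) \<le> C * r powr (- (real n + 1) / 2)" if "r \<ge> 1" for r
    proof -
      have "norm (- of_real k * hank k 1 r - \<i> * of_real k * hank k 0 r) \<le> k * gauss_moment k 2 * r powr (- 3 / 2)"
        using that by (intro hank_radiation(2)[OF k]) simp
      also have "\<dots> \<le> C * r powr (- 3 / 2)" unfolding C_def by (intro mult_right_mono) auto
      finally show ?thesis by (simp add: n)
    qed
  qed (use n in simp)
  then show ?thesis by blast
next
  assume n: "n = 3"
  \<comment> \<open>The functions e^(ikr) / r^m are closed under differentiation up to linear
    combination, and m = 1 is the fundamental solution. Its radiation defect is exactly
    \<open>- h 2\<close>.\<close>
  define h where "h m r = exp (\<i> * of_real k * of_real r) * inverse (of_real r) ^ m" for m :: nat and r :: real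
  have h: "(h m has_vector_derivative \<i> * of_real k * h m r - of_nat m * h (Suc m) r) (at r)" if "r > 0" for m r
  proof -
    have 1: "((\<lambda>z. exp (\<i> * of_real k * z)) has_field_derivative exp (\<i> * of_real k * of_real r) * (\<i> * of_real k)) (at (of_real r))"
      by (rule DERIV_chain2[OF DERIV_exp]) (auto intro!: derivative_eq_intros)
    have 2: "((\<lambda>z. inverse z ^ m) has_field_derivative - (of_nat m * inverse (complex_of_real r) ^ Suc m)) (at (of_real r))"
    proof (rule DERIV_cong[OF DERIV_power[OF DERIV_inverse]])
      show "complex_of_real r \<noteq> 0" using that by simp
      show "of_nat m * (- (inverse (complex_of_real r) ^ Suc (Suc 0)) * inverse (complex_of_real r) ^ (m - Suc 0))
          = - (of_nat m * inverse (complex_of_real r) ^ Suc m)"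
        by (cases m) simp_all
    qed
    have "((\<lambda>z. exp (\<i> * of_real k * z) * inverse z ^ m) has_field_derivative
        \<i> * of_real k * (exp (\<i> * of_real k * of_real r) * inverse (of_real r) ^ m) - of_nat m * (exp (\<i> * of_real k * of_real r) * inverse (of_real r) ^ Suc m)) (at (of_real r))"
      by (rule DERIV_cong[OF DERIV_mult[OF 1 2]]) (simp only: mult_ac mult_minus_left mult_minus_right diff_conv_add_uminus)
    from has_field_derivative_at_within[OF this, THEN has_vector_derivative_real_field]
    show ?thesis unfolding h_def[abs_def] .
  qed
  have cont: "isCont (h m) r" if "r > 0" for m r by (rule has_vector_derivative_continuous[OF h[OF that]])
  have "\<exists>F F' F''. fundamental_radial n k F F' F'' (- 1 / 2) 1"
  proof (intro exI, rule fundamental_radial_of_radius)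
    show "(h 1 has_vector_derivative \<i> * of_real k * h 1 r - h 2 r) (at r)" if "r > 0" for r
      using h[OF that, of 1] by (simp add: numeral_2_eq_2)
    show "((\<lambda>r. \<i> * of_real k * h 1 r - h 2 r) has_vector_derivative
        \<i> * of_real k * (\<i> * of_real k * h 1 r - h 2 r) - (\<i> * of_real k * h 2 r - 2 * h 3 r)) (at r)" if "r > 0" for r
      by (intro has_vector_derivative_diff has_vector_derivative_mult_right)
         (use h[OF that, of 1] h[OF that, of 2] in \<open>simp_all add: numeral_2_eq_2 numeral_3_eq_3\<close>)
    show "isCont (\<lambda>r. \<i> * of_real k * (\<i> * of_real k * h 1 r - h 2 r) - (\<i> * of_real k * h 2 r - 2 * h 3 r)) r" if "r > 0" for r
      by (intro continuous_intros cont that)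
    show "\<i> * of_real k * (\<i> * of_real k * h 1 r - h 2 r) - (\<i> * of_real k * h 2 r - 2 * h 3 r) + of_real ((real n - 1) / r) * (\<i> * of_real k * h 1 r - h 2 r) + of_real (k\<^sup>2) * h 1 r = 0" if "r > 0" for r
    proof -
      define a where "a = inverse (complex_of_real r)"
      have 1: "h 2 r = h 1 r * a" "h 3 r = h 1 r * a * a"
        unfolding h_def a_def[symmetric] by (simp_all add: power2_eq_square power3_eq_cube)
      have 2: "of_real ((real n - 1) / r) = 2 * a" "of_real (k\<^sup>2) = of_real k * complex_of_real k"
        by (simp_all add: a_def n inverse_eq_divide power2_eq_square)
      show ?thesis unfolding 1 2 by (simp add: algebra_simps)
    qed
    have e: "((\<lambda>r. exp (\<i> * of_real k * of_real r)) \<longlongrightarrow> exp (\<i> * of_real k * of_real 0)) (at_right 0)" by (intro tendsto_intros)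
    have "((\<lambda>r. (\<i> * of_real k * of_real r - 1) * exp (\<i> * of_real k * of_real r)) \<longlongrightarrow> (\<i> * of_real k * of_real 0 - 1) * exp (\<i> * of_real k * of_real 0)) (at_right 0)"
      by (intro tendsto_intros e)
    then have "((\<lambda>r. (\<i> * of_real k * of_real r - 1) * exp (\<i> * of_real k * of_real r)) \<longlongrightarrow> - 1) (at_right 0)" by simp
    moreover have "\<forall>\<^sub>F r in at_right 0. (\<i> * of_real k * of_real r - 1) * exp (\<i> * of_real k * of_real r) = of_real (r ^ (n - 1)) * (\<i> * of_real k * h 1 r - h 2 r)"
      using eventually_at_right_less[of "0::real"]
    proof (rule eventually_mono)
      fix r :: real assume r: "0 < r"
      define R a E where "R = complex_of_real r" and "a = inverse R" and "E = exp (\<i> * of_real k * R)"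
      have Ra: "R * a = 1" using r by (simp add: R_def a_def)
      have "R * R * (\<i> * of_real k * (E * a) - E * (a * a)) = \<i> * of_real k * R * E * (R * a) - E * ((R * a) * (R * a))"
        by (simp only: right_diff_distrib mult_ac)
      also have "\<dots> = (\<i> * of_real k * R - 1) * E" by (simp add: Ra algebra_simps)
      finally show "(\<i> * of_real k * of_real r - 1) * exp (\<i> * of_real k * of_real r) = of_real (r ^ (n - 1)) * (\<i> * of_real k * h 1 r - h 2 r)"
        by (simp add: h_def n power2_eq_square flip: R_def a_def E_def)
    qed
    ultimately show "((\<lambda>r. of_real (r ^ (n - 1)) * (\<i> * of_real k * h 1 r - h 2 r)) \<longlongrightarrow> - 1) (at_right 0)"
      by (rule Lim_transform_eventually)
    have "((\<lambda>r. of_real (r * r) * exp (\<i> * of_real k * of_real r)) \<longlongrightarrow> of_real (0 * 0) * exp (\<i> * of_real k * of_real 0)) (at_right 0)"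
      by (intro tendsto_intros e)
    then have "((\<lambda>r. of_real (r * r) * exp (\<i> * of_real k * of_real r)) \<longlongrightarrow> 0) (at_right 0)" by simp
    moreover have "\<forall>\<^sub>F r in at_right 0. of_real (r * r) * exp (\<i> * of_real k * of_real r) = of_real (r ^ n) * h 1 r"
      using eventually_at_right_less[of "0::real"]
      by (rule eventually_mono) (simp add: h_def n power3_eq_cube)
    ultimately show "((\<lambda>r. of_real (r ^ n) * h 1 r) \<longlongrightarrow> 0) (at_right 0)" by (rule Lim_transform_eventually)
    have nh: "norm (h m r) = inverse r ^ m" if "r \<ge> 1" for m r
      using that by (simp add: h_def norm_mult norm_power norm_inverse norm_exp_eq_Re)
    show "norm (h 1 r) \<le> 1 * r powr (- (real n - 1) / 2)" if "r \<ge> 1" for r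
    proof -
      have "r powr (- 1) = inverse r" using that by (simp add: powr_minus)
      then show ?thesis using nh[OF that, of 1] by (simp add: n)
    qed
    show "norm (\<i> * of_real k * h 1 r - h 2 r - \<i> * of_real k * h 1 r) \<le> 1 * r powr (- (real n + 1) / 2)" if "r \<ge> 1" for r
    proof -
      have "r powr (- 2) = inverse r ^ 2" using that by (simp add: powr_minus power_inverse)
      then show ?thesis using nh[OF that, of 2] by (simp add: n)
    qed
  qed (use n in simp_all)
  then show ?thesis by blast
qed

section \<open>The singularity of the fundamental solution\<close>

lemma lborel_integral_scale:
  fixes f :: "'a::euclidean_space \<Rightarrow> real"
  assumes [measurable]: "f \<in> borel_measurable borel" and c: "c > 0"
  shows "integral\<^sup>L lborel f = c ^ DIM('a) * (\<integral>x. f (c *\<^sub>R x) \<partial>lborel)"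
proof -
  have "integral\<^sup>L lborel f = integral\<^sup>L (density (distr lborel borel (\<lambda>x. 0 + c *\<^sub>R x)) (\<lambda>_. ennreal (\<bar>c\<bar>^DIM('a)))) f"
    using c by (intro arg_cong[where f="\<lambda>M. integral\<^sup>L M f"] lborel_affine) simp
  also have "\<dots> = (\<integral>x. c ^ DIM('a) *\<^sub>R f x \<partial>distr lborel borel (\<lambda>x. 0 + c *\<^sub>R x))"
    using c by (subst integral_density) auto
  also have "\<dots> = (\<integral>x. c ^ DIM('a) *\<^sub>R f (c *\<^sub>R x) \<partial>lborel)"
    by (subst integral_distr) auto
  finally show ?thesis by simp
qed

lemma integrable_indicator_ball_times:
  fixes g :: "'a::euclidean_space \<Rightarrow> real"
  assumes "continuous_on UNIV g"
  shows "integrable lborel (\<lambda>y. indicator (ball x r) y * g y)"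
proof -
  have "integrable lborel (\<lambda>y. indicator (cball x r) y *\<^sub>R g y)"
    by (rule borel_integrable_compact) (auto intro: continuous_on_subset[OF assms])
  then have "integrable lborel (\<lambda>y. indicator (ball x r) y *\<^sub>R (indicator (cball x r) y *\<^sub>R g y))"
    by (rule integrable_mult_indicator[rotated]) simp
  moreover have "indicator (ball x r) y *\<^sub>R (indicator (cball x r) y *\<^sub>R g y) = indicator (ball x r) y * g y" for y
    by (simp add: indicator_def)
  ultimately show ?thesis by (simp only:)
qed

lemma measure_lborel_ball:
  fixes x :: "'a::euclidean_space"
  assumes "r > 0" shows "measure lborel (ball x r) = measure lborel (ball (0::'a) 1) * r ^ DIM('a)"
  using content_ball[of r x] content_ball[of 1 "0::'a"] assms by simp

text \<open>The factor n/(n+2) is found without polar coordinates. Scaling gives the moment as m(1)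
  r^(n+2) and the volume as w r^n. On the shell between radii 1 and b the integrand lies between 1
  and b^2; comparing derivatives at b = 1 in the two resulting inequalities forces (n+2) m(1) = n
  w.\<close>

lemma ball_second_moment:
  fixes x :: "'a::euclidean_space"
  assumes r: "r > 0"
  shows "(\<integral>y. indicator (ball x r) y * (norm (y - x))\<^sup>2 \<partial>lborel)
    = real DIM('a) / (real DIM('a) + 2) * r ^ (DIM('a) + 2) * measure lborel (ball (0::'a) 1)"
proof -
  define n where "n = DIM('a)"
  have n1: "n \<ge> 1" unfolding n_def using DIM_positive[where 'a='a] by linarith
  define w where "w = measure lborel (ball (0::'a) 1)"
  define m where "m r = (\<integral>y. indicator (ball (0::'a) r) y * (norm y)\<^sup>2 \<partial>lborel)" for r
  have ball_w: "measure lborel (ball (0::'a) r) = w * r ^ n" if "r > 0" for r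
    using measure_lborel_ball[OF that, of 0] by (simp add: w_def n_def)
  have int: "integrable lborel (\<lambda>y. indicator (ball (0::'a) r) y * (norm y)\<^sup>2)" for r
    by (rule integrable_indicator_ball_times) (intro continuous_intros)
  have mm: "(\<lambda>y. indicator (ball (0::'a) r) y * (norm y)\<^sup>2) \<in> borel_measurable borel" for r :: real
    using borel_measurable_integrable[OF int] by simp
  have scale: "m r = r ^ (n + 2) * m 1" if "r > 0" for r
  proof -
    have "m r = r ^ n * (\<integral>y. indicator (ball (0::'a) r) (r *\<^sub>R y) * (norm (r *\<^sub>R y))\<^sup>2 \<partial>lborel)"
      unfolding m_def n_def by (rule lborel_integral_scale[OF mm that])
    also have "(\<lambda>y. indicator (ball (0::'a) r) (r *\<^sub>R y) * (norm (r *\<^sub>R y))\<^sup>2) = (\<lambda>y. r\<^sup>2 * (indicator (ball 0 1) y * (norm y)\<^sup>2) :: real)"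
      using that by (auto simp: fun_eq_iff indicator_def power_mult_distrib)
    also have "r ^ n * (\<integral>y. r\<^sup>2 * (indicator (ball 0 1) y * (norm (y::'a))\<^sup>2) \<partial>lborel) = r ^ (n + 2) * m 1"
      unfolding m_def by (simp add: power_add power2_eq_square)
    finally show ?thesis .
  qed
  have inti: "integrable lborel (\<lambda>y. c * indicator (ball (0::'a) r) y :: real)" for r c
    by (intro integrable_mult_right integrable_real_indicator) (auto simp: emeasure_bounded_finite[simplified])
  have lower: "w * (b ^ n - 1) \<le> m 1 * (b ^ (n + 2) - 1)" and upper: "m 1 * (b ^ (n + 2) - 1) \<le> b\<^sup>2 * (w * (b ^ n - 1))" if b: "b > 1" for b
  proof -
    have 1: "m b - m 1 = (\<integral>y. indicator (ball (0::'a) b) y * (norm y)\<^sup>2 - indicator (ball 0 1) y * (norm y)\<^sup>2 \<partial>lborel)"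
      unfolding m_def using int by simp
    have 2: "c * (w * (b ^ n - 1)) = (\<integral>y. c * indicator (ball (0::'a) b) y - c * indicator (ball 0 1) y \<partial>lborel)" for c
      using inti ball_w[of b] ball_w[of 1] b by (simp add: algebra_simps)
    have "1 * (w * (b ^ n - 1)) \<le> m b - m 1" unfolding 1 2
    proof (rule integral_mono)
      fix y :: 'a
      show "1 * indicator (ball 0 b) y - 1 * indicator (ball 0 1) y \<le> indicator (ball 0 b) y * (norm y)\<^sup>2 - indicator (ball 0 1) y * (norm y)\<^sup>2"
        using b by (auto simp: indicator_def one_le_power)
    qed (use int inti in auto)
    moreover have "m b - m 1 \<le> b\<^sup>2 * (w * (b ^ n - 1))" unfolding 1 2
    proof (rule integral_mono)
      fix y :: 'a
      show "indicator (ball 0 b) y * (norm y)\<^sup>2 - indicator (ball 0 1) y * (norm y)\<^sup>2 \<le> b\<^sup>2 * indicator (ball 0 b) y - b\<^sup>2 * indicator (ball 0 1) y"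
        using b by (auto simp: indicator_def intro!: power_mono)
    qed (use int inti in auto)
    ultimately show "w * (b ^ n - 1) \<le> m 1 * (b ^ (n + 2) - 1)" "m 1 * (b ^ (n + 2) - 1) \<le> b\<^sup>2 * (w * (b ^ n - 1))"
      using scale[of b] b by (simp_all add: algebra_simps)
  qed
  \<comment> \<open>\<open>f\<close> and \<open>g\<close> vanish at 1 and are nonnegative to its
    right, and their derivatives at 1 are opposite numbers, hence zero.\<close>
  define f where "f b = m 1 * (b ^ (n + 2) - 1) - w * (b ^ n - 1)" for b
  define g where "g b = b\<^sup>2 * (w * (b ^ n - 1)) - m 1 * (b ^ (n + 2) - 1)" for b
  have df: "(f has_real_derivative (m 1 * real (n + 2) - w * real n)) (at 1)"
    unfolding f_def by (auto intro!: derivative_eq_intros)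
  have dg: "(g has_real_derivative (w * real n - m 1 * real (n + 2))) (at 1)"
    unfolding g_def by (auto intro!: derivative_eq_intros)
  have nonneg: "l \<ge> 0" if h: "(h has_real_derivative l) (at 1)" "h 1 = 0" "\<And>b. b > 1 \<Longrightarrow> h b \<ge> 0" for h :: "real \<Rightarrow> real" and l
  proof (rule ccontr)
    assume "\<not> l \<ge> 0"
    then obtain d where "d > 0" "\<And>e. 0 < e \<Longrightarrow> e < d \<Longrightarrow> h (1 + e) < h 1"
      using DERIV_neg_dec_right[OF h(1)] by auto
    from this(2)[of "d / 2"] this(1) h(3)[of "1 + d / 2"] h(2) show False by simp
  qed
  have "m 1 * real (n + 2) - w * real n \<ge> 0" using nonneg[OF df] lower by (simp add: f_def)
  moreover have "w * real n - m 1 * real (n + 2) \<ge> 0" using nonneg[OF dg] upper by (simp add: g_def)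
  ultimately have "m 1 * (real n + 2) = w * real n" by (simp add: add.commute)
  then have m1: "m 1 = real n / (real n + 2) * w" by (simp add: field_simps)
  have "(\<integral>y. indicator (ball x r) y * (norm (y - x))\<^sup>2 \<partial>lborel) = (\<integral>y. indicator (ball x r) (x + y) * (norm (x + y - x))\<^sup>2 \<partial>lborel)"
  proof -
    have "(\<integral>y. indicator (ball x r) y * (norm (y - x))\<^sup>2 \<partial>lborel) = (\<integral>y. indicator (ball x r) y * (norm (y - x))\<^sup>2 \<partial>distr lborel borel ((+) x))"
      by (simp only: lborel_distr_plus)
    also have "\<dots> = (\<integral>y. indicator (ball x r) (x + y) * (norm (x + y - x))\<^sup>2 \<partial>lborel)"
    proof (rule integral_distr)
      have "integrable lborel (\<lambda>y. indicator (ball x r) y * (norm (y - x))\<^sup>2)"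
        by (rule integrable_indicator_ball_times) (intro continuous_intros)
      from borel_measurable_integrable[OF this]
      show "(\<lambda>y. indicator (ball x r) y * (norm (y - x))\<^sup>2 :: real) \<in> borel_measurable borel" by simp
    qed simp
    finally show ?thesis .
  qed
  also have "(\<lambda>y. indicator (ball x r) (x + y) * (norm (x + y - x))\<^sup>2) = (\<lambda>y. indicator (ball 0 r) y * (norm y)\<^sup>2 :: real)"
    by (auto simp: fun_eq_iff indicator_def dist_norm)
  also have "(\<integral>y. indicator (ball 0 r) y * (norm (y::'a))\<^sup>2 \<partial>lborel) = m r" by (simp add: m_def)
  finally show ?thesis unfolding scale[OF r] m1 by (simp add: n_def w_def)
qed

lemma has_grad_radial:
  fixes F :: "real \<Rightarrow> complex" and z :: "real^'n"
  assumes "(F has_vector_derivative D) (at (z \<bullet> z))"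
  shows "has_grad (\<lambda>z. F (z \<bullet> z)) (\<lambda>j. of_real (2 * z $ j) * D) z"
proof -
  have 1: "((\<lambda>z. z \<bullet> z) has_derivative (\<lambda>h. 2 * (z \<bullet> h))) (at z)"
    by (rule has_derivative_eq_rhs[OF has_derivative_inner[OF has_derivative_ident has_derivative_ident]])
       (simp add: inner_commute)
  have "((\<lambda>z. F (z \<bullet> z)) has_derivative (\<lambda>h. (2 * (z \<bullet> h)) *\<^sub>R D)) (at z)"
    by (rule has_derivative_compose[OF 1 assms[unfolded has_vector_derivative_def]])
  then show ?thesis
  proof (rule has_gradI)
    fix h :: "real^'n"
    have "(2 * (z \<bullet> h)) *\<^sub>R D = (\<Sum>j\<in>UNIV. 2 * (z $ j * h $ j)) *\<^sub>R D"
      by (simp add: inner_vec_def sum_distrib_left)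
    also have "\<dots> = (\<Sum>j\<in>UNIV. (h $ j) *\<^sub>R (of_real (2 * z $ j) * D))"
      unfolding scaleR_sum_left by (rule sum.cong) (simp_all add: scaleR_conv_of_real mult_ac)
    finally show "(2 * (z \<bullet> h)) *\<^sub>R D = (\<Sum>j\<in>UNIV. (h $ j) *\<^sub>R (of_real (2 * z $ j) * D))" .
  qed
qed

definition taylor_ext :: "real \<Rightarrow> (real \<Rightarrow> complex) \<Rightarrow> (real \<Rightarrow> complex) \<Rightarrow> real \<Rightarrow> complex" where
  "taylor_ext e f p s = (if s \<in> {e..} then f s else p s)"

lemma has_vector_derivative_taylor_ext:
  assumes f: "\<And>s. s > 0 \<Longrightarrow> (f has_vector_derivative f' s) (at s)"
    and p: "\<And>s. (p has_vector_derivative p' s) (at s)" and "p e = f e" "p' e = f' e" "e > 0"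
  shows "(taylor_ext e f p has_vector_derivative taylor_ext e f' p' s) (at s)"
proof -
  have "((\<lambda>s. if s \<in> {e..} then f s else p s) has_vector_derivative (if s \<in> {e..} then f' s else p' s)) (at s within UNIV)"
  proof (rule has_vector_derivative_If_within_closures[where T="{..<e}"])
    show "(f has_vector_derivative f' s) (at s within {e..} \<union> closure {e..} \<inter> closure {..<e})" if "s \<in> {e..} \<union> closure {e..} \<inter> closure {..<e}"
      by (rule has_vector_derivative_at_within[OF f]) (use that assms(5) in auto)
    show "(p has_vector_derivative p' s) (at s within {..<e} \<union> closure {e..} \<inter> closure {..<e})"
      by (rule has_vector_derivative_at_within[OF p])
  qed (use assms in \<open>auto simp: not_le\<close>)
  then show ?thesis by (simp add: taylor_ext_def[abs_def])
qed

lemma continuous_on_taylor_ext: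
  assumes f: "continuous_on {0<..} f" and p: "continuous_on UNIV p" and "p e = f e" "e > 0"
  shows "continuous_on UNIV (taylor_ext e f p)"
proof -
  have "continuous_on ({e..} \<union> {..e}) (\<lambda>s. if s \<in> {e..} then f s else p s)"
    using assms
    by (intro continuous_on_cases continuous_on_subset[OF f] continuous_on_subset[OF p]) auto
  moreover have "{e..} \<union> {..e} = UNIV" by auto
  ultimately show ?thesis by (simp add: taylor_ext_def[abs_def])
qed

text \<open>The sum of the entries with i = j is 2 n F' + 4 s F'', the Laplacian in the variable s;
  this is where the equation in \<open>fundamental_radial\<close> comes from.\<close>

lemma has_grad_radial_second:
  fixes F :: "real \<Rightarrow> complex" and z :: "real^'n"
  assumes "(F has_vector_derivative D) (at (z \<bullet> z))"
  shows "has_grad (\<lambda>z. of_real (2 * z $ j) * F (z \<bullet> z))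
     (\<lambda>i. (if i = j then 2 * F (z \<bullet> z) else 0) + of_real (4 * z $ i * z $ j) * D) z"
proof -
  have "bounded_linear (\<lambda>t. complex_of_real (2 * t))"
    by (intro bounded_linear_compose[OF bounded_linear_of_real] bounded_linear_mult_right)
  from has_grad_mult[OF has_grad_linear[OF this has_grad_nth[of j z]] has_grad_radial[OF assms]]
  show ?thesis by (rule has_grad_cong) (auto simp: algebra_simps)
qed

lemma C1c_mult:
  assumes "C1c \<zeta> \<zeta>' K" and f: "\<And>y. has_grad f (\<lambda>j. f' j y) y" "\<And>j. continuous_on UNIV (f' j)"
  shows "C1c (\<lambda>y. \<zeta> y * f y) (\<lambda>j y. \<zeta>' j y * f y + \<zeta> y * f' j y) K"
proof -
  note D = C1cD[OF assms(1)]
  show ?thesis unfolding C1c_def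
    by (intro conjI allI impI D(1) has_grad_mult[OF D(2) f(1)] continuous_intros D(3) D(4) f(2) has_grad_continuous_on[OF f(1)])
       (simp add: D(5))
qed

lemma locally_const_grad_zero:
  assumes "has_grad f g y" "open S" "y \<in> S" "\<And>z. z \<in> S \<Longrightarrow> f z = c"
  shows "g j = 0"
  using has_grad_unique[OF assms(1) has_grad_cong_ev[OF has_grad_const[of c y] assms(2,3)], of j] assms(4) by simp

lemma has_vector_derivative_taylor2:
  "((\<lambda>s. A + of_real (s - e) * B + of_real ((s - e)\<^sup>2 / 2) * D) has_vector_derivative (B + of_real (s - e) * D :: complex)) (at s)"
  "((\<lambda>s. B + of_real (s - e) * D) has_vector_derivative D) (at s)"
proof -
  have q: "((\<lambda>s. (s - e)\<^sup>2 / 2) has_real_derivative (s - e)) (at s)"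
    by (auto intro!: derivative_eq_intros)
  have l: "((\<lambda>s. s - e) has_real_derivative 1) (at s)" by (auto intro!: derivative_eq_intros)
  have lin: "((\<lambda>s. complex_of_real (s - e) * X) has_vector_derivative of_real 1 * X) (at s)" for X
    by (rule has_vector_derivative_mult_left[OF has_vector_derivative_of_real[OF l]])
  have quad: "((\<lambda>s. complex_of_real ((s - e)\<^sup>2 / 2) * D) has_vector_derivative of_real (s - e) * D) (at s)"
    by (rule has_vector_derivative_mult_left[OF has_vector_derivative_of_real[OF q]])
  show "((\<lambda>s. A + of_real (s - e) * B + of_real ((s - e)\<^sup>2 / 2) * D) has_vector_derivative (B + of_real (s - e) * D)) (at s)"
    using has_vector_derivative_add[OF has_vector_derivative_add[OF has_vector_derivative_const lin] quad, of A B] by simp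
  show "((\<lambda>s. B + of_real (s - e) * D) has_vector_derivative D) (at s)"
    using has_vector_derivative_add[OF has_vector_derivative_const lin, of B D] by simp
qed

locale exterior_fundamental = exterior_helmholtz k R0 u G
  for k R0 :: real and u :: "real^'n::finite \<Rightarrow> complex" and G :: "'n \<Rightarrow> real^'n \<Rightarrow> complex" +
  fixes F F' F'' :: "real \<Rightarrow> complex" and c :: complex and C :: real
  assumes fund: "fundamental_radial CARD('n) k F F' F'' c C"
begin

definition \<Phi> :: "real^'n \<Rightarrow> complex" where "\<Phi> z = F (z \<bullet> z)"
definition \<Phi>1 :: "'n \<Rightarrow> real^'n \<Rightarrow> complex" where "\<Phi>1 j z = of_real (2 * z $ j) * F' (z \<bullet> z)"
definition \<Phi>2 :: "'n \<Rightarrow> 'n \<Rightarrow> real^'n \<Rightarrow> complex" where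
  "\<Phi>2 i j z = (if i = j then 2 * F' (z \<bullet> z) else 0) + of_real (4 * z $ i * z $ j) * F'' (z \<bullet> z)"

lemma F_deriv: "s > 0 \<Longrightarrow> (F has_vector_derivative F' s) (at s)" "s > 0 \<Longrightarrow> (F' has_vector_derivative F'' s) (at s)"
  and F''_cont: "s > 0 \<Longrightarrow> isCont F'' s"
  and F_ode: "s > 0 \<Longrightarrow> of_real (4 * s) * F'' s + of_real (2 * real CARD('n)) * F' s + of_real (k\<^sup>2) * F s = 0"
  and c0: "c \<noteq> 0"
  using fund by (auto simp: fundamental_radial_def)

lemma \<Phi>_grad: "z \<noteq> 0 \<Longrightarrow> has_grad \<Phi> (\<lambda>j. \<Phi>1 j z) z"
  unfolding \<Phi>_def[abs_def] \<Phi>1_def by (intro has_grad_radial F_deriv) simp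

lemma \<Phi>1_grad: "z \<noteq> 0 \<Longrightarrow> has_grad (\<Phi>1 j) (\<lambda>i. \<Phi>2 i j z) z"
  unfolding \<Phi>1_def[abs_def] \<Phi>2_def by (intro has_grad_radial_second F_deriv) simp

lemma u_integrable:
  assumes "continuous_on UNIV f" "compact K" "\<And>y. y \<notin> K \<Longrightarrow> f y = 0"
  shows "integrable lebesgue (\<lambda>y. u y * f y)"
proof -
  obtain B where B: "\<And>y. norm (f y) \<le> B" using continuous_compact_support_bounded[OF assms] by blast
  show ?thesis
    by (rule integrable_mult_bounded[OF u_l1[OF assms(2)] u_meas borel_measurable_lebesgue_continuous[OF assms(1)] assms(3) B])
qed

lemma G_integrable:
  assumes "continuous_on UNIV f" "compact K" "\<And>y. y \<notin> K \<Longrightarrow> f y = 0"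
  shows "integrable lebesgue (\<lambda>y. G j y * f y)"
proof -
  obtain B where B: "\<And>y. norm (f y) \<le> B" using continuous_compact_support_bounded[OF assms] by blast
  show ?thesis
    by (rule integrable_mult_bounded[OF G_l1[OF assms(2)] G_meas borel_measurable_lebesgue_continuous[OF assms(1)] assms(3) B])
qed

text \<open>Inside the ball $s < e$ the singular \<open>F\<close> is replaced by its second Taylor polynomial at \<open>e\<close>; the
  resulting error \<open>ge e\<close> in the Helmholtz equation approximates a multiple of the Dirac mass.\<close>

definition Fe where "Fe e = taylor_ext e F (\<lambda>s. F e + of_real (s - e) * F' e + of_real ((s - e)\<^sup>2 / 2) * F'' e)"
definition Fe' where "Fe' e = taylor_ext e F' (\<lambda>s. F' e + of_real (s - e) * F'' e)"
definition Fe'' where "Fe'' e = taylor_ext e F'' (\<lambda>s. F'' e)"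
definition ge where "ge e s = of_real (2 * real CARD('n)) * Fe' e s + of_real (4 * s) * Fe'' e s + of_real (k\<^sup>2) * Fe e s"

lemma Fe_deriv:
  assumes "e > 0"
  shows "(Fe e has_vector_derivative Fe' e s) (at s)" "(Fe' e has_vector_derivative Fe'' e s) (at s)"
  unfolding Fe_def Fe'_def Fe''_def
  by (rule has_vector_derivative_taylor_ext[OF F_deriv(1) has_vector_derivative_taylor2(1)]; use assms in simp)
     (rule has_vector_derivative_taylor_ext[OF F_deriv(2) has_vector_derivative_taylor2(2)]; use assms in simp)

lemma Fe''_cont: "e > 0 \<Longrightarrow> continuous_on UNIV (Fe'' e)"
  unfolding Fe''_def
  by (rule continuous_on_taylor_ext) (auto intro!: continuous_at_imp_continuous_on F''_cont)

lemma Fe_conts: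
  assumes "e > 0" shows "continuous_on UNIV (Fe e)" "continuous_on UNIV (Fe' e)"
  using has_vector_derivative_continuous[OF Fe_deriv(1)[OF assms]] has_vector_derivative_continuous[OF Fe_deriv(2)[OF assms]]
  by (simp_all add: continuous_at_imp_continuous_on)

text \<open>The weak equation is tested with the cut-off times the regularised kernel, the weak
  gradient with the cut-off times each partial derivative of it; together they move both derivatives
  onto the kernel. Apart from \<open>ge\<close>, only the gradient of the cut-off remains, and where
  it is nonzero the kernel is unchanged. So the right side does not depend on
  \<open>e\<close>.\<close>

lemma singular_identity:
  assumes \<zeta>: "C1c \<zeta> \<zeta>' K" and KW: "K \<subseteq> {x. norm x > R0}" and d: "d > 0" "\<And>y. y \<in> ball x d \<Longrightarrow> \<zeta> y = 1"
    and e: "0 < e" "e < d\<^sup>2"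
  shows "(LINT y|lebesgue. u y * (\<zeta> y * ge e ((y - x) \<bullet> (y - x))))
    = (LINT y|lebesgue. (\<Sum>j\<in>UNIV. \<zeta>' j y * (G j y * \<Phi> (y - x) - u y * \<Phi>1 j (y - x))))"
proof -
  note D = C1cD[OF \<zeta>]
  define \<psi> where "\<psi> y = Fe e ((y - x) \<bullet> (y - x))" for y
  define \<psi>1 where "\<psi>1 j y = of_real (2 * (y - x) $ j) * Fe' e ((y - x) \<bullet> (y - x))" for j y
  define \<psi>2 where "\<psi>2 i j y = (if i = j then 2 * Fe' e ((y - x) \<bullet> (y - x)) else 0) + of_real (4 * (y - x) $ i * (y - x) $ j) * Fe'' e ((y - x) \<bullet> (y - x))" for i j y
  have g1: "has_grad \<psi> (\<lambda>j. \<psi>1 j y) y" for y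
    unfolding \<psi>_def[abs_def] \<psi>1_def by (rule has_grad_shift_arg, rule has_grad_radial, rule Fe_deriv(1)[OF e(1)])
  have g2: "has_grad (\<psi>1 j) (\<lambda>i. \<psi>2 i j y) y" for j y
    unfolding \<psi>1_def[abs_def] \<psi>2_def by (rule has_grad_shift_arg, rule has_grad_radial_second, rule Fe_deriv(2)[OF e(1)])
  have c1: "continuous_on UNIV (\<psi>1 j)" for j by (rule has_grad_continuous_on[OF g2])
  have cs: "continuous_on UNIV \<psi>" by (rule has_grad_continuous_on[OF g1])
  have c2: "continuous_on UNIV (\<psi>2 i j)" for i j
  proof -
    have "continuous_on UNIV (\<lambda>y. (y - x) \<bullet> (y - x))" by (intro continuous_intros)
    then have "continuous_on UNIV (\<lambda>y. Fe' e ((y - x) \<bullet> (y - x)))" "continuous_on UNIV (\<lambda>y. Fe'' e ((y - x) \<bullet> (y - x)))"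
      by (auto intro: continuous_on_compose2[OF Fe_conts(2)[OF e(1)]] continuous_on_compose2[OF Fe''_cont[OF e(1)]])
    then show ?thesis unfolding \<psi>2_def[abs_def] by (cases "i = j") (auto intro!: continuous_intros)
  qed
  have A: "(LINT y|lebesgue. u y * (\<zeta>' j y * \<psi>1 j y + \<zeta> y * \<psi>2 j j y)) = - (LINT y|lebesgue. G j y * (\<zeta> y * \<psi>1 j y))" for j
    by (rule weak_grad[OF C1c_mult[OF \<zeta> g2 c2] KW])
  have B: "(LINT y|lebesgue. (\<Sum>j\<in>UNIV. G j y * (\<zeta>' j y * \<psi> y + \<zeta> y * \<psi>1 j y)) - of_real (k\<^sup>2) * u y * (\<zeta> y * \<psi> y)) = 0"
    by (rule weak_eq[OF C1c_mult[OF \<zeta> g1 c1] KW])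
  have iu: "integrable lebesgue (\<lambda>y. u y * f y)" and iG: "integrable lebesgue (\<lambda>y. G j y * f y)"
    if "continuous_on UNIV f" "\<And>y. y \<notin> K \<Longrightarrow> f y = 0" for f j
    using u_integrable[OF that(1) D(1) that(2)] G_integrable[OF that(1) D(1) that(2)] by blast+
  have i1: "integrable lebesgue (\<lambda>y. u y * (\<zeta>' j y * \<psi>1 j y))" "integrable lebesgue (\<lambda>y. u y * (\<zeta> y * \<psi>2 j j y))"
    "integrable lebesgue (\<lambda>y. G j y * (\<zeta> y * \<psi>1 j y))" "integrable lebesgue (\<lambda>y. G j y * (\<zeta>' j y * \<psi> y))"
    "integrable lebesgue (\<lambda>y. u y * (\<zeta> y * \<psi> y))" for j
    by (rule iu iG; use D in \<open>auto intro!: continuous_intros c1 c2 cs\<close>)+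
  define I1 I2 I3 I4 I5 where "I1 j = (LINT y|lebesgue. u y * (\<zeta>' j y * \<psi>1 j y))" and "I2 j = (LINT y|lebesgue. u y * (\<zeta> y * \<psi>2 j j y))"
    and "I3 j = (LINT y|lebesgue. G j y * (\<zeta> y * \<psi>1 j y))" and "I4 j = (LINT y|lebesgue. G j y * (\<zeta>' j y * \<psi> y))"
    and "I5 = (LINT y|lebesgue. u y * (\<zeta> y * \<psi> y))" for j
  have A': "I1 j + I2 j = - I3 j" for j
    using A[of j] i1 by (simp add: I1_def I2_def I3_def distrib_left)
  have B': "(\<Sum>j\<in>UNIV. I4 j + I3 j) - of_real (k\<^sup>2) * I5 = 0"
    using B i1 by (simp add: I3_def I4_def I5_def distrib_left mult.assoc)
  \<comment> \<open>The terms \<open>I3\<close>, in which one derivative sits on u and one on the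
    kernel, are eliminated between the two identities.\<close>
  have "(\<Sum>j\<in>UNIV. I4 j - I1 j) = (\<Sum>j\<in>UNIV. (I4 j + I3 j) + I2 j)"
  proof (rule sum.cong[OF refl])
    fix j
    have "I1 j = - I3 j - I2 j" using A'[of j] by (simp add: algebra_simps)
    then show "I4 j - I1 j = (I4 j + I3 j) + I2 j" by simp
  qed
  also have "\<dots> = (\<Sum>j\<in>UNIV. I4 j + I3 j) + (\<Sum>j\<in>UNIV. I2 j)" by (rule sum.distrib)
  also have "(\<Sum>j\<in>UNIV. I4 j + I3 j) = of_real (k\<^sup>2) * I5" using B' by simp
  finally have E: "(\<Sum>j\<in>UNIV. I4 j - I1 j) = of_real (k\<^sup>2) * I5 + (\<Sum>j\<in>UNIV. I2 j)" .
  have L: "(\<Sum>j\<in>UNIV. \<psi>2 j j y) = of_real (2 * real CARD('n)) * Fe' e ((y - x) \<bullet> (y - x)) + of_real (4 * ((y - x) \<bullet> (y - x))) * Fe'' e ((y - x) \<bullet> (y - x))" for y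
  proof -
    have "(\<Sum>j\<in>UNIV. of_real (4 * v $ j * v $ j)) = complex_of_real (4 * (v \<bullet> v))" for v :: "real^'n"
      unfolding inner_vec_def by (simp add: sum_distrib_left mult.assoc)
    note this[of "y - x"]
    then show ?thesis unfolding \<psi>2_def sum.distrib sum_distrib_right[symmetric] by simp
  qed
  have "(LINT y|lebesgue. u y * (\<zeta> y * ge e ((y - x) \<bullet> (y - x)))) = (LINT y|lebesgue. of_real (k\<^sup>2) * (u y * (\<zeta> y * \<psi> y)) + (\<Sum>j\<in>UNIV. u y * (\<zeta> y * \<psi>2 j j y)))"
  proof (rule Bochner_Integration.integral_cong[OF refl])
    fix y
    have "ge e ((y - x) \<bullet> (y - x)) = (\<Sum>j\<in>UNIV. \<psi>2 j j y) + of_real (k\<^sup>2) * \<psi> y" by (simp only: ge_def L \<psi>_def)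
    then show "u y * (\<zeta> y * ge e ((y - x) \<bullet> (y - x))) = of_real (k\<^sup>2) * (u y * (\<zeta> y * \<psi> y)) + (\<Sum>j\<in>UNIV. u y * (\<zeta> y * \<psi>2 j j y))"
      by (simp only: sum_distrib_left[symmetric]) (simp add: algebra_simps)
  qed
  also have "\<dots> = of_real (k\<^sup>2) * I5 + (\<Sum>j\<in>UNIV. I2 j)"
    using i1 by (simp add: I5_def I2_def)
  also have "\<dots> = (\<Sum>j\<in>UNIV. I4 j - I1 j)" by (rule E[symmetric])
  also have "\<dots> = (LINT y|lebesgue. (\<Sum>j\<in>UNIV. G j y * (\<zeta>' j y * \<psi> y) - u y * (\<zeta>' j y * \<psi>1 j y)))"
    using i1 by (simp add: I4_def I1_def)
  also have "\<dots> = (LINT y|lebesgue. (\<Sum>j\<in>UNIV. \<zeta>' j y * (G j y * \<Phi> (y - x) - u y * \<Phi>1 j (y - x))))"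
  proof (rule Bochner_Integration.integral_cong[OF refl], rule sum.cong[OF refl])
    fix y j
    \<comment> \<open>Either the cut-off is locally constant at y, or y has distance at least d from
      x and lies outside the ball where the kernel was modified.\<close>
    show "G j y * (\<zeta>' j y * \<psi> y) - u y * (\<zeta>' j y * \<psi>1 j y) = \<zeta>' j y * (G j y * \<Phi> (y - x) - u y * \<Phi>1 j (y - x))"
    proof (cases "y \<in> ball x d")
      case True
      have "\<zeta>' j y = 0" by (rule locally_const_grad_zero[OF D(2) open_ball True d(2)])
      then show ?thesis by simp
    next
      case False
      then have "d \<le> norm (y - x)" by (simp add: dist_norm norm_minus_commute)
      then have "d\<^sup>2 \<le> (norm (y - x))\<^sup>2" using d(1) by (intro power_mono) auto
      then have "e \<le> (y - x) \<bullet> (y - x)" using e(2) by (simp add: power2_norm_eq_inner)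
      then have "\<psi> y = \<Phi> (y - x)" "\<psi>1 j y = \<Phi>1 j (y - x)"
        by (simp_all add: \<psi>_def \<psi>1_def \<Phi>_def \<Phi>1_def Fe_def Fe'_def taylor_ext_def)
      then show ?thesis by (simp only: right_diff_distrib mult_ac)
    qed
  qed
  finally show ?thesis .
qed


section \<open>The approximate Dirac mass\<close>

lemma ge_outside: "e > 0 \<Longrightarrow> s \<ge> e \<Longrightarrow> ge e s = 0"
  using F_ode[of s] by (simp add: ge_def Fe_def Fe'_def Fe''_def taylor_ext_def add.commute)

lemma ge_cont: "e > 0 \<Longrightarrow> continuous_on UNIV (ge e)"
  unfolding ge_def[abs_def] by (intro continuous_intros Fe_conts Fe''_cont)

text \<open>The size of the Taylor data at \<open>e\<close>; the factor \<open>e\<close> puts the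
  second derivative on the scale of the first near the singularity.\<close>

definition Me where "Me e = norm (F e) + norm (F' e) + e * norm (F'' e)"

text \<open>The first form separates an affine function of s, which can be integrated exactly over a
  ball, from the zero order term. The two bounds control that term and the whole error.\<close>

lemma ge_inside:
  assumes "0 < e" "e \<le> 1" "0 \<le> s" "s < e"
  shows "ge e s = (of_real (2 * real CARD('n)) * F' e - of_real (2 * real CARD('n) * e) * F'' e + of_real (2 * real CARD('n) + 4) * F'' e * of_real s)
      + of_real (k\<^sup>2) * Fe e s" "norm (Fe e s) \<le> norm (F e) + e * Me e"
    "norm (ge e s) \<le> (2 * real CARD('n) + 4 + k\<^sup>2 * 2) * Me e"
proof -
  have ins: "s \<notin> {e..}" using assms by simp
  have se: "\<bar>s - e\<bar> \<le> e" using assms by (simp add: abs_le_iff)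
  show 1: "ge e s = (of_real (2 * real CARD('n)) * F' e - of_real (2 * real CARD('n) * e) * F'' e + of_real (2 * real CARD('n) + 4) * F'' e * of_real s)
      + of_real (k\<^sup>2) * Fe e s"
    unfolding ge_def Fe'_def Fe''_def taylor_ext_def using ins by (simp add: algebra_simps)
  have t1: "norm (of_real (s - e) * F' e) \<le> e * norm (F' e)"
    unfolding norm_mult norm_of_real by (intro mult_right_mono se) auto
  have "(s - e)\<^sup>2 \<le> e\<^sup>2" using se by (metis abs_le_square_iff abs_of_pos assms(1))
  then have "(s - e)\<^sup>2 / 2 \<le> e\<^sup>2" using zero_le_power2[of e] by linarith
  then have "\<bar>(s - e)\<^sup>2 / 2\<bar> \<le> e * e" by (simp add: power2_eq_square)
  then have t2: "norm (of_real ((s - e)\<^sup>2 / 2) * F'' e) \<le> e * (e * norm (F'' e))"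
    unfolding norm_mult norm_of_real mult.assoc[symmetric] by (intro mult_right_mono) auto
  have "Fe e s = F e + of_real (s - e) * F' e + of_real ((s - e)\<^sup>2 / 2) * F'' e"
    unfolding Fe_def taylor_ext_def using ins by simp
  then have "norm (Fe e s) = norm (F e + of_real (s - e) * F' e + of_real ((s - e)\<^sup>2 / 2) * F'' e)" by (rule arg_cong)
  then have "norm (Fe e s) \<le> norm (F e) + norm (of_real (s - e) * F' e) + norm (of_real ((s - e)\<^sup>2 / 2) * F'' e)"
    using norm_triangle_ineq[of "F e + of_real (s - e) * F' e" "of_real ((s - e)\<^sup>2 / 2) * F'' e"] norm_triangle_ineq[of "F e" "of_real (s - e) * F' e"] by linarith
  then have "norm (Fe e s) \<le> norm (F e) + (e * norm (F' e) + e * (e * norm (F'' e)))" using t1 t2 by linarith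
  also have "e * norm (F' e) + e * (e * norm (F'' e)) \<le> e * Me e"
    using assms(1) by (simp add: Me_def flip: distrib_left)
  finally show 2: "norm (Fe e s) \<le> norm (F e) + e * Me e" by simp
  have Me0: "Me e \<ge> 0" using assms(1) by (simp add: Me_def)
  then have "e * Me e \<le> Me e" using assms(2) by (simp add: mult_left_le_one_le assms(1) less_imp_le)
  moreover have "norm (F e) \<le> Me e" using assms(1) by (simp add: Me_def)
  ultimately have 3: "norm (Fe e s) \<le> 2 * Me e" using 2 by linarith
  have p: "norm (of_real (2 * real CARD('n)) * (F' e + of_real (s - e) * F'' e)) \<le> 2 * real CARD('n) * Me e"
  proof -
    have "norm (of_real (s - e) * F'' e) \<le> e * norm (F'' e)" unfolding norm_mult norm_of_real by (intro mult_right_mono se) auto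
    then have "norm (F' e + of_real (s - e) * F'' e) \<le> Me e"
      using norm_triangle_ineq[of "F' e" "of_real (s - e) * F'' e"] norm_ge_zero[of "F e"] unfolding Me_def by linarith
    then have "2 * real CARD('n) * norm (F' e + of_real (s - e) * F'' e) \<le> 2 * real CARD('n) * Me e" by (intro mult_left_mono) auto
    then show ?thesis unfolding norm_mult norm_of_real by simp
  qed
  have q: "norm (of_real (4 * s) * F'' e) \<le> 4 * Me e"
  proof -
    have "norm (of_real (4 * s) * F'' e) \<le> (4 * e) * norm (F'' e)"
      unfolding norm_mult norm_of_real using assms by (intro mult_right_mono) auto
    also have "\<dots> \<le> 4 * Me e" by (simp add: Me_def)
    finally show ?thesis .
  qed
  have r: "norm (of_real (k\<^sup>2) * Fe e s) \<le> k\<^sup>2 * (2 * Me e)"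
    unfolding norm_mult norm_of_real abs_of_nonneg[OF zero_le_power2] by (rule mult_left_mono[OF 3]) simp
  have "ge e s = of_real (2 * real CARD('n)) * (F' e + of_real (s - e) * F'' e) + of_real (4 * s) * F'' e + of_real (k\<^sup>2) * Fe e s"
    unfolding ge_def Fe'_def Fe''_def taylor_ext_def using ins by simp
  then have "norm (ge e s) = norm (of_real (2 * real CARD('n)) * (F' e + of_real (s - e) * F'' e) + of_real (4 * s) * F'' e + of_real (k\<^sup>2) * Fe e s)"
    by (rule arg_cong)
  then have "norm (ge e s) \<le> 2 * real CARD('n) * Me e + 4 * Me e + k\<^sup>2 * (2 * Me e)"
    using norm_triangle_ineq[of "of_real (2 * real CARD('n)) * (F' e + of_real (s - e) * F'' e) + of_real (4 * s) * F'' e" "of_real (k\<^sup>2) * Fe e s"]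
      norm_triangle_ineq[of "of_real (2 * real CARD('n)) * (F' e + of_real (s - e) * F'' e)" "of_real (4 * s) * F'' e"] p q r by linarith
  then show "norm (ge e s) \<le> (2 * real CARD('n) + 4 + k\<^sup>2 * 2) * Me e" by (simp add: algebra_simps)
qed

definition omega :: real where "omega = measure lborel (ball (0::real^'n) 1)"

lemma omega_pos: "omega > 0"
  unfolding omega_def by (simp add: content_ball)

text \<open>The behaviour at 0 is prescribed for F and F' only; the second derivative is controlled
  through the differential equation, which expresses 4 e F'' by F' and F.\<close>

lemma Me_bounded: "\<exists>M. \<forall>\<^sub>F e in at_right 0. sqrt e ^ CARD('n) * Me e \<le> M"
proof -
  have l: "((\<lambda>s. of_real (sqrt s ^ CARD('n)) * F' s) \<longlongrightarrow> c) (at_right 0)" "((\<lambda>s. of_real (sqrt s ^ CARD('n)) * F s) \<longlongrightarrow> 0) (at_right 0)"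
    using fund by (auto simp: fundamental_radial_def)
  have "\<forall>\<^sub>F e in at_right 0. norm (of_real (sqrt e ^ CARD('n)) * F' e) < norm c + 1"
    using tendsto_norm[OF l(1)] by (rule order_tendstoD(2)) simp
  moreover have "\<forall>\<^sub>F e in at_right 0. norm (of_real (sqrt e ^ CARD('n)) * F e) < 1"
    using tendsto_norm[OF l(2)] by (rule order_tendstoD(2)) simp
  moreover note eventually_at_right_less[of "0::real"]
  ultimately have "\<forall>\<^sub>F e in at_right 0. sqrt e ^ CARD('n) * Me e \<le> 1 + (norm c + 1) + (2 * real CARD('n) * (norm c + 1) + k\<^sup>2) / 4"
  proof eventually_elim
    case (elim e)
    define p where "p = sqrt e ^ CARD('n)"
    have p: "p \<ge> 0" using elim by (simp add: p_def)
    have a: "p * norm (F' e) \<le> norm c + 1" "p * norm (F e) \<le> 1"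
      using elim(1,2) p unfolding p_def[symmetric] norm_mult norm_of_real by (simp_all add: less_imp_le)
    have "of_real (4 * e) * F'' e = - (of_real (2 * real CARD('n)) * F' e + of_real (k\<^sup>2) * F e)"
      using F_ode[OF elim(3)] by (simp only: eq_neg_iff_add_eq_0 add.assoc[symmetric])
    then have "norm (of_real (4 * e) * F'' e) = norm (of_real (2 * real CARD('n)) * F' e + of_real (k\<^sup>2) * F e)" by (simp only: norm_minus_cancel)
    also have "\<dots> \<le> norm (of_real (2 * real CARD('n)) * F' e) + norm (of_real (k\<^sup>2) * F e)" by (rule norm_triangle_ineq)
    finally have "4 * (e * norm (F'' e)) \<le> 2 * real CARD('n) * norm (F' e) + k\<^sup>2 * norm (F e)"
      unfolding norm_mult norm_of_real using elim(3) by simp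
    then have "p * (4 * (e * norm (F'' e))) \<le> p * (2 * real CARD('n) * norm (F' e) + k\<^sup>2 * norm (F e))"
      using p by (rule mult_left_mono)
    also have "\<dots> = 2 * real CARD('n) * (p * norm (F' e)) + k\<^sup>2 * (p * norm (F e))" by (simp add: algebra_simps)
    also have "\<dots> \<le> 2 * real CARD('n) * (norm c + 1) + k\<^sup>2 * 1"
      by (intro add_mono mult_left_mono a) auto
    finally have "p * (e * norm (F'' e)) \<le> (2 * real CARD('n) * (norm c + 1) + k\<^sup>2) / 4" by simp
    then show ?case using a unfolding p_def[symmetric] Me_def distrib_left by linarith
  qed
  then show ?thesis by blast
qed


text \<open>By the second moment of the ball the contribution of s F'' cancels that of e F''
  exactly, since (2n+4) n/(n+2) = 2n. There remains 2 n \<omega> e^(n/2) F'(e), with \<omega> the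
  volume of the unit ball, and the zero order term tends to 0.\<close>

lemma ge_integral_tendsto:
  fixes x :: "real^'n"
  shows "((\<lambda>e. LINT y|lborel. indicator (ball x (sqrt e)) y *\<^sub>R ge e ((y - x) \<bullet> (y - x)))
    \<longlongrightarrow> of_real (2 * real CARD('n) * omega) * c) (at_right 0)" (is "(?I \<longlongrightarrow> ?L) _")
proof -
  define N where "N = real CARD('n)"
  have N: "N > 0" by (simp add: N_def)
  have l: "((\<lambda>s. of_real (sqrt s ^ CARD('n)) * F' s) \<longlongrightarrow> c) (at_right 0)"
    using fund by (auto simp: fundamental_radial_def)
  obtain M where M: "\<forall>\<^sub>F e in at_right 0. sqrt e ^ CARD('n) * Me e \<le> M" using Me_bounded by blast
  define A where "A e = (LINT y|lborel. indicator (ball x (sqrt e)) y *\<^sub>R Fe e ((y - x) \<bullet> (y - x)))" for e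
  have main: "?I e = of_real (2 * N * omega) * (of_real (sqrt e ^ CARD('n)) * F' e) + of_real (k\<^sup>2) * A e"
    and Ab: "norm (A e) \<le> omega * (sqrt e ^ CARD('n)) * (norm (F e) + e * Me e)" if e: "0 < e" "e \<le> 1" for e
  proof -
    define B where "B = ball x (sqrt e)"
    have s: "0 \<le> (y - x) \<bullet> (y - x)" "(y - x) \<bullet> (y - x) < e" if "y \<in> B" for y
    proof -
      have "(norm (y - x))\<^sup>2 < (sqrt e)\<^sup>2" using that e by (intro power_strict_mono) (auto simp: B_def dist_norm norm_minus_commute)
      then show "0 \<le> (y - x) \<bullet> (y - x)" "(y - x) \<bullet> (y - x) < e" using e by (simp_all add: power2_norm_eq_inner)
    qed
    have fB: "emeasure lborel B < \<infinity>" unfolding B_def by (rule emeasure_bounded_finite) simp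
    have mB: "measure lborel B = omega * sqrt e ^ CARD('n)"
      unfolding B_def omega_def using e by (subst measure_lborel_ball) auto
    have iB: "integrable lborel (\<lambda>y. indicator B y *\<^sub>R (a::complex))" for a
      by (intro integrable_scaleR_left integrable_real_indicator) (use fB in \<open>auto simp: B_def\<close>)
    have IB: "(LINT y|lborel. indicator B y *\<^sub>R (a::complex)) = of_real (omega * sqrt e ^ CARD('n)) * a" for a
      using fB mB by (simp add: B_def scaleR_conv_of_real)
    have iS: "integrable lborel (\<lambda>y. indicator B y * (norm (y - x))\<^sup>2)"
      unfolding B_def by (rule integrable_indicator_ball_times) (intro continuous_intros)
    have IS: "(LINT y|lborel. indicator B y * (norm (y - x))\<^sup>2) = N / (N + 2) * (sqrt e ^ CARD('n) * e) * omega"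
      unfolding B_def omega_def N_def using e by (subst ball_second_moment) (auto simp: power_add)
    have cFe: "continuous_on UNIV (\<lambda>y. Fe e ((y - x) \<bullet> (y - x)))"
      by (rule continuous_on_compose2[OF Fe_conts(1)[OF e(1)]]) (auto intro!: continuous_intros)
    have iFe: "integrable lborel (\<lambda>y. indicator B y *\<^sub>R Fe e ((y - x) \<bullet> (y - x)))"
    proof (rule Bochner_Integration.integrable_bound[OF iB[of "of_real (norm (F e) + e * Me e)"]])
      show "(\<lambda>y. indicator B y *\<^sub>R Fe e ((y - x) \<bullet> (y - x))) \<in> borel_measurable lborel"
        unfolding B_def measurable_lborel1 using borel_measurable_continuous_onI[OF cFe]
        by (intro borel_measurable_scaleR borel_measurable_indicator) simp_all
      show "AE y in lborel. norm (indicator B y *\<^sub>R Fe e ((y - x) \<bullet> (y - x))) \<le> norm (indicator B y *\<^sub>R complex_of_real (norm (F e) + e * Me e))"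
        using ge_inside(2)[OF e s] by (intro AE_I2) (auto simp: indicator_def simp del: of_real_add intro: order_trans[OF _ abs_ge_self])
    qed
    have "?I e = (LINT y|lborel. (indicator B y *\<^sub>R (of_real (2 * N) * F' e - of_real (2 * N * e) * F'' e) +
         (of_real (2 * N + 4) * F'' e) * of_real (indicator B y * (norm (y - x))\<^sup>2)) + of_real (k\<^sup>2) * (indicator B y *\<^sub>R Fe e ((y - x) \<bullet> (y - x))))"
    proof (rule Bochner_Integration.integral_cong[OF refl])
      fix y
      show "indicator (ball x (sqrt e)) y *\<^sub>R ge e ((y - x) \<bullet> (y - x)) = (indicator B y *\<^sub>R (of_real (2 * N) * F' e - of_real (2 * N * e) * F'' e) +
         (of_real (2 * N + 4) * F'' e) * of_real (indicator B y * (norm (y - x))\<^sup>2)) + of_real (k\<^sup>2) * (indicator B y *\<^sub>R Fe e ((y - x) \<bullet> (y - x)))"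
      proof (cases "y \<in> B")
        case True
        show ?thesis using True unfolding B_def[symmetric] ge_inside(1)[OF e s[OF True]] N_def by (simp add: power2_norm_eq_inner)
      qed (simp add: B_def)
    qed
    also have "\<dots> = of_real (omega * sqrt e ^ CARD('n)) * (of_real (2 * N) * F' e - of_real (2 * N * e) * F'' e) +
         (of_real (2 * N + 4) * F'' e) * of_real (N / (N + 2) * (sqrt e ^ CARD('n) * e) * omega) + of_real (k\<^sup>2) * A e"
    proof -
      have 1: "integrable lborel (\<lambda>y. (of_real (2 * N + 4) * F'' e) * of_real (indicator B y * (norm (y - x))\<^sup>2))"
        by (intro integrable_mult_right integrable_of_real iS)
      have 2: "(LINT y|lborel. (of_real (2 * N + 4) * F'' e) * of_real (indicator B y * (norm (y - x))\<^sup>2)) = (of_real (2 * N + 4) * F'' e) * of_real (N / (N + 2) * (sqrt e ^ CARD('n) * e) * omega)"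
        by (simp only: integral_mult_right_zero integral_complex_of_real IS)
      have 3: "(LINT y|lborel. of_real (k\<^sup>2) * (indicator B y *\<^sub>R Fe e ((y - x) \<bullet> (y - x)))) = of_real (k\<^sup>2) * A e"
        unfolding A_def B_def by (rule integral_mult_right_zero)
      show ?thesis
        by (subst Bochner_Integration.integral_add[OF Bochner_Integration.integrable_add[OF iB 1] integrable_mult_right[OF iFe]],
            subst Bochner_Integration.integral_add[OF iB 1]) (simp only: 2 3 IB)
    qed
    also have "(of_real (2 * N + 4) * F'' e) * of_real (N / (N + 2) * (sqrt e ^ CARD('n) * e) * omega) = of_real (omega * sqrt e ^ CARD('n)) * (of_real (2 * N * e) * F'' e)"
    proof -
      have "(2 * N + 4) * (N / (N + 2) * (sqrt e ^ CARD('n) * e) * omega) = (omega * sqrt e ^ CARD('n)) * (2 * N * e)"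
        using N by (simp add: field_simps)
      then have "of_real ((2 * N + 4) * (N / (N + 2) * (sqrt e ^ CARD('n) * e) * omega)) * F'' e = of_real ((omega * sqrt e ^ CARD('n)) * (2 * N * e)) * F'' e" by (rule arg_cong)
      then show ?thesis by (simp only: of_real_mult mult_ac)
    qed
    finally show "?I e = of_real (2 * N * omega) * (of_real (sqrt e ^ CARD('n)) * F' e) + of_real (k\<^sup>2) * A e"
      by (simp add: algebra_simps)
    have "norm (A e) \<le> (LINT y|lborel. indicator B y *\<^sub>R (norm (F e) + e * Me e))" unfolding A_def B_def[symmetric]
    proof (rule Bochner_Integration.integral_norm_bound_integral[OF iFe])
      show "integrable lborel (\<lambda>y. indicator B y *\<^sub>R (norm (F e) + e * Me e))"
        by (intro integrable_scaleR_left integrable_real_indicator) (use fB in \<open>auto simp: B_def\<close>)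
      show "norm (indicator B y *\<^sub>R Fe e ((y - x) \<bullet> (y - x))) \<le> indicator B y *\<^sub>R (norm (F e) + e * Me e)" for y
        using ge_inside(2)[OF e s] by (auto simp: indicator_def)
    qed
    also have "\<dots> = omega * (sqrt e ^ CARD('n)) * (norm (F e) + e * Me e)" using fB mB by (simp add: B_def)
    finally show "norm (A e) \<le> omega * (sqrt e ^ CARD('n)) * (norm (F e) + e * Me e)" .
  qed
  have small: "\<forall>\<^sub>F e in at_right 0. 0 < e \<and> e \<le> (1::real)"
    by (rule eventually_mono[OF eventually_at_right_real[of 0 1]]) auto
  have l0: "((\<lambda>s. of_real (sqrt s ^ CARD('n)) * F s) \<longlongrightarrow> 0) (at_right 0)"
    using fund by (auto simp: fundamental_radial_def)
  have "(A \<longlongrightarrow> 0) (at_right 0)"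
  proof (rule tendsto_norm_zero_cancel, rule tendsto_sandwich[OF _ _ tendsto_const])
    show "\<forall>\<^sub>F e in at_right 0. norm (A e) \<le> omega * (norm (of_real (sqrt e ^ CARD('n)) * F e) + e * M)"
      using small M
    proof eventually_elim
      case (elim e)
      have "norm (A e) \<le> omega * (sqrt e ^ CARD('n)) * (norm (F e) + e * Me e)" by (rule Ab) (use elim in auto)
      also have "\<dots> = omega * (sqrt e ^ CARD('n) * norm (F e) + e * (sqrt e ^ CARD('n) * Me e))" by (simp add: algebra_simps)
      also have "\<dots> \<le> omega * (sqrt e ^ CARD('n) * norm (F e) + e * M)"
        using elim omega_pos by (intro mult_left_mono add_left_mono) auto
      finally show ?case using elim by (simp add: norm_mult norm_power)
    qed
    have "((\<lambda>e. omega * (norm (of_real (sqrt e ^ CARD('n)) * F e) + e * M)) \<longlongrightarrow> omega * (norm (0::complex) + 0 * M)) (at_right 0)"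
      by (intro tendsto_intros l0)
    then show "((\<lambda>e. omega * (norm (of_real (sqrt e ^ CARD('n)) * F e) + e * M)) \<longlongrightarrow> 0) (at_right 0)" by simp
  qed simp
  then have "((\<lambda>e. of_real (2 * N * omega) * (of_real (sqrt e ^ CARD('n)) * F' e) + of_real (k\<^sup>2) * A e) \<longlongrightarrow> of_real (2 * N * omega) * c + of_real (k\<^sup>2) * 0) (at_right 0)"
    by (intro tendsto_intros l)
  then have "((\<lambda>e. of_real (2 * N * omega) * (of_real (sqrt e ^ CARD('n)) * F' e) + of_real (k\<^sup>2) * A e) \<longlongrightarrow> ?L) (at_right 0)"
    by (simp add: N_def)
  moreover have "\<forall>\<^sub>F e in at_right 0. of_real (2 * N * omega) * (of_real (sqrt e ^ CARD('n)) * F' e) + of_real (k\<^sup>2) * A e = ?I e"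
    using small by (rule eventually_mono) (rule main[symmetric], auto)
  ultimately show ?thesis by (rule Lim_transform_eventually)
qed

text \<open>The left side of \<open>singular_identity\<close> tends to u(x) times the mass of
  \<open>ge\<close> by continuity of u, while its right side is constant in \<open>e\<close>. The
  bound on \<open>ge\<close> times the volume of its ball stays bounded, so an oscillation \<eta> of
  u costs only a multiple of \<eta>.\<close>

lemma representation:
  assumes \<zeta>: "C1c \<zeta> \<zeta>' K" and KW: "K \<subseteq> {x. norm x > R0}" and d: "d > 0" "\<And>y. y \<in> ball x d \<Longrightarrow> \<zeta> y = 1"
    and x: "norm x > R0"
  shows "of_real (2 * real CARD('n) * omega) * c * u x
    = (LINT y|lebesgue. (\<Sum>j\<in>UNIV. \<zeta>' j y * (G j y * \<Phi> (y - x) - u y * \<Phi>1 j (y - x))))" (is "_ = ?R")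
proof -
  note D = C1cD[OF \<zeta>]
  define I where "I e = (LINT y|lborel. indicator (ball x (sqrt e)) y *\<^sub>R ge e ((y - x) \<bullet> (y - x)))" for e
  obtain M where M: "\<forall>\<^sub>F e in at_right 0. sqrt e ^ CARD('n) * Me e \<le> M" using Me_bounded by blast
  define Q where "Q = 2 * real CARD('n) + 4 + k\<^sup>2 * 2"
  have Q: "Q > 0" by (simp add: Q_def add_pos_nonneg)
  have est: "norm (?R - u x * I e) \<le> \<eta> * (Q * omega * (sqrt e ^ CARD('n) * Me e))"
    if e: "0 < e" "e \<le> 1" "e < d\<^sup>2" and \<eta>: "\<And>y. y \<in> ball x (sqrt e) \<Longrightarrow> norm (u y - u x) \<le> \<eta>" for e \<eta>
  proof -
    define B where "B = ball x (sqrt e)"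
    define g where "g y = ge e ((y - x) \<bullet> (y - x))" for y
    have s: "(y - x) \<bullet> (y - x) < e \<longleftrightarrow> y \<in> B" for y
    proof -
      have "y \<in> B \<longleftrightarrow> norm (y - x) < sqrt e" by (simp add: B_def dist_norm norm_minus_commute)
      also have "\<dots> \<longleftrightarrow> (norm (y - x))\<^sup>2 < e" by (metis norm_ge_zero real_sqrt_abs abs_norm_cancel real_sqrt_less_iff)
      finally show ?thesis by (simp add: power2_norm_eq_inner)
    qed
    have cg: "continuous_on UNIV g" unfolding g_def[abs_def]
      by (rule continuous_on_compose2[OF ge_cont[OF e(1)]]) (auto intro!: continuous_intros)
    have gb: "norm (g y) \<le> Q * Me e" if "y \<in> B" for y
      unfolding g_def Q_def by (rule ge_inside(3)[OF e(1,2)]) (use that s in auto)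
    have g0: "g y = 0" if "y \<notin> B" for y unfolding g_def by (rule ge_outside[OF e(1)]) (use that s[of y] in auto)
    have B1: "\<zeta> y = 1" if "y \<in> B" for y
    proof (rule d(2))
      have "sqrt e < d" using e(3) d(1) by (metis real_sqrt_less_iff real_sqrt_abs abs_of_pos)
      then show "y \<in> ball x d" using that by (simp add: B_def)
    qed
    have bor: "(\<lambda>y. indicator B y *\<^sub>R g y) \<in> borel_measurable lborel"
      unfolding B_def measurable_lborel1 using borel_measurable_continuous_onI[OF cg]
      by (intro borel_measurable_scaleR borel_measurable_indicator) simp_all
    have fB: "emeasure lborel B < \<infinity>" unfolding B_def by (rule emeasure_bounded_finite) simp
    have mB: "measure lborel B = omega * sqrt e ^ CARD('n)"
      unfolding B_def omega_def using e by (subst measure_lborel_ball) auto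
    have iBr: "integrable lborel (\<lambda>y. indicator B y *\<^sub>R (a::real))" for a
      by (intro integrable_scaleR_left integrable_real_indicator) (use fB in \<open>auto simp: B_def\<close>)
    have ig: "integrable lborel (\<lambda>y. indicator B y *\<^sub>R g y)"
      by (rule Bochner_Integration.integrable_bound[OF iBr[of "Q * Me e"] bor])
         (auto simp: indicator_def gb intro!: AE_I2 order_trans[OF gb abs_ge_self])
    have igl: "integrable lebesgue (\<lambda>y. indicator B y *\<^sub>R g y)"
      using ig bor by (simp add: integrable_completion)
    have Il: "I e = (LINT y|lebesgue. indicator B y *\<^sub>R g y)"
      unfolding I_def B_def[symmetric] g_def[symmetric] by (rule integral_completion[symmetric, OF bor])
    have iu: "integrable lebesgue (\<lambda>y. u y * (\<zeta> y * g y))"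
      by (rule u_integrable[OF _ D(1)]) (auto intro!: continuous_intros D(4) cg simp: D(5))
    have iux: "integrable lebesgue (\<lambda>y. u x * (indicator B y *\<^sub>R g y))" by (intro integrable_mult_right igl)
    have R: "?R = (LINT y|lebesgue. u y * (\<zeta> y * g y))"
      unfolding g_def by (rule singular_identity[OF \<zeta> KW d e(1,3), symmetric])
    have "?R - u x * I e = (LINT y|lebesgue. u y * (\<zeta> y * g y) - u x * (indicator B y *\<^sub>R g y))"
      unfolding R Il by (simp only: Bochner_Integration.integral_diff[OF iu iux] integral_mult_right_zero)
    also have "norm \<dots> \<le> (LINT y|lebesgue. indicator B y *\<^sub>R (\<eta> * (Q * Me e)))"
    proof (rule Bochner_Integration.integral_norm_bound_integral)
      show "integrable lebesgue (\<lambda>y. u y * (\<zeta> y * g y) - u x * (indicator B y *\<^sub>R g y))" using iu iux by simp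
      show "integrable lebesgue (\<lambda>y. indicator B y *\<^sub>R (\<eta> * (Q * Me e)))"
        using iBr[of "\<eta> * (Q * Me e)"] integrable_completion[OF borel_measurable_integrable[OF iBr[of "\<eta> * (Q * Me e)"]]] by blast
      show "norm (u y * (\<zeta> y * g y) - u x * (indicator B y *\<^sub>R g y)) \<le> indicator B y *\<^sub>R (\<eta> * (Q * Me e))" for y
      proof (cases "y \<in> B")
        case True
        have "norm (u y * (\<zeta> y * g y) - u x * (indicator B y *\<^sub>R g y)) = norm (u y - u x) * norm (g y)"
          using True by (simp add: B1 norm_mult left_diff_distrib[symmetric])
        also have "\<dots> \<le> \<eta> * (Q * Me e)"
          using True by (intro mult_mono \<eta> gb) (auto simp: B_def intro: order_trans[OF norm_ge_zero \<eta>])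
        finally show ?thesis using True by simp
      qed (simp add: g0)
    qed
    also have "\<dots> = (LINT y|lborel. indicator B y *\<^sub>R (\<eta> * (Q * Me e)))" by (rule integral_completion[OF borel_measurable_integrable[OF iBr]])
    also have "\<dots> = \<eta> * (Q * omega * (sqrt e ^ CARD('n) * Me e))" using fB mB by (simp add: B_def)
    finally show ?thesis .
  qed
  have "((\<lambda>e. ?R - u x * I e) \<longlongrightarrow> 0) (at_right 0)"
  proof (rule tendstoI)
    fix \<epsilon> :: real assume \<epsilon>: "\<epsilon> > 0"
    \<comment> \<open>The admissible oscillation of u is matched to the bound of the total mass so
      that \<epsilon>/2 results; the added 1 guards against M = 0.\<close>
    define \<eta> where "\<eta> = \<epsilon> / (2 * (Q * omega * (\<bar>M\<bar> + 1)))"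
    have Qo: "Q * omega * (\<bar>M\<bar> + 1) > 0" using Q omega_pos by (simp add: add_nonneg_pos)
    have \<eta>: "\<eta> > 0" unfolding \<eta>_def using \<epsilon> Qo by simp
    have "open {x::real^'n. norm x > R0}" by (intro open_Collect_less continuous_intros)
    then have "isCont u x" using u_cont x by (simp add: continuous_on_eq_continuous_at)
    then obtain r where r: "r > 0" "\<And>y. dist y x < r \<Longrightarrow> dist (u y) (u x) < \<eta>"
      using \<eta> unfolding continuous_at by (metis LIM_def dist_self)
    have "\<forall>\<^sub>F e in at_right 0. e < min 1 (min (d\<^sup>2) (r\<^sup>2))"
      using d(1) r(1) by (intro eventually_at_rightI[of 0 "min 1 (min (d\<^sup>2) (r\<^sup>2))"]) auto
    then show "\<forall>\<^sub>F e in at_right 0. dist (?R - u x * I e) 0 < \<epsilon>"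
      using M eventually_at_right_less[of "0::real"]
    proof eventually_elim
      case (elim e)
      have sr: "sqrt e < r" using elim r(1) by (metis abs_of_pos min_less_iff_conj real_sqrt_abs real_sqrt_less_iff)
      have "norm (?R - u x * I e) \<le> \<eta> * (Q * omega * (sqrt e ^ CARD('n) * Me e))"
      proof (rule est)
        show "norm (u y - u x) \<le> \<eta>" if "y \<in> ball x (sqrt e)" for y
          using r(2)[of y] that sr by (auto simp: dist_norm norm_minus_commute)
      qed (use elim in auto)
      also have "\<dots> \<le> \<eta> * (Q * omega * (\<bar>M\<bar> + 1))"
        using \<eta> Q omega_pos elim by (intro mult_left_mono) auto
      also have "\<dots> = \<epsilon> / 2" unfolding \<eta>_def using Qo by (simp add: field_simps)
      also have "\<dots> < \<epsilon>" using \<epsilon> by simp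
      finally show ?case by simp
    qed
  qed
  moreover have "((\<lambda>e. ?R - u x * I e) \<longlongrightarrow> ?R - u x * (of_real (2 * real CARD('n) * omega) * c)) (at_right 0)"
    unfolding I_def by (intro tendsto_intros ge_integral_tendsto)
  ultimately have "?R - u x * (of_real (2 * real CARD('n) * omega) * c) = 0"
    by (rule tendsto_unique[OF trivial_limit_at_right_real, symmetric])
  then show ?thesis by (simp add: mult_ac)
qed


end

section \<open>Potentials\<close>

definition possq :: "real \<Rightarrow> real" where "possq t = (max 0 t)\<^sup>2"

lemma possq_deriv: "(possq has_real_derivative 2 * max 0 t) (at t)"
proof -
  consider "t > 0" | "t < 0" | "t = 0" by linarith
  then show ?thesis
  proof cases
    case 1
    have "((\<lambda>t. t\<^sup>2) has_real_derivative 2 * max 0 t) (at t)" using 1 by (auto intro!: derivative_eq_intros)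
    then show ?thesis
      by (rule has_field_derivative_transform_within_open[of _ _ _ "{0<..}"]) (use 1 in \<open>auto simp: possq_def\<close>)
  next
    case 2
    have "((\<lambda>t. 0) has_real_derivative 2 * max 0 t) (at t)" using 2 by (auto intro!: derivative_eq_intros)
    then show ?thesis
      by (rule has_field_derivative_transform_within_open[of _ _ _ "{..<0}"]) (use 2 in \<open>auto simp: possq_def\<close>)
  next
    case 3
    have "((\<lambda>h::real. max 0 h) \<longlongrightarrow> max 0 0) (at 0)" by (intro tendsto_intros)
    then have "((\<lambda>h::real. max 0 h) \<longlongrightarrow> 0) (at 0)" by simp
    moreover have "\<forall>\<^sub>F h in at 0. max 0 h = (possq (0 + h) - possq 0) / h"
      unfolding eventually_at_filter by (rule always_eventually) (auto simp: possq_def power2_eq_square max_def)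
    ultimately have "((\<lambda>h. (possq (0 + h) - possq 0) / h) \<longlongrightarrow> 0) (at 0)" by (rule Lim_transform_eventually)
    then show ?thesis using 3 by (simp add: DERIV_def)
  qed
qed

text \<open>One continuous derivative is enough for every cut-off below, because
  \<open>exterior_helmholtz\<close> admits C1 test functions.\<close>

definition C1_step :: "(real \<Rightarrow> real) \<Rightarrow> (real \<Rightarrow> real) \<Rightarrow> real \<Rightarrow> bool" where
  "C1_step st st' M \<longleftrightarrow> (\<forall>t. (st has_real_derivative st' t) (at t)) \<and> continuous_on UNIV st' \<and>
     (\<forall>t\<le>0. st t = 0 \<and> st' t = 0) \<and> (\<forall>t\<ge>1. st t = 1 \<and> st' t = 0) \<and> (\<forall>t. 0 \<le> st' t \<and> st' t \<le> M)"

lemma C1_stepD: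
  assumes "C1_step st st' M"
  shows "(st has_real_derivative st' t) (at t)" "continuous_on UNIV st'" "continuous_on UNIV st"
    "t \<le> 0 \<Longrightarrow> st t = 0" "t \<ge> 1 \<Longrightarrow> st t = 1" "0 \<le> st' t" "st' t \<le> M" "t \<le> 0 \<Longrightarrow> st' t = 0" "t \<ge> 1 \<Longrightarrow> st' t = 0"
    "0 \<le> st t" "st t \<le> 1"
proof -
  show 1: "(st has_real_derivative st' t) (at t)" "continuous_on UNIV st'" "t \<le> 0 \<Longrightarrow> st t = 0" "t \<ge> 1 \<Longrightarrow> st t = 1"
    "0 \<le> st' t" "st' t \<le> M" "t \<le> 0 \<Longrightarrow> st' t = 0" "t \<ge> 1 \<Longrightarrow> st' t = 0" for t
    using assms by (auto simp: C1_step_def)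
  show "continuous_on UNIV st" using 1(1) by (meson DERIV_isCont continuous_at_imp_continuous_on)
  have mono: "st s \<le> st t" if "s \<le> t" for s t
    using DERIV_nonneg_imp_nondecreasing[OF that] 1(1,5) by blast
  show "0 \<le> st t" "st t \<le> 1"
    using mono[of "min t 0" t] 1(3)[of "min t 0"] mono[of t "max t 1"] 1(4)[of "max t 1"] by auto
qed

text \<open>A quotient of squared positive parts. The denominator never vanishes because t and 1 - t
  are not both nonpositive, and squaring makes the positive part continuously
  differentiable.\<close>

lemma C1_step_exists: "\<exists>st st' M. C1_step st st' M"
proof -
  define st where "st t = possq t / (possq t + possq (1 - t))" for t
  define st' where "st' t = (2 * max 0 t * possq (1 - t) + possq t * (2 * max 0 (1 - t))) / (possq t + possq (1 - t))\<^sup>2" for t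
  have pos: "possq t + possq (1 - t) > 0" for t
    by (cases "t > 0") (auto simp: possq_def max_def intro: add_pos_nonneg add_nonneg_pos)
  have cq: "continuous_on UNIV possq" unfolding possq_def[abs_def] by (intro continuous_intros)
  have cst': "continuous_on UNIV st'" unfolding st'_def[abs_def] possq_def
    using pos by (intro continuous_intros) (auto simp: possq_def less_imp_neq[symmetric])
  have z: "st' t = 0" if "t \<le> 0 \<or> t \<ge> 1" for t using that by (auto simp: st'_def possq_def max_def)
  obtain M where M: "\<And>t. norm (st' t) \<le> M"
    using continuous_compact_support_bounded[OF cst' compact_Icc[of 0 1]] z by (metis atLeastAtMost_iff linear)
  have "C1_step st st' M" unfolding C1_step_def
  proof (intro conjI allI impI)
    fix t
    have d2: "((\<lambda>t. possq (1 - t)) has_real_derivative - (2 * max 0 (1 - t))) (at t)"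
    proof -
      have "((\<lambda>t. 1 - t) has_real_derivative - 1) (at t)" by (auto intro!: derivative_eq_intros)
      from DERIV_chain2[where f=possq and g="\<lambda>t. 1 - t", OF possq_deriv this] show ?thesis by simp
    qed
    have "(st has_real_derivative (2 * max 0 t * (possq t + possq (1 - t)) - possq t * (2 * max 0 t + - (2 * max 0 (1 - t)))) / ((possq t + possq (1 - t)) * (possq t + possq (1 - t)))) (at t)"
      unfolding st_def[abs_def] by (rule DERIV_divide[OF possq_deriv DERIV_add[OF possq_deriv d2]]) (use pos[of t] in simp)
    moreover have "(2 * max 0 t * (possq t + possq (1 - t)) - possq t * (2 * max 0 t + - (2 * max 0 (1 - t)))) / ((possq t + possq (1 - t)) * (possq t + possq (1 - t))) = st' t"
      unfolding st'_def power2_eq_square by (rule arg_cong2[where f="(/)"]) (simp_all add: algebra_simps)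
    ultimately show "(st has_real_derivative st' t) (at t)" by simp
    show "st' t \<le> M" using M[of t] by simp
    show "0 \<le> st' t" unfolding st'_def by (simp add: possq_def)
  qed (use z cst' in \<open>auto simp: st_def possq_def max_def\<close>)
  then show ?thesis by blast
qed

section \<open>Kernels and potentials away from the singularity\<close>

context exterior_fundamental begin

lemma \<Phi>_conts:
  assumes "z \<noteq> 0" shows "isCont \<Phi> z" "isCont (\<Phi>1 j) z" "isCont (\<Phi>2 i j) z"
proof -
  have s: "z \<bullet> z > 0" using assms by simp
  have i: "isCont (\<lambda>z. z \<bullet> z) z" by (intro continuous_intros)
  show "isCont \<Phi> z" by (rule has_grad_continuous[OF \<Phi>_grad[OF assms]])
  show "isCont (\<Phi>1 j) z" by (rule has_grad_continuous[OF \<Phi>1_grad[OF assms]])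
  have a: "isCont (\<lambda>z. F' (z \<bullet> z)) z" "isCont (\<lambda>z. F'' (z \<bullet> z)) z"
    by (rule isCont_o2[OF i has_vector_derivative_continuous[OF F_deriv(2)[OF s]]])
       (rule isCont_o2[OF i F''_cont[OF s]])
  show "isCont (\<Phi>2 i j) z" unfolding \<Phi>2_def[abs_def]
    by (cases "i = j") (auto intro!: continuous_intros a)
qed

lemma \<Phi>_measurable: "\<Phi> \<in> borel_measurable borel" "\<Phi>1 j \<in> borel_measurable borel" "\<Phi>2 i j \<in> borel_measurable borel"
  by (rule borel_measurable_continuous_countable_exceptions[of "{0}"];
      auto intro!: continuous_at_imp_continuous_on \<Phi>_conts)+

lemma \<Phi>_shift_measurable:
  "(\<lambda>y. \<Phi> (y - x)) \<in> borel_measurable lebesgue" "(\<lambda>y. \<Phi>1 j (y - x)) \<in> borel_measurable lebesgue" "(\<lambda>y. \<Phi>2 i j (y - x)) \<in> borel_measurable lebesgue"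
proof -
  have "(\<lambda>y. f (y - x)) \<in> borel_measurable lebesgue" if "f \<in> borel_measurable borel" for f :: "real^'n \<Rightarrow> complex"
  proof -
    have "(\<lambda>y. y - x) \<in> borel_measurable borel" by (intro borel_measurable_continuous_onI continuous_intros)
    from measurable_compose[OF this that] show ?thesis by (intro measurable_completion) simp
  qed
  then show "(\<lambda>y. \<Phi> (y - x)) \<in> borel_measurable lebesgue" "(\<lambda>y. \<Phi>1 j (y - x)) \<in> borel_measurable lebesgue" "(\<lambda>y. \<Phi>2 i j (y - x)) \<in> borel_measurable lebesgue"
    using \<Phi>_measurable by auto
qed

text \<open>Compactness of a spherical shell turns continuity into one constant for the kernel and
  its derivatives up to order two, which later dominates the potentials.\<close>

lemma \<Phi>_bounded:
  assumes "\<delta> > 0"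
  shows "\<exists>M. \<forall>z i j. \<delta> \<le> norm z \<longrightarrow> norm z \<le> \<rho> \<longrightarrow> norm (\<Phi> z) \<le> M \<and> norm (\<Phi>1 j z) \<le> M \<and> norm (\<Phi>2 i j z) \<le> M"
proof -
  define S where "S = cball (0::real^'n) \<rho> - ball 0 \<delta>"
  have S: "compact S" unfolding S_def by (intro compact_diff) auto
  have nz: "z \<noteq> 0" if "z \<in> S" for z using that assms by (auto simp: S_def)
  have b: "\<exists>M. \<forall>z\<in>S. norm (f z) \<le> M" if "\<And>z. z \<in> S \<Longrightarrow> isCont f z" for f :: "real^'n \<Rightarrow> complex"
  proof -
    have "bounded (f ` S)"
      by (intro compact_imp_bounded compact_continuous_image S continuous_at_imp_continuous_on ballI that)
    then show ?thesis unfolding bounded_iff by auto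
  qed
  obtain M0 where M0: "\<And>z. z \<in> S \<Longrightarrow> norm (\<Phi> z) \<le> M0" using b[OF \<Phi>_conts(1)[OF nz]] by blast
  have "\<exists>M1. \<forall>j. \<forall>z\<in>S. norm (\<Phi>1 j z) \<le> M1 j" by (intro choice allI b \<Phi>_conts nz)
  then obtain M1 where M1: "\<And>j z. z \<in> S \<Longrightarrow> norm (\<Phi>1 j z) \<le> M1 j" by blast
  have "\<exists>M2. \<forall>p :: 'n \<times> 'n. \<forall>z\<in>S. norm (\<Phi>2 (fst p) (snd p) z) \<le> M2 p" by (intro choice allI b \<Phi>_conts nz)
  then obtain M2 where M2: "\<And>p z. z \<in> S \<Longrightarrow> norm (\<Phi>2 (fst p) (snd p) z) \<le> M2 p" by blast
  define M where "M = \<bar>M0\<bar> + (\<Sum>j\<in>UNIV. \<bar>M1 j\<bar>) + (\<Sum>p\<in>UNIV. \<bar>M2 p\<bar>)"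
  have nn: "(\<Sum>j\<in>UNIV. \<bar>M1 j\<bar>) \<ge> 0" "(\<Sum>p\<in>UNIV. \<bar>M2 p\<bar>) \<ge> 0" by (auto intro: sum_nonneg)
  have m1: "M1 j \<le> M" for j
  proof -
    have "\<bar>M1 j\<bar> \<le> (\<Sum>j\<in>UNIV. \<bar>M1 j\<bar>)" by (rule member_le_sum) auto
    then show ?thesis using nn unfolding M_def by linarith
  qed
  have m2: "M2 p \<le> M" for p
  proof -
    have "\<bar>M2 p\<bar> \<le> (\<Sum>p\<in>UNIV. \<bar>M2 p\<bar>)" by (rule member_le_sum) auto
    then show ?thesis using nn unfolding M_def by linarith
  qed
  have m0: "M0 \<le> M" using nn unfolding M_def by linarith
  show ?thesis
  proof (intro exI[of _ M] allI impI)
    fix z :: "real^'n" and i j assume "\<delta> \<le> norm z" "norm z \<le> \<rho>"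
    then have z: "z \<in> S" by (simp add: S_def)
    show "norm (\<Phi> z) \<le> M \<and> norm (\<Phi>1 j z) \<le> M \<and> norm (\<Phi>2 i j z) \<le> M"
      using order_trans[OF M0[OF z] m0] order_trans[OF M1[OF z] m1] order_trans[OF M2[OF z, of "(i, j)"] m2] by simp
  qed
qed

text \<open>The sources keep distance \<delta> from a whole ball around \<open>x0\<close>, where the
  kernels are bounded and smooth enough, so integrable densities may be differentiated under the
  integral. The minus sign is the inner derivative of y - x.\<close>

lemma potential_grad:
  fixes A :: "real^'n \<Rightarrow> complex" and B :: "'n \<Rightarrow> real^'n \<Rightarrow> complex"
  assumes A: "integrable lebesgue A" and B: "\<And>j. integrable lebesgue (B j)"
    and S: "\<And>y. y \<notin> S \<Longrightarrow> A y = 0" "\<And>j y. y \<notin> S \<Longrightarrow> B j y = 0" "S \<subseteq> cball 0 \<rho>"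
    and \<delta>: "\<delta> > 0" "\<And>x y. x \<in> ball x0 \<delta> \<Longrightarrow> y \<in> S \<Longrightarrow> \<delta> \<le> norm (y - x)"
  shows "has_grad (\<lambda>x. LINT y|lebesgue. A y * \<Phi> (y - x) + (\<Sum>j\<in>UNIV. B j y * \<Phi>1 j (y - x)))
      (\<lambda>i. LINT y|lebesgue. - (A y * \<Phi>1 i (y - x0) + (\<Sum>j\<in>UNIV. B j y * \<Phi>2 i j (y - x0)))) x0" (is ?grad)
    "isCont (\<lambda>x. LINT y|lebesgue. - (A y * \<Phi>1 i (y - x) + (\<Sum>j\<in>UNIV. B j y * \<Phi>2 i j (y - x)))) x0" (is ?cont)
    "integrable lebesgue (\<lambda>y. A y * \<Phi> (y - x0) + (\<Sum>j\<in>UNIV. B j y * \<Phi>1 j (y - x0)))"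
proof -
  obtain M where M: "\<And>z i j. \<delta> \<le> norm z \<Longrightarrow> norm z \<le> \<rho> + norm x0 + \<delta> \<Longrightarrow> norm (\<Phi> z) \<le> M \<and> norm (\<Phi>1 j z) \<le> M \<and> norm (\<Phi>2 i j z) \<le> M"
    using \<Phi>_bounded[OF \<delta>(1), of "\<rho> + norm x0 + \<delta>"] by blast
  define W where "W y = M * (norm (A y) + (\<Sum>j\<in>UNIV. norm (B j y)))" for y
  have W: "integrable lebesgue W" unfolding W_def[abs_def]
    by (intro integrable_mult_right Bochner_Integration.integrable_add integrable_norm Bochner_Integration.integrable_sum A B)
  have far: "norm (\<Phi> (y - x)) \<le> M \<and> norm (\<Phi>1 j (y - x)) \<le> M \<and> norm (\<Phi>2 i j (y - x)) \<le> M" if x: "x \<in> ball x0 \<delta>" and y: "y \<in> S" for x y i j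
  proof (rule M)
    show "\<delta> \<le> norm (y - x)" by (rule \<delta>(2)[OF x y])
    have "norm x \<le> norm x0 + norm (x - x0)" using norm_triangle_sub by blast
    also have "\<dots> \<le> norm x0 + \<delta>" using x by (simp add: dist_norm norm_minus_commute)
    finally show "norm (y - x) \<le> \<rho> + norm x0 + \<delta>" using norm_triangle_ineq4[of y x] S(3) y by (force simp: subset_iff)
  qed
  have nz: "y - x \<noteq> 0" if "x \<in> ball x0 \<delta>" "y \<in> S" for x y using \<delta>(2)[OF that] \<delta>(1) by auto
  have bound: "norm (A y * f + (\<Sum>j\<in>UNIV. B j y * g j)) \<le> W y" if "norm f \<le> M" "\<And>j. norm (g j) \<le> M" for y f and g :: "'n \<Rightarrow> complex"
  proof -
    have "norm (A y * f) \<le> M * norm (A y)" using mult_left_mono[OF that(1), of "norm (A y)"] by (simp add: norm_mult mult.commute)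
    moreover have "norm (\<Sum>j\<in>UNIV. B j y * g j) \<le> (\<Sum>j\<in>UNIV. M * norm (B j y))"
    proof (rule sum_norm_le)
      fix j show "norm (B j y * g j) \<le> M * norm (B j y)" using mult_left_mono[OF that(2), of "norm (B j y)"] by (simp add: norm_mult mult.commute)
    qed
    ultimately show ?thesis using norm_triangle_ineq[of "A y * f" "\<Sum>j\<in>UNIV. B j y * g j"]
      unfolding W_def distrib_left sum_distrib_left by linarith
  qed
  have M0: "W y \<ge> 0" if "x \<in> ball x0 \<delta>" for x y
  proof (cases "y \<in> S")
    case True
    have "0 \<le> M" using far[OF that True] order_trans[OF norm_ge_zero] by blast
    then show ?thesis unfolding W_def
      by (intro mult_nonneg_nonneg add_nonneg_nonneg sum_nonneg) auto
  qed (simp add: W_def S)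
  have x0: "x0 \<in> ball x0 \<delta>" using \<delta>(1) by simp
  note mA = borel_measurable_integrable[OF A] and mB = borel_measurable_integrable[OF B]
  note [measurable] = mA mB \<Phi>_shift_measurable
  have b1: "norm (A y * \<Phi> (y - x) + (\<Sum>j\<in>UNIV. B j y * \<Phi>1 j (y - x))) \<le> W y"
    and b2: "norm (- (A y * \<Phi>1 i (y - x) + (\<Sum>j\<in>UNIV. B j y * \<Phi>2 i j (y - x)))) \<le> W y" if x: "x \<in> ball x0 \<delta>" for x y i
  proof -
    show "norm (A y * \<Phi> (y - x) + (\<Sum>j\<in>UNIV. B j y * \<Phi>1 j (y - x))) \<le> W y"
    proof (cases "y \<in> S")
      case True then show ?thesis using far[OF x True] by (intro bound) auto
    qed (use M0[OF x] in \<open>simp add: S\<close>)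
    show "norm (- (A y * \<Phi>1 i (y - x) + (\<Sum>j\<in>UNIV. B j y * \<Phi>2 i j (y - x)))) \<le> W y"
      unfolding norm_minus_cancel
    proof (cases "y \<in> S")
      case True then show "norm (A y * \<Phi>1 i (y - x) + (\<Sum>j\<in>UNIV. B j y * \<Phi>2 i j (y - x))) \<le> W y" using far[OF x True] by (intro bound) auto
    qed (use M0[OF x] in \<open>simp add: S\<close>)
  qed
  have int: "integrable lebesgue (\<lambda>y. A y * \<Phi> (y - x) + (\<Sum>j\<in>UNIV. B j y * \<Phi>1 j (y - x)))" if x: "x \<in> ball x0 \<delta>" for x
    by (rule Bochner_Integration.integrable_bound[OF W]) (measurable, auto intro!: AE_I2 order_trans[OF b1[OF x] abs_ge_self])
  show "integrable lebesgue (\<lambda>y. A y * \<Phi> (y - x0) + (\<Sum>j\<in>UNIV. B j y * \<Phi>1 j (y - x0)))" by (rule int[OF x0])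
  show ?grad
  proof (rule has_grad_integral[OF \<delta>(1), where B=W])
    fix x assume x: "x \<in> ball x0 \<delta>"
    show "integrable lebesgue (\<lambda>y. A y * \<Phi> (y - x) + (\<Sum>j\<in>UNIV. B j y * \<Phi>1 j (y - x)))" by (rule int[OF x])
    fix y
    show "has_grad (\<lambda>x. A y * \<Phi> (y - x) + (\<Sum>j\<in>UNIV. B j y * \<Phi>1 j (y - x))) (\<lambda>i. - (A y * \<Phi>1 i (y - x) + (\<Sum>j\<in>UNIV. B j y * \<Phi>2 i j (y - x)))) x"
    proof (cases "y \<in> S")
      case True
      have "has_grad (\<lambda>x. A y * \<Phi> (y - x) + (\<Sum>j\<in>UNIV. B j y * \<Phi>1 j (y - x)))
         (\<lambda>i. (0 * \<Phi> (y - x) + A y * (- \<Phi>1 i (y - x))) + (\<Sum>j\<in>UNIV. 0 * \<Phi>1 j (y - x) + B j y * (- \<Phi>2 i j (y - x)))) x"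
        by (intro has_grad_add has_grad_sum has_grad_mult has_grad_const has_grad_minus_arg \<Phi>_grad \<Phi>1_grad nz[OF x True])
      then show ?thesis by (rule has_grad_cong) (simp add: sum_negf)
    qed (simp add: S has_grad_const)
    show "norm (- (A y * \<Phi>1 i (y - x) + (\<Sum>j\<in>UNIV. B j y * \<Phi>2 i j (y - x)))) \<le> W y" for i by (rule b2[OF x])
  qed (use W in measurable)
  show ?cont
  proof (rule isCont_integral_dominated[OF \<delta>(1) _ W])
    fix y
    show "isCont (\<lambda>x. - (A y * \<Phi>1 i (y - x) + (\<Sum>j\<in>UNIV. B j y * \<Phi>2 i j (y - x)))) x0"
    proof (cases "y \<in> S")
      case True
      have "isCont (\<lambda>x. f (y - x)) x0" if "isCont f (y - x0)" for f :: "real^'n \<Rightarrow> complex"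
        by (rule isCont_o2[where g=f and f="\<lambda>x. y - x"]) (use that in \<open>auto intro!: continuous_intros\<close>)
      note this[OF \<Phi>_conts(2)[OF nz[OF x0 True]]] this[OF \<Phi>_conts(3)[OF nz[OF x0 True]]]
      then show ?thesis by (intro continuous_intros)
    qed (simp add: S)
    show "norm (- (A y * \<Phi>1 i (y - x) + (\<Sum>j\<in>UNIV. B j y * \<Phi>2 i j (y - x)))) \<le> W y" if "x \<in> ball x0 \<delta>" for x
      by (rule b2[OF that])
  next
    show "(\<lambda>y. - (A y * \<Phi>1 i (y - x) + (\<Sum>j\<in>UNIV. B j y * \<Phi>2 i j (y - x)))) \<in> borel_measurable lebesgue" for x
      by measurable
  qed
qed

end

section \<open>The fundamental lemma of the calculus of variations\<close>

text \<open>Translation invariance: the integral of \<phi>(y - x) over y does not depend on x, yet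
  its gradient in x is minus the integral of the gradient.\<close>

lemma integral_partial_eq_0:
  fixes \<phi> :: "real^'n \<Rightarrow> complex"
  assumes "C1c \<phi> \<phi>' K"
  shows "(LINT y|lebesgue. \<phi>' j y) = 0"
proof -
  note D = C1cD[OF assms]
  obtain B where B: "\<And>j y. norm (\<phi>' j y) \<le> B" using C1c_bounded(2)[OF assms] by blast
  obtain B0 where B0: "\<And>y. norm (\<phi> y) \<le> B0" using C1c_bounded(1)[OF assms] by blast
  obtain r where r: "K \<subseteq> ball 0 r" using compact_imp_bounded[OF D(1)] bounded_subset_ballD by blast
  have mb: "\<phi> \<in> borel_measurable borel" "\<phi>' j \<in> borel_measurable borel" for j
    by (rule borel_measurable_continuous_onI D(3,4))+
  have ind: "integrable lborel (\<lambda>y. c * indicator (cball 0 (r + 1)) y :: real)" for c :: real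
    by (intro integrable_mult_right integrable_real_indicator) (auto simp: emeasure_bounded_finite[simplified])
  have sub: "y \<in> cball 0 (r + 1)" if "x \<in> ball 0 1" "y - x \<in> K" for x y :: "real^'n"
  proof -
    have "norm y \<le> norm (y - x) + norm x" using norm_triangle_sub by (metis add.commute)
    then show ?thesis using that r by force
  qed
  have bd: "norm (f (y - x)) \<le> \<bar>b\<bar> * indicator (cball 0 (r + 1)) y"
    if "x \<in> ball 0 1" "\<And>z. norm (f z) \<le> b" "\<And>z. z \<notin> K \<Longrightarrow> f z = 0" for f :: "real^'n \<Rightarrow> complex" and b x y
    using sub[OF that(1), of y] that(2)[of "y - x"] that(3)[of "y - x"]
    by (cases "y - x \<in> K") (auto intro: order_trans[OF _ abs_ge_self])
  have sh: "(\<lambda>y. y - x) \<in> borel_measurable borel" for x :: "real^'n" by (intro borel_measurable_continuous_onI continuous_intros)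
  have int0: "(LINT y|lborel. f (y - x)) = integral\<^sup>L lborel f" if "f \<in> borel_measurable borel" for f :: "real^'n \<Rightarrow> complex" and x
  proof -
    have "integral\<^sup>L lborel f = integral\<^sup>L (distr lborel borel ((+) (- x))) f" by (simp only: lborel_distr_plus)
    also have "\<dots> = (LINT y|lborel. f (- x + y))" by (rule integral_distr) (use that in auto)
    finally show ?thesis by simp
  qed
  have "has_grad (\<lambda>x. LINT y|lborel. \<phi> (y - x)) (\<lambda>j. LINT y|lborel. - \<phi>' j (y - 0)) 0"
  proof (rule has_grad_integral[where r=1 and D="\<lambda>j x y. - \<phi>' j (y - x)" and B="\<lambda>y. \<bar>B\<bar> * indicator (cball 0 (r + 1)) y"])
    fix x :: "real^'n" assume x: "x \<in> ball 0 1"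
    show "integrable lborel (\<lambda>y. \<phi> (y - x))"
    proof (rule Bochner_Integration.integrable_bound[OF ind[of "\<bar>B0\<bar>"]])
      show "(\<lambda>y. \<phi> (y - x)) \<in> borel_measurable lborel" using measurable_compose[OF sh mb(1)] by simp
      show "AE y in lborel. norm (\<phi> (y - x)) \<le> norm (\<bar>B0\<bar> * indicator (cball 0 (r + 1)) y :: real)"
      proof (rule AE_I2)
        fix y
        have "norm (\<phi> (y - x)) \<le> \<bar>B0\<bar> * indicator (cball 0 (r + 1)) y" by (rule bd[OF x], rule B0, rule D(5))
        then show "norm (\<phi> (y - x)) \<le> norm (\<bar>B0\<bar> * indicator (cball 0 (r + 1)) y :: real)"
          unfolding real_norm_def by (rule order_trans[OF _ abs_ge_self])
      qed
    qed
    fix y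
    show "has_grad (\<lambda>x. \<phi> (y - x)) (\<lambda>j. - \<phi>' j (y - x)) x" by (rule has_grad_minus_arg[OF D(2)])
    show "norm (- \<phi>' j (y - x)) \<le> \<bar>B\<bar> * indicator (cball 0 (r + 1)) y" for j
      unfolding norm_minus_cancel by (rule bd[OF x B D(6)])
  next
    show "(\<lambda>y. - \<phi>' j (y - 0)) \<in> borel_measurable lborel" for j using mb(2) by simp
  qed (use ind in auto)
  moreover have "has_grad (\<lambda>x. LINT y|lborel. \<phi> (y - x)) (\<lambda>j. 0) 0"
    unfolding int0[OF mb(1)] by (rule has_grad_const)
  ultimately have "(LINT y|lborel. - \<phi>' j (y - 0)) = 0" by (rule has_grad_unique)
  then have "(LINT y|lborel. \<phi>' j y) = 0" by simp
  then show ?thesis using integral_completion[of "\<phi>' j" lborel] mb(2) by simp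
qed

text \<open>The factor f is C1 only near \<open>K\<close>. Off \<open>K\<close> the product vanishes
  identically, and the open sets \<open>W\<close> and \<open>- K\<close> cover the space.\<close>

lemma C1c_mult_on:
  fixes f :: "real^'n \<Rightarrow> complex"
  assumes \<phi>: "C1c \<phi> \<phi>' K" and W: "open W" "K \<subseteq> W"
    and f: "\<And>y. y \<in> W \<Longrightarrow> has_grad f (\<lambda>j. f' j y) y" "\<And>j. continuous_on W (f' j)"
  shows "C1c (\<lambda>y. \<phi> y * f y) (\<lambda>j y. \<phi>' j y * f y + \<phi> y * f' j y) K"
proof -
  note D = C1cD[OF \<phi>]
  have cf: "continuous_on W f"
    using f(1) has_grad_continuous by (blast intro: continuous_at_imp_continuous_on)
  have oK: "open (- K)" using compact_imp_closed[OF D(1)] by (rule open_Compl)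
  show ?thesis unfolding C1c_def
  proof (intro conjI allI impI)
    show "compact K" by (rule D(1))
    show "\<phi> y * f y = 0" if "y \<notin> K" for y using D(5)[OF that] by simp
    show "has_grad (\<lambda>y. \<phi> y * f y) (\<lambda>j. \<phi>' j y * f y + \<phi> y * f' j y) y" for y
    proof (cases "y \<in> W")
      case True show ?thesis by (rule has_grad_mult[OF D(2) f(1)[OF True]])
    next
      case False
      then have y: "y \<in> - K" using W(2) by blast
      have "has_grad (\<lambda>y. \<phi> y * f y) (\<lambda>j. 0) y"
        by (rule has_grad_cong_ev[OF has_grad_const[of 0] oK y]) (simp add: D(5))
      then show ?thesis by (rule has_grad_cong) (use y in \<open>simp add: D(5) D(6)\<close>)
    qed
    show "continuous_on UNIV (\<lambda>y. \<phi>' j y * f y + \<phi> y * f' j y)" for j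
    proof -
      have "continuous_on (W \<union> - K) (\<lambda>y. \<phi>' j y * f y + \<phi> y * f' j y)"
      proof (rule continuous_on_open_Un[OF W(1) oK])
        show "continuous_on W (\<lambda>y. \<phi>' j y * f y + \<phi> y * f' j y)"
          by (intro continuous_intros cf f(2) continuous_on_subset[OF D(3)] continuous_on_subset[OF D(4)]) auto
        have "continuous_on (- K) (\<lambda>y. 0 :: complex)" by (intro continuous_intros)
        then show "continuous_on (- K) (\<lambda>y. \<phi>' j y * f y + \<phi> y * f' j y)"
          by (rule continuous_on_eq) (simp add: D(5) D(6))
      qed
      moreover have "W \<union> - K = UNIV" using W(2) by blast
      ultimately show ?thesis by simp
    qed
  qed
qed

text \<open>Taken as densities, the positive and the negative part of f give measures that agree on
  boxes. Boxes are an intersection stable generator with an exhausting sequence of finite measure,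
  so the measures coincide and with them the densities.\<close>

lemma AE_eq_0_of_box_integrals_real:
  fixes f :: "'a::euclidean_space \<Rightarrow> real"
  assumes f: "integrable lborel f" and z: "\<And>l r. (LINT y|lborel. indicator (box l r) y *\<^sub>R f y) = 0"
  shows "AE y in lborel. f y = 0"
proof -
  have [measurable]: "f \<in> borel_measurable borel" using f by auto
  define M1 M2 where "M1 = density lborel (\<lambda>y. ennreal (f y))" and "M2 = density lborel (\<lambda>y. ennreal (- f y))"
  have e: "emeasure M1 (box l r) = ennreal (LINT y|lborel. max 0 (indicator (box l r) y *\<^sub>R f y))"
    "emeasure M2 (box l r) = ennreal (LINT y|lborel. max 0 (- (indicator (box l r) y *\<^sub>R f y)))" for l r
  proof -
    have i: "integrable lborel (\<lambda>y. indicator (box l r) y *\<^sub>R f y)" using f by (intro integrable_mult_indicator) auto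
    have "emeasure M1 (box l r) = (\<integral>\<^sup>+y. ennreal (max 0 (indicator (box l r) y *\<^sub>R f y)) \<partial>lborel)"
      unfolding M1_def by (subst emeasure_density) (auto intro!: nn_integral_cong simp: indicator_def max_def ennreal_neg)
    also have "\<dots> = ennreal (LINT y|lborel. max 0 (indicator (box l r) y *\<^sub>R f y))"
      by (rule nn_integral_eq_integral) (use i in auto)
    finally show "emeasure M1 (box l r) = ennreal (LINT y|lborel. max 0 (indicator (box l r) y *\<^sub>R f y))" .
    have "emeasure M2 (box l r) = (\<integral>\<^sup>+y. ennreal (max 0 (- (indicator (box l r) y *\<^sub>R f y))) \<partial>lborel)"
      unfolding M2_def by (subst emeasure_density) (auto intro!: nn_integral_cong simp: indicator_def max_def ennreal_neg)
    also have "\<dots> = ennreal (LINT y|lborel. max 0 (- (indicator (box l r) y *\<^sub>R f y)))"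
      by (rule nn_integral_eq_integral) (use i in auto)
    finally show "emeasure M2 (box l r) = ennreal (LINT y|lborel. max 0 (- (indicator (box l r) y *\<^sub>R f y)))" .
  qed
  have "M1 = M2"
  proof (rule measure_eqI_generator_eq[where E="range (\<lambda>(l, r). box l r)" and \<Omega>=UNIV and A="\<lambda>n::nat. box (- (real n *\<^sub>R One)) (real n *\<^sub>R One)"])
    show "Int_stable (range (\<lambda>(l::'a, r). box l r))" by (auto simp: Int_stable_def box_Int_box)
    show "sets M1 = sigma_sets UNIV (range (\<lambda>(l, r). box l r))" "sets M2 = sigma_sets UNIV (range (\<lambda>(l, r). box l r))"
      unfolding M1_def M2_def by (simp_all add: borel_eq_box sets_measure_of)
    show "(\<Union>n::nat. box (- (real n *\<^sub>R One)) (real n *\<^sub>R One)) = (UNIV :: 'a set)" by (rule UN_box_eq_UNIV)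
    show "emeasure M1 (box (- (real n *\<^sub>R One)) (real n *\<^sub>R One)) \<noteq> \<infinity>" for n by (simp add: e)
    fix X :: "'a set" assume "X \<in> range (\<lambda>(l, r). box l r)"
    then obtain l r where X: "X = box l r" by auto
    have i: "integrable lborel (\<lambda>y. indicator (box l r) y *\<^sub>R f y)" using f by (intro integrable_mult_indicator) auto
    have "(LINT y|lborel. max 0 (indicator (box l r) y *\<^sub>R f y)) - (LINT y|lborel. max 0 (- (indicator (box l r) y *\<^sub>R f y)))
      = (LINT y|lborel. max 0 (indicator (box l r) y *\<^sub>R f y) - max 0 (- (indicator (box l r) y *\<^sub>R f y)))"
      by (rule Bochner_Integration.integral_diff[symmetric]) (use i in auto)
    also have "\<dots> = (LINT y|lborel. indicator (box l r) y *\<^sub>R f y)" by (rule Bochner_Integration.integral_cong) auto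
    also have "\<dots> = 0" by (rule z)
    finally show "emeasure M1 X = emeasure M2 X" unfolding X e by simp
  qed auto
  then have "AE y in lborel. ennreal (f y) = ennreal (- f y)"
    unfolding M1_def M2_def by (intro sigma_finite_measure.density_unique[OF sigma_finite_lborel]) auto
  \<comment> \<open>Truncation of negative numbers makes one of the two sides 0, so the other one
    vanishes as well.\<close>
  then show ?thesis
  proof eventually_elim
    case (elim y)
    show ?case
    proof (cases "f y \<ge> 0")
      case True
      then have "ennreal (f y) = 0" using elim by (simp add: ennreal_neg)
      then show ?thesis using True by (simp add: ennreal_eq_0_iff)
    next
      case False
      then have "ennreal (- f y) = 0" using elim by (simp add: ennreal_neg)
      then show ?thesis using False by (simp add: ennreal_eq_0_iff)
    qed
  qed
qed

text \<open>A Borel representative reduces Lebesgue measurable functions to the previous case; real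
  and imaginary parts are treated separately.\<close>

lemma AE_eq_0_of_box_integrals:
  fixes h :: "'a::euclidean_space \<Rightarrow> complex"
  assumes h: "integrable lebesgue h" and z: "\<And>l r. (LINT y|lebesgue. indicator (box l r) y *\<^sub>R h y) = 0"
  shows "AE y in lebesgue. h y = 0"
proof -
  have real: "AE y in lebesgue. g y = 0" if g: "integrable lebesgue g" and gz: "\<And>l r. (LINT y|lebesgue. indicator (box l r) y *\<^sub>R g y) = 0" for g :: "'a \<Rightarrow> real"
  proof -
    obtain g' where g': "g' \<in> borel_measurable lborel" "AE y in lborel. g y = g' y"
      using completion_ex_borel_measurable_real[of g lborel] g by auto
    have ae: "AE y in lebesgue. g y = g' y" by (rule AE_completion[OF g'(2)])
    have m': "g' \<in> borel_measurable lebesgue" using g'(1) by (rule measurable_completion)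
    have ig: "integrable lebesgue g'" by (rule integrable_cong_AE_imp[OF g m' ae])
    have il: "integrable lborel g'" using ig g'(1) by (simp add: integrable_completion)
    have "AE y in lborel. g' y = 0"
    proof (rule AE_eq_0_of_box_integrals_real[OF il])
      fix l r :: 'a
      have mb: "(\<lambda>y. indicator (box l r) y *\<^sub>R g' y) \<in> borel_measurable lborel"
        using g'(1) unfolding measurable_lborel1 by (intro borel_measurable_scaleR borel_measurable_indicator) simp_all
      have "(LINT y|lborel. indicator (box l r) y *\<^sub>R g' y) = (LINT y|lebesgue. indicator (box l r) y *\<^sub>R g' y)"
        by (rule integral_completion[OF mb, symmetric])
      also have "\<dots> = (LINT y|lebesgue. indicator (box l r) y *\<^sub>R g y)"
      proof (rule integral_cong_AE)
        show "(\<lambda>y. indicator (box l r) y *\<^sub>R g' y) \<in> borel_measurable lebesgue" "(\<lambda>y. indicator (box l r) y *\<^sub>R g y) \<in> borel_measurable lebesgue"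
          by (intro borel_measurable_scaleR borel_measurable_indicator m' borel_measurable_integrable[OF g]; simp)+
        show "AE y in lebesgue. indicator (box l r) y *\<^sub>R g' y = indicator (box l r) y *\<^sub>R g y"
          using ae by eventually_elim simp
      qed
      finally show "(LINT y|lborel. indicator (box l r) y *\<^sub>R g' y) = 0" using gz by simp
    qed
    then have "AE y in lebesgue. g' y = 0" by (rule AE_completion)
    with ae show ?thesis by eventually_elim simp
  qed
  have i: "integrable lebesgue (\<lambda>y. indicator (box l r) y *\<^sub>R h y)" for l r
    by (rule integrable_mult_indicator[OF _ h]) simp
  have "AE y in lebesgue. Re (h y) = 0"
  proof (rule real)
    show "integrable lebesgue (\<lambda>y. Re (h y))" using h by simp
    fix l r :: 'a
    have "(LINT y|lebesgue. Re (indicator (box l r) y *\<^sub>R h y)) = Re (LINT y|lebesgue. indicator (box l r) y *\<^sub>R h y)"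
      by (rule integral_Re[OF i])
    then show "(LINT y|lebesgue. indicator (box l r) y *\<^sub>R Re (h y)) = 0" by (simp only: z scaleR_complex.sel zero_complex.sel real_scaleR_def)
  qed
  moreover have "AE y in lebesgue. Im (h y) = 0"
  proof (rule real)
    show "integrable lebesgue (\<lambda>y. Im (h y))" using h by simp
    fix l r :: 'a
    have "(LINT y|lebesgue. Im (indicator (box l r) y *\<^sub>R h y)) = Im (LINT y|lebesgue. indicator (box l r) y *\<^sub>R h y)"
      by (rule integral_Im[OF i])
    then show "(LINT y|lebesgue. indicator (box l r) y *\<^sub>R Im (h y)) = 0" by (simp only: z scaleR_complex.sel zero_complex.sel real_scaleR_def)
  qed
  ultimately show ?thesis by eventually_elim (simp add: complex_eq_iff)
qed

lemma C1c_box_product: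
  fixes p p' :: "'n::finite \<Rightarrow> real \<Rightarrow> real" and l r :: "real^'n"
  assumes p: "\<And>i t. (p i has_real_derivative p' i t) (at t)" and p': "\<And>i. continuous_on UNIV (p' i)"
    and z: "\<And>i t. t \<notin> {l $ i..r $ i} \<Longrightarrow> p i t = 0"
  shows "C1c (\<lambda>y. of_real (\<Prod>i\<in>UNIV. p i (y $ i))) (\<lambda>j y. of_real (p' j (y $ j) * (\<Prod>i\<in>UNIV - {j}. p i (y $ i)))) (cbox l r)"
  unfolding C1c_def
proof (intro conjI allI impI)
  have 1: "((\<lambda>y. p i (y $ i)) has_derivative (\<lambda>h. p' i (y $ i) * h $ i)) (at y)" for i y
    by (rule has_derivative_compose[OF bounded_linear.has_derivative[OF bounded_linear_vec_nth has_derivative_ident]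
          p[unfolded has_field_derivative_def]])
  have "has_grad (\<lambda>y. \<Prod>i\<in>UNIV. p i (y $ i)) (\<lambda>j. p' j (y $ j) * (\<Prod>i\<in>UNIV - {j}. p i (y $ i))) y" for y
    by (rule has_gradI[OF has_derivative_prod[OF 1]]) (simp only: real_scaleR_def ac_simps)
  from has_grad_linear[OF bounded_linear_of_real this]
  show "has_grad (\<lambda>y. complex_of_real (\<Prod>i\<in>UNIV. p i (y $ i))) (\<lambda>j. of_real (p' j (y $ j) * (\<Prod>i\<in>UNIV - {j}. p i (y $ i)))) y" for y .
  have cp: "continuous_on UNIV (p i)" for i
    by (intro continuous_at_imp_continuous_on ballI DERIV_isCont[OF p])
  have cc: "continuous_on UNIV (\<lambda>y::real^'n. f (y $ i))" if "continuous_on UNIV f" for f :: "real \<Rightarrow> real" and i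
    by (rule continuous_on_compose2[OF that _ subset_UNIV]) (intro continuous_intros)
  show "continuous_on UNIV (\<lambda>y. complex_of_real (p' j (y $ j) * (\<Prod>i\<in>UNIV - {j}. p i (y $ i))))" for j
    by (intro continuous_on_of_real continuous_on_mult continuous_on_prod cc[OF cp] cc[OF p'])
  fix y assume "y \<notin> cbox l r"
  then obtain i where "y $ i \<notin> {l $ i..r $ i}" by (auto simp: mem_box_cart)
  then have "p i (y $ i) = 0" by (rule z)
  then have "(\<Prod>i\<in>UNIV. p i (y $ i)) = 0" by (auto intro!: prod_zero)
  then show "complex_of_real (\<Prod>i\<in>UNIV. p i (y $ i)) = 0" by simp
qed simp

text \<open>Products of one-dimensional steps converge boundedly to the indicator of a box, so
  vanishing against test functions becomes vanishing over boxes. Closed boxes inside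
  \<open>W\<close> localise the claim, and countably many of them cover \<open>W\<close>.\<close>

lemma AE_eq_0_of_C1c_integrals:
  fixes h :: "real^'n \<Rightarrow> complex"
  assumes W: "open W" and m: "h \<in> borel_measurable lebesgue" and i: "\<And>l r. cbox l r \<subseteq> W \<Longrightarrow> integrable lebesgue (\<lambda>y. indicator (cbox l r) y *\<^sub>R h y)"
    and z: "\<And>\<phi> \<phi>' K. C1c \<phi> \<phi>' K \<Longrightarrow> K \<subseteq> W \<Longrightarrow> (LINT y|lebesgue. h y * \<phi> y) = 0"
  shows "AE y in lebesgue. y \<in> W \<longrightarrow> h y = 0"
proof -
  obtain st st' Ms where step: "C1_step st st' Ms" using C1_step_exists by blast
  note st = C1_stepD[OF step]
  have box0: "(LINT y|lebesgue. indicator (box l r) y *\<^sub>R h y) = 0" if lr: "cbox l r \<subseteq> W" for l r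
  proof -
    \<comment> \<open>Transitions of width 1/m at both ends: the product vanishes outside the
      interval and equals 1 at each interior point once m is large.\<close>
    define p where "p m i t = st (real m * (t - l $ i)) * st (real m * (r $ i - t))" for m i t
    define \<phi> where "\<phi> m y = complex_of_real (\<Prod>i\<in>UNIV. p m i (y $ i))" for m and y :: "real^'n"
    have dp: "(p m i has_real_derivative (st' (real m * (t - l $ i)) * real m * st (real m * (r $ i - t)) + st (real m * (t - l $ i)) * (st' (real m * (r $ i - t)) * - real m))) (at t)" for m i t
    proof -
      have 1: "((\<lambda>t. real m * (t - l $ i)) has_real_derivative real m) (at t)" "((\<lambda>t. real m * (r $ i - t)) has_real_derivative - real m) (at t)"
        by (auto intro!: derivative_eq_intros)
      have 2: "((\<lambda>t. st (real m * (t - l $ i))) has_real_derivative st' (real m * (t - l $ i)) * real m) (at t)"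
        by (rule DERIV_chain2[where f=st and g="\<lambda>t. real m * (t - l $ i)", OF st(1) 1(1)])
      have 3: "((\<lambda>t. st (real m * (r $ i - t))) has_real_derivative st' (real m * (r $ i - t)) * - real m) (at t)"
        by (rule DERIV_chain2[where f=st and g="\<lambda>t. real m * (r $ i - t)", OF st(1) 1(2)])
      show ?thesis unfolding p_def[abs_def] by (rule DERIV_cong[OF DERIV_mult[OF 2 3]]) (simp add: mult_ac)
    qed
    have C: "\<exists>\<phi>'. C1c (\<phi> m) \<phi>' (cbox l r)" for m
      unfolding \<phi>_def[abs_def]
    proof (rule exI, rule C1c_box_product[OF dp])
      fix i
      show "continuous_on UNIV (\<lambda>t. st' (real m * (t - l $ i)) * real m * st (real m * (r $ i - t)) + st (real m * (t - l $ i)) * (st' (real m * (r $ i - t)) * - real m))"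
      proof -
        have aff: "continuous_on UNIV (\<lambda>t. real m * (t - l $ i))" "continuous_on UNIV (\<lambda>t. real m * (r $ i - t))"
          by (intro continuous_intros)+
        note c = continuous_on_compose2[OF st(2) aff(1) subset_UNIV] continuous_on_compose2[OF st(2) aff(2) subset_UNIV]
          continuous_on_compose2[OF st(3) aff(1) subset_UNIV] continuous_on_compose2[OF st(3) aff(2) subset_UNIV]
        show ?thesis by (intro continuous_on_add continuous_on_mult continuous_on_const c)
      qed
      show "p m i t = 0" if "t \<notin> {l $ i..r $ i}" for t
        using that st(4)[of "real m * (t - l $ i)"] st(4)[of "real m * (r $ i - t)"]
        by (auto simp: p_def not_le mult_le_0_iff)
    qed
    have p01: "0 \<le> p m i t" "p m i t \<le> 1" for m i t using st(10,11) by (auto simp: p_def intro: mult_le_one)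
    have \<phi>1: "norm (\<phi> m y) \<le> 1" for m y
      unfolding \<phi>_def norm_of_real using p01 by (simp add: abs_of_nonneg prod_nonneg prod_le_1)
    have lim: "(\<lambda>m. \<phi> m y) \<longlonglongrightarrow> indicator (box l r) y" for y
    proof (cases "y \<in> box l r")
      case True
      have "\<forall>\<^sub>F m in sequentially. p m i (y $ i) = 1" for i
      proof -
        have pos: "y $ i - l $ i > 0" "r $ i - y $ i > 0" using True by (auto simp: mem_box_cart)
        obtain N where N: "1 \<le> real N * (y $ i - l $ i)" "1 \<le> real N * (r $ i - y $ i)"
        proof -
          obtain N1 N2 :: nat where N1: "1 < real N1 * (y $ i - l $ i)" "1 < real N2 * (r $ i - y $ i)"
            using reals_Archimedean3[OF pos(1), rule_format, of 1] reals_Archimedean3[OF pos(2), rule_format, of 1] by blast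
          have "real N1 * (y $ i - l $ i) \<le> real (max N1 N2) * (y $ i - l $ i)" "real N2 * (r $ i - y $ i) \<le> real (max N1 N2) * (r $ i - y $ i)"
            using pos by (auto intro!: mult_right_mono)
          then show ?thesis using N1 by (intro that[of "max N1 N2"]) linarith+
        qed
        show ?thesis unfolding eventually_sequentially
        proof (intro exI[of _ N] allI impI)
          fix m assume "N \<le> m"
          then have "real N * (y $ i - l $ i) \<le> real m * (y $ i - l $ i)" "real N * (r $ i - y $ i) \<le> real m * (r $ i - y $ i)"
            using pos by (auto intro!: mult_right_mono)
          then show "p m i (y $ i) = 1" unfolding p_def using N by (simp add: st(5))
        qed
      qed
      then have "\<forall>\<^sub>F m in sequentially. \<forall>i. p m i (y $ i) = 1" by (rule eventually_all_finite)
      then have "\<forall>\<^sub>F m in sequentially. \<phi> m y = indicator (box l r) y"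
        by (rule eventually_mono) (use True in \<open>simp add: \<phi>_def\<close>)
      then show ?thesis by (rule tendsto_eventually)
    next
      case False
      then obtain i where i: "y $ i \<le> l $ i \<or> r $ i \<le> y $ i" by (auto simp: mem_box_cart not_less)
      have "p m i (y $ i) = 0" for m using i st(4)[of "real m * (y $ i - l $ i)"] st(4)[of "real m * (r $ i - y $ i)"]
        by (auto simp: p_def mult_le_0_iff)
      then have "\<phi> m y = 0" for m unfolding \<phi>_def by (auto intro!: prod_zero)
      then show ?thesis using False by simp
    qed
    have out: "\<phi> m y = 0" if "y \<notin> cbox l r" for m y using C[of m] that C1cD(5) by blast
    have "(\<lambda>m. LINT y|lebesgue. h y * \<phi> m y) \<longlonglongrightarrow> (LINT y|lebesgue. indicator (box l r) y *\<^sub>R h y)"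
    proof (rule integral_dominated_convergence[where w="\<lambda>y. norm (indicator (cbox l r) y *\<^sub>R h y)"])
      show "(\<lambda>y. indicator (box l r) y *\<^sub>R h y) \<in> borel_measurable lebesgue"
        by (intro borel_measurable_scaleR borel_measurable_indicator m) simp
      show "(\<lambda>y. h y * \<phi> m' y) \<in> borel_measurable lebesgue" for m'
        using C[of m'] C1c_measurable(1) m by (blast intro: borel_measurable_times)
      show "integrable lebesgue (\<lambda>y. norm (indicator (cbox l r) y *\<^sub>R h y))" by (rule integrable_norm[OF i[OF lr]])
      show "AE y in lebesgue. (\<lambda>m. h y * \<phi> m y) \<longlonglongrightarrow> indicator (box l r) y *\<^sub>R h y"
      proof (rule AE_I2)
        fix y
        have "(\<lambda>m. h y * \<phi> m y) \<longlonglongrightarrow> h y * indicator (box l r) y" by (intro tendsto_intros lim)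
        then show "(\<lambda>m. h y * \<phi> m y) \<longlonglongrightarrow> indicator (box l r) y *\<^sub>R h y" by (cases "y \<in> box l r") simp_all
      qed
      show "AE y in lebesgue. norm (h y * \<phi> m y) \<le> norm (indicator (cbox l r) y *\<^sub>R h y)" for m
      proof (rule AE_I2)
        fix y
        show "norm (h y * \<phi> m y) \<le> norm (indicator (cbox l r) y *\<^sub>R h y)"
          using mult_left_mono[OF \<phi>1[of m y], of "norm (h y)"] by (cases "y \<in> cbox l r") (auto simp: out norm_mult)
      qed
    qed
    moreover have "(LINT y|lebesgue. h y * \<phi> m y) = 0" for m using C[of m] z lr by blast
    ultimately show ?thesis by (simp add: LIMSEQ_const_iff)
  qed
  have local: "AE y in lebesgue. y \<in> cbox a b \<longrightarrow> h y = 0" if ab: "cbox a b \<subseteq> W" for a b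
  proof -
    have "AE y in lebesgue. indicator (box a b) y *\<^sub>R h y = 0"
    proof (rule AE_eq_0_of_box_integrals)
      have "integrable lebesgue (\<lambda>y. indicator (box a b) y *\<^sub>R (indicator (cbox a b) y *\<^sub>R h y))"
        by (rule integrable_mult_indicator[OF _ i[OF ab]]) simp
      moreover have "indicator (box a b) y *\<^sub>R (indicator (cbox a b) y *\<^sub>R h y) = indicator (box a b) y *\<^sub>R h y" for y
        using box_subset_cbox[of a b] by (auto simp: indicator_def)
      ultimately show "integrable lebesgue (\<lambda>y. indicator (box a b) y *\<^sub>R h y)" by (simp only:)
      fix l r :: "real^'n"
      \<comment> \<open>The intersection of boxes is a box. Unless it is empty, its closure lies in
        \<open>cbox a b\<close> and hence in \<open>W\<close>, so \<open>box0\<close>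
        applies.\<close>
      obtain l' r' where lr: "box l r \<inter> box a b = box l' r'" unfolding box_Int_box by blast
      have "indicator (box l r) y *\<^sub>R (indicator (box a b) y *\<^sub>R h y) = indicator (box l' r') y *\<^sub>R h y" for y
        unfolding lr[symmetric] by (simp add: indicator_def)
      moreover have "(LINT y|lebesgue. indicator (box l' r') y *\<^sub>R h y) = 0"
      proof (cases "box l' r' = {}")
        case False
        then have "cbox l' r' = closure (box l' r')" by (simp add: closure_box)
        also have "\<dots> \<subseteq> closure (box a b)" unfolding lr[symmetric] by (rule closure_mono) blast
        also have "\<dots> \<subseteq> cbox a b" by (rule closure_minimal[OF box_subset_cbox closed_cbox])
        finally show ?thesis using box0 ab by blast
      qed simp
      ultimately show "(LINT y|lebesgue. indicator (box l r) y *\<^sub>R (indicator (box a b) y *\<^sub>R h y)) = 0" by (simp only:)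
    qed
    \<comment> \<open>The faces lost in passing to the open box are negligible.\<close>
    moreover have "AE y in lebesgue. y \<notin> cbox a b - box a b"
    proof -
      have "negligible (cbox a b - box a b)" by (rule negligible_frontier_interval)
      then have "cbox a b - box a b \<in> null_sets lebesgue" by (simp only: negligible_iff_null_sets)
      then show ?thesis by (rule AE_not_in)
    qed
    ultimately show ?thesis by eventually_elim (auto simp: indicator_def split: if_splits)
  qed
  obtain \<D> where \<D>: "countable \<D>" "\<D> \<subseteq> Pow W" "\<And>X. X \<in> \<D> \<Longrightarrow> \<exists>a b. X = cbox a b" "\<Union>\<D> = W"
    using open_countable_Union_open_cbox[OF W] by metis
  have "\<forall>X\<in>\<D>. AE y in lebesgue. y \<in> X \<longrightarrow> h y = 0" using local \<D>(2,3) by blast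
  then have "AE y in lebesgue. \<forall>X\<in>\<D>. y \<in> X \<longrightarrow> h y = 0" by (rule AE_ball_countable[THEN iffD2, OF \<D>(1)])
  then show ?thesis by eventually_elim (use \<D>(4) in blast)
qed

section \<open>Green representation and regularity\<close>

locale exterior_cut = exterior_fundamental k R0 u G F F' F'' c C
  for k R0 :: real and u :: "real^'n::finite \<Rightarrow> complex" and G :: "'n \<Rightarrow> real^'n \<Rightarrow> complex"
    and F F' F'' :: "real \<Rightarrow> complex" and c :: complex and C :: real +
  fixes st st' :: "real \<Rightarrow> real" and Ms :: real
  assumes step: "C1_step st st' Ms"
begin

section \<open>Radial cut-offs and Green's formula\<close>

lemmas stD = C1_stepD[OF step]

text \<open>Cut-offs in the variable s = |y|^2: \<open>cin\<close> rises between the radii a and b,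
  \<open>cout\<close> falls between R and 2R, and 3 R^2 is the length of the interval from R^2 to 4
  R^2. The sign is chosen so that \<open>\<beta>\<close>, minus the derivative of
  \<open>cout\<close>, is nonnegative.\<close>

definition cin where "cin a b s = st ((s - a\<^sup>2) / (b\<^sup>2 - a\<^sup>2))"
definition cin' where "cin' a b s = st' ((s - a\<^sup>2) / (b\<^sup>2 - a\<^sup>2)) / (b\<^sup>2 - a\<^sup>2)"
definition cout where "cout R s = st ((4 * R\<^sup>2 - s) / (3 * R\<^sup>2))"
definition \<beta> where "\<beta> R s = st' ((4 * R\<^sup>2 - s) / (3 * R\<^sup>2)) / (3 * R\<^sup>2)"

lemma cut_conts: "continuous_on UNIV (cin' a b)" "continuous_on UNIV (\<beta> R)"
proof -
  have aff: "continuous_on UNIV (\<lambda>s. (s - a\<^sup>2) / (b\<^sup>2 - a\<^sup>2))" "continuous_on UNIV (\<lambda>s. (4 * R\<^sup>2 - s) / (3 * R\<^sup>2))"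
    by (cases "b\<^sup>2 - a\<^sup>2 = 0"; cases "R = 0"; auto intro!: continuous_intros)+
  have div: "continuous_on UNIV (\<lambda>s::real. f s / d)" if "continuous_on UNIV f" for f and d :: real
    using that unfolding divide_inverse by (intro continuous_on_mult continuous_on_const)
  show "continuous_on UNIV (cin' a b)" "continuous_on UNIV (\<beta> R)"
    unfolding cin'_def[abs_def] \<beta>_def[abs_def]
    by (intro div continuous_on_compose2[OF stD(2) aff(1) subset_UNIV] continuous_on_compose2[OF stD(2) aff(2) subset_UNIV])+
qed

lemma cin_values:
  assumes "0 < a" "a < b"
  shows "s \<le> a\<^sup>2 \<Longrightarrow> cin a b s = 0" "s \<le> a\<^sup>2 \<Longrightarrow> cin' a b s = 0" "b\<^sup>2 \<le> s \<Longrightarrow> cin a b s = 1" "b\<^sup>2 \<le> s \<Longrightarrow> cin' a b s = 0"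
proof -
  have p: "b\<^sup>2 - a\<^sup>2 > 0" using assms by (simp add: power_strict_mono)
  show "cin a b s = 0" "cin' a b s = 0" if "s \<le> a\<^sup>2"
  proof -
    have "(s - a\<^sup>2) / (b\<^sup>2 - a\<^sup>2) \<le> 0" using that p by (simp add: divide_nonpos_pos)
    then show "cin a b s = 0" "cin' a b s = 0" by (simp_all add: cin_def cin'_def stD)
  qed
  show "cin a b s = 1" "cin' a b s = 0" if "b\<^sup>2 \<le> s"
  proof -
    have "1 \<le> (s - a\<^sup>2) / (b\<^sup>2 - a\<^sup>2)" using that p by (simp add: le_divide_eq)
    then show "cin a b s = 1" "cin' a b s = 0" by (simp_all add: cin_def cin'_def stD)
  qed
qed

lemma cout_values:
  assumes "R > 0"
  shows "s \<le> R\<^sup>2 \<Longrightarrow> cout R s = 1" "s \<le> R\<^sup>2 \<Longrightarrow> \<beta> R s = 0" "4 * R\<^sup>2 \<le> s \<Longrightarrow> cout R s = 0" "4 * R\<^sup>2 \<le> s \<Longrightarrow> \<beta> R s = 0"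
proof -
  have p: "3 * R\<^sup>2 > 0" using assms by simp
  show "cout R s = 1" "\<beta> R s = 0" if "s \<le> R\<^sup>2"
  proof -
    have "1 \<le> (4 * R\<^sup>2 - s) / (3 * R\<^sup>2)" using that p by (simp add: le_divide_eq)
    then show "cout R s = 1" "\<beta> R s = 0" by (simp_all add: cout_def \<beta>_def stD)
  qed
  show "cout R s = 0" "\<beta> R s = 0" if "4 * R\<^sup>2 \<le> s"
  proof -
    have "(4 * R\<^sup>2 - s) / (3 * R\<^sup>2) \<le> 0" using that p by (simp add: divide_nonpos_pos)
    then show "cout R s = 0" "\<beta> R s = 0" by (simp_all add: cout_def \<beta>_def stD)
  qed
qed

lemma \<beta>_bounds: "0 \<le> \<beta> R s" "R > 0 \<Longrightarrow> \<beta> R s \<le> Ms / (3 * R\<^sup>2)"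
  by (simp_all add: \<beta>_def stD divide_right_mono)

text \<open>For b <= R the transitions do not overlap: where one factor varies, the other is 1. The
  derivative is therefore a difference of two weights, and this difference later separates the inner
  from the outer potential.\<close>

lemma cut_deriv:
  assumes "0 < a" "a < b" "b \<le> R"
  shows "((\<lambda>s. cin a b s * cout R s) has_real_derivative (cin' a b s - \<beta> R s)) (at s)"
proof -
  have R: "R > 0" using assms by simp
  have p: "b\<^sup>2 - a\<^sup>2 > 0" using assms by (simp add: power_strict_mono)
  have bR: "b\<^sup>2 \<le> R\<^sup>2" using assms by (intro power_mono) auto
  have 1: "((\<lambda>s. (s - a\<^sup>2) / (b\<^sup>2 - a\<^sup>2)) has_real_derivative 1 / (b\<^sup>2 - a\<^sup>2)) (at s)"
    using p by (auto intro!: derivative_eq_intros)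
  have 2: "((\<lambda>s. (4 * R\<^sup>2 - s) / (3 * R\<^sup>2)) has_real_derivative - 1 / (3 * R\<^sup>2)) (at s)"
    by (intro DERIV_cdivide) (auto intro!: derivative_eq_intros)
  have ci: "(cin a b has_real_derivative cin' a b s) (at s)"
    using DERIV_chain2[where f=st and g="\<lambda>s. (s - a\<^sup>2) / (b\<^sup>2 - a\<^sup>2)", OF stD(1) 1] by (simp add: cin_def[abs_def] cin'_def)
  have co: "(cout R has_real_derivative - \<beta> R s) (at s)"
    using DERIV_chain2[where f=st and g="\<lambda>s. (4 * R\<^sup>2 - s) / (3 * R\<^sup>2)", OF stD(1) 2] by (simp add: cout_def[abs_def] \<beta>_def)
  have "cin' a b s * cout R s + - \<beta> R s * cin a b s = cin' a b s - \<beta> R s"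
  proof (cases "s \<le> b\<^sup>2")
    case True
    then have "s \<le> R\<^sup>2" using bR by simp
    then show ?thesis using cout_values[OF R] by simp
  next
    case False
    then show ?thesis using cin_values[OF assms(1,2)] by simp
  qed
  then show ?thesis using DERIV_mult[OF ci co] by simp
qed

lemma cutoff_C1c:
  assumes "0 < a" "a < b" "b \<le> R"
  shows "C1c (\<lambda>y::real^'n. of_real (cin a b (y \<bullet> y) * cout R (y \<bullet> y)))
     (\<lambda>j y. of_real (2 * y $ j) * of_real (cin' a b (y \<bullet> y) - \<beta> R (y \<bullet> y))) (cball 0 (2 * R) - ball 0 a)"
  unfolding C1c_def
proof (intro conjI allI impI)
  have R: "R > 0" using assms by simp
  show "compact (cball (0::real^'n) (2 * R) - ball 0 a)" by (intro compact_diff) auto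
  show "has_grad (\<lambda>y::real^'n. complex_of_real (cin a b (y \<bullet> y) * cout R (y \<bullet> y)))
     (\<lambda>j. of_real (2 * y $ j) * of_real (cin' a b (y \<bullet> y) - \<beta> R (y \<bullet> y))) y" for y
    by (rule has_grad_radial[where F="\<lambda>s. of_real (cin a b s * cout R s)"]) (rule has_vector_derivative_of_real[OF cut_deriv[OF assms]])
  have s: "continuous_on UNIV (\<lambda>y::real^'n. y \<bullet> y)" by (intro continuous_intros)
  show "continuous_on UNIV (\<lambda>y::real^'n. complex_of_real (2 * y $ j) * of_real (cin' a b (y \<bullet> y) - \<beta> R (y \<bullet> y)))" for j
    by (intro continuous_on_mult continuous_on_of_real continuous_on_diff continuous_on_compose2[OF cut_conts(1) s subset_UNIV]
        continuous_on_compose2[OF cut_conts(2) s subset_UNIV] continuous_on_const) (intro continuous_intros)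
  fix y :: "real^'n" assume "y \<notin> cball 0 (2 * R) - ball 0 a"
  then consider "2 * R < norm y" | "norm y < a" by (auto simp: not_le)
  then have "cin a b (y \<bullet> y) * cout R (y \<bullet> y) = 0"
  proof cases
    case 1
    then have "(2 * R)\<^sup>2 \<le> (norm y)\<^sup>2" using R by (intro power_mono) auto
    then show ?thesis using cout_values(3)[OF R] by (simp add: power2_norm_eq_inner power_mult_distrib)
  next
    case 2
    then have "(norm y)\<^sup>2 \<le> a\<^sup>2" by (intro power_mono) auto
    then show ?thesis using cin_values(1)[OF assms(1,2)] by (simp add: power2_norm_eq_inner)
  qed
  then show "complex_of_real (cin a b (y \<bullet> y) * cout R (y \<bullet> y)) = 0" by simp
qed

text \<open>A radial cut-off with derivative w in s has gradient 2 y_j w. \<open>Aw\<close> and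
  \<open>Bw\<close> are the single and double layer densities of Green's formula, spread over a
  shell. Both are linear in w, so the inner and the outer potential are one construction applied to
  \<open>cin' a b\<close> and \<open>\<beta> R\<close>.\<close>

definition Aw :: "(real \<Rightarrow> real) \<Rightarrow> real^'n \<Rightarrow> complex" where
  "Aw w y = (\<Sum>j\<in>UNIV. of_real (2 * y $ j) * of_real (w (y \<bullet> y)) * G j y)"
definition Bw :: "(real \<Rightarrow> real) \<Rightarrow> 'n \<Rightarrow> real^'n \<Rightarrow> complex" where
  "Bw w j y = - (of_real (2 * y $ j) * of_real (w (y \<bullet> y)) * u y)"
definition pot :: "(real \<Rightarrow> real) \<Rightarrow> real^'n \<Rightarrow> complex" where
  "pot w x = (LINT y|lebesgue. Aw w y * \<Phi> (y - x) + (\<Sum>j\<in>UNIV. Bw w j y * \<Phi>1 j (y - x)))"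
definition potD :: "(real \<Rightarrow> real) \<Rightarrow> 'n \<Rightarrow> real^'n \<Rightarrow> complex" where
  "potD w i x = (LINT y|lebesgue. - (Aw w y * \<Phi>1 i (y - x) + (\<Sum>j\<in>UNIV. Bw w j y * \<Phi>2 i j (y - x))))"

lemma weight_integrable:
  assumes w: "continuous_on UNIV w" and S: "\<And>y::real^'n. y \<notin> S \<Longrightarrow> w (y \<bullet> y) = 0" "S \<subseteq> cball 0 \<rho>"
  shows "integrable lebesgue (Aw w)" "integrable lebesgue (Bw w j)"
proof -
  have s: "continuous_on UNIV (\<lambda>y::real^'n. y \<bullet> y)" by (intro continuous_intros)
  have c: "continuous_on UNIV (\<lambda>y::real^'n. complex_of_real (2 * y $ j) * of_real (w (y \<bullet> y)))" for j
    by (intro continuous_on_mult continuous_on_of_real continuous_on_compose2[OF w s subset_UNIV] continuous_on_const) (intro continuous_intros)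
  have z: "complex_of_real (2 * y $ j) * of_real (w (y \<bullet> y)) = 0" if "y \<notin> cball 0 \<rho>" for j and y :: "real^'n"
  proof -
    have "y \<notin> S" using S(2) that by blast
    then show ?thesis using S(1) by simp
  qed
  have "Aw w = (\<lambda>y. \<Sum>j\<in>UNIV. G j y * (of_real (2 * y $ j) * of_real (w (y \<bullet> y))))"
    by (simp add: Aw_def[abs_def] mult_ac)
  moreover have "integrable lebesgue (\<lambda>y. G j y * (of_real (2 * y $ j) * of_real (w (y \<bullet> y))))" for j
    by (rule G_integrable[OF c compact_cball[of 0 \<rho>] z])
  ultimately show "integrable lebesgue (Aw w)"
    by (simp only:) (intro Bochner_Integration.integrable_sum)
  have "Bw w j = (\<lambda>y. - (u y * (of_real (2 * y $ j) * of_real (w (y \<bullet> y)))))"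
    by (simp add: Bw_def[abs_def] mult_ac)
  moreover have "integrable lebesgue (\<lambda>y. u y * (of_real (2 * y $ j) * of_real (w (y \<bullet> y))))"
    by (rule u_integrable[OF c compact_cball[of 0 \<rho>] z])
  ultimately show "integrable lebesgue (Bw w j)" by (simp only:) (rule integrable_minus)
qed

lemma pot_grad:
  assumes w: "continuous_on UNIV w" and S: "\<And>y::real^'n. y \<notin> S \<Longrightarrow> w (y \<bullet> y) = 0" "S \<subseteq> cball 0 \<rho>"
    and \<delta>: "\<delta> > 0" "\<And>x y. x \<in> ball x0 \<delta> \<Longrightarrow> y \<in> S \<Longrightarrow> \<delta> \<le> norm (y - x)"
  shows "has_grad (pot w) (\<lambda>i. potD w i x0) x0" "isCont (potD w i) x0"
    "integrable lebesgue (\<lambda>y. Aw w y * \<Phi> (y - x0) + (\<Sum>j\<in>UNIV. Bw w j y * \<Phi>1 j (y - x0)))"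
proof -
  have z: "Aw w y = 0" "Bw w j y = 0" if "y \<notin> S" for j y using S(1)[OF that] by (simp_all add: Aw_def Bw_def)
  note P = potential_grad[OF weight_integrable(1)[OF w S] weight_integrable(2)[OF w S] z S(2) \<delta>]
  show "has_grad (pot w) (\<lambda>i. potD w i x0) x0" "isCont (potD w i) x0"
    "integrable lebesgue (\<lambda>y. Aw w y * \<Phi> (y - x0) + (\<Sum>j\<in>UNIV. Bw w j y * \<Phi>1 j (y - x0)))"
    unfolding pot_def[abs_def] potD_def[abs_def] by (rule P; assumption)+
qed

text \<open>The mass of the approximate Dirac distribution, carried along instead of normalising the
  fundamental solution.\<close>

definition \<kappa> :: complex where "\<kappa> = of_real (2 * real CARD('n) * omega) * c"

lemma \<kappa>0: "\<kappa> \<noteq> 0" using omega_pos c0 by (simp add: \<kappa>_def)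

lemma rep_pot:
  assumes ab: "R0 < a" "a < b" "b \<le> R" and x: "b < norm x" "norm x < R"
  shows "\<kappa> * u x = pot (\<lambda>s. cin' a b s - \<beta> R s) x"
proof -
  have a: "0 < a" using ab R0 by simp
  have R: "R > 0" using a ab by simp
  \<comment> \<open>Within this distance of x both cut-offs are 1, as \<open>representation\<close>
    demands.\<close>
  define d where "d = min (norm x - b) (R - norm x)"
  have "\<kappa> * u x = (LINT y|lebesgue. (\<Sum>j\<in>UNIV. (of_real (2 * y $ j) * of_real (cin' a b (y \<bullet> y) - \<beta> R (y \<bullet> y))) * (G j y * \<Phi> (y - x) - u y * \<Phi>1 j (y - x))))"
    unfolding \<kappa>_def
  proof (rule representation[OF cutoff_C1c[OF a ab(2,3)]])
    show "cball 0 (2 * R) - ball 0 a \<subseteq> {x. R0 < norm x}" using ab by auto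
    show "d > 0" using x by (simp add: d_def)
    show "complex_of_real (cin a b (y \<bullet> y) * cout R (y \<bullet> y)) = 1" if "y \<in> ball x d" for y
    proof -
      have "norm (y - x) < d" using that by (simp add: dist_norm norm_minus_commute)
      then have "b \<le> norm y" "norm y \<le> R"
        using norm_triangle_ineq2[of x y] norm_triangle_ineq2[of y x] by (auto simp: d_def norm_minus_commute)
      then have "b\<^sup>2 \<le> (norm y)\<^sup>2" "(norm y)\<^sup>2 \<le> R\<^sup>2" using a ab by (auto intro!: power_mono)
      then show ?thesis using cin_values(3)[OF a ab(2)] cout_values(1)[OF R] by (simp add: power2_norm_eq_inner)
    qed
    show "R0 < norm x" using ab x by simp
  qed
  also have "\<dots> = pot (\<lambda>s. cin' a b s - \<beta> R s) x" unfolding pot_def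
  proof (rule Bochner_Integration.integral_cong[OF refl])
    fix y :: "real^'n"
    define e where "e j = complex_of_real (2 * y $ j) * of_real (cin' a b (y \<bullet> y) - \<beta> R (y \<bullet> y))" for j
    have "(\<Sum>j\<in>UNIV. e j * (G j y * \<Phi> (y - x) - u y * \<Phi>1 j (y - x))) = (\<Sum>j\<in>UNIV. (e j * G j y) * \<Phi> (y - x) + (- (e j * u y)) * \<Phi>1 j (y - x))"
      by (rule sum.cong) (simp_all add: algebra_simps)
    also have "\<dots> = (\<Sum>j\<in>UNIV. e j * G j y) * \<Phi> (y - x) + (\<Sum>j\<in>UNIV. (- (e j * u y)) * \<Phi>1 j (y - x))"
      by (simp only: sum.distrib sum_distrib_right)
    finally show "(\<Sum>j\<in>UNIV. complex_of_real (2 * y $ j) * of_real (cin' a b (y \<bullet> y) - \<beta> R (y \<bullet> y)) * (G j y * \<Phi> (y - x) - u y * \<Phi>1 j (y - x)))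
       = Aw (\<lambda>s. cin' a b s - \<beta> R s) y * \<Phi> (y - x) + (\<Sum>j\<in>UNIV. Bw (\<lambda>s. cin' a b s - \<beta> R s) j y * \<Phi>1 j (y - x))"
      by (simp only: Aw_def Bw_def e_def)
  qed
  finally show ?thesis .
qed

lemma weight_supports:
  fixes y :: "real^'n"
  assumes "0 < a" "a < b" "0 < R"
  shows "y \<notin> cball 0 b - ball 0 a \<Longrightarrow> cin' a b (y \<bullet> y) = 0" "y \<notin> cball 0 (2 * R) - ball 0 R \<Longrightarrow> \<beta> R (y \<bullet> y) = 0"
proof -
  have sq: "y \<bullet> y = (norm y)\<^sup>2" by (simp add: power2_norm_eq_inner)
  show "cin' a b (y \<bullet> y) = 0" if "y \<notin> cball 0 b - ball 0 a"
  proof (cases "norm y \<le> b")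
    case True
    then have "norm y \<le> a" using that by auto
    then have "(norm y)\<^sup>2 \<le> a\<^sup>2" by (intro power_mono) auto
    then show ?thesis using cin_values(2)[OF assms(1,2)] sq by simp
  next
    case False
    then have "b\<^sup>2 \<le> (norm y)\<^sup>2" using assms by (intro power_mono) auto
    then show ?thesis using cin_values(4)[OF assms(1,2)] sq by simp
  qed
  show "\<beta> R (y \<bullet> y) = 0" if "y \<notin> cball 0 (2 * R) - ball 0 R"
  proof (cases "norm y \<le> 2 * R")
    case True
    then have "norm y \<le> R" using that by auto
    then have "(norm y)\<^sup>2 \<le> R\<^sup>2" by (intro power_mono) auto
    then show ?thesis using cout_values(2)[OF assms(3)] sq by simp
  next
    case False
    then have "(2 * R)\<^sup>2 \<le> (norm y)\<^sup>2" using assms by (intro power_mono) auto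
    then show ?thesis using cout_values(4)[OF assms(3)] sq by (simp add: power_mult_distrib)
  qed
qed

text \<open>Different points need representations with different radii. Choosing a gradient at each
  point gives one global function, and uniqueness of gradients identifies it with every local
  formula.\<close>

definition Du :: "'n \<Rightarrow> real^'n \<Rightarrow> complex" where "Du i x = (SOME g. has_grad u g x) i"

lemma Du_eq:
  assumes "has_grad u g x" shows "Du i x = g i"
  unfolding Du_def by (rule has_grad_unique[OF someI[of "\<lambda>g. has_grad u g x", OF assms] assms])

lemma norm_diff_lower:
  fixes x y :: "real^'n"
  shows "norm y - norm x \<le> norm (y - x)" "norm x - norm y \<le> norm (y - x)"
  using norm_triangle_ineq2[of y x] norm_triangle_ineq2[of x y] by (simp_all add: norm_minus_commute)

text \<open>With radii adapted to \<open>x0\<close> the weight vanishes on a shell around it, so the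
  representation exhibits u there as a potential with distant sources, which is continuously
  differentiable.\<close>

lemma u_C1:
  assumes x0: "norm x0 > R0"
  shows "has_grad u (\<lambda>i. Du i x0) x0" "isCont (Du i) x0"
proof -
  \<comment> \<open>a and b divide the distance from \<open>R0\<close> to the norm of
    \<open>x0\<close> into thirds, which leaves room below \<open>x0\<close>; R leaves room
    above.\<close>
  define a b R where "a = (2 * R0 + norm x0) / 3" and "b = (R0 + 2 * norm x0) / 3" and "R = 2 * norm x0"
  have ab: "R0 < a" "a < b" "b \<le> R" "b < norm x0" "norm x0 < R" "0 < a" "0 < R" using x0 R0 by (auto simp: a_def b_def R_def)
  define w where "w = (\<lambda>s. cin' a b s - \<beta> R s)"
  define S where "S = (cball 0 b - ball 0 a) \<union> (cball 0 (2 * R) - ball (0::real^'n) R)"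
  have wc: "continuous_on UNIV w" unfolding w_def by (intro continuous_on_diff cut_conts)
  have wS: "w (y \<bullet> y) = 0" if "y \<notin> S" for y
    using weight_supports[OF ab(6) ab(2) ab(7), of y] that by (simp add: w_def S_def)
  have Sb: "S \<subseteq> cball 0 (2 * R)" using ab by (auto simp: S_def)
  have P: "has_grad (pot w) (\<lambda>i. potD w i x) x" "isCont (potD w i) x" if x: "b < norm x" "norm x < R" for x i
  proof -
    \<comment> \<open>Half the distance to the sources, so that a whole ball around x stays equally
      far from them.\<close>
    define \<delta> where "\<delta> = min (norm x - b) (R - norm x) / 2"
    have \<delta>: "\<delta> > 0" using x by (simp add: \<delta>_def)
    have far: "\<delta> \<le> norm (y - x')" if "x' \<in> ball x \<delta>" "y \<in> S" for x' y
    proof -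
      have 1: "norm (x' - x) < \<delta>" using that(1) by (simp add: dist_norm norm_minus_commute)
      have 2: "norm y \<le> b \<or> R \<le> norm y" using that(2) by (auto simp: S_def)
      have "2 * \<delta> \<le> norm (y - x)" using 2 norm_diff_lower[where x=x and y=y] by (auto simp: \<delta>_def min_def)
      also have "\<dots> \<le> norm (y - x') + norm (x' - x)" using norm_triangle_ineq[of "y - x'" "x' - x"] by simp
      finally show ?thesis using 1 by linarith
    qed
    note pg = pot_grad[OF wc wS Sb \<delta> far]
    show "has_grad (pot w) (\<lambda>i. potD w i x) x" by (rule pg(1))
    show "isCont (potD w i) x" by (rule pg(2))
  qed
  define V where "V = {x::real^'n. b < norm x \<and> norm x < R}"
  have oV: "open V" unfolding V_def by (intro open_Collect_conj open_Collect_less continuous_intros)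
  have x0V: "x0 \<in> V" using ab by (simp add: V_def)
  have g: "has_grad u (\<lambda>i. potD w i x / \<kappa>) x" if "x \<in> V" for x
  proof -
    have "bounded_linear (\<lambda>z. z / \<kappa>)" by (rule bounded_linear_divide)
    from has_grad_linear[OF this P(1)] have "has_grad (\<lambda>x. pot w x / \<kappa>) (\<lambda>i. potD w i x / \<kappa>) x" using that by (simp add: V_def)
    then show ?thesis
    proof (rule has_grad_cong_ev[OF _ oV that])
      fix y assume "y \<in> V"
      then have "\<kappa> * u y = pot w y" unfolding w_def using ab by (intro rep_pot) (auto simp: V_def)
      then show "pot w y / \<kappa> = u y" using \<kappa>0 by (simp add: field_simps)
    qed
  qed
  have D: "Du i x = potD w i x / \<kappa>" if "x \<in> V" for x i by (rule Du_eq[OF g[OF that]])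
  show "has_grad u (\<lambda>i. Du i x0) x0" using g[OF x0V] by (simp only: D[OF x0V])
  have "isCont (\<lambda>x. potD w i x / \<kappa>) x0" using P(2)[of x0 i] ab \<kappa>0 by (intro continuous_intros) auto
  moreover have "\<forall>\<^sub>F x in nhds x0. potD w i x / \<kappa> = Du i x"
    using eventually_nhds_in_open[OF oV x0V] by (rule eventually_mono) (simp add: D)
  ultimately show "isCont (Du i) x0" by (simp add: isCont_cong)
qed

lemma open_W: "open {x::real^'n. norm x > R0}"
  by (intro open_Collect_less continuous_intros)

lemma Du_cont: "continuous_on {x. norm x > R0} (Du j)"
  by (intro continuous_at_imp_continuous_on ballI u_C1(2)) simp

text \<open>The integral of the partial derivative of \<phi> u vanishes. Comparison with the
  definition of the weak gradient shows that \<open>G j - Du j\<close> is orthogonal to every test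
  function.\<close>

lemma G_eq_Du: "AE y in lebesgue. norm y > R0 \<longrightarrow> G j y = Du j y"
proof -
  define W where "W = {x::real^'n. norm x > R0}"
  have oW: "open W" unfolding W_def by (rule open_W)
  define d where "d y = indicator W y *\<^sub>R Du j y" for y
  have md: "d \<in> borel_measurable borel" unfolding d_def[abs_def]
    by (rule borel_measurable_continuous_on_indicator[OF borel_open[OF oW]]) (use Du_cont in \<open>simp add: W_def\<close>)
  have mdl: "d \<in> borel_measurable lebesgue" using md by (intro measurable_completion) simp
  have "AE y in lebesgue. y \<in> W \<longrightarrow> G j y - d y = 0"
  proof (rule AE_eq_0_of_C1c_integrals[OF oW])
    show "(\<lambda>y. G j y - d y) \<in> borel_measurable lebesgue" by (rule borel_measurable_diff[OF G_meas mdl])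
    have mi: "(\<lambda>y. indicator (cbox l r) y *\<^sub>R f y) \<in> borel_measurable lebesgue" if "f \<in> borel_measurable lebesgue" for f :: "real^'n \<Rightarrow> complex" and l r
      by (intro borel_measurable_scaleR borel_measurable_indicator that) simp
    fix l r :: "real^'n" assume lr: "cbox l r \<subseteq> W"
    have "integrable lebesgue (\<lambda>y. indicator (cbox l r) y *\<^sub>R G j y)"
      by (rule Bochner_Integration.integrable_bound[OF G_l1[OF compact_cbox] mi[OF G_meas]]) (auto intro!: AE_I2)
    moreover have "integrable lebesgue (\<lambda>y. indicator (cbox l r) y *\<^sub>R d y)"
    proof -
      have "integrable lborel (\<lambda>y. indicator (cbox l r) y *\<^sub>R Du j y)"
        by (rule borel_integrable_compact) (use Du_cont continuous_on_subset lr in \<open>auto simp: W_def\<close>)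
      moreover have "indicator (cbox l r) y *\<^sub>R Du j y = indicator (cbox l r) y *\<^sub>R d y" for y
        using lr by (auto simp: d_def indicator_def)
      ultimately have "integrable lborel (\<lambda>y. indicator (cbox l r) y *\<^sub>R d y)" by (simp only:)
      then show ?thesis using integrable_completion[OF borel_measurable_integrable] by blast
    qed
    ultimately show "integrable lebesgue (\<lambda>y. indicator (cbox l r) y *\<^sub>R (G j y - d y))"
      unfolding scaleR_diff_right by (rule Bochner_Integration.integrable_diff)
  next
    fix \<phi> :: "real^'n \<Rightarrow> complex" and \<phi>' K assume \<phi>: "C1c \<phi> \<phi>' K" and KW: "K \<subseteq> W"
    note D = C1cD[OF \<phi>]
    have P: "C1c (\<lambda>y. \<phi> y * u y) (\<lambda>j y. \<phi>' j y * u y + \<phi> y * Du j y) K"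
      by (rule C1c_mult_on[OF \<phi> oW KW]) (use u_C1(1) Du_cont in \<open>auto simp: W_def\<close>)
    have iG: "integrable lebesgue (\<lambda>y. G j y * \<phi> y)" by (rule G_integrable[OF D(4) D(1) D(5)])
    have iu: "integrable lebesgue (\<lambda>y. u y * \<phi>' j y)" by (rule u_integrable[OF D(3) D(1) D(6)])
    have e: "\<phi>' j y * u y + \<phi> y * Du j y - u y * \<phi>' j y = d y * \<phi> y" for y
      using D(5)[of y] KW by (cases "y \<in> K") (auto simp: d_def)
    have i1: "integrable lebesgue (\<lambda>y. \<phi>' j y * u y + \<phi> y * Du j y)"
    proof -
      have "integrable lborel (\<lambda>y. indicator K y *\<^sub>R (\<phi>' j y * u y + \<phi> y * Du j y))"
        by (rule borel_integrable_compact[OF D(1)]) (rule continuous_on_subset[OF C1cD(3)[OF P] subset_UNIV])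
      moreover have "indicator K y *\<^sub>R (\<phi>' j y * u y + \<phi> y * Du j y) = \<phi>' j y * u y + \<phi> y * Du j y" for y
        using D(5,6)[of y] by (cases "y \<in> K") auto
      ultimately have "integrable lborel (\<lambda>y. \<phi>' j y * u y + \<phi> y * Du j y)" by (simp only:)
      then show ?thesis using integrable_completion[OF borel_measurable_integrable] by blast
    qed
    have id: "integrable lebesgue (\<lambda>y. d y * \<phi> y)"
      using Bochner_Integration.integrable_diff[OF i1 iu] by (simp only: e)
    have "(LINT y|lebesgue. d y * \<phi> y) = (LINT y|lebesgue. \<phi>' j y * u y + \<phi> y * Du j y) - (LINT y|lebesgue. u y * \<phi>' j y)"
      using Bochner_Integration.integral_diff[OF i1 iu] by (simp only: e)
    also have "\<dots> = (LINT y|lebesgue. G j y * \<phi> y)"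
      using integral_partial_eq_0[OF P, of j] weak_grad[OF \<phi>, of j] KW by (simp add: W_def)
    finally have "(LINT y|lebesgue. G j y * \<phi> y) - (LINT y|lebesgue. d y * \<phi> y) = 0" by simp
    then show "(LINT y|lebesgue. (G j y - d y) * \<phi> y) = 0"
      unfolding left_diff_distrib by (subst Bochner_Integration.integral_diff[OF iG id])
  qed
  then show ?thesis by eventually_elim (auto simp: W_def d_def)
qed

section \<open>Energy flux\<close>

text \<open>The radial derivative expressed by the weak gradient and, in \<open>Z\<close>, its
  radiation defect. At y = 0 the quotients are 0 by the convention for division.\<close>

definition V :: "real^'n \<Rightarrow> complex" where "V y = (\<Sum>j\<in>UNIV. of_real (y $ j / norm y) * G j y)"
definition Z :: "real^'n \<Rightarrow> complex" where "Z y = V y - \<i> * of_real k * u y"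

lemma x_norm_meas: "(\<lambda>y::real^'n. complex_of_real (y $ j / norm y)) \<in> borel_measurable lebesgue"
proof -
  have "(\<lambda>y::real^'n. y $ j / norm y) \<in> borel_measurable borel"
    by (intro borel_measurable_divide borel_measurable_continuous_onI continuous_intros)
  then have "(\<lambda>y::real^'n. complex_of_real (y $ j / norm y)) \<in> borel_measurable borel" by simp
  then show ?thesis by (intro measurable_completion) simp
qed

lemma VZ_meas [measurable]: "V \<in> borel_measurable lebesgue" "Z \<in> borel_measurable lebesgue" "u \<in> borel_measurable lebesgue"
proof -
  show "V \<in> borel_measurable lebesgue" unfolding V_def[abs_def]
    by (intro borel_measurable_sum borel_measurable_times x_norm_meas G_meas)
  then show "Z \<in> borel_measurable lebesgue" unfolding Z_def[abs_def]
    by (intro borel_measurable_diff borel_measurable_times borel_measurable_const u_meas)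
qed (rule u_meas)

lemma norm_component_ratio: "\<bar>y $ j / norm (y::real^'n)\<bar> \<le> 1"
proof (cases "y = 0")
  case False
  then show ?thesis using component_le_norm_cart[of y j] by (simp add: divide_le_eq)
qed simp

lemma V_sq: "integrable lebesgue (\<lambda>y. indicator (ball 0 R) y * (norm (V y))\<^sup>2)"
proof (rule Bochner_Integration.integrable_bound)
  show "integrable lebesgue (\<lambda>y. \<Sum>j\<in>UNIV. real CARD('n) * (indicator (ball 0 R) y * (norm (G j y))\<^sup>2))"
    by (intro Bochner_Integration.integrable_sum integrable_mult_right G_sq)
  have m: "(\<lambda>y. indicator (ball 0 R) y :: real) \<in> borel_measurable lebesgue" by (intro borel_measurable_indicator) simp
  show "(\<lambda>y. indicator (ball 0 R) y * (norm (V y))\<^sup>2) \<in> borel_measurable lebesgue"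
    by (intro borel_measurable_times m borel_measurable_power measurable_compose[OF VZ_meas(1) borel_measurable_norm])
  show "AE y in lebesgue. norm (indicator (ball 0 R) y * (norm (V y))\<^sup>2) \<le> norm (\<Sum>j\<in>UNIV. real CARD('n) * (indicator (ball 0 R) y * (norm (G j y))\<^sup>2))"
  proof (rule AE_I2)
    fix y :: "real^'n"
    have "norm (V y) \<le> (\<Sum>j\<in>UNIV. norm (G j y))" unfolding V_def
    proof (rule sum_norm_le)
      fix j
      show "norm (of_real (y $ j / norm y) * G j y) \<le> norm (G j y)"
        unfolding norm_mult norm_of_real using mult_right_mono[OF norm_component_ratio[of y j] norm_ge_zero[of "G j y"]] by simp
    qed
    then have "(norm (V y))\<^sup>2 \<le> (\<Sum>j\<in>UNIV. norm (G j y))\<^sup>2" by (intro power_mono) auto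
    also have "\<dots> \<le> (\<Sum>j\<in>UNIV. (norm (G j y))\<^sup>2) * real CARD('n)"
      using sum_squared_le_sum_of_squares[of "\<lambda>j. norm (G j y)" UNIV] by simp
    finally have "(norm (V y))\<^sup>2 \<le> (\<Sum>j\<in>UNIV. real CARD('n) * (norm (G j y))\<^sup>2)"
      by (simp add: sum_distrib_left mult.commute sum_distrib_right)
    then show "norm (indicator (ball 0 R) y * (norm (V y))\<^sup>2) \<le> norm (\<Sum>j\<in>UNIV. real CARD('n) * (indicator (ball 0 R) y * (norm (G j y))\<^sup>2))"
      by (cases "y \<in> ball 0 R") (auto intro: order_trans[OF _ abs_ge_self])
  qed
qed

lemma cs_bound: "norm (a * b) \<le> (norm a)\<^sup>2 + (norm b)\<^sup>2" for a b :: complex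
proof -
  have "0 \<le> (norm a - norm b)\<^sup>2" by simp
  then have "2 * (norm a * norm b) \<le> (norm a)\<^sup>2 + (norm b)\<^sup>2" by (simp add: power2_diff)
  moreover have "0 \<le> norm a * norm b" by simp
  ultimately show ?thesis unfolding norm_mult by linarith
qed

lemma weighted_integrable:
  fixes w :: "real^'n \<Rightarrow> real" and q :: "real^'n \<Rightarrow> real"
  assumes "w \<in> borel_measurable lebesgue" "q \<in> borel_measurable lebesgue" "\<And>y. \<bar>w y\<bar> \<le> b" "\<And>y. y \<notin> ball 0 R \<Longrightarrow> w y = 0"
    and q: "integrable lebesgue Q" "\<And>y. \<bar>indicator (ball 0 R) y * q y\<bar> \<le> Q y"
  shows "integrable lebesgue (\<lambda>y. w y * q y)"
proof (rule Bochner_Integration.integrable_bound[OF integrable_mult_right[OF q(1), of b]])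
  show "(\<lambda>y. w y * q y) \<in> borel_measurable lebesgue" by (intro borel_measurable_times assms)
  show "AE y in lebesgue. norm (w y * q y) \<le> norm (b * Q y)"
  proof (rule AE_I2)
    fix y
    have b0: "0 \<le> b" using assms(3)[of y] by linarith
    show "norm (w y * q y) \<le> norm (b * Q y)"
    proof (cases "y \<in> ball 0 R")
      case True
      then have "\<bar>q y\<bar> \<le> Q y" using q(2)[of y] by simp
      then have "\<bar>w y\<bar> * \<bar>q y\<bar> \<le> b * Q y" using assms(3)[of y] b0 by (intro mult_mono) auto
      then show ?thesis by (simp add: abs_mult[symmetric]) (simp add: abs_mult)?
    qed (simp add: assms(4))
  qed
qed

lemma square_integrables:
  assumes w: "w \<in> borel_measurable lebesgue" "\<And>y. \<bar>w y\<bar> \<le> b" "\<And>y. y \<notin> ball 0 R \<Longrightarrow> w y = 0"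
  shows "integrable lebesgue (\<lambda>y. w y * (norm (u y))\<^sup>2)" "integrable lebesgue (\<lambda>y. w y * (norm (V y))\<^sup>2)"
    "integrable lebesgue (\<lambda>y. w y * (norm (Z y))\<^sup>2)" "integrable lebesgue (\<lambda>y. w y * Im (V y * cnj (u y)))"
proof -
  have i: "integrable lebesgue (\<lambda>y. a * (indicator (ball 0 R) y * (norm (V y))\<^sup>2) + a' * (indicator (ball 0 R) y * (norm (u y))\<^sup>2))" for a a'
    by (intro Bochner_Integration.integrable_add integrable_mult_right V_sq u_sq)
  have W: "integrable lebesgue (\<lambda>y. w y * q y)" if "q \<in> borel_measurable lebesgue"
    "\<And>y. \<bar>indicator (ball 0 R) y * q y\<bar> \<le> a * (indicator (ball 0 R) y * (norm (V y))\<^sup>2) + a' * (indicator (ball 0 R) y * (norm (u y))\<^sup>2)" for q a a'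
    by (rule weighted_integrable[OF w(1) that(1) w(2,3) i that(2)])
  show "integrable lebesgue (\<lambda>y. w y * (norm (u y))\<^sup>2)"
    using W[of "\<lambda>y. (norm (u y))\<^sup>2" 0 1] by (simp add: abs_mult)
  show "integrable lebesgue (\<lambda>y. w y * (norm (V y))\<^sup>2)"
    using W[of "\<lambda>y. (norm (V y))\<^sup>2" 1 0] by (simp add: abs_mult)
  show "integrable lebesgue (\<lambda>y. w y * (norm (Z y))\<^sup>2)"
  proof (rule W[of _ 2 "2 * k\<^sup>2"])
    show "\<bar>indicator (ball 0 R) y * (norm (Z y))\<^sup>2\<bar> \<le> 2 * (indicator (ball 0 R) y * (norm (V y))\<^sup>2) + 2 * k\<^sup>2 * (indicator (ball 0 R) y * (norm (u y))\<^sup>2)" for y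
    proof -
      have "norm (Z y) \<le> norm (V y) + k * norm (u y)"
        using norm_triangle_ineq4[of "V y" "\<i> * of_real k * u y"] k by (simp add: Z_def norm_mult)
      then have "(norm (Z y))\<^sup>2 \<le> (norm (V y) + k * norm (u y))\<^sup>2" by (intro power_mono) auto
      also have "\<dots> \<le> 2 * (norm (V y))\<^sup>2 + 2 * (k * norm (u y))\<^sup>2"
        using zero_le_power2[of "norm (V y) - k * norm (u y)"] by (simp add: power2_sum power2_diff)
      finally show ?thesis by (simp add: indicator_def power_mult_distrib)
    qed
  qed simp
  show "integrable lebesgue (\<lambda>y. w y * Im (V y * cnj (u y)))"
  proof (rule W[of _ 1 1])
    show "(\<lambda>y. Im (V y * cnj (u y))) \<in> borel_measurable lebesgue" by simp
    show "\<bar>indicator (ball 0 R) y * Im (V y * cnj (u y))\<bar> \<le> 1 * (indicator (ball 0 R) y * (norm (V y))\<^sup>2) + 1 * (indicator (ball 0 R) y * (norm (u y))\<^sup>2)" for y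
      using order_trans[OF abs_Im_le_cmod cs_bound[of "V y" "cnj (u y)"]] by (simp add: indicator_def)
  qed
qed

lemma radial_weight_meas: "continuous_on UNIV w \<Longrightarrow> (\<lambda>y::real^'n. w (y \<bullet> y) * norm y) \<in> borel_measurable lebesgue"
proof -
  assume w: "continuous_on UNIV w"
  have "continuous_on UNIV (\<lambda>y::real^'n. y \<bullet> y)" by (intro continuous_intros)
  then have "continuous_on UNIV (\<lambda>y::real^'n. w (y \<bullet> y) * norm y)"
    by (intro continuous_on_mult continuous_on_compose2[OF w _ subset_UNIV]) (intro continuous_intros)+
  then show ?thesis by (rule borel_measurable_lebesgue_continuous)
qed

text \<open>Half the modulus of the gradient of the outer cut-off: the factor |y| converts a
  derivative in s = |y|^2 into one in the radius. Its size on the shell is at most of order 1/R, so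
  integrating against it amounts to averaging surface integrals over the radii from R to 2R.\<close>

definition wt :: "real \<Rightarrow> real^'n \<Rightarrow> real" where "wt R y = \<beta> R (y \<bullet> y) * norm y"

lemma wt_props:
  assumes R: "R > 0"
  shows "wt R \<in> borel_measurable lebesgue" "0 \<le> wt R y" "wt R y \<le> Ms / R" "y \<notin> cball 0 (2 * R) - ball 0 R \<Longrightarrow> wt R y = 0"
proof -
  show "wt R \<in> borel_measurable lebesgue" unfolding wt_def[abs_def] by (rule radial_weight_meas[OF cut_conts(2)])
  show "0 \<le> wt R y" by (simp add: wt_def \<beta>_bounds(1))
  show z: "wt R y = 0" if "y \<notin> cball 0 (2 * R) - ball 0 R" for y
    using weight_supports(2)[of "R/2" R R y] R that by (simp add: wt_def)
  have Ms: "Ms \<ge> 0" using stD(6,7) order_trans by blast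
  show "wt R y \<le> Ms / R"
  proof (cases "y \<in> cball 0 (2 * R) - ball 0 R")
    case True
    then have "norm y \<le> 2 * R" by simp
    then have "wt R y \<le> (Ms / (3 * R\<^sup>2)) * (2 * R)" unfolding wt_def using Ms R by (intro mult_mono \<beta>_bounds) auto
    also have "\<dots> = (2 / 3) * (Ms / R)" using R by (simp add: power2_eq_square)
    also have "\<dots> \<le> Ms / R" using mult_right_mono[of "2/3" 1 "Ms / R"] Ms R by simp
    finally show ?thesis .
  qed (use Ms R z in simp)
qed

definition NR where "NR R = (LINT y|lebesgue. wt R y * (norm (u y))\<^sup>2)"
text \<open>\<open>QR R \<longrightarrow> 0\<close> is the averaged radiation condition through which both conditions factor.\<close>

definition QR where "QR R = (LINT y|lebesgue. wt R y * (norm (Z y))\<^sup>2)"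

lemma wt_abs: "R > 0 \<Longrightarrow> \<bar>wt R y\<bar> \<le> Ms / R" "R > 0 \<Longrightarrow> y \<notin> ball 0 (2 * R + 1) \<Longrightarrow> wt R y = 0"
  using wt_props(2,3)[where R=R and y=y] wt_props(4)[where R=R and y=y] by auto

lemma cin'_bound: "0 < a \<Longrightarrow> a < b \<Longrightarrow> \<bar>cin' a b (y \<bullet> y) * norm (y::real^'n)\<bar> \<le> Ms / (b\<^sup>2 - a\<^sup>2) * b"
proof -
  assume ab: "0 < a" "a < b"
  then have p: "b\<^sup>2 - a\<^sup>2 > 0" by (simp add: power_strict_mono)
  have Ms: "Ms \<ge> 0" using stD(6,7) order_trans by blast
  have c: "0 \<le> cin' a b s" "cin' a b s \<le> Ms / (b\<^sup>2 - a\<^sup>2)" for s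
    unfolding cin'_def using p stD(6,7) by (auto intro!: divide_nonneg_pos divide_right_mono)
  show ?thesis
  proof (cases "y \<in> cball 0 b - ball 0 a")
    case True
    then show ?thesis using c[of "y \<bullet> y"] Ms p unfolding abs_mult by (intro mult_mono) auto
  next
    case False
    then show ?thesis using weight_supports(1)[of a b 1 y] ab Ms p by simp
  qed
qed

lemma inner_weight:
  assumes "0 < a" "a < b"
  shows "integrable lebesgue (\<lambda>y. (cin' a b (y \<bullet> y) * norm y) * Im (V y * cnj (u y)))"
proof (rule square_integrables(4)[where R="b + 1"])
  show "(\<lambda>y::real^'n. cin' a b (y \<bullet> y) * norm y) \<in> borel_measurable lebesgue" by (rule radial_weight_meas[OF cut_conts(1)])
  show "\<bar>cin' a b (y \<bullet> y) * norm y\<bar> \<le> Ms / (b\<^sup>2 - a\<^sup>2) * b" for y :: "real^'n" by (rule cin'_bound[OF assms])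
  show "cin' a b (y \<bullet> y) * norm y = 0" if "y \<notin> ball 0 (b + 1)" for y :: "real^'n"
    using weight_supports(1)[of a b 1 y] assms that by simp
qed

text \<open>Since u is C1, the cut-off times the conjugate of u is an admissible test function. The
  terms with the squared gradient and with k^2 |u|^2 are real, so the imaginary part of the weak
  equation contains only the flux through the two transition zones.\<close>

lemma flux_balance:
  assumes ab: "R0 < a" "a < b" "b \<le> R"
  shows "(LINT y|lebesgue. wt R y * Im (V y * cnj (u y))) = (LINT y|lebesgue. (cin' a b (y \<bullet> y) * norm y) * Im (V y * cnj (u y)))"
proof -
  have a: "0 < a" "0 < R" "0 < b" using ab R0 by auto
  define W where "W = {x::real^'n. norm x > R0}"
  have oW: "open W" unfolding W_def by (rule open_W)
  have iw: "integrable lebesgue (\<lambda>y. wt R y * Im (V y * cnj (u y)))"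
    by (rule square_integrables(4)[OF wt_props(1)[OF a(2)] wt_abs(1)[OF a(2)] wt_abs(2)[OF a(2)]])
  have i1: "integrable lebesgue (\<lambda>y. (cin' a b (y \<bullet> y) * norm y) * Im (V y * cnj (u y)))"
    using inner_weight[OF a(1) ab(2)] by blast
  define K where "K = cball (0::real^'n) (2 * R) - ball 0 a"
  have KW: "K \<subseteq> W" using ab by (auto simp: K_def W_def)
  define w where "w s = cin' a b s - \<beta> R s" for s
  have wm: "(\<lambda>y::real^'n. w (y \<bullet> y) * norm y) \<in> borel_measurable lebesgue"
    unfolding w_def by (intro radial_weight_meas continuous_on_diff cut_conts)
  define \<zeta> where "\<zeta> y = cin a b (y \<bullet> y) * cout R (y \<bullet> y)" for y :: "real^'n"
  define \<zeta>' where "\<zeta>' j y = complex_of_real (2 * y $ j) * of_real (w (y \<bullet> y))" for j and y :: "real^'n"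
  have C: "C1c (\<lambda>y. of_real (\<zeta> y)) \<zeta>' K" using cutoff_C1c[OF a(1) ab(2,3)] unfolding \<zeta>_def K_def \<zeta>'_def[abs_def] w_def .
  note D = C1cD[OF C]
  have P: "C1c (\<lambda>y. of_real (\<zeta> y) * cnj (u y)) (\<lambda>j y. \<zeta>' j y * cnj (u y) + of_real (\<zeta> y) * cnj (Du j y)) K"
  proof (rule C1c_mult_on[OF C oW KW])
    show "has_grad (\<lambda>y. cnj (u y)) (\<lambda>j. cnj (Du j y)) y" if "y \<in> W" for y
      by (rule has_grad_linear[OF bounded_linear_cnj u_C1(1)]) (use that in \<open>simp add: W_def\<close>)
    show "continuous_on W (\<lambda>y. cnj (Du j y))" for j using Du_cont by (intro continuous_on_cnj) (simp add: W_def)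
  qed
  note DP = C1cD[OF P]
  define E where "E y = (\<Sum>j\<in>UNIV. G j y * (\<zeta>' j y * cnj (u y) + of_real (\<zeta> y) * cnj (Du j y))) - of_real (k\<^sup>2) * u y * (of_real (\<zeta> y) * cnj (u y))" for y
  have "(LINT y|lebesgue. E y) = 0" unfolding E_def by (rule weak_eq[OF P]) (use KW in \<open>simp add: W_def\<close>)
  moreover have iE: "integrable lebesgue E"
  proof -
    have "integrable lebesgue (\<lambda>y. u y * (of_real (\<zeta> y) * cnj (u y)))" by (rule u_integrable[OF DP(4,1,5)])
    moreover have "integrable lebesgue (\<lambda>y. G j y * (\<zeta>' j y * cnj (u y) + of_real (\<zeta> y) * cnj (Du j y)))" for j
      by (rule G_integrable[OF DP(3,1,6)])
    ultimately show ?thesis unfolding E_def[abs_def] mult.assoc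
      by (intro Bochner_Integration.integrable_diff Bochner_Integration.integrable_sum integrable_mult_right)
  qed
  ultimately have "(LINT y|lebesgue. Im (E y)) = 0" by simp
  moreover have "AE y in lebesgue. Im (E y) = 2 * ((w (y \<bullet> y) * norm y) * Im (V y * cnj (u y)))"
  proof -
    have "AE y in lebesgue. \<forall>j. norm y > R0 \<longrightarrow> G j y = Du j y"
      unfolding AE_all_countable by (rule allI[OF G_eq_Du])
    then show ?thesis
    proof eventually_elim
      case (elim y)
      \<comment> \<open>On \<open>K\<close> the weak gradient is the classical one and the product
        is a real multiple of a square; elsewhere the cut-off vanishes.\<close>
      have r: "Im (of_real (\<zeta> y) * (G j y * cnj (Du j y))) = 0" for j
      proof (cases "y \<in> K")
        case True
        then have "G j y = Du j y" using elim KW by (auto simp: W_def)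
        then show ?thesis by simp
      next
        case False then have "\<zeta> y = 0" using D(5)[of y] by simp
        then show ?thesis by simp
      qed
      have uu: "Im (of_real (k\<^sup>2) * u y * (of_real (\<zeta> y) * cnj (u y))) = 0"
        by simp
      have nV: "of_real (norm y) * V y = (\<Sum>j\<in>UNIV. of_real (y $ j) * G j y)"
      proof (cases "y = 0")
        case False
        then show ?thesis unfolding V_def by (simp add: sum_distrib_left)
      qed simp
      have "E y = (\<Sum>j\<in>UNIV. G j y * \<zeta>' j y * cnj (u y)) + (\<Sum>j\<in>UNIV. of_real (\<zeta> y) * (G j y * cnj (Du j y))) - of_real (k\<^sup>2) * u y * (of_real (\<zeta> y) * cnj (u y))"
        unfolding E_def sum.distrib[symmetric] by (simp add: algebra_simps)
      also have "(\<Sum>j\<in>UNIV. G j y * \<zeta>' j y * cnj (u y)) = (2 * of_real (w (y \<bullet> y)) * cnj (u y)) * (\<Sum>j\<in>UNIV. of_real (y $ j) * G j y)"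
        unfolding sum_distrib_left by (rule sum.cong) (simp_all add: \<zeta>'_def mult_ac)
      also have "\<dots> = of_real (2 * (w (y \<bullet> y) * norm y)) * (V y * cnj (u y))"
        unfolding nV[symmetric] by (simp add: mult_ac)
      finally have "Im (E y) = Im (of_real (2 * (w (y \<bullet> y) * norm y)) * (V y * cnj (u y)))"
        using uu r by (simp only: minus_complex.sel plus_complex.sel Im_sum sum.neutral_const)
      also have "\<dots> = 2 * (w (y \<bullet> y) * norm y) * Im (V y * cnj (u y))" by simp
      finally show ?case by simp
    qed
  qed
  ultimately have z: "(LINT y|lebesgue. 2 * ((w (y \<bullet> y) * norm y) * Im (V y * cnj (u y)))) = 0"
    using integral_cong_AE[of "\<lambda>y. Im (E y)" lebesgue "\<lambda>y. 2 * ((w (y \<bullet> y) * norm y) * Im (V y * cnj (u y)))"]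
      borel_measurable_integrable[OF iE] wm by simp
  have "(LINT y|lebesgue. (cin' a b (y \<bullet> y) * norm y) * Im (V y * cnj (u y)) - wt R y * Im (V y * cnj (u y))) = 0"
    using z unfolding integral_mult_right_zero w_def wt_def left_diff_distrib by (simp only: mult_eq_0_iff) (simp only: zero_neq_numeral[symmetric] simp_thms)
  then show ?thesis
    using Bochner_Integration.integral_diff[OF i1 iw] by (simp only: right_minus_eq)
qed

section \<open>Decay of the outer potential\<close>

text \<open>The amplitude of a spherical wave: its square times the area of the sphere of radius r
  does not depend on r.\<close>

definition dec :: "real \<Rightarrow> real" where "dec r = r powr (- (real CARD('n) - 1) / 2)"

lemma dec_nonneg: "0 \<le> dec r"
  by (simp add: dec_def)

lemma card_ge_1: "1 \<le> real CARD('n)"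
  using zero_less_card_finite[where 'a='n] by (simp add: Suc_le_eq)

lemma dec_antimono: "0 < r \<Longrightarrow> r \<le> s \<Longrightarrow> dec s \<le> dec r"
  unfolding dec_def by (rule powr_mono2') (use card_ge_1 in auto)

lemma dec_half: "0 < r \<Longrightarrow> dec (r / 2) = 2 powr ((real CARD('n) - 1) / 2) * dec r"
proof -
  assume r: "0 < r"
  have gen: "(r / 2) powr (- p) = 2 powr p * r powr (- p)" for p using r by (simp add: powr_divide powr_minus field_simps)
  have e: "- (real CARD('n) - 1) / 2 = - ((real CARD('n) - 1) / 2)" by (rule minus_divide_left[symmetric])
  show ?thesis unfolding dec_def e by (rule gen)
qed

lemma dec_square: "r > 0 \<Longrightarrow> (dec r)\<^sup>2 * r ^ CARD('n) = r"
proof -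
  assume r: "r > 0"
  have "(dec r)\<^sup>2 * r ^ CARD('n) = r powr (- (real CARD('n) - 1) / 2 + - (real CARD('n) - 1) / 2 + real CARD('n))"
    using r by (simp only: dec_def power2_eq_square powr_add powr_realpow)
  also have "- (real CARD('n) - 1) / 2 + - (real CARD('n) - 1) / 2 + real CARD('n) = 1" by (simp add: field_simps)
  finally show ?thesis using r by simp
qed

lemma C_nonneg: "0 \<le> C"
proof -
  have "norm (F (1\<^sup>2)) \<le> C * 1 powr (- (real CARD('n) - 1) / 2)" using fund unfolding fundamental_radial_def by blast
  then show ?thesis using order_trans[OF norm_ge_zero] by fastforce
qed

text \<open>Differentiating the kernel multiplies it by ik times the direction, up to one more power
  of 1/r. For first derivatives this is the radiation condition on F. For second derivatives the
  differential equation replaces F'' by F' and F, and the term n F' so produced is already of the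
  smaller order.\<close>

lemma kernel_far:
  "\<exists>M\<ge>0. \<forall>z i j. 1 \<le> norm z \<longrightarrow> norm (\<Phi> z) \<le> M * dec (norm z) \<and> norm (\<Phi>1 j z) \<le> M * dec (norm z)
     \<and> norm (\<Phi>1 j z - \<i> * of_real k * of_real (z $ j / norm z) * \<Phi> z) \<le> M * (dec (norm z) / norm z)
     \<and> norm (\<Phi>2 i j z - \<i> * of_real k * of_real (z $ i / norm z) * \<Phi>1 j z) \<le> M * (dec (norm z) / norm z)"
proof -
  define n where "n = real CARD('n)"
  \<comment> \<open>\<open>E1\<close> bounds the radial derivative by the triangle inequality;
    \<open>E2\<close> adds the diagonal term of the Hessian and the cost of eliminating F''.\<close>
  define E1 E2 where "E1 = C * (1 + k)" and "E2 = E1 + (n * E1 + k * C)"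
  have n: "n \<ge> 1" unfolding n_def by (rule card_ge_1)
  have E1: "E1 \<ge> 0" using C_nonneg k by (simp add: E1_def)
  have E2: "E2 \<ge> E1" using C_nonneg k n E1 by (simp add: E2_def)
  have E1C: "C \<le> E1" using C_nonneg k by (simp add: E1_def distrib_left)
  have main: "norm (\<Phi> z) \<le> E2 * dec (norm z) \<and> norm (\<Phi>1 j z) \<le> E2 * dec (norm z)
     \<and> norm (\<Phi>1 j z - \<i> * of_real k * of_real (z $ j / norm z) * \<Phi> z) \<le> E2 * (dec (norm z) / norm z)
     \<and> norm (\<Phi>2 i j z - \<i> * of_real k * of_real (z $ i / norm z) * \<Phi>1 j z) \<le> E2 * (dec (norm z) / norm z)"
    if z: "1 \<le> norm z" for z :: "real^'n" and i j
  proof -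
    define r where "r = norm z"
    have r: "r \<ge> 1" "r > 0" "r \<noteq> 0" using z by (auto simp: r_def)
    have zz: "z \<bullet> z = r\<^sup>2" by (simp add: r_def power2_norm_eq_inner)
    define q where "q j = complex_of_real (z $ j / r)" for j
    have q: "norm (q j) \<le> 1" for j using norm_component_ratio[of z j] by (simp only: q_def r_def norm_of_real)
    \<comment> \<open>With h(r) = F(r^2) these are h, h' and h'' - h'/r.\<close>
    define g g1 g2 where "g = F (r\<^sup>2)" and "g1 = of_real (2 * r) * F' (r\<^sup>2)" and "g2 = of_real (4 * r\<^sup>2) * F'' (r\<^sup>2)"
    define d where "d = dec r"
    have d0: "0 \<le> d" by (simp add: d_def dec_nonneg)
    have dr: "d / r \<le> d" using r(1) d0 by (simp add: divide_le_eq mult_le_cancel_left1)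
    have dr0: "0 \<le> d / r" using d0 r by simp
    have FB: "norm (F (r\<^sup>2)) \<le> C * r powr (- (real CARD('n) - 1) / 2) \<and> norm (of_real (2 * r) * F' (r\<^sup>2) - \<i> * of_real k * F (r\<^sup>2)) \<le> C * r powr (- (real CARD('n) + 1) / 2)"
      using fund r(1) unfolding fundamental_radial_def by blast
    have b1: "norm g \<le> C * d" using FB by (simp add: g_def d_def dec_def)
    have "r powr (- (real CARD('n) + 1) / 2) = r powr (- (real CARD('n) - 1) / 2 + - 1)" by (simp add: field_simps)
    also have "\<dots> = d / r" unfolding powr_add d_def dec_def using r by (simp add: powr_minus divide_simps)
    finally have b2: "norm (g1 - \<i> * of_real k * g) \<le> C * (d / r)" using FB by (simp add: g_def g1_def)
    have b3: "norm g1 \<le> E1 * d"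
    proof -
      have "norm g1 \<le> norm (g1 - \<i> * of_real k * g) + norm (\<i> * of_real k * g)" using norm_triangle_ineq[of "g1 - \<i> * of_real k * g" "\<i> * of_real k * g"] by simp
      also have "\<dots> \<le> C * d + k * (C * d)"
        using b2 b1 k order_trans[OF b2 mult_left_mono[OF dr C_nonneg]] by (intro add_mono) (auto simp: norm_mult)
      finally show ?thesis by (simp add: E1_def algebra_simps)
    qed
    have b4: "norm (g2 - \<i> * of_real k * g1) \<le> (n * E1 + k * C) * (d / r)"
    proof -
      have "g2 + of_real (2 * n) * F' (r\<^sup>2) + of_real (k\<^sup>2) * g = 0"
        using F_ode[of "r\<^sup>2"] r by (simp add: g2_def g_def n_def)
      moreover have "of_real (2 * n) * F' (r\<^sup>2) = of_real (n / r) * g1" using r(3) by (simp add: g1_def)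
      ultimately have "g2 = - (of_real (n / r) * g1) - of_real (k\<^sup>2) * g" by (simp add: algebra_simps eq_neg_iff_add_eq_0)
      moreover have "of_real (k\<^sup>2) * g = - (\<i> * of_real k * (\<i> * of_real k * g))" by (simp add: power2_eq_square algebra_simps)
      ultimately have "g2 - \<i> * of_real k * g1 = - (of_real (n / r) * g1) - \<i> * of_real k * (g1 - \<i> * of_real k * g)"
        by (simp only: right_diff_distrib) (simp add: algebra_simps)
      then have "norm (g2 - \<i> * of_real k * g1) \<le> norm (of_real (n / r) * g1) + norm (\<i> * of_real k * (g1 - \<i> * of_real k * g))"
        using norm_triangle_ineq4[of "- (of_real (n / r) * g1)"] by (simp only: norm_minus_cancel)
      also have "\<dots> = (n / r) * norm g1 + k * norm (g1 - \<i> * of_real k * g)"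
        unfolding norm_mult norm_of_real norm_ii using n r k by simp
      also have "\<dots> \<le> (n / r) * (E1 * d) + k * (C * (d / r))"
        using b2 b3 n r k by (intro add_mono mult_left_mono) auto
      finally show ?thesis by (simp add: algebra_simps)
    qed
    have P: "\<Phi> z = g" "\<Phi>1 j z = q j * g1" for j using r(3) by (simp_all add: \<Phi>_def \<Phi>1_def zz g_def g1_def q_def)
    have P2: "\<Phi>2 i j z = (if i = j then of_real (1 / r) * g1 else 0) + q i * q j * g2"
    proof -
      have e1: "2 * F' (r\<^sup>2) = of_real (1 / r) * g1" using r(3) by (simp add: g1_def)
      have e2: "of_real (4 * z $ i * z $ j) * F'' (r\<^sup>2) = q i * q j * g2"
        using r(3) by (simp add: q_def g2_def power2_eq_square)
      show ?thesis unfolding \<Phi>2_def zz e1 e2 ..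
    qed
    have A: "norm (q j * (g1 - \<i> * of_real k * g)) \<le> C * (d / r)"
      using mult_mono[OF q b2] by (simp add: norm_mult)
    have B: "norm (q i * q j * (g2 - \<i> * of_real k * g1)) \<le> (n * E1 + k * C) * (d / r)"
      using mult_mono[OF mult_mono[OF q[of i] q[of j]] b4] by (simp add: norm_mult)
    have "norm (\<Phi>2 i j z - \<i> * of_real k * q i * \<Phi>1 j z) = norm ((if i = j then of_real (1 / r) * g1 else 0) + q i * q j * (g2 - \<i> * of_real k * g1))"
      unfolding P P2 by (simp add: algebra_simps)
    also have "\<dots> \<le> norm (if i = j then of_real (1 / r) * g1 else 0) + norm (q i * q j * (g2 - \<i> * of_real k * g1))" by (rule norm_triangle_ineq)
    also have "norm (if i = j then of_real (1 / r) * g1 else 0) \<le> E1 * (d / r)"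
    proof (cases "i = j")
      case True
      have "norm (of_real (1 / r) * g1) = (1 / r) * norm g1" unfolding norm_mult norm_of_real using r by simp
      also have "\<dots> \<le> (1 / r) * (E1 * d)" by (rule mult_left_mono[OF b3]) (use r in simp)
      finally show ?thesis using True by simp
    next
      case False
      then show ?thesis using mult_nonneg_nonneg[OF E1 dr0] by simp
    qed
    finally have 4: "norm (\<Phi>2 i j z - \<i> * of_real k * q i * \<Phi>1 j z) \<le> E2 * (d / r)" using B unfolding E2_def by (simp only: distrib_right) linarith
    have "norm (\<Phi>1 j z - \<i> * of_real k * q j * \<Phi> z) = norm (q j * (g1 - \<i> * of_real k * g))"
      unfolding P by (simp add: algebra_simps)
    also have "\<dots> \<le> E2 * (d / r)" by (rule order_trans[OF A mult_right_mono[OF _ dr0]]) (use E2 E1C in simp)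
    finally have 3: "norm (\<Phi>1 j z - \<i> * of_real k * q j * \<Phi> z) \<le> E2 * (d / r)" .
    have 2: "norm (\<Phi>1 j z) \<le> E2 * d"
      using mult_mono[OF q[of j] order_trans[OF b3 mult_right_mono[OF E2 d0]]] by (simp add: P norm_mult)
    have 1: "norm (\<Phi> z) \<le> E2 * d" unfolding P by (rule order_trans[OF b1 mult_right_mono[OF _ d0]]) (use E2 E1C in simp)
    show ?thesis using 1 2 3 4 unfolding d_def q_def r_def by (intro conjI)
  qed
  have "0 \<le> E2" using E1 E2 by simp
  then show ?thesis using main by (intro exI[of _ E2]) blast
qed

text \<open>The difference of directions is the direction of w + h times a relative change of
  length, plus a component of h over |w|; each of the two costs at most |h| / |w|.\<close>

lemma direction_shift:
  fixes w h :: "real^'n"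
  assumes "0 < norm w" "2 * norm h \<le> norm w"
  shows "norm w / 2 \<le> norm (w + h)" "\<bar>(w + h) $ j / norm (w + h) - w $ j / norm w\<bar> \<le> 2 * norm h / norm w"
proof -
  have 1: "norm w - norm h \<le> norm (w + h)" using norm_triangle_ineq2[of w "- h"] by simp
  have 2: "\<bar>norm w - norm (w + h)\<bar> \<le> norm h" using norm_triangle_ineq3[of w "w + h"] by simp
  show half: "norm w / 2 \<le> norm (w + h)" using 1 assms by linarith
  then have z: "norm (w + h) > 0" using assms by linarith
  have "(w + h) $ j / norm (w + h) - w $ j / norm w = ((w + h) $ j / norm (w + h)) * ((norm w - norm (w + h)) / norm w) + h $ j / norm w"
  proof -
    have "((w + h) $ j / norm (w + h)) * ((norm w - norm (w + h)) / norm w) = (w + h) $ j / norm (w + h) - (w + h) $ j / norm w"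
      using z assms by (simp add: right_diff_distrib diff_divide_distrib)
    then show ?thesis by (simp add: add_divide_distrib)
  qed
  also have "\<bar>\<dots>\<bar> \<le> \<bar>(w + h) $ j / norm (w + h)\<bar> * (\<bar>norm w - norm (w + h)\<bar> / norm w) + \<bar>h $ j\<bar> / norm w"
    by (rule order_trans[OF abs_triangle_ineq]) (simp add: abs_mult)
  also have "\<dots> \<le> 1 * (norm h / norm w) + norm h / norm w"
    using 2 assms component_le_norm_cart[of h j] by (intro add_mono mult_mono norm_component_ratio divide_right_mono) auto
  finally show "\<bar>(w + h) $ j / norm (w + h) - w $ j / norm w\<bar> \<le> 2 * norm h / norm w" by simp
qed

text \<open>The direction of the argument w + h is replaced by that of w at the price of a factor 1
  + |h|. Two uses are intended: w = y and h = -x for distant sources, w = -x and h = y for a distant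
  point.\<close>

lemma kernel_shift:
  "\<exists>M\<ge>0. \<forall>w h i j. 2 \<le> norm w \<longrightarrow> 2 * norm h \<le> norm w \<longrightarrow> norm (\<Phi> (w + h)) \<le> M * dec (norm w)
     \<and> norm (\<Phi>1 j (w + h) - \<i> * of_real k * of_real (w $ j / norm w) * \<Phi> (w + h)) \<le> M * (1 + norm h) * (dec (norm w) / norm w)
     \<and> norm (\<Phi>2 i j (w + h) - \<i> * of_real k * of_real (w $ i / norm w) * \<Phi>1 j (w + h)) \<le> M * (1 + norm h) * (dec (norm w) / norm w)"
proof -
  obtain M where M: "M \<ge> 0" and far: "\<And>z i j. 1 \<le> norm z \<Longrightarrow> norm (\<Phi> z) \<le> M * dec (norm z) \<and> norm (\<Phi>1 j z) \<le> M * dec (norm z)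
     \<and> norm (\<Phi>1 j z - \<i> * of_real k * of_real (z $ j / norm z) * \<Phi> z) \<le> M * (dec (norm z) / norm z)
     \<and> norm (\<Phi>2 i j z - \<i> * of_real k * of_real (z $ i / norm z) * \<Phi>1 j z) \<le> M * (dec (norm z) / norm z)"
    using kernel_far by blast
  \<comment> \<open>The argument has at least half the length of w, and halving the radius changes
    \<open>dec\<close> by this power.\<close>
  define P where "P = (2::real) powr ((real CARD('n) - 1) / 2)"
  have P: "P > 0" by (simp add: P_def)
  define M' where "M' = 2 * M * P * (1 + k)"
  have M': "M' \<ge> 0" "M * P \<le> M'"
  proof -
    have "0 \<le> M * P" using M P by simp
    moreover have "M' = 2 * (M * P) + 2 * (M * P) * k" by (simp add: M'_def algebra_simps)
    moreover have "0 \<le> (M * P) * k" using M P k by simp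
    ultimately show "M' \<ge> 0" "M * P \<le> M'" by linarith+
  qed
  have "norm (\<Phi> (w + h)) \<le> M' * dec (norm w)
     \<and> norm (\<Phi>1 j (w + h) - \<i> * of_real k * of_real (w $ j / norm w) * \<Phi> (w + h)) \<le> M' * (1 + norm h) * (dec (norm w) / norm w)
     \<and> norm (\<Phi>2 i j (w + h) - \<i> * of_real k * of_real (w $ i / norm w) * \<Phi>1 j (w + h)) \<le> M' * (1 + norm h) * (dec (norm w) / norm w)"
    if w: "2 \<le> norm w" "2 * norm h \<le> norm w" for w h :: "real^'n" and i j
  proof -
    define z where "z = w + h"
    have w0: "0 < norm w" using w by linarith
    note ds = direction_shift[OF w0 w(2), folded z_def]
    have z1: "1 \<le> norm z" using ds(1) w by linarith
    define d where "d = dec (norm w)"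
    have d0: "0 \<le> d" by (simp add: d_def dec_nonneg)
    have dz: "dec (norm z) \<le> P * d"
      using dec_antimono[OF _ ds(1)] w0 dec_half[OF w0] by (simp add: P_def d_def)
    have "dec (norm z) / norm z \<le> (P * d) / (norm w / 2)"
      using dz ds(1) w0 P d0 dec_nonneg by (intro frac_le) auto
    then have dz2: "dec (norm z) / norm z \<le> 2 * P * (d / norm w)" by (simp add: mult_ac)
    note f = far[OF z1]
    have gen: "norm (b - \<i> * of_real k * of_real (w $ j / norm w) * a) \<le> M' * (1 + norm h) * (d / norm w)"
      if ab: "norm a \<le> M * dec (norm z)" "norm (b - \<i> * of_real k * of_real (z $ j / norm z) * a) \<le> M * (dec (norm z) / norm z)" for a b :: complex and j
    proof -
      have "b - \<i> * of_real k * of_real (w $ j / norm w) * a = (b - \<i> * of_real k * of_real (z $ j / norm z) * a) + \<i> * of_real k * of_real (z $ j / norm z - w $ j / norm w) * a"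
        unfolding of_real_diff by (simp add: algebra_simps)
      then have "norm (b - \<i> * of_real k * of_real (w $ j / norm w) * a) \<le> norm (b - \<i> * of_real k * of_real (z $ j / norm z) * a) + norm (\<i> * of_real k * of_real (z $ j / norm z - w $ j / norm w) * a)"
        using norm_triangle_ineq by metis
      also have "norm (\<i> * of_real k * of_real (z $ j / norm z - w $ j / norm w) * a) = k * \<bar>z $ j / norm z - w $ j / norm w\<bar> * norm a"
        unfolding norm_mult norm_of_real norm_ii using k by simp
      also have "\<dots> \<le> k * (2 * norm h / norm w) * (M * (P * d))"
        using ds(2) order_trans[OF ab(1) mult_left_mono[OF dz M]] k by (intro mult_mono) auto
      also have "norm (b - \<i> * of_real k * of_real (z $ j / norm z) * a) \<le> M * (2 * P * (d / norm w))"
        by (rule order_trans[OF ab(2) mult_left_mono[OF dz2 M]])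
      finally have "norm (b - \<i> * of_real k * of_real (w $ j / norm w) * a) \<le> (2 * M * P * (1 + k * norm h)) * (d / norm w)"
        by (simp add: algebra_simps)
      also have "\<dots> \<le> (2 * M * P * ((1 + k) * (1 + norm h))) * (d / norm w)"
        using M P k d0 by (intro mult_right_mono mult_left_mono) (auto simp: algebra_simps)
      finally show ?thesis by (simp add: M'_def mult.assoc)
    qed
    have "norm (\<Phi> z) \<le> M' * d"
    proof -
      have "norm (\<Phi> z) \<le> M * (P * d)" using order_trans[OF conjunct1[OF f] mult_left_mono[OF dz M]] .
      also have "\<dots> \<le> M' * d" using mult_right_mono[OF M'(2) d0] by simp
      finally show ?thesis .
    qed
    then show ?thesis unfolding z_def[symmetric] d_def[symmetric] using gen f by (intro conjI) blast+
  qed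
  then show ?thesis using M'(1) by (intro exI[of _ M']) blast
qed

text \<open>The weight is of order 1/R on a set of volume of order R^n; by \<open>dec_square\<close>
  the square of the kernel's decay compensates this exactly.\<close>

lemma wt_integral: "\<exists>L\<ge>0. \<forall>R>0. integrable lebesgue (wt R) \<and> (LINT y|lebesgue. wt R y) * (dec R)\<^sup>2 \<le> L"
proof -
  have Ms: "Ms \<ge> 0" using stD(6,7) order_trans by blast
  define L where "L = Ms * 3 ^ CARD('n) * omega"
  have "integrable lebesgue (wt R) \<and> (LINT y|lebesgue. wt R y) * (dec R)\<^sup>2 \<le> L" if R: "R > 0" for R
  proof -
    define B where "B = ball (0::real^'n) (3 * R)"
    have iB: "integrable lborel (\<lambda>y. Ms / R * indicator B y :: real)"
      by (intro integrable_mult_right integrable_real_indicator) (use emeasure_bounded_finite[of B] in \<open>auto simp: B_def\<close>)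
    have iBl: "integrable lebesgue (\<lambda>y. Ms / R * indicator B y :: real)"
      by (rule integrable_completion[OF borel_measurable_integrable[OF iB], THEN iffD2, OF iB])
    have le: "wt R y \<le> Ms / R * indicator B y" for y
    proof (cases "y \<in> B")
      case False
      then have "y \<notin> cball 0 (2 * R) - ball 0 R" using R by (auto simp: B_def)
      then show ?thesis using wt_props(4)[OF R] False by simp
    qed (simp add: wt_props(3)[OF R])
    have ab: "norm (wt R y) \<le> norm (Ms / R * indicator B y)" for y
      using le[of y] wt_props(2)[OF R, of y] unfolding real_norm_def by linarith
    have i: "integrable lebesgue (wt R)"
      by (rule Bochner_Integration.integrable_bound[OF iBl wt_props(1)[OF R]])
         (rule AE_I2, rule ab)
    have "(LINT y|lebesgue. wt R y) \<le> (LINT y|lebesgue. Ms / R * indicator B y)"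
      by (rule integral_mono[OF i iBl le])
    also have "\<dots> = Ms / R * measure lborel B"
      using integral_completion[OF borel_measurable_integrable[OF iB]] by (simp add: B_def)
    also have "measure lborel B = omega * (3 * R) ^ CARD('n)"
      unfolding B_def omega_def using R by (subst measure_lborel_ball) auto
    finally have "(LINT y|lebesgue. wt R y) * (dec R)\<^sup>2 \<le> (Ms / R * (omega * (3 * R) ^ CARD('n))) * (dec R)\<^sup>2"
      by (rule mult_right_mono) simp
    also have "\<dots> = (Ms / R * omega * 3 ^ CARD('n)) * ((dec R)\<^sup>2 * R ^ CARD('n))"
      by (simp add: power_mult_distrib mult_ac)
    also have "\<dots> = L" unfolding dec_square[OF R] using R by (simp add: L_def)
    finally show ?thesis using i by simp
  qed
  moreover have "L \<ge> 0" using Ms omega_pos by (simp add: L_def)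
  ultimately show ?thesis by blast
qed

lemma pot_integrable:
  assumes "0 < a" "a < b" "0 < R"
  shows "b < norm x \<Longrightarrow> integrable lebesgue (\<lambda>y. Aw (cin' a b) y * \<Phi> (y - x) + (\<Sum>j\<in>UNIV. Bw (cin' a b) j y * \<Phi>1 j (y - x)))"
    "b < norm x \<Longrightarrow> has_grad (pot (cin' a b)) (\<lambda>i. potD (cin' a b) i x) x"
    "norm x < R \<Longrightarrow> integrable lebesgue (\<lambda>y. Aw (\<beta> R) y * \<Phi> (y - x) + (\<Sum>j\<in>UNIV. Bw (\<beta> R) j y * \<Phi>1 j (y - x)))"
proof -
  {
    assume x: "b < norm x"
    define d where "d = (norm x - b) / 2"
    have d: "d > 0" using x by (simp add: d_def)
    have far: "d \<le> norm (y - x')" if "x' \<in> ball x d" "y \<in> cball 0 b - ball 0 a" for x' y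
    proof -
      have "norm (x - x') < d" "norm y \<le> b" using that by (simp_all add: dist_norm)
      then show ?thesis using norm_triangle_ineq2[of x "x - x'"] norm_diff_lower(2)[where x=x' and y=y] by (simp add: d_def field_simps)
    qed
    note P = pot_grad[where S="cball 0 b - ball 0 a" and \<rho>=b, OF cut_conts(1) weight_supports(1)[OF assms] Diff_subset d far]
    show "integrable lebesgue (\<lambda>y. Aw (cin' a b) y * \<Phi> (y - x) + (\<Sum>j\<in>UNIV. Bw (cin' a b) j y * \<Phi>1 j (y - x)))" by (rule P(3))
    show "has_grad (pot (cin' a b)) (\<lambda>i. potD (cin' a b) i x) x" by (rule P(1))
  }
  assume x: "norm x < R"
  define d where "d = (R - norm x) / 2"
  have d: "d > 0" using x by (simp add: d_def)
  have far: "d \<le> norm (y - x')" if "x' \<in> ball x d" "y \<in> cball 0 (2 * R) - ball 0 R" for x' y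
  proof -
    have "norm (x' - x) < d" "R \<le> norm y" using that by (simp_all add: dist_norm norm_minus_commute not_less)
    then show ?thesis using norm_triangle_ineq2[of x' x] norm_diff_lower(1)[where x=x' and y=y] by (simp add: d_def field_simps)
  qed
  show "integrable lebesgue (\<lambda>y. Aw (\<beta> R) y * \<Phi> (y - x) + (\<Sum>j\<in>UNIV. Bw (\<beta> R) j y * \<Phi>1 j (y - x)))"
    by (rule pot_grad(3)[where S="cball 0 (2 * R) - ball 0 R" and \<rho>="2 * R", OF cut_conts(2) weight_supports(2)[OF assms] Diff_subset d far])
qed

section \<open>The outer potential\<close>

lemma young: "t > 0 \<Longrightarrow> 2 * (a * b) \<le> a\<^sup>2 / t + t * b\<^sup>2" for a b t :: real
proof -
  assume t: "t > 0"
  have "0 \<le> (a - t * b)\<^sup>2 / t" using t by simp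
  also have "\<dots> = a\<^sup>2 / t + t * b\<^sup>2 - 2 * (a * b)" using t by (simp add: power2_eq_square field_simps)
  finally show ?thesis by simp
qed

lemma sum_direction_sq: "y \<noteq> 0 \<Longrightarrow> (\<Sum>j\<in>UNIV. (y $ j / norm y)\<^sup>2) = 1" for y :: "real^'n"
proof -
  assume "y \<noteq> 0"
  have "(\<Sum>j\<in>UNIV. (y $ j)\<^sup>2) = (norm y)\<^sup>2" unfolding power2_norm_eq_inner inner_vec_def by (simp add: power2_eq_square)
  then show ?thesis using \<open>y \<noteq> 0\<close> by (simp add: power_divide sum_divide_distrib[symmetric])
qed

text \<open>Green's combination of u and the kernel is unchanged when ik times the function is
  subtracted from both radial derivatives, because the squared direction cosines sum to 1. Both
  factors then show their radiation defects: \<open>Z\<close> for u, and a small term for the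
  kernel.\<close>

lemma outer_integrand:
  fixes x y :: "real^'n"
  assumes "R > 0"
  shows "Aw (\<beta> R) y * \<Phi> (y - x) + (\<Sum>j\<in>UNIV. Bw (\<beta> R) j y * \<Phi>1 j (y - x))
    = of_real (2 * wt R y) * (Z y * \<Phi> (y - x) - u y * (\<Sum>j\<in>UNIV. of_real (y $ j / norm y) * (\<Phi>1 j (y - x) - \<i> * of_real k * of_real (y $ j / norm y) * \<Phi> (y - x))))"
proof (cases "y = 0")
  case True
  then have "\<beta> R (y \<bullet> y) = 0" using weight_supports(2)[of 1 2 R y] assms by simp
  then show ?thesis by (simp add: Aw_def Bw_def wt_def)
next
  case False
  define e where "e j = complex_of_real (y $ j / norm y)" for j
  have ee: "complex_of_real (2 * y $ j) * of_real (\<beta> R (y \<bullet> y)) = of_real (2 * wt R y) * e j" for j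
    using False by (simp add: e_def wt_def)
  have "(\<Sum>j\<in>UNIV. e j * e j) = of_real (\<Sum>j\<in>UNIV. (y $ j / norm y)\<^sup>2)" by (simp add: e_def power2_eq_square)
  then have s1: "(\<Sum>j\<in>UNIV. e j * e j) = 1" using sum_direction_sq[OF False] by simp
  have A: "Aw (\<beta> R) y = of_real (2 * wt R y) * V y"
    unfolding Aw_def ee V_def e_def[symmetric] by (simp add: sum_distrib_left mult.assoc)
  have B: "(\<Sum>j\<in>UNIV. Bw (\<beta> R) j y * \<Phi>1 j (y - x)) = - (of_real (2 * wt R y) * u y * (\<Sum>j\<in>UNIV. e j * \<Phi>1 j (y - x)))"
    unfolding Bw_def ee by (simp add: sum_distrib_left sum_negf mult_ac)
  have S: "(\<Sum>j\<in>UNIV. e j * (\<Phi>1 j (y - x) - \<i> * of_real k * e j * \<Phi> (y - x))) = (\<Sum>j\<in>UNIV. e j * \<Phi>1 j (y - x)) - \<i> * of_real k * \<Phi> (y - x)"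
  proof -
    have "(\<Sum>j\<in>UNIV. e j * (\<Phi>1 j (y - x) - \<i> * of_real k * e j * \<Phi> (y - x))) = (\<Sum>j\<in>UNIV. e j * \<Phi>1 j (y - x)) - (\<Sum>j\<in>UNIV. (\<i> * of_real k * \<Phi> (y - x)) * (e j * e j))"
      unfolding sum_subtractf[symmetric] by (rule sum.cong) (simp_all add: algebra_simps)
    then show ?thesis unfolding sum_distrib_left[symmetric] s1 by simp
  qed
  show ?thesis unfolding A B e_def[symmetric] S Z_def by (simp add: algebra_simps)
qed

lemma QR_nonneg: "R > 0 \<Longrightarrow> 0 \<le> QR R" and NR_nonneg: "R > 0 \<Longrightarrow> 0 \<le> NR R"
  unfolding QR_def NR_def by (rule Bochner_Integration.integral_nonneg; simp add: wt_props(2))+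

lemma wt_integrables:
  assumes "R > 0"
  shows "integrable lebesgue (\<lambda>y. wt R y * (norm (u y))\<^sup>2)" "integrable lebesgue (\<lambda>y. wt R y * (norm (Z y))\<^sup>2)"
    "integrable lebesgue (\<lambda>y. wt R y * Im (V y * cnj (u y)))"
proof -
  note sq = square_integrables[OF wt_props(1)[OF assms] wt_abs(1)[OF assms] wt_abs(2)[OF assms]]
  show "integrable lebesgue (\<lambda>y. wt R y * (norm (u y))\<^sup>2)" by (rule sq(1))
  show "integrable lebesgue (\<lambda>y. wt R y * (norm (Z y))\<^sup>2)" by (rule sq(3))
  show "integrable lebesgue (\<lambda>y. wt R y * Im (V y * cnj (u y)))" by (rule sq(4))
qed

text \<open>\<open>Z\<close> meets the plain kernel, while u meets the defect of the kernel, which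
  is smaller by 1/R. Young's inequality with weight t for the first product and R for the second
  separates the shell means from the kernels; t remains free to be adapted to
  \<open>QR\<close>.\<close>

lemma pot_outer_bound:
  "\<exists>L1 L2. \<forall>R t. 2 + 2 * norm x \<le> R \<longrightarrow> 0 < t \<longrightarrow> norm (pot (\<beta> R) x) \<le> QR R / t + NR R / R + L1 * t + L2 / R"
proof -
  obtain M where M: "M \<ge> 0" and ker: "\<And>w h i j. 2 \<le> norm w \<Longrightarrow> 2 * norm h \<le> norm w \<Longrightarrow> norm (\<Phi> (w + h)) \<le> M * dec (norm w)
     \<and> norm (\<Phi>1 j (w + h) - \<i> * of_real k * of_real (w $ j / norm w) * \<Phi> (w + h)) \<le> M * (1 + norm h) * (dec (norm w) / norm w)
     \<and> norm (\<Phi>2 i j (w + h) - \<i> * of_real k * of_real (w $ i / norm w) * \<Phi>1 j (w + h)) \<le> M * (1 + norm h) * (dec (norm w) / norm w)"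
    using kernel_shift by blast
  obtain L where L: "L \<ge> 0" "\<And>R. R > 0 \<Longrightarrow> integrable lebesgue (wt R)" "\<And>R. R > 0 \<Longrightarrow> (LINT y|lebesgue. wt R y) * (dec R)\<^sup>2 \<le> L"
    using wt_integral by blast
  define K where "K = real CARD('n) * (M * (1 + norm x))"
  have K: "K \<ge> 0" using M by (simp add: K_def)
  have "norm (pot (\<beta> R) x) \<le> QR R / t + NR R / R + (L * M\<^sup>2) * t + (L * K\<^sup>2) / R" if R: "2 + 2 * norm x \<le> R" and t: "0 < t" for R t
  proof -
    have R0: "R > 0" "norm x < R" "1 \<le> R" using R norm_ge_zero[of x] by linarith+
    define S where "S y = (\<Sum>j\<in>UNIV. of_real (y $ j / norm y) * (\<Phi>1 j (y - x) - \<i> * of_real k * of_real (y $ j / norm y) * \<Phi> (y - x)))" for y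
    define I where "I y = of_real (2 * wt R y) * (Z y * \<Phi> (y - x) - u y * S y)" for y
    \<comment> \<open>The part of Young's inequality that contains neither u nor \<open>Z\<close>;
      multiplied by the mass of the weight it is bounded through \<open>wt_integral\<close>.\<close>
    define e where "e = (dec R)\<^sup>2 * (t * M\<^sup>2 + K\<^sup>2 / R)"
    define bnd where "bnd y = (wt R y * (norm (Z y))\<^sup>2) / t + (wt R y * (norm (u y))\<^sup>2) / R + wt R y * e" for y
    have pI: "pot (\<beta> R) x = (LINT y|lebesgue. I y)" and iI: "integrable lebesgue I"
      using pot_integrable(3)[of 1 2 R x] R0 unfolding pot_def outer_integrand[OF R0(1)] I_def[abs_def] S_def by simp_all
    have ib: "integrable lebesgue bnd" unfolding bnd_def[abs_def]
      by (intro Bochner_Integration.integrable_add integrable_divide integrable_mult_left wt_integrables L(2) R0)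
    have pw: "norm (I y) \<le> bnd y" for y
    proof (cases "y \<in> cball 0 (2 * R) - ball 0 R")
      case True
      then have yR: "R \<le> norm y" by simp
      then have c: "2 \<le> norm y" "2 * norm (- x) \<le> norm y" "0 < norm y" using R norm_ge_zero[of x] unfolding norm_minus_cancel by linarith+
      note kb = ker[OF c(1,2), unfolded add_uminus_conv_diff norm_minus_cancel]
      have d: "dec (norm y) \<le> dec R" by (rule dec_antimono[OF R0(1) yR])
      have d2: "dec (norm y) / norm y \<le> dec R / R" using d yR R0 dec_nonneg by (intro frac_le) auto
      have P: "norm (\<Phi> (y - x)) \<le> M * dec R" by (rule order_trans[OF conjunct1[OF kb] mult_left_mono[OF d M]])
      have S: "norm (S y) \<le> K * (dec R / R)"
      proof -
        have "norm (S y) \<le> (\<Sum>j\<in>(UNIV::'n set). M * (1 + norm x) * (dec R / R))" unfolding S_def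
        proof (rule sum_norm_le)
          fix j :: 'n
          have 1: "norm (\<Phi>1 j (y - x) - \<i> * of_real k * of_real (y $ j / norm y) * \<Phi> (y - x)) \<le> M * (1 + norm x) * (dec R / R)"
            by (rule order_trans[OF conjunct1[OF conjunct2[OF kb]] mult_left_mono[OF d2]]) (use M in simp)
          show "norm (of_real (y $ j / norm y) * (\<Phi>1 j (y - x) - \<i> * of_real k * of_real (y $ j / norm y) * \<Phi> (y - x))) \<le> M * (1 + norm x) * (dec R / R)"
            using mult_mono[OF norm_component_ratio[of y j] 1] by (simp only: norm_mult norm_of_real mult_1 norm_ge_zero zero_le_one)
        qed
        then show ?thesis by (simp add: K_def mult.assoc)
      qed
      have w0: "0 \<le> wt R y" by (rule wt_props(2)[OF R0(1)])
      have "norm (Z y * \<Phi> (y - x) - u y * S y) \<le> norm (Z y) * (M * dec R) + norm (u y) * (K * (dec R / R))"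
        by (rule order_trans[OF norm_triangle_ineq4]) (auto simp: norm_mult intro!: add_mono mult_left_mono P S simp del: times_divide_eq_right)
      then have "2 * wt R y * norm (Z y * \<Phi> (y - x) - u y * S y) \<le> 2 * wt R y * (norm (Z y) * (M * dec R) + norm (u y) * (K * (dec R / R)))"
        by (rule mult_left_mono) (use w0 in simp)
      moreover have "norm (I y) = 2 * wt R y * norm (Z y * \<Phi> (y - x) - u y * S y)"
        unfolding I_def norm_mult[of "of_real _"] norm_of_real using w0 by simp
      moreover have "2 * w * (p + q) = w * (2 * p + 2 * q)" for w p q :: real by (simp add: algebra_simps)
      ultimately have "norm (I y) \<le> wt R y * (2 * (norm (Z y) * (M * dec R)) + 2 * (norm (u y) * (K * (dec R / R))))"
        by (simp only:)
      also have "\<dots> \<le> wt R y * (((norm (Z y))\<^sup>2 / t + t * (M * dec R)\<^sup>2) + ((norm (u y))\<^sup>2 / R + R * (K * (dec R / R))\<^sup>2))"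
        by (intro mult_left_mono add_mono young t R0 w0)
      also have "R * (K * (dec R / R))\<^sup>2 = (dec R)\<^sup>2 * (K\<^sup>2 / R)"
        using R0 by (simp add: power2_eq_square field_simps)
      also have "wt R y * (((norm (Z y))\<^sup>2 / t + t * (M * dec R)\<^sup>2) + ((norm (u y))\<^sup>2 / R + (dec R)\<^sup>2 * (K\<^sup>2 / R))) = bnd y"
      proof -
        have "w * ((z / t + t * (M * d)\<^sup>2) + (v / R + d\<^sup>2 * (K\<^sup>2 / R))) = (w * z) / t + (w * v) / R + w * (d\<^sup>2 * (t * M\<^sup>2 + K\<^sup>2 / R))" for w z v d
          by (simp add: distrib_left power_mult_distrib)
        then show ?thesis unfolding bnd_def e_def .
      qed
      finally show ?thesis .
    next
      case False
      then have "wt R y = 0" by (rule wt_props(4)[OF R0(1)])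
      then show ?thesis by (simp add: I_def bnd_def)
    qed
    have "norm (pot (\<beta> R) x) \<le> (LINT y|lebesgue. bnd y)" unfolding pI
      by (rule Bochner_Integration.integral_norm_bound_integral[OF iI ib pw])
    also have "\<dots> = QR R / t + NR R / R + (LINT y|lebesgue. wt R y) * e"
      unfolding bnd_def[abs_def] QR_def NR_def using wt_integrables[OF R0(1)] L(2)[OF R0(1)] by simp
    also have "(LINT y|lebesgue. wt R y) * e = ((LINT y|lebesgue. wt R y) * (dec R)\<^sup>2) * (t * M\<^sup>2 + K\<^sup>2 / R)" by (simp add: e_def)
    also have "\<dots> \<le> L * (t * M\<^sup>2 + K\<^sup>2 / R)" using t R0 by (intro mult_right_mono L(3)) auto
    finally show ?thesis by (simp add: distrib_left mult_ac)
  qed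
  then show ?thesis by (intro exI[of _ "L * M\<^sup>2"] exI[of _ "L * K\<^sup>2"]) simp
qed

text \<open>Expanding the square gives |Z|^2 + 2k Im(V conj u) = |V|^2 + k^2 |u|^2. Against the
  weight, the flux term equals a fixed inner flux by \<open>flux_balance\<close>, so the shell mean
  of |u|^2 exceeds that of |Z|^2 by at most a constant, up to k^2.\<close>

lemma NR_bound: "\<exists>B. \<forall>R\<ge>R0 + 2. k\<^sup>2 * NR R \<le> QR R + B"
proof -
  define a b where "a = R0 + 1" and "b = R0 + 2"
  define Fl where "Fl = (LINT y|lebesgue. (cin' a b (y \<bullet> y) * norm y) * Im (V y * cnj (u y)))"
  have "k\<^sup>2 * NR R \<le> QR R + 2 * k * Fl" if "R \<ge> R0 + 2" for R
  proof -
    have R: "R > 0" using that R0 by simp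
    have fl: "(LINT y|lebesgue. wt R y * Im (V y * cnj (u y))) = Fl"
      unfolding Fl_def by (rule flux_balance) (use that in \<open>auto simp: a_def b_def\<close>)
    note i = wt_integrables[OF R]
    have pw: "k\<^sup>2 * (wt R y * (norm (u y))\<^sup>2) \<le> wt R y * (norm (Z y))\<^sup>2 + (2 * k) * (wt R y * Im (V y * cnj (u y)))" for y
    proof -
      have "(norm (Z y))\<^sup>2 + 2 * k * Im (V y * cnj (u y)) = (norm (V y))\<^sup>2 + k\<^sup>2 * (norm (u y))\<^sup>2"
        unfolding Z_def cmod_power2 by (simp add: power2_eq_square algebra_simps)
      then have "k\<^sup>2 * (norm (u y))\<^sup>2 \<le> (norm (Z y))\<^sup>2 + 2 * k * Im (V y * cnj (u y))" by simp
      from mult_left_mono[OF this wt_props(2)[OF R]] show ?thesis by (simp only: distrib_left mult_ac)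
    qed
    have "k\<^sup>2 * NR R = (LINT y|lebesgue. k\<^sup>2 * (wt R y * (norm (u y))\<^sup>2))" by (simp add: NR_def)
    also have "\<dots> \<le> (LINT y|lebesgue. wt R y * (norm (Z y))\<^sup>2 + (2 * k) * (wt R y * Im (V y * cnj (u y))))"
      by (rule integral_mono[OF integrable_mult_right[OF i(1)] Bochner_Integration.integrable_add[OF i(2) integrable_mult_right[OF i(3)]] pw])
    also have "\<dots> = QR R + 2 * k * (LINT y|lebesgue. wt R y * Im (V y * cnj (u y)))"
      unfolding QR_def Bochner_Integration.integral_add[OF i(2) integrable_mult_right[OF i(3)]] integral_mult_right_zero ..
    finally show ?thesis unfolding fl .
  qed
  then show ?thesis by blast
qed

lemma pot_outer_tendsto:
  assumes Q: "(QR \<longlongrightarrow> 0) at_top"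
  shows "((\<lambda>R. pot (\<beta> R) x) \<longlongrightarrow> 0) at_top"
proof -
  obtain L1 L2 where P: "\<And>R t. 2 + 2 * norm x \<le> R \<Longrightarrow> 0 < t \<Longrightarrow> norm (pot (\<beta> R) x) \<le> QR R / t + NR R / R + L1 * t + L2 / R"
    using pot_outer_bound by blast
  obtain B where B: "\<And>R. R \<ge> R0 + 2 \<Longrightarrow> k\<^sup>2 * NR R \<le> QR R + B" using NR_bound by blast
  \<comment> \<open>The bound for t = sqrt(QR) + 1/R. This t tends to 0, but QR / t is at most
    sqrt(QR) and tends to 0 as well; the summand 1/R keeps t positive where QR vanishes.\<close>
  define f where "f R = sqrt (QR R) + (QR R + B) / k\<^sup>2 * inverse R + L1 * (sqrt (QR R) + inverse R) + L2 * inverse R" for R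
  have "(f \<longlongrightarrow> sqrt 0 + (0 + B) / k\<^sup>2 * 0 + L1 * (sqrt 0 + 0) + L2 * 0) at_top"
    unfolding f_def[abs_def] by (intro tendsto_intros Q tendsto_inverse_0_at_top filterlim_ident) (use k in auto)
  then have f0: "(f \<longlongrightarrow> 0) at_top" by simp
  show ?thesis
  proof (rule Lim_null_comparison[OF _ f0])
    show "\<forall>\<^sub>F R in at_top. norm (pot (\<beta> R) x) \<le> f R"
      using eventually_ge_at_top[of "2 + 2 * norm x"] eventually_ge_at_top[of "R0 + 2"]
    proof eventually_elim
      case (elim R)
      have R: "R > 0" using elim R0 by simp
      define s where "s = sqrt (QR R)"
      have s: "s \<ge> 0" "QR R = s * s" using QR_nonneg[OF R] by (simp_all add: s_def)
      have t: "s + inverse R > 0" using s(1) R by (simp add: add_nonneg_pos)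
      have "QR R / (s + inverse R) \<le> s"
        unfolding s(2) using t s(1) R by (simp add: divide_le_eq mult_left_mono)
      moreover have "NR R \<le> (QR R + B) / k\<^sup>2" using B[OF elim(2)] k by (simp add: le_divide_eq mult.commute)
      then have "NR R / R \<le> (QR R + B) / k\<^sup>2 * inverse R" using R by (simp add: divide_inverse mult_right_mono)
      ultimately show ?case using P[OF elim(1) t] unfolding f_def s_def[symmetric] by (simp add: divide_inverse[of L2 R])
    qed
  qed
qed

text \<open>For every large R the outer potential equals the inner potential minus \<kappa> u(x),
  which does not depend on R. A constant tending to 0 is 0.\<close>

lemma u_eq_inner_pot:
  assumes Q: "(QR \<longlongrightarrow> 0) at_top" and ab: "R0 < a" "a < b" "b < norm x"
  shows "\<kappa> * u x = pot (cin' a b) x"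
proof -
  have a: "0 < a" using ab R0 by simp
  have "\<forall>\<^sub>F R in at_top. pot (cin' a b) x - \<kappa> * u x = pot (\<beta> R) x"
    using eventually_gt_at_top[of "norm x"]
  proof eventually_elim
    case (elim R)
    have R: "0 < R" using elim norm_ge_zero[of x] by linarith
    have "\<kappa> * u x = pot (\<lambda>s. cin' a b s - \<beta> R s) x" by (rule rep_pot) (use ab elim in auto)
    also have "\<dots> = pot (cin' a b) x - pot (\<beta> R) x"
      unfolding pot_def Bochner_Integration.integral_diff[OF pot_integrable(1)[OF a ab(2) R ab(3)] pot_integrable(3)[OF a ab(2) R elim], symmetric]
    proof (rule Bochner_Integration.integral_cong[OF refl])
      fix y :: "real^'n"
      have "Aw (\<lambda>s. cin' a b s - \<beta> R s) y = Aw (cin' a b) y - Aw (\<beta> R) y"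
        unfolding Aw_def sum_subtractf[symmetric] by (rule sum.cong) (simp_all add: algebra_simps)
      moreover have "Bw (\<lambda>s. cin' a b s - \<beta> R s) j y = Bw (cin' a b) j y - Bw (\<beta> R) j y" for j
        by (simp add: Bw_def algebra_simps)
      ultimately show "Aw (\<lambda>s. cin' a b s - \<beta> R s) y * \<Phi> (y - x) + (\<Sum>j\<in>UNIV. Bw (\<lambda>s. cin' a b s - \<beta> R s) j y * \<Phi>1 j (y - x))
        = Aw (cin' a b) y * \<Phi> (y - x) + (\<Sum>j\<in>UNIV. Bw (cin' a b) j y * \<Phi>1 j (y - x)) - (Aw (\<beta> R) y * \<Phi> (y - x) + (\<Sum>j\<in>UNIV. Bw (\<beta> R) j y * \<Phi>1 j (y - x)))"
        by (simp add: left_diff_distrib sum_subtractf)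
    qed
    finally show ?case by simp
  qed
  then have "((\<lambda>R. pot (\<beta> R) x) \<longlongrightarrow> pot (cin' a b) x - \<kappa> * u x) at_top" by (rule tendsto_eventually[OF eventually_mono]) simp
  then have "pot (cin' a b) x - \<kappa> * u x = 0"
    using tendsto_unique[OF trivial_limit_at_top_linorder _ pot_outer_tendsto[OF Q]] by blast
  then show ?thesis by simp
qed

section \<open>Radiation conditions\<close>

text \<open>The inner potential has its sources in a fixed shell, so for distant x the kernel bounds
  hold with the direction of -x. The defect can be taken under the integral, where it gains the
  factor 1/|x| over the decay of u.\<close>

lemma radiation_asymptotics:
  assumes Q: "(QR \<longlongrightarrow> 0) at_top"
  shows "\<exists>K \<rho>. 0 \<le> K \<and> R0 < \<rho> \<and> (\<forall>x i. \<rho> \<le> norm x \<longrightarrow>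
    norm (Du i x - \<i> * of_real k * of_real (x $ i / norm x) * u x) \<le> K * (dec (norm x) / norm x))"
proof -
  define a b where "a = R0 + 1" and "b = R0 + 2"
  have ab: "R0 < a" "a < b" "0 < a" "0 < b" using R0 by (auto simp: a_def b_def)
  obtain M where M: "M \<ge> 0" and ker: "\<And>w h i j. 2 \<le> norm w \<Longrightarrow> 2 * norm h \<le> norm w \<Longrightarrow> norm (\<Phi> (w + h)) \<le> M * dec (norm w)
     \<and> norm (\<Phi>1 j (w + h) - \<i> * of_real k * of_real (w $ j / norm w) * \<Phi> (w + h)) \<le> M * (1 + norm h) * (dec (norm w) / norm w)
     \<and> norm (\<Phi>2 i j (w + h) - \<i> * of_real k * of_real (w $ i / norm w) * \<Phi>1 j (w + h)) \<le> M * (1 + norm h) * (dec (norm w) / norm w)"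
    using kernel_shift by blast
  define A B where "A = Aw (cin' a b)" and "B j = Bw (cin' a b) j" for j
  note wi = weight_integrable[where S="cball 0 b - ball 0 a" and \<rho>=b, OF cut_conts(1) weight_supports(1)[OF ab(3,2) zero_less_one] Diff_subset]
  have Ai: "integrable lebesgue A" unfolding A_def by (rule wi(1))
  have Bi: "integrable lebesgue (B j)" for j unfolding B_def by (rule wi(2))
  have z: "A y = 0" "B j y = 0" if "\<not> norm y \<le> b" for y j
    using weight_supports(1)[OF ab(3,2) zero_less_one, of y] that by (simp_all add: A_def B_def Aw_def Bw_def)
  define T where "T y = norm (A y) + (\<Sum>j\<in>UNIV. norm (B j y))" for y
  have Ti: "integrable lebesgue T" unfolding T_def[abs_def]
    by (intro Bochner_Integration.integrable_add Bochner_Integration.integrable_sum integrable_norm Ai Bi)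
  have T0: "0 \<le> T y" for y by (simp add: T_def sum_nonneg)
  define K where "K = (LINT y|lebesgue. T y) * (M * (1 + b)) / norm \<kappa>"
  have K: "K \<ge> 0" using M ab T0 by (simp add: K_def Bochner_Integration.integral_nonneg)
  \<comment> \<open>Beyond 2b + 2 every source y satisfies 2 |y| <= |x|, and |x| is at least 2, as
    \<open>kernel_shift\<close> asks.\<close>
  have "norm (Du i x - \<i> * of_real k * of_real (x $ i / norm x) * u x) \<le> K * (dec (norm x) / norm x)" if x: "2 * b + 2 \<le> norm x" for x i
  proof -
    have xb: "b < norm x" "0 < norm x" "2 \<le> norm (- x)" using x ab(4) unfolding norm_minus_cancel by linarith+
    define q where "q = \<i> * of_real k * of_real (x $ i / norm x)"
    define f where "f y = A y * \<Phi> (y - x) + (\<Sum>j\<in>UNIV. B j y * \<Phi>1 j (y - x))" for y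
    \<comment> \<open>Differentiation in x brings the outer minus sign, and ik times the direction
      of -x is -q; the sums with q are therefore the small defects.\<close>
    define g where "g y = - (A y * (\<Phi>1 i (y - x) + q * \<Phi> (y - x)) + (\<Sum>j\<in>UNIV. B j y * (\<Phi>2 i j (y - x) + q * \<Phi>1 j (y - x))))" for y
    have fi: "integrable lebesgue f" unfolding f_def[abs_def] A_def B_def by (rule pot_integrable(1)[OF ab(3,2) zero_less_one xb(1)])
    define m where "m = M * (1 + b) * (dec (norm x) / norm x)"
    have m0: "m \<ge> 0" using M ab dec_nonneg by (simp add: m_def)
    have gb: "norm (g y) \<le> T y * m" for y
    proof (cases "norm y \<le> b")
      case True
      have c: "2 * norm y \<le> norm (- x)" using True x by simp
      have sh: "M * (1 + norm y) * (dec (norm (- x)) / norm (- x)) \<le> m"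
        unfolding m_def norm_minus_cancel using True M dec_nonneg[of "norm x"] by (intro mult_right_mono mult_left_mono) auto
      have k1: "norm (\<Phi>1 i (y - x) + q * \<Phi> (y - x)) \<le> m" "norm (\<Phi>2 i j (y - x) + q * \<Phi>1 j (y - x)) \<le> m" for j
      proof -
        have e: "- x + y = y - x" "\<And>X. X - \<i> * of_real k * of_real ((- x) $ i / norm (- x)) * Y = X + q * Y" for Y
          by (simp_all add: q_def)
        show "norm (\<Phi>1 i (y - x) + q * \<Phi> (y - x)) \<le> m"
          using order_trans[OF _ sh] ker[OF xb(3) c, of i i] unfolding e by blast
        show "norm (\<Phi>2 i j (y - x) + q * \<Phi>1 j (y - x)) \<le> m"
          using order_trans[OF _ sh] ker[OF xb(3) c, of j i] unfolding e by blast
      qed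
      have "norm (g y) \<le> norm (A y * (\<Phi>1 i (y - x) + q * \<Phi> (y - x))) + norm (\<Sum>j\<in>UNIV. B j y * (\<Phi>2 i j (y - x) + q * \<Phi>1 j (y - x)))"
        unfolding g_def norm_minus_cancel by (rule norm_triangle_ineq)
      also have "\<dots> \<le> norm (A y) * m + (\<Sum>j\<in>UNIV. norm (B j y) * m)"
      proof (rule add_mono)
        show "norm (A y * (\<Phi>1 i (y - x) + q * \<Phi> (y - x))) \<le> norm (A y) * m"
          unfolding norm_mult by (rule mult_left_mono[OF k1(1)]) simp
        show "norm (\<Sum>j\<in>UNIV. B j y * (\<Phi>2 i j (y - x) + q * \<Phi>1 j (y - x))) \<le> (\<Sum>j\<in>UNIV. norm (B j y) * m)"
          by (rule sum_norm_le) (simp only: norm_mult mult_left_mono[OF k1(2)] norm_ge_zero)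
      qed
      finally show ?thesis by (simp add: T_def distrib_right sum_distrib_right)
    next
      case False
      then show ?thesis using mult_nonneg_nonneg[OF T0 m0] by (simp add: g_def z)
    qed
    have gm: "g \<in> borel_measurable lebesgue" unfolding g_def[abs_def]
      by (intro borel_measurable_uminus borel_measurable_add borel_measurable_sum borel_measurable_times borel_measurable_const
          \<Phi>_shift_measurable borel_measurable_integrable[OF Ai] borel_measurable_integrable[OF Bi])
    have Tmi: "integrable lebesgue (\<lambda>y. T y * m)" by (rule integrable_mult_left[OF Ti])
    have gi: "integrable lebesgue g"
      by (rule Bochner_Integration.integrable_bound[OF Tmi gm]) (rule AE_I2, rule order_trans[OF gb], simp)
    have pD: "potD (cin' a b) i x = (LINT y|lebesgue. g y) + q * (LINT y|lebesgue. f y)"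
    proof -
      have "- (A y * \<Phi>1 i (y - x) + (\<Sum>j\<in>UNIV. B j y * \<Phi>2 i j (y - x))) = g y + q * f y" for y
        by (simp add: g_def f_def distrib_left sum.distrib sum_distrib_left mult_ac)
      then have "potD (cin' a b) i x = (LINT y|lebesgue. g y + q * f y)" by (simp add: potD_def A_def[symmetric] B_def[symmetric])
      also have "\<dots> = (LINT y|lebesgue. g y) + (LINT y|lebesgue. q * f y)"
        by (rule Bochner_Integration.integral_add[OF gi integrable_mult_right[OF fi]])
      finally show ?thesis by simp
    qed
    have pf: "pot (cin' a b) x = (LINT y|lebesgue. f y)" by (simp add: pot_def f_def A_def B_def)
    define S where "S = {x::real^'n. b < norm x}"
    have oS: "open S" unfolding S_def by (intro open_Collect_less continuous_intros)
    have xS: "x \<in> S" using xb by (simp add: S_def)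
    have up: "u y = pot (cin' a b) y / \<kappa>" if "y \<in> S" for y
      using u_eq_inner_pot[OF Q ab(1,2), of y] that \<kappa>0 by (simp add: S_def field_simps)
    have "has_grad (\<lambda>y. pot (cin' a b) y / \<kappa>) (\<lambda>i. potD (cin' a b) i x / \<kappa>) x"
      by (rule has_grad_linear[OF bounded_linear_divide pot_integrable(2)[OF ab(3,2) zero_less_one xb(1)]])
    then have "has_grad u (\<lambda>i. potD (cin' a b) i x / \<kappa>) x"
      by (rule has_grad_cong_ev[OF _ oS xS]) (simp add: up)
    then have "Du i x = potD (cin' a b) i x / \<kappa>" by (rule Du_eq)
    then have "Du i x - q * u x = (LINT y|lebesgue. g y) / \<kappa>"
      unfolding up[OF xS] pf pD by (simp add: add_divide_distrib)
    then have "norm (Du i x - q * u x) = norm (LINT y|lebesgue. g y) / norm \<kappa>" by (simp add: norm_divide)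
    also have "\<dots> \<le> (LINT y|lebesgue. T y * m) / norm \<kappa>"
      by (rule divide_right_mono[OF Bochner_Integration.integral_norm_bound_integral[OF gi Tmi gb]]) simp
    also have "\<dots> = K * (dec (norm x) / norm x)" by (simp add: K_def m_def mult_ac)
    finally show ?thesis unfolding q_def .
  qed
  moreover have "R0 < 2 * b + 2" using R0 by (simp add: b_def)
  ultimately show ?thesis using K by blast
qed

section \<open>Each radiation condition makes the shell mean vanish\<close>

lemma radial_derivative:
  assumes v: "\<And>x. R0 < norm x \<Longrightarrow> v x = u x" and xh: "norm xh = 1" and r: "R0 < r"
  shows "vector_derivative (\<lambda>t. v (t *\<^sub>R xh)) (at r) - \<i> * of_real k * v (r *\<^sub>R xh)
    = (\<Sum>j\<in>UNIV. of_real (xh $ j) * Du j (r *\<^sub>R xh)) - \<i> * of_real k * u (r *\<^sub>R xh)"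
proof -
  have n: "R0 < norm (r *\<^sub>R xh)" using xh r R0 by simp
  have "has_grad v (\<lambda>j. Du j (r *\<^sub>R xh)) (r *\<^sub>R xh)"
    by (rule has_grad_cong_ev[OF u_C1(1)[OF n] open_W]) (use n v in auto)
  then have "has_grad v (\<lambda>j. Du j (r *\<^sub>R xh)) (0 + r *\<^sub>R xh)" by simp
  from has_grad_direction[OF this] have "((\<lambda>t. v (t *\<^sub>R xh)) has_vector_derivative (\<Sum>j\<in>UNIV. of_real (xh $ j) * Du j (r *\<^sub>R xh))) (at r)"
    by (simp add: scaleR_conv_of_real)
  then show ?thesis using v[OF n] by (simp add: vector_derivative_at)
qed

lemma all_G_eq_Du: "AE y in lebesgue. \<forall>j. R0 < norm y \<longrightarrow> G j y = Du j y"
  unfolding AE_all_countable by (rule allI[OF G_eq_Du])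

lemma dec_powr: "r > 0 \<Longrightarrow> r powr ((real CARD('n) - 1) / 2) * dec r = 1"
  unfolding dec_def powr_add[symmetric] by (simp add: add_divide_distrib[symmetric])

text \<open>On the shell of radius R the pointwise condition bounds |Z| by \<epsilon>
  \<open>dec R\<close>, and the weight has mass at most of order 1 / \<open>dec R\<close>^2, so the
  shell mean is O(\<epsilon>^2).\<close>

lemma QR_tendsto_of_SRC:
  assumes v: "\<And>x. R0 < norm x \<Longrightarrow> v x = u x" and S: "SRC k v"
  shows "(QR \<longlongrightarrow> 0) at_top"
proof (rule tendstoI)
  fix e :: real assume e: "e > 0"
  obtain L where L: "L \<ge> 0" "\<And>R. R > 0 \<Longrightarrow> integrable lebesgue (wt R)" "\<And>R. R > 0 \<Longrightarrow> (LINT y|lebesgue. wt R y) * (dec R)\<^sup>2 \<le> L"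
    using wt_integral by blast
  \<comment> \<open>With L + 1 in the denominator, \<epsilon>^2 L < e holds strictly, also for L =
    0.\<close>
  define \<epsilon> where "\<epsilon> = sqrt (e / (L + 1))"
  have \<epsilon>: "\<epsilon> > 0" "\<epsilon>\<^sup>2 * L < e"
  proof -
    have q: "e / (L + 1) > 0" using e L by simp
    show "\<epsilon> > 0" using q by (simp add: \<epsilon>_def)
    have "\<epsilon>\<^sup>2 = e / (L + 1)" using q by (simp add: \<epsilon>_def)
    then have "\<epsilon>\<^sup>2 * L + \<epsilon>\<^sup>2 = e" using L by (simp add: field_simps)
    moreover have "0 < \<epsilon>\<^sup>2" using \<open>\<epsilon> > 0\<close> by simp
    ultimately show "\<epsilon>\<^sup>2 * L < e" by linarith
  qed
  obtain R1 where R1: "\<And>r xh. R1 \<le> r \<Longrightarrow> norm xh = 1 \<Longrightarrow> r powr ((real CARD('n) - 1) / 2) *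
      norm (vector_derivative (\<lambda>t. v (t *\<^sub>R xh)) (at r) - \<i> * of_real k * v (r *\<^sub>R xh)) < \<epsilon>"
    using S \<epsilon>(1) unfolding SRC_def by blast
  have "dist (QR R) 0 < e" if R: "R1 \<le> R" "R0 + 1 \<le> R" for R
  proof -
    have R0': "0 < R" using R R0 by simp
    have "AE y in lebesgue. wt R y * (norm (Z y))\<^sup>2 \<le> wt R y * (\<epsilon> * dec R)\<^sup>2"
      using all_G_eq_Du
    proof eventually_elim
      case (elim y)
      show ?case
      proof (cases "y \<in> cball 0 (2 * R) - ball 0 R")
        case True
        then have y: "R \<le> norm y" by simp
        then have y': "R0 < norm y" "0 < norm y" "R1 \<le> norm y" using R R0 by auto
        define xh where "xh = y /\<^sub>R norm y"
        have xh: "norm xh = 1" "norm y *\<^sub>R xh = y" "xh $ j = y $ j / norm y" for j using y' by (auto simp: xh_def divide_inverse)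
        have Zy: "Z y = (\<Sum>j\<in>UNIV. of_real (xh $ j) * Du j (norm y *\<^sub>R xh)) - \<i> * of_real k * u (norm y *\<^sub>R xh)"
          unfolding Z_def V_def xh(2,3) using elim y' by simp
        have "norm y powr ((real CARD('n) - 1) / 2) * norm (Z y) < \<epsilon>"
          using R1[OF y'(3) xh(1)] radial_derivative[OF v xh(1) y'(1)] Zy by simp
        then have "dec (norm y) * (norm y powr ((real CARD('n) - 1) / 2) * norm (Z y)) \<le> dec (norm y) * \<epsilon>"
          by (intro mult_left_mono dec_nonneg) simp
        then have "norm (Z y) \<le> \<epsilon> * dec (norm y)" using dec_powr[OF y'(2)]
          by (simp only: mult.assoc[symmetric] mult.commute[of "dec (norm y)"] mult_1)
        also have "\<dots> \<le> \<epsilon> * dec R" using \<epsilon> dec_antimono[OF R0' y] by simp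
        finally show ?thesis by (intro mult_left_mono power_mono wt_props(2)[OF R0']) auto
      qed (simp add: wt_props(4)[OF R0'])
    qed
    then have "QR R \<le> (LINT y|lebesgue. wt R y * (\<epsilon> * dec R)\<^sup>2)" unfolding QR_def
      by (rule integral_mono_AE[OF wt_integrables(2)[OF R0'] integrable_mult_left[OF L(2)[OF R0']]])
    also have "\<dots> = \<epsilon>\<^sup>2 * ((LINT y|lebesgue. wt R y) * (dec R)\<^sup>2)" by (simp add: power_mult_distrib)
    also have "\<dots> \<le> \<epsilon>\<^sup>2 * L" by (rule mult_left_mono[OF L(3)[OF R0']]) simp
    also have "\<dots> < e" by (rule \<epsilon>(2))
    finally show ?thesis using QR_nonneg[OF R0'] by simp
  qed
  then show "\<forall>\<^sub>F R in at_top. dist (QR R) 0 < e"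
    using eventually_ge_at_top[of "max R1 (R0 + 1)"] by (auto elim: eventually_mono)
qed

lemma radial_part_le:
  fixes E :: "complex^'n" and y :: "real^'n"
  assumes "y \<noteq> 0"
  shows "norm (\<Sum>j\<in>UNIV. of_real (y $ j / norm y) * E $ j) \<le> norm E"
proof -
  have "norm (\<Sum>j\<in>UNIV. of_real (y $ j / norm y) * E $ j) \<le> (\<Sum>j\<in>UNIV. \<bar>y $ j / norm y\<bar> * \<bar>norm (E $ j)\<bar>)"
    by (rule sum_norm_le) (simp only: norm_mult norm_of_real abs_norm_cancel order_refl)
  also have "\<dots> \<le> L2_set (\<lambda>j. y $ j / norm y) UNIV * L2_set (\<lambda>j. norm (E $ j)) UNIV" by (rule L2_set_mult_ineq)
  also have "L2_set (\<lambda>j. y $ j / norm y) UNIV = 1" unfolding L2_set_def sum_direction_sq[OF assms] by simp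
  finally show ?thesis by (simp add: norm_vec_def)
qed

text \<open>\<open>Z\<close> is the radial component of the vector in GSRC, hence no larger. On the
  shell the weight \<open>wt R\<close> is at most a constant times R^(1 - 2 \<delta>) times the
  weight of GSRC, and this power tends to 0 because \<delta> > 1/2.\<close>

lemma QR_tendsto_of_GSRC:
  fixes Gv :: "real^'n \<Rightarrow> complex^'n"
  assumes W: "{x. R0 < norm x} \<subseteq> \<Omega>" and v: "\<And>x. R0 < norm x \<Longrightarrow> v x = u x" and Gv: "\<And>x j. R0 < norm x \<Longrightarrow> Gv x $ j = G j x"
    and S: "GSRC k \<Omega> v Gv"
  shows "(QR \<longlongrightarrow> 0) at_top"
proof -
  obtain \<delta> where \<delta>: "1/2 < \<delta>" "\<delta> < 1" and fin: "(\<integral>\<^sup>+ x\<in>\<Omega>. ennreal ((1 + (norm x)\<^sup>2) powr (\<delta> - 1) *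
            (norm (Gv x - (\<chi> j. \<i> * of_real k * of_real (x $ j / norm x) * v x)))\<^sup>2) \<partial>lebesgue) < \<infinity>"
    using S unfolding GSRC_def by blast
  define h where "h y = indicator {x. R0 < norm x} y * ((1 + (norm y)\<^sup>2) powr (\<delta> - 1) * (norm (Z y))\<^sup>2)" for y
  have hm: "h \<in> borel_measurable lebesgue"
  proof -
    have "continuous_on UNIV (\<lambda>y::real^'n. (1 + (norm y)\<^sup>2) powr (\<delta> - 1))"
      by (intro continuous_intros) (metis add_pos_nonneg less_irrefl zero_le_power2 zero_less_one)
    then show ?thesis unfolding h_def[abs_def]
      by (intro borel_measurable_times borel_measurable_indicator borel_measurable_power borel_measurable_lebesgue_continuous
          measurable_compose[OF VZ_meas(2) borel_measurable_norm]) (use borel_open[OF open_W] in simp_all)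
  qed
  have h0: "0 \<le> h y" for y by (simp add: h_def)
  have "(\<integral>\<^sup>+ y. ennreal (h y) \<partial>lebesgue) \<le> (\<integral>\<^sup>+ x\<in>\<Omega>. ennreal ((1 + (norm x)\<^sup>2) powr (\<delta> - 1) *
            (norm (Gv x - (\<chi> j. \<i> * of_real k * of_real (x $ j / norm x) * v x)))\<^sup>2) \<partial>lebesgue)"
  proof (rule nn_integral_mono)
    fix y :: "real^'n"
    show "ennreal (h y) \<le> ennreal ((1 + (norm y)\<^sup>2) powr (\<delta> - 1) *
            (norm (Gv y - (\<chi> j. \<i> * of_real k * of_real (y $ j / norm y) * v y)))\<^sup>2) * indicator \<Omega> y"
    proof (cases "R0 < norm y")
      case True
      then have y0: "y \<noteq> 0" using R0 by auto
      define E where "E = Gv y - (\<chi> j. \<i> * of_real k * of_real (y $ j / norm y) * v y)"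
      have "(\<Sum>j\<in>UNIV. of_real (y $ j / norm y) * E $ j) = V y - (\<i> * of_real k * u y) * of_real (\<Sum>j\<in>UNIV. (y $ j / norm y)\<^sup>2)"
        unfolding V_def of_real_sum sum_distrib_left sum_subtractf[symmetric]
        by (rule sum.cong) (use True in \<open>simp_all add: E_def Gv v power2_eq_square right_diff_distrib mult_ac\<close>)
      then have "norm (Z y) \<le> norm E" using radial_part_le[OF y0, of E] unfolding sum_direction_sq[OF y0] by (simp add: Z_def)
      then have "(norm (Z y))\<^sup>2 \<le> (norm E)\<^sup>2" by (intro power_mono) auto
      then have "h y \<le> (1 + (norm y)\<^sup>2) powr (\<delta> - 1) * (norm E)\<^sup>2" using True by (simp add: h_def mult_left_mono)
      then show ?thesis using True W unfolding E_def by (auto simp: ennreal_leI)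
    qed (simp add: h_def)
  qed
  then have hf: "(\<integral>\<^sup>+ y. ennreal (h y) \<partial>lebesgue) < \<infinity>" using fin by (rule le_less_trans)
  have hi: "integrable lebesgue h" by (rule integrableI_nonneg[OF hm _ hf]) (simp add: h0)
  define T where "T = (LINT y|lebesgue. h y)"
  have Ms: "Ms \<ge> 0" using stD(6,7) order_trans by blast
  have T0: "T \<ge> 0" unfolding T_def by (rule Bochner_Integration.integral_nonneg) (rule h0)
  have bound: "QR R \<le> Ms * 5 powr (1 - \<delta>) * T * R powr (1 - 2 * \<delta>)" if R: "R \<ge> R0 + 1" for R
  proof -
    have R1: "0 < R" "1 \<le> R" using R R0 by auto
    define c where "c = Ms / R * (1 + (2 * R)\<^sup>2) powr (1 - \<delta>)"
    have pw: "wt R y * (norm (Z y))\<^sup>2 \<le> c * h y" for y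
    proof (cases "y \<in> cball 0 (2 * R) - ball 0 R")
      case True
      then have y: "R0 < norm y" "norm y \<le> 2 * R" using R by auto
      have p: "1 + (norm y)\<^sup>2 > 0" by (simp add: add_pos_nonneg)
      have "1 + (norm y)\<^sup>2 \<le> 1 + (2 * R)\<^sup>2" using y by (intro add_left_mono power_mono) auto
      then have "(1 + (norm y)\<^sup>2) powr (1 - \<delta>) \<le> (1 + (2 * R)\<^sup>2) powr (1 - \<delta>)" using p \<delta> by (intro powr_mono2) auto
      moreover have "(1 + (norm y)\<^sup>2) powr (1 - \<delta>) * (1 + (norm y)\<^sup>2) powr (\<delta> - 1) = 1"
        unfolding powr_add[symmetric] using p by simp
      ultimately have "1 \<le> (1 + (2 * R)\<^sup>2) powr (1 - \<delta>) * (1 + (norm y)\<^sup>2) powr (\<delta> - 1)"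
        using mult_right_mono[of "(1 + (norm y)\<^sup>2) powr (1 - \<delta>)" _ "(1 + (norm y)\<^sup>2) powr (\<delta> - 1)"] by fastforce
      then have "wt R y * 1 \<le> Ms / R * ((1 + (2 * R)\<^sup>2) powr (1 - \<delta>) * (1 + (norm y)\<^sup>2) powr (\<delta> - 1))"
        using wt_props(2,3)[OF R1(1)] Ms R1 by (intro mult_mono) auto
      then have "wt R y * (norm (Z y))\<^sup>2 \<le> Ms / R * ((1 + (2 * R)\<^sup>2) powr (1 - \<delta>) * (1 + (norm y)\<^sup>2) powr (\<delta> - 1)) * (norm (Z y))\<^sup>2"
        by (intro mult_right_mono) auto
      then show ?thesis using y(1) by (simp add: h_def c_def mult.assoc)
    next
      case False
      then show ?thesis using h0[of y] Ms R1 by (simp add: wt_props(4)[OF R1(1)] c_def)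
    qed
    have "QR R \<le> (LINT y|lebesgue. c * h y)" unfolding QR_def
      by (rule integral_mono[OF wt_integrables(2)[OF R1(1)] integrable_mult_right[OF hi] pw])
    also have "\<dots> = c * T" by (simp add: T_def)
    also have "c \<le> Ms * 5 powr (1 - \<delta>) * R powr (1 - 2 * \<delta>)"
    proof -
      \<comment> \<open>Since R >= 1, the summand 1 is absorbed into R^2; this is the origin of the
        factor 5.\<close>
      have "1 + (2 * R)\<^sup>2 \<le> 5 * (R * R)" using mult_mono[OF R1(2) R1(2)] R1 by (simp add: power2_eq_square)
      then have "(1 + (2 * R)\<^sup>2) powr (1 - \<delta>) \<le> (5 * (R * R)) powr (1 - \<delta>)" using \<delta> by (intro powr_mono2) auto
      also have "\<dots> = 5 powr (1 - \<delta>) * R powr ((1 - \<delta>) + (1 - \<delta>))" using R1 by (simp only: powr_mult powr_add)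
      finally have "c \<le> Ms / R * (5 powr (1 - \<delta>) * R powr ((1 - \<delta>) + (1 - \<delta>)))"
        unfolding c_def using Ms R1 by (intro mult_left_mono) auto
      also have "\<dots> = Ms * 5 powr (1 - \<delta>) * (R powr ((1 - \<delta>) + (1 - \<delta>)) / R)" by simp
      also have "R powr ((1 - \<delta>) + (1 - \<delta>)) / R = R powr (1 - 2 * \<delta>)"
        using powr_diff[of R "(1 - \<delta>) + (1 - \<delta>)" 1] R1 by (simp add: algebra_simps)
      finally show ?thesis .
    qed
    finally show ?thesis using T0 by (simp add: mult_ac mult_right_mono)
  qed
  have "((\<lambda>R. Ms * 5 powr (1 - \<delta>) * T * R powr (1 - 2 * \<delta>)) \<longlongrightarrow> Ms * 5 powr (1 - \<delta>) * T * 0) at_top"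
    by (intro tendsto_mult_left tendsto_neg_powr filterlim_ident) (use \<delta> in simp)
  then have lim: "((\<lambda>R. Ms * 5 powr (1 - \<delta>) * T * R powr (1 - 2 * \<delta>)) \<longlongrightarrow> 0) at_top" by simp
  show ?thesis
    by (rule tendsto_sandwich[OF _ _ tendsto_const lim];
        rule eventually_mono[OF eventually_ge_at_top[of "R0 + 1"]]) (use bound QR_nonneg R0 in auto)
qed

section \<open>A vanishing shell mean implies each radiation condition\<close>

lemma SRC_of_QR_tendsto:
  assumes Q: "(QR \<longlongrightarrow> 0) at_top" and v: "\<And>x. R0 < norm x \<Longrightarrow> v x = u x"
  shows "SRC k v"
  unfolding SRC_def
proof (intro allI impI)
  fix \<epsilon> :: real assume \<epsilon>: "\<epsilon> > 0"
  obtain K \<rho> where K: "0 \<le> K" and \<rho>: "R0 < \<rho>" and as: "\<And>x i. \<rho> \<le> norm x \<Longrightarrow>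
    norm (Du i x - \<i> * of_real k * of_real (x $ i / norm x) * u x) \<le> K * (dec (norm x) / norm x)"
    using radiation_asymptotics[OF Q] by blast
  define n where "n = real CARD('n)"
  \<comment> \<open>The n components of the gradient cost a factor n, and after cancelling
    \<open>dec\<close> a factor 1/r remains; r > n K / \<epsilon> makes the product small.\<close>
  have "r powr ((real CARD('n) - 1) / 2) * norm (vector_derivative (\<lambda>t. v (t *\<^sub>R xh)) (at r) - \<i> * of_real k * v (r *\<^sub>R xh)) < \<epsilon>"
    if r: "max \<rho> (n * K / \<epsilon> + 1) \<le> r" and xh: "norm xh = 1" for r and xh :: "real^'n"
  proof -
    have r': "R0 < r" "0 < r" "\<rho> \<le> r" "n * K / \<epsilon> < r" using r \<rho> R0 by auto
    define x where "x = r *\<^sub>R xh"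
    have x: "norm x = r" "x \<noteq> 0" "xh $ j = x $ j / norm x" for j using xh r' by (auto simp: x_def)
    have "(\<Sum>j\<in>UNIV. of_real (xh $ j) * Du j x) - \<i> * of_real k * u x
        = (\<Sum>j\<in>UNIV. of_real (x $ j / norm x) * (Du j x - \<i> * of_real k * of_real (x $ j / norm x) * u x))"
    proof -
      have "\<i> * of_real k * u x = (\<i> * of_real k * u x) * of_real (\<Sum>j\<in>UNIV. (x $ j / norm x)\<^sup>2)" unfolding sum_direction_sq[OF x(2)] by simp
      also have "\<dots> = (\<Sum>j\<in>UNIV. of_real (x $ j / norm x) * (\<i> * of_real k * of_real (x $ j / norm x) * u x))"
        unfolding of_real_sum sum_distrib_left by (rule sum.cong) (simp_all add: power2_eq_square mult_ac)
      finally show ?thesis unfolding x(3) by (simp only: right_diff_distrib sum_subtractf)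
    qed
    also have "norm \<dots> \<le> (\<Sum>j\<in>(UNIV::'n set). K * (dec r / r))"
    proof (rule sum_norm_le)
      fix j
      show "norm (of_real (x $ j / norm x) * (Du j x - \<i> * of_real k * of_real (x $ j / norm x) * u x)) \<le> K * (dec r / r)"
        using mult_mono[OF norm_component_ratio[of x j] as[of x j]] r' by (simp only: norm_mult norm_of_real mult_1 norm_ge_zero zero_le_one x(1))
    qed
    finally have "norm ((\<Sum>j\<in>UNIV. of_real (xh $ j) * Du j x) - \<i> * of_real k * u x) \<le> n * (K * (dec r / r))"
      by (simp add: n_def)
    moreover have "vector_derivative (\<lambda>t. v (t *\<^sub>R xh)) (at r) - \<i> * of_real k * v (r *\<^sub>R xh) = (\<Sum>j\<in>UNIV. of_real (xh $ j) * Du j x) - \<i> * of_real k * u x"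
      unfolding x_def by (rule radial_derivative[OF v xh r'(1)])
    ultimately have "norm (vector_derivative (\<lambda>t. v (t *\<^sub>R xh)) (at r) - \<i> * of_real k * v (r *\<^sub>R xh)) \<le> n * (K * (dec r / r))"
      by (simp only:)
    then have "r powr ((real CARD('n) - 1) / 2) * norm (vector_derivative (\<lambda>t. v (t *\<^sub>R xh)) (at r) - \<i> * of_real k * v (r *\<^sub>R xh))
       \<le> r powr ((real CARD('n) - 1) / 2) * (n * (K * (dec r / r)))" by (rule mult_left_mono) simp
    also have "\<dots> = (r powr ((real CARD('n) - 1) / 2) * dec r) * (n * K / r)" by simp
    also have "\<dots> < \<epsilon>" unfolding dec_powr[OF r'(2)] using r' \<epsilon> by (simp add: field_simps)
    finally show ?thesis .
  qed
  then show "\<exists>R. \<forall>r\<ge>R. \<forall>xh::real^'n. norm xh = 1 \<longrightarrow> r powr ((real CARD('n) - 1) / 2) *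
      norm (vector_derivative (\<lambda>t. v (t *\<^sub>R xh)) (at r) - \<i> * of_real k * v (r *\<^sub>R xh)) < \<epsilon>" by blast
qed

lemma dyadic_bound: "1 \<le> (x::real) \<Longrightarrow> \<exists>m. 2 ^ m \<le> x \<and> x < 2 ^ Suc m"
proof -
  assume x: "1 \<le> x"
  define m where "m = (LEAST m. x < 2 ^ Suc m)"
  have ex: "\<exists>m. x < 2 ^ Suc m"
  proof -
    obtain l where "x < 2 ^ l" using real_arch_pow[of 2 x] by auto
    also have "\<dots> \<le> 2 ^ Suc l" by simp
    finally show ?thesis by blast
  qed
  have 1: "x < 2 ^ Suc m" unfolding m_def using ex by (rule LeastI_ex)
  have "2 ^ m \<le> x"
  proof (cases m)
    case (Suc l)
    then have "\<not> x < 2 ^ Suc l" using not_less_Least[of l "\<lambda>m. x < 2 ^ Suc m"] by (simp add: m_def)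
    then show ?thesis using Suc by simp
  qed (use x in simp)
  then show ?thesis using 1 by blast
qed

text \<open>Dyadic balls replace polar coordinates: the m-th ball has volume proportional to 2^(mn)
  and carries the constant (\<open>dec r\<close> / r)^2 at r = 2^m. By \<open>dec_square\<close> the
  product is proportional to 2^(-m), which is summable.\<close>

lemma decay_square_dominated:
  "\<exists>S. S \<in> borel_measurable lebesgue \<and> (\<integral>\<^sup>+ y. S y \<partial>lebesgue) < \<infinity> \<and> (\<forall>y::real^'n. 1 \<le> norm y \<longrightarrow> ennreal ((dec (norm y) / norm y)\<^sup>2) \<le> S y)"
proof -
  define c where "c m = (dec (2 ^ m) / 2 ^ m)\<^sup>2" for m :: nat
  define B where "B m = ball (0::real^'n) (2 ^ Suc m)" for m
  have B: "B m \<in> sets lebesgue" for m by (simp add: B_def)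
  define S where "S y = (\<Sum>m. ennreal (c m) * indicator (B m) y)" for y
  have tm: "(\<lambda>y. ennreal (c m) * indicator (B m) y) \<in> borel_measurable lebesgue" for m
    using B by (intro borel_measurable_times_ennreal borel_measurable_const borel_measurable_indicator)
  have Sm: "S \<in> borel_measurable lebesgue" unfolding S_def[abs_def] using tm by (rule borel_measurable_suminf_order)
  have em: "emeasure lebesgue (B m) = ennreal (omega * (2 ^ Suc m) ^ CARD('n))" for m
  proof -
    have "emeasure lebesgue (B m) = emeasure lborel (B m)" by (simp add: B_def)
    also have "\<dots> = ennreal (measure lborel (B m))"
      by (rule emeasure_eq_ennreal_measure) (use emeasure_bounded_finite[of "B m"] in \<open>auto simp: B_def\<close>)
    also have "measure lborel (B m) = omega * (2 ^ Suc m) ^ CARD('n)" unfolding B_def omega_def by (subst measure_lborel_ball) auto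
    finally show ?thesis .
  qed
  have val: "c m * (omega * (2 ^ Suc m) ^ CARD('n)) = omega * 2 ^ CARD('n) * (1 / 2) ^ m" for m
  proof -
    have "c m * (omega * (2 ^ Suc m) ^ CARD('n)) = omega * 2 ^ CARD('n) * ((dec (2 ^ m))\<^sup>2 * (2 ^ m) ^ CARD('n)) / (2 ^ m * 2 ^ m)"
      by (simp add: c_def power_divide power2_eq_square power_mult_distrib)
    also have "\<dots> = omega * 2 ^ CARD('n) * (1 / 2) ^ m" by (subst dec_square) (simp_all add: power_divide)
    finally show ?thesis .
  qed
  have shell: "(\<integral>\<^sup>+ y. ennreal (c m) * indicator (B m) y \<partial>lebesgue) = ennreal (omega * 2 ^ CARD('n) * (1 / 2) ^ m)" for m
  proof -
    have "(\<integral>\<^sup>+ y. ennreal (c m) * indicator (B m) y \<partial>lebesgue) = ennreal (c m) * ennreal (omega * (2 ^ Suc m) ^ CARD('n))"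
      by (simp only: nn_integral_cmult_indicator[OF B] em)
    also have "\<dots> = ennreal (c m * (omega * (2 ^ Suc m) ^ CARD('n)))"
      by (rule ennreal_mult[symmetric]) (use omega_pos in \<open>auto simp: c_def\<close>)
    finally show ?thesis by (simp only: val)
  qed
  have "(\<integral>\<^sup>+ y. S y \<partial>lebesgue) = (\<Sum>m. \<integral>\<^sup>+ y. ennreal (c m) * indicator (B m) y \<partial>lebesgue)"
    unfolding S_def by (rule nn_integral_suminf[OF tm])
  also have "\<dots> = (\<Sum>m. ennreal (omega * 2 ^ CARD('n) * (1 / 2) ^ m))"
    by (simp only: shell)
  also have "\<dots> = ennreal (\<Sum>m. omega * 2 ^ CARD('n) * (1 / 2) ^ m)"
    by (rule suminf_ennreal2) (use omega_pos in \<open>auto intro!: summable_mult summable_geometric\<close>)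
  finally have fin: "(\<integral>\<^sup>+ y. S y \<partial>lebesgue) < \<infinity>" by simp
  have "ennreal ((dec (norm y) / norm y)\<^sup>2) \<le> S y" if y: "1 \<le> norm y" for y :: "real^'n"
  proof -
    obtain m where m: "2 ^ m \<le> norm y" "norm y < 2 ^ Suc m" using dyadic_bound[OF y] by blast
    have "dec (norm y) / norm y \<le> dec (2 ^ m) / 2 ^ m"
      using dec_antimono[OF _ m(1)] m(1) dec_nonneg by (intro frac_le) auto
    then have "(dec (norm y) / norm y)\<^sup>2 \<le> c m" unfolding c_def by (intro power_mono) (auto simp: dec_nonneg)
    then have "ennreal ((dec (norm y) / norm y)\<^sup>2) \<le> ennreal (c m) * indicator (B m) y" using m(2) by (simp add: B_def ennreal_leI)
    also have "\<dots> \<le> S y" unfolding S_def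
    proof -
      have "t m \<le> suminf t" for t :: "nat \<Rightarrow> ennreal" using sum_le_suminf[OF summableI, of "{m}" t] by simp
      then show "ennreal (c m) * indicator (B m) y \<le> (\<Sum>m. ennreal (c m) * indicator (B m) y)" .
    qed
    finally show ?thesis .
  qed
  then show ?thesis using Sm fin by blast
qed

text \<open>Inside a large ball local square integrability of u and its gradient suffices, outside
  it the asymptotics. The defect is square integrable at infinity even with weight 1, so the choice
  of \<delta> is free and 3/4 is taken.\<close>

lemma GSRC_of_QR_tendsto:
  fixes Gv :: "real^'n \<Rightarrow> complex^'n"
  assumes Q: "(QR \<longlongrightarrow> 0) at_top"
    and v: "\<And>x. R0 < norm x \<Longrightarrow> v x = u x" and Gv: "\<And>x j. R0 < norm x \<Longrightarrow> Gv x $ j = G j x"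
    and loc: "\<And>R. R > 0 \<Longrightarrow> set_integrable lebesgue (\<Omega> \<inter> ball 0 R) (\<lambda>x. (norm (v x))\<^sup>2)"
      "\<And>R. R > 0 \<Longrightarrow> set_integrable lebesgue (\<Omega> \<inter> ball 0 R) (\<lambda>x. (norm (Gv x))\<^sup>2)"
  shows "GSRC k \<Omega> v Gv"
proof -
  obtain K \<rho> where K: "0 \<le> K" and \<rho>: "R0 < \<rho>" and as: "\<And>x i. \<rho> \<le> norm x \<Longrightarrow>
    norm (Du i x - \<i> * of_real k * of_real (x $ i / norm x) * u x) \<le> K * (dec (norm x) / norm x)"
    using radiation_asymptotics[OF Q] by blast
  obtain S where S: "S \<in> borel_measurable lebesgue" "(\<integral>\<^sup>+ y. S y \<partial>lebesgue) < \<infinity>"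
    "\<And>y::real^'n. 1 \<le> norm y \<Longrightarrow> ennreal ((dec (norm y) / norm y)\<^sup>2) \<le> S y"
    using decay_square_dominated by blast
  define R where "R = \<rho> + 1"
  have R: "R > 0" "1 \<le> R" "R0 < R" "\<rho> \<le> R" using \<rho> R0 by (auto simp: R_def)
  define E where "E y = Gv y - (\<chi> j. \<i> * of_real k * of_real (y $ j / norm y) * v y)" for y
  define n where "n = real CARD('n)"
  \<comment> \<open>An integrable majorant of the squared defect inside the ball, from the bound 2
    a^2 + 2 b^2 for a squared sum.\<close>
  define p where "p y = 2 * (indicator (\<Omega> \<inter> ball 0 R) y *\<^sub>R (norm (Gv y))\<^sup>2) + 2 * k\<^sup>2 * (indicator (\<Omega> \<inter> ball 0 R) y *\<^sub>R (norm (v y))\<^sup>2)" for y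
  have pi: "integrable lebesgue p" unfolding p_def[abs_def]
    by (intro Bochner_Integration.integrable_add integrable_mult_right loc[OF R(1), unfolded set_integrable_def])
  have p0: "0 \<le> p y" for y by (simp add: p_def)
  have wle: "(1 + (norm y)\<^sup>2) powr (3/4 - 1) * (norm (E y))\<^sup>2 \<le> (norm (E y))\<^sup>2" for y :: "real^'n"
  proof -
    have "(1 + (norm y)\<^sup>2) powr (3/4 - 1) \<le> (1::real) powr (3/4 - 1)" by (intro powr_mono2') auto
    then show ?thesis using mult_right_mono[of "(1 + (norm y)\<^sup>2) powr (3/4 - 1)" 1 "(norm (E y))\<^sup>2"] by simp
  qed
  have "AE y in lebesgue. ennreal ((1 + (norm y)\<^sup>2) powr (3/4 - 1) * (norm (E y))\<^sup>2) * indicator \<Omega> y \<le> ennreal (p y) + ennreal (n * K\<^sup>2) * S y"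
    using all_G_eq_Du
  proof eventually_elim
    case (elim y)
    show ?case
    proof (cases "y \<in> \<Omega>")
      case yO: True
      show ?thesis
      proof (cases "norm y < R")
        case True
        have "norm (\<chi> j. \<i> * of_real k * of_real (y $ j / norm y) * v y) \<le> k * norm (v y)"
        proof (cases "y = 0")
          case False
          have "norm (\<chi> j. \<i> * of_real k * of_real (y $ j / norm y) * v y) = sqrt (\<Sum>j\<in>UNIV. (k * norm (v y))\<^sup>2 * (y $ j / norm y)\<^sup>2)"
            unfolding norm_vec_def L2_set_def using k by (simp add: norm_mult power_mult_distrib norm_divide power_divide mult_ac)
          also have "\<dots> = k * norm (v y)" unfolding sum_distrib_left[symmetric] sum_direction_sq[OF False] using k by simp
          finally show ?thesis by simp
        next
          case True
          have "(\<chi> j. \<i> * of_real k * of_real (y $ j / norm y) * v y) = 0" using True by (simp add: vec_eq_iff)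
          then show ?thesis using k by simp
        qed
        then have "norm (E y) \<le> norm (Gv y) + k * norm (v y)" unfolding E_def by (rule order_trans[OF norm_triangle_ineq4 add_left_mono])
        then have "(norm (E y))\<^sup>2 \<le> (norm (Gv y) + k * norm (v y))\<^sup>2" by (intro power_mono) auto
        also have "\<dots> \<le> 2 * (norm (Gv y))\<^sup>2 + 2 * (k * norm (v y))\<^sup>2"
          using zero_le_power2[of "norm (Gv y) - k * norm (v y)"] by (simp add: power2_sum power2_diff)
        also have "\<dots> = p y" using True yO by (simp add: p_def power_mult_distrib)
        finally have "(1 + (norm y)\<^sup>2) powr (3/4 - 1) * (norm (E y))\<^sup>2 \<le> p y" by (rule order_trans[OF wle])
        then have "ennreal ((1 + (norm y)\<^sup>2) powr (3/4 - 1) * (norm (E y))\<^sup>2) \<le> ennreal (p y)" by (rule ennreal_leI)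
        then show ?thesis using yO by (simp add: add_increasing2)
      next
        case False
        then have y: "R0 < norm y" "\<rho> \<le> norm y" "1 \<le> norm y" using R by auto
        have "(norm (E y))\<^sup>2 = (\<Sum>j\<in>UNIV. (norm (E y $ j))\<^sup>2)" by (simp add: norm_vec_def L2_set_def sum_nonneg)
        also have "\<dots> \<le> (\<Sum>j\<in>(UNIV::'n set). (K * (dec (norm y) / norm y))\<^sup>2)"
        proof (intro sum_mono power_mono)
          fix j
          have "E y $ j = Du j y - \<i> * of_real k * of_real (y $ j / norm y) * u y" using elim y(1) by (simp add: E_def Gv v)
          then show "norm (E y $ j) \<le> K * (dec (norm y) / norm y)" using as[OF y(2)] by simp
        qed simp
        also have "\<dots> = (n * K\<^sup>2) * (dec (norm y) / norm y)\<^sup>2" unfolding power_mult_distrib by (simp add: n_def)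
        finally have "ennreal ((1 + (norm y)\<^sup>2) powr (3/4 - 1) * (norm (E y))\<^sup>2) \<le> ennreal ((n * K\<^sup>2) * (dec (norm y) / norm y)\<^sup>2)"
          by (intro ennreal_leI order_trans[OF wle])
        also have "\<dots> = ennreal (n * K\<^sup>2) * ennreal ((dec (norm y) / norm y)\<^sup>2)" by (rule ennreal_mult) (auto simp: n_def)
        also have "\<dots> \<le> ennreal (n * K\<^sup>2) * S y" by (rule mult_left_mono[OF S(3)[OF y(3)]]) simp
        finally show ?thesis using yO by (simp add: add_increasing)
      qed
    qed simp
  qed
  then have "(\<integral>\<^sup>+ y\<in>\<Omega>. ennreal ((1 + (norm y)\<^sup>2) powr (3/4 - 1) * (norm (E y))\<^sup>2) \<partial>lebesgue) \<le> (\<integral>\<^sup>+ y. ennreal (p y) + ennreal (n * K\<^sup>2) * S y \<partial>lebesgue)"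
    by (rule nn_integral_mono_AE)
  also have "\<dots> = (\<integral>\<^sup>+ y. ennreal (p y) \<partial>lebesgue) + ennreal (n * K\<^sup>2) * (\<integral>\<^sup>+ y. S y \<partial>lebesgue)"
    using borel_measurable_integrable[OF pi] S(1) by (simp add: nn_integral_add nn_integral_cmult)
  also have "\<dots> < \<infinity>"
    using S(2) by (simp add: nn_integral_eq_integral[OF pi] p0 ennreal_mult_less_top)
  finally show ?thesis unfolding GSRC_def E_def by (intro exI[of _ "3/4"]) simp
qed

end

text \<open>SRC speaks of values of u on single rays, so continuity selects the representative of u,
  while \<open>G\<close> is determined only almost everywhere. An arbitrary bounded set may have a
  complement that is not open; the equation is posed in its interior.\<close>

theorem mainTheorem18:
  fixes k :: real and D :: "(real^'n) set"
    and u :: "real^'n \<Rightarrow> complex" and G :: "real^'n \<Rightarrow> complex^'n"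
  assumes "k > 0"
    and "CARD('n) = 2 \<or> CARD('n) = 3"
    and "bounded D"
    and "H1_loc_with_grad (interior (- D)) u G"
    and "weak_helmholtz k (interior (- D)) u G"
    and "continuous_on (interior (- D)) u"
  shows "SRC k u \<longleftrightarrow> GSRC k (interior (- D)) u G"
proof -
  define U where "U = interior (- D)"
  obtain R0 where R0: "R0 > 0" "\<And>x. x \<in> D \<Longrightarrow> norm x \<le> R0" using assms(3) by (auto simp: bounded_pos)
  have "open {x::real^'n. norm x > R0}" by (intro open_Collect_less continuous_intros)
  then have WU: "{x::real^'n. norm x > R0} \<subseteq> U" unfolding U_def by (rule interior_maximal[rotated]) (use R0(2) in force)
  have U: "open U" "H1_loc_with_grad U u G" "weak_helmholtz k U u G" "continuous_on U u" using assms by (simp_all add: U_def)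
  \<comment> \<open>Extension by zero lets all integrals run over the whole space and changes
    nothing beyond the radius \<open>R0\<close>.\<close>
  define v Gv where "v x = (if x \<in> U then u x else 0)" and "Gv j x = (if x \<in> U then G x $ j else 0)" for x j
  have ext: "exterior_helmholtz k R0 v Gv" unfolding v_def[abs_def] Gv_def[abs_def]
    by (rule exterior_helmholtz_of_weak[OF assms(1) R0(1) U(1) WU U(2,3,4)])
  obtain F F' F'' c C where F: "fundamental_radial CARD('n) k F F' F'' c C" using fundamental_radial_exists[OF assms(1,2)] by blast
  obtain st st' Ms where st: "C1_step st st' Ms" using C1_step_exists by blast
  interpret E: exterior_cut k R0 v Gv F F' F'' c C st st' Ms
    by (intro exterior_cut.intro exterior_fundamental.intro exterior_fundamental_axioms.intro exterior_cut_axioms.intro ext F st)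
  have ag: "u x = v x" "G x $ j = Gv j x" if "R0 < norm x" for x j using WU that by (auto simp: v_def Gv_def)
  have loc: "set_integrable lebesgue (U \<inter> ball 0 R) (\<lambda>x. (norm (u x))\<^sup>2)" "set_integrable lebesgue (U \<inter> ball 0 R) (\<lambda>x. (norm (G x))\<^sup>2)" if "R > 0" for R
    using U(2) that unfolding H1_loc_with_grad_def by blast+
  show ?thesis unfolding U_def[symmetric]
    using E.QR_tendsto_of_SRC[of u, OF ag(1)] E.QR_tendsto_of_GSRC[of U u G, OF WU ag] E.SRC_of_QR_tendsto[of u, OF _ ag(1)]
      E.GSRC_of_QR_tendsto[of u G U, OF _ ag loc] by blast
qed

end
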